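(* Let $(M,g)$ be a closed Riemannian manifold of dimension $n\geq3$ and let $m\geq1$ be an integer. Then $$\sup\left\{\int_MV\,dv_g:\ V\in L^\infty(M),\ \nu_{m+1}(V)\geq0\right\}=\sup_{0\leq\beta\in L^\infty(M),\ \beta\not\equiv0}\lambda_m(\beta)\int_M\beta\,dv_g.$$
   Context: Closed manifold means compact, connected, without boundary. For $V\in L^\infty(M)$, $\nu_1(V)<\nu_2(V)\leq\dots$ are the eigenvalues, with multiplicity, of the Schrödinger operator $\Delta_g-V$, $\Delta_g=d^*d$; equivalently $\nu_m(V)=\inf_{F_m}\sup_{u\in F_m\setminus\{0\}}\frac{\int_M|du|_g^2-Vu^2\,dv_g}{\int_Mu^2\,dv_g}$. For $0\leq\beta\in L^\infty(M)$, $\beta\not\equiv0$, $0=\lambda_0(\beta)<\lambda_1(\beta)\leq\dots$ are the eigenvalues of $\Delta_gf=\lambda\beta f$; equivalently $\lambda_{m-1}(\beta)=\inf_{F_m}\sup_{u\in F_m\setminus\{0\}}\frac{\int_M|du|_g^2\,dv_g}{\int_Mu^2\beta\,dv_g}$ (quotient $=+\infty$ if the denominator vanishes). Here $F_m$ ranges over $m$-dimensional subspaces of $W^{1,2}(M)$. (The left-hand side is the paper's quantity $\mathcal{V}_m(M,g)$.) *)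

theory Defs
  imports "HOL-Analysis.Analysis"
begin

section \<open>Smooth maps\<close>

text \<open>Intended for open \<open>S\<close>: the values of \<open>f\<close> outside \<open>S\<close> are then irrelevant.\<close>

fun Ck_on :: "nat \<Rightarrow> 'e::euclidean_space set \<Rightarrow> ('e \<Rightarrow> 'f::real_normed_vector) \<Rightarrow> bool" where
  "Ck_on 0 S f \<longleftrightarrow> continuous_on S f"
| "Ck_on (Suc k) S f \<longleftrightarrow>
     (\<forall>x\<in>S. f differentiable (at x)) \<and>
     (\<forall>v. Ck_on k S (\<lambda>x. frechet_derivative f (at x) v))"

definition smooth_on :: "'e::euclidean_space set \<Rightarrow> ('e \<Rightarrow> 'f::real_normed_vector) \<Rightarrow> bool" where
  "smooth_on S f \<longleftrightarrow> (\<forall>k. Ck_on k S f)"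

section \<open>Closed Riemannian manifolds\<close>

text \<open>
  A chart is a pair \<open>(U, \<phi>)\<close> of its domain and its coordinate map; \<open>\<phi>\<close> is only
  meaningful on \<open>U\<close>. The dimension of the manifold is \<open>CARD('n)\<close>.
\<close>

type_synonym ('a, 'n) chart = "'a set \<times> ('a \<Rightarrow> real ^ 'n)"

definition chart_inv :: "('a, 'n) chart \<Rightarrow> real ^ 'n \<Rightarrow> 'a" where
  "chart_inv c = inv_into (fst c) (snd c)"

definition is_chart :: "'a::topological_space set \<Rightarrow> ('a, 'n::finite) chart \<Rightarrow> bool" where
  "is_chart M c \<longleftrightarrow>
     openin (top_of_set M) (fst c) \<and> open (snd c ` fst c) \<and>
     homeomorphism (fst c) (snd c ` fst c) (snd c) (chart_inv c)"

definition transition :: "('a, 'n) chart \<Rightarrow> ('a, 'n) chart \<Rightarrow> real ^ 'n \<Rightarrow> real ^ 'n" where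
  "transition c d = snd d \<circ> chart_inv c"

definition overlap :: "('a, 'n) chart \<Rightarrow> ('a, 'n) chart \<Rightarrow> (real ^ 'n) set" where
  "overlap c d = snd c ` (fst c \<inter> fst d)"

definition jacobian :: "('a, 'n::finite) chart \<Rightarrow> ('a, 'n) chart \<Rightarrow> real ^ 'n \<Rightarrow> real ^ 'n ^ 'n" where
  "jacobian c d x = matrix (frechet_derivative (transition c d) (at x))"

text \<open>
  The smooth structure is given by an atlas \<open>A\<close>, not required to be maximal. The metric
  \<open>g\<close> is given by its coefficient matrices \<open>g c x\<close> in each chart \<open>c\<close>, as a function of
  the coordinates \<open>x\<close>; the last assumption is the transformation law of a
  \<open>(0,2)\<close>-tensor. There is no boundary since charts have open image in \<open>real ^ 'n\<close>.
\<close>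

locale closed_riemannian_manifold =
  fixes M :: "'a::t2_space set"
    and A :: "('a, 'n::finite) chart set"
    and g :: "('a, 'n) chart \<Rightarrow> real ^ 'n \<Rightarrow> real ^ 'n ^ 'n"
  assumes nonempty: "M \<noteq> {}"
    and compact: "compact M"
    and connected: "connected M"
    and charts: "\<And>c. c \<in> A \<Longrightarrow> is_chart M c"
    and cover: "(\<Union>c\<in>A. fst c) = M"
    and smooth_transition:
      "\<And>c d. c \<in> A \<Longrightarrow> d \<in> A \<Longrightarrow> smooth_on (overlap c d) (transition c d)"
    and metric_smooth: "\<And>c. c \<in> A \<Longrightarrow> smooth_on (snd c ` fst c) (g c)"
    and metric_symmetric:
      "\<And>c x. c \<in> A \<Longrightarrow> x \<in> snd c ` fst c \<Longrightarrow> transpose (g c x) = g c x"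
    and metric_positive:
      "\<And>c x v. c \<in> A \<Longrightarrow> x \<in> snd c ` fst c \<Longrightarrow> v \<noteq> 0 \<Longrightarrow> v \<bullet> (g c x *v v) > 0"
    and metric_transform:
      "\<And>c d x. c \<in> A \<Longrightarrow> d \<in> A \<Longrightarrow> x \<in> overlap c d \<Longrightarrow>
         g c x = transpose (jacobian c d x) ** g d (transition c d x) ** jacobian c d x"

text \<open>
  The Riemannian volume \<open>dv\<^sub>g\<close> is the unique Borel measure on \<open>M\<close> with density
  \<open>sqrt (det g)\<close> with respect to Lebesgue measure in every chart.
\<close>

definition is_riemannian_volume ::
    "'a::topological_space set \<Rightarrow> ('a, 'n::finite) chart set \<Rightarrow>
     (('a, 'n) chart \<Rightarrow> real ^ 'n \<Rightarrow> real ^ 'n ^ 'n) \<Rightarrow> 'a measure \<Rightarrow> bool" where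
  "is_riemannian_volume M A g \<mu> \<longleftrightarrow>
     sets \<mu> = sets (restrict_space borel M) \<and>
     (\<forall>c\<in>A. \<forall>B\<in>sets \<mu>. B \<subseteq> fst c \<longrightarrow>
        emeasure \<mu> B = (\<integral>\<^sup>+x\<in>snd c ` B. ennreal (sqrt (det (g c x))) \<partial>lborel))"

definition riemannian_volume ::
    "'a::topological_space set \<Rightarrow> ('a, 'n::finite) chart set \<Rightarrow>
     (('a, 'n) chart \<Rightarrow> real ^ 'n \<Rightarrow> real ^ 'n ^ 'n) \<Rightarrow> 'a measure" where
  "riemannian_volume M A g = (THE \<mu>. is_riemannian_volume M A g \<mu>)"

section \<open>Weak differentials and \<open>W\<^sup>1\<^sup>,\<^sup>2(M)\<close>\<close>

definition test_function_on :: "(real ^ 'n::finite) set \<Rightarrow> (real ^ 'n \<Rightarrow> real) \<Rightarrow> bool" where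
  "test_function_on W \<eta> \<longleftrightarrow>
     smooth_on UNIV \<eta> \<and> (\<exists>K. compact K \<and> K \<subseteq> W \<and> (\<forall>x. x \<notin> K \<longrightarrow> \<eta> x = 0))"

definition weak_gradient_on ::
    "(real ^ 'n::finite) set \<Rightarrow> (real ^ 'n \<Rightarrow> real) \<Rightarrow> (real ^ 'n \<Rightarrow> real ^ 'n) \<Rightarrow> bool" where
  "weak_gradient_on W f G \<longleftrightarrow>
     (\<forall>K. compact K \<longrightarrow> K \<subseteq> W \<longrightarrow> set_integrable lborel K f \<and> set_integrable lborel K G) \<and>
     (\<forall>\<eta> i. test_function_on W \<eta> \<longrightarrow>
        (LINT x:W|lborel. f x * frechet_derivative \<eta> (at x) (axis i 1)) =
        - (LINT x:W|lborel. G x $ i * \<eta> x))"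

text \<open>
  A (not necessarily continuous) 1-form is given by its coefficients in each chart. The
  transformation law is imposed at every point, so that pointwise expressions do not
  depend on the chart even if the atlas is uncountable; a weak differential always has
  such a representative.
\<close>

definition one_form ::
    "('a, 'n::finite) chart set \<Rightarrow> (('a, 'n) chart \<Rightarrow> real ^ 'n \<Rightarrow> real ^ 'n) \<Rightarrow> bool" where
  "one_form A \<omega> \<longleftrightarrow>
     (\<forall>c\<in>A. \<forall>d\<in>A. \<forall>x\<in>overlap c d.
        \<omega> c x = transpose (jacobian c d x) *v \<omega> d (transition c d x))"

definition is_weak_differential ::
    "('a, 'n::finite) chart set \<Rightarrow> ('a \<Rightarrow> real) \<Rightarrow>
     (('a, 'n) chart \<Rightarrow> real ^ 'n \<Rightarrow> real ^ 'n) \<Rightarrow> bool" where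
  "is_weak_differential A u \<omega> \<longleftrightarrow>
     one_form A \<omega> \<and> (\<forall>c\<in>A. weak_gradient_on (snd c ` fst c) (u \<circ> chart_inv c) (\<omega> c))"

definition weak_differential ::
    "('a, 'n::finite) chart set \<Rightarrow> ('a \<Rightarrow> real) \<Rightarrow> ('a, 'n) chart \<Rightarrow> real ^ 'n \<Rightarrow> real ^ 'n" where
  "weak_differential A u = (SOME \<omega>. is_weak_differential A u \<omega>)"

text \<open>
  \<open>\<bar>\<omega>\<bar>\<^sub>g\<^sup>2\<close> at a point, where \<open>g\<close> acts on covectors by its inverse matrix; the value does
  not depend on the chart chosen around the point.
\<close>

definition one_form_normsq ::
    "('a, 'n::finite) chart set \<Rightarrow> (('a, 'n) chart \<Rightarrow> real ^ 'n \<Rightarrow> real ^ 'n ^ 'n) \<Rightarrow>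
     (('a, 'n) chart \<Rightarrow> real ^ 'n \<Rightarrow> real ^ 'n) \<Rightarrow> 'a \<Rightarrow> real" where
  "one_form_normsq A g \<omega> p =
     (let c = (SOME c. c \<in> A \<and> p \<in> fst c); x = snd c p
      in \<omega> c x \<bullet> (matrix_inv (g c x) *v \<omega> c x))"

text \<open>Elements of \<open>W\<^sup>1\<^sup>,\<^sup>2(M)\<close> are represented by Borel functions; values outside \<open>M\<close> play no role.\<close>

definition W12 ::
    "'a::topological_space set \<Rightarrow> ('a, 'n::finite) chart set \<Rightarrow>
     (('a, 'n) chart \<Rightarrow> real ^ 'n \<Rightarrow> real ^ 'n ^ 'n) \<Rightarrow> ('a \<Rightarrow> real) set" where
  "W12 M A g =
     {u. u \<in> borel_measurable (riemannian_volume M A g) \<and>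
         integrable (riemannian_volume M A g) (\<lambda>p. (u p)\<^sup>2) \<and>
         (\<exists>\<omega>. is_weak_differential A u \<omega> \<and>
              integrable (riemannian_volume M A g) (one_form_normsq A g \<omega>))}"

definition dirichlet_energy ::
    "'a::topological_space set \<Rightarrow> ('a, 'n::finite) chart set \<Rightarrow>
     (('a, 'n) chart \<Rightarrow> real ^ 'n \<Rightarrow> real ^ 'n ^ 'n) \<Rightarrow> ('a \<Rightarrow> real) \<Rightarrow> real" where
  "dirichlet_energy M A g u =
     (LINT p|riemannian_volume M A g. one_form_normsq A g (weak_differential A u) p)"

text \<open>
  An \<open>m\<close>-dimensional subspace of \<open>W\<^sup>1\<^sup>,\<^sup>2(M)\<close> is given by the linear combinations of \<open>m\<close>
  representatives. Linear independence is understood in \<open>W\<^sup>1\<^sup>,\<^sup>2(M)\<close>, i.e. modulo functions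
  vanishing almost everywhere; likewise for \<open>nonzero_elements\<close>.
\<close>

definition W12_subspace ::
    "'a::topological_space set \<Rightarrow> ('a, 'n::finite) chart set \<Rightarrow>
     (('a, 'n) chart \<Rightarrow> real ^ 'n \<Rightarrow> real ^ 'n ^ 'n) \<Rightarrow> nat \<Rightarrow> ('a \<Rightarrow> real) set \<Rightarrow> bool" where
  "W12_subspace M A g m F \<longleftrightarrow>
     (\<exists>b :: nat \<Rightarrow> 'a \<Rightarrow> real.
        (\<forall>i<m. b i \<in> W12 M A g) \<and>
        (\<forall>a :: nat \<Rightarrow> real.
           (AE p in riemannian_volume M A g. (\<Sum>i<m. a i * b i p) = 0) \<longrightarrow> (\<forall>i<m. a i = 0)) \<and>
        F = range (\<lambda>(a :: nat \<Rightarrow> real) p. \<Sum>i<m. a i * b i p))"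

definition nonzero_elements :: "'a measure \<Rightarrow> ('a \<Rightarrow> real) set \<Rightarrow> ('a \<Rightarrow> real) set" where
  "nonzero_elements \<mu> F = {u \<in> F. \<not> (AE p in \<mu>. u p = 0)}"

section \<open>Eigenvalues\<close>

definition Linfty :: "'a measure \<Rightarrow> ('a \<Rightarrow> real) set" where
  "Linfty \<mu> = {V \<in> borel_measurable \<mu>. \<exists>C. AE p in \<mu>. \<bar>V p\<bar> \<le> C}"

text \<open>
  \<open>schroedinger_eigenvalue M A g V m\<close> is \<open>\<nu>\<^sub>m(V)\<close>, with \<open>m \<ge> 1\<close>, and
  \<open>weighted_eigenvalue M A g \<beta> k\<close> is \<open>\<lambda>\<^sub>k(\<beta>)\<close>, with \<open>k \<ge> 0\<close> (whence the dimension \<open>k + 1\<close>),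
  both given by the min-max formula.
\<close>

definition schroedinger_eigenvalue ::
    "'a::topological_space set \<Rightarrow> ('a, 'n::finite) chart set \<Rightarrow>
     (('a, 'n) chart \<Rightarrow> real ^ 'n \<Rightarrow> real ^ 'n ^ 'n) \<Rightarrow> ('a \<Rightarrow> real) \<Rightarrow> nat \<Rightarrow> ereal" where
  "schroedinger_eigenvalue M A g V m =
     (let \<mu> = riemannian_volume M A g in
      INF F\<in>{F. W12_subspace M A g m F}. SUP u\<in>nonzero_elements \<mu> F.
        ereal ((dirichlet_energy M A g u - (LINT p|\<mu>. V p * (u p)\<^sup>2)) / (LINT p|\<mu>. (u p)\<^sup>2)))"

definition weighted_eigenvalue ::
    "'a::topological_space set \<Rightarrow> ('a, 'n::finite) chart set \<Rightarrow>
     (('a, 'n) chart \<Rightarrow> real ^ 'n \<Rightarrow> real ^ 'n ^ 'n) \<Rightarrow> ('a \<Rightarrow> real) \<Rightarrow> nat \<Rightarrow> ereal" where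
  "weighted_eigenvalue M A g \<beta> k =
     (let \<mu> = riemannian_volume M A g in
      INF F\<in>{F. W12_subspace M A g (k + 1) F}. SUP u\<in>nonzero_elements \<mu> F.
        (if (LINT p|\<mu>. (u p)\<^sup>2 * \<beta> p) = 0 then \<infinity>
         else ereal (dirichlet_energy M A g u / (LINT p|\<mu>. (u p)\<^sup>2 * \<beta> p))))"

end

theory Submission
  imports Defs "HOL-Real_Asymp.Real_Asymp"
begin

text \<open>
  Let \<open>E\<close> be the Dirichlet energy. Since \<open>\<nu>\<^sub>m\<^sub>+\<^sub>1(t \<beta>) \<ge> 0\<close> whenever \<open>0 \<le> t \<le> \<lambda>\<^sub>m(\<beta>)\<close>, the potentials \<open>t \<beta>\<close>
  give one inequality. For the other one, a bounded \<open>V\<^sub>0\<close> with \<open>\<nu>\<^sub>m\<^sub>+\<^sub>1(V\<^sub>0) \<ge> 0\<close> is replaced, for small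
  \<open>\<alpha> > 0\<close>, by a bounded \<open>V \<ge> 0\<close> with \<open>\<lambda>\<^sub>m(V) \<ge> 1\<close> and \<open>\<integral>V \<ge> \<integral>V\<^sub>0 - O(\<alpha>)\<close>. Let \<open>G = (1 + \<alpha> \<Delta>)\<^sup>-\<^sup>1\<close>; it is
  symmetric and positive with \<open>G 1 = 1\<close>, and \<open>(u - G u, u) / \<alpha> \<le> E(u)\<close>. Let \<open>D = 1 - \<alpha> (V\<^sub>0 - \<kappa>)\<close> with a
  suitable constant \<open>\<kappa> = O(\<alpha>)\<close>. Iterating \<open>h \<mapsto> min h (G h / D)\<close> from \<open>h = 1\<close> decreases \<open>(D h, h) - (G h, h)\<close>
  and leads to some \<open>0 \<le> h \<le> 1\<close> with \<open>h D h \<le> h G h\<close>. Hence \<open>V = (h G h - D h\<^sup>2) / \<alpha>\<close> is nonnegative and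
  \<open>\<integral>V \<ge> \<integral>(V\<^sub>0 - \<kappa>)\<close>. By the substitution \<open>u = h w\<close>, \<open>E(w) - \<integral>V w\<^sup>2\<close> is at least
  \<open>(u - G u, u) / \<alpha> - \<integral>(V\<^sub>0 - \<kappa>) u\<^sup>2\<close>, and by the assumption on \<open>V\<^sub>0\<close>, applied to the space of the
  \<open>G (h w)\<close>, the latter is nonnegative for some \<open>w \<noteq> 0\<close> in every space of dimension \<open>m + 1\<close>.
\<close>

section \<open>Square integrable functions\<close>

text \<open>The obstacle is the sign: the positive part of the potential is larger and may produce
  more than \<open>m\<close> negative eigenvalues. The construction comes from the formal limit
  \<open>\<alpha> = 0\<close>, where \<open>V = V\<^sub>0 h\<^sup>2 - h \<Delta> h\<close>.
  Integrating by parts, E(w) minus the integral of \<open>V w\<^sup>2\<close> becomes the integral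
  of \<open>(1 - h\<^sup>2) |dw|\<^sup>2\<close> plus E(h w) minus the integral of
  \<open>V\<^sub>0 (h w)\<^sup>2\<close>, so for \<open>h \<le> 1\<close> the substitution loses
  nothing. The choice \<open>h = 1\<close> returns \<open>V\<^sub>0\<close>, and
  \<open>V \<ge> 0\<close> says that \<open>h\<close> is a subsolution where it is positive, as in
  an obstacle problem with obstacle 1. But then \<open>h \<Delta> h\<close> need not be a bounded
  function. With \<open>(1 - G) / \<alpha>\<close> in place of \<open>\<Delta>\<close> it is one:
  \<open>h\<close> and \<open>G h\<close> lie between 0 and 1, whence
  \<open>V \<le> 1 / \<alpha>\<close>. The price is that \<open>h w\<close> lies in L2 only, so that
  the hypothesis on \<open>V\<^sub>0\<close> is applied to \<open>G (h w)\<close>;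
  \<open>\<kappa>\<close> pays for the difference. Infima and suprema in the min-max formulas are
  handled with a small slack in place of eigenfunctions.\<close>

definition L2 :: "'a measure \<Rightarrow> ('a \<Rightarrow> real) set" where
  "L2 \<mu> = {u \<in> borel_measurable \<mu>. integrable \<mu> (\<lambda>p. (u p)\<^sup>2)}"

lemma L2_measurable: "u \<in> L2 \<mu> \<Longrightarrow> u \<in> borel_measurable \<mu>"
  by (simp add: L2_def)

lemma L2_square: "u \<in> L2 \<mu> \<Longrightarrow> integrable \<mu> (\<lambda>p. (u p)\<^sup>2)"
  by (simp add: L2_def)

lemma L2_mult:
  assumes "u \<in> L2 \<mu>" "v \<in> L2 \<mu>"
  shows "integrable \<mu> (\<lambda>p. u p * v p)"
proof (rule Bochner_Integration.integrable_bound)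
  show "integrable \<mu> (\<lambda>p. (u p)\<^sup>2 + (v p)\<^sup>2)"
    using assms by (auto simp: L2_def)
  show "(\<lambda>p. u p * v p) \<in> borel_measurable \<mu>"
    using assms by (auto simp: L2_def)
  have "\<bar>a * b\<bar> \<le> a\<^sup>2 + b\<^sup>2" for a b :: real
  proof -
    have "0 \<le> (a - b)\<^sup>2" "0 \<le> (a + b)\<^sup>2" "0 \<le> a\<^sup>2" "0 \<le> b\<^sup>2" by simp_all
    then show ?thesis unfolding power2_diff power2_sum by linarith
  qed
  then show "AE p in \<mu>. norm (u p * v p) \<le> norm ((u p)\<^sup>2 + (v p)\<^sup>2)"
    by auto
qed

lemma L2_scale:
  assumes "u \<in> L2 \<mu>"
  shows "(\<lambda>p. c * u p) \<in> L2 \<mu>"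
  using assms by (auto simp: L2_def power_mult_distrib)

lemma L2_add:
  assumes "u \<in> L2 \<mu>" "v \<in> L2 \<mu>"
  shows "(\<lambda>p. u p + v p) \<in> L2 \<mu>"
proof -
  have "integrable \<mu> (\<lambda>p. (u p)\<^sup>2 + (v p)\<^sup>2 + 2 * (u p * v p))"
    using assms L2_mult[OF assms] by (intro Bochner_Integration.integrable_add) (auto simp: L2_def)
  then show ?thesis
    using assms by (auto simp: L2_def power2_sum algebra_simps)
qed

lemma L2_diff:
  assumes "u \<in> L2 \<mu>" "v \<in> L2 \<mu>"
  shows "(\<lambda>p. u p - v p) \<in> L2 \<mu>"
  using L2_add[OF assms(1) L2_scale[OF assms(2), of "-1"]] by simp

lemma L2_bounded_mult:
  assumes "u \<in> L2 \<mu>" "b \<in> borel_measurable \<mu>" "AE p in \<mu>. \<bar>b p\<bar> \<le> C"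
  shows "(\<lambda>p. b p * u p) \<in> L2 \<mu>"
proof -
  have "integrable \<mu> (\<lambda>p. (b p * u p)\<^sup>2)"
  proof (rule Bochner_Integration.integrable_bound)
    show "integrable \<mu> (\<lambda>p. C\<^sup>2 * (u p)\<^sup>2)"
      using assms by (auto simp: L2_def)
    show "(\<lambda>p. (b p * u p)\<^sup>2) \<in> borel_measurable \<mu>"
      using assms by (auto simp: L2_def)
    show "AE p in \<mu>. norm ((b p * u p)\<^sup>2) \<le> norm (C\<^sup>2 * (u p)\<^sup>2)"
      using assms(3)
    proof eventually_elim
      case (elim p)
      then have "(b p)\<^sup>2 \<le> C\<^sup>2"
        by (metis abs_le_square_iff abs_ge_self order.trans)
      then show ?case by (simp add: power_mult_distrib mult_right_mono)
    qed
  qed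
  then show ?thesis using assms by (auto simp: L2_def)
qed

lemma (in finite_measure) L2_bounded:
  assumes "b \<in> borel_measurable M" "AE p in M. \<bar>b p\<bar> \<le> C"
  shows "b \<in> L2 M"
proof -
  have "(\<lambda>p. 1::real) \<in> L2 M" by (auto simp: L2_def)
  from L2_bounded_mult[OF this assms] show ?thesis by simp
qed

lemma (in finite_measure) L2_integrable:
  assumes "u \<in> L2 M"
  shows "integrable M u"
proof -
  have "(\<lambda>p. 1::real) \<in> L2 M" by (auto simp: L2_def)
  from L2_mult[OF assms this] show ?thesis by simp
qed

lemma L2_sum:
  assumes "\<And>i. i \<in> I \<Longrightarrow> f i \<in> L2 \<mu>"
  shows "(\<lambda>p. \<Sum>i\<in>I. f i p) \<in> L2 \<mu>"
  using assms
proof (induction I rule: infinite_finite_induct)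
  case (insert i I)
  then show ?case using L2_add[of "f i" \<mu> "\<lambda>p. \<Sum>i\<in>I. f i p"] by simp
qed (auto simp: L2_def)

text \<open>The discriminant criterion. It yields Cauchy-Schwarz for abstract forms and for the
  metric at a point, and, with a small \<open>a\<close>, an approximate Euler-Lagrange equation for
  almost minimizers.\<close>

lemma quadratic_nonneg_imp:
  fixes a b c :: real
  assumes "\<And>t. 0 \<le> a + 2 * t * b + t\<^sup>2 * c" and "0 \<le> c"
  shows "b\<^sup>2 \<le> a * c"
proof (cases "c = 0")
  case True
  have "b = 0"
  proof (rule ccontr)
    assume "b \<noteq> 0"
    then show False
      \<comment> \<open>This \<open>t\<close> turns the affine expression
        \<open>a + 2 * t * b\<close> into \<open>-1\<close>.\<close>
      using assms(1)[of "- (a + 1) / (2 * b)"] True by (simp add: field_simps)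
  qed
  then show ?thesis using True by simp
next
  case False
  then have "c > 0" using assms(2) by simp
  then show ?thesis
    using assms(1)[of "- b / c"] by (simp add: field_simps power2_eq_square)
qed

section \<open>The L2 inner product and semidefinite forms on spaces of functions\<close>

definition ip :: "'a measure \<Rightarrow> ('a \<Rightarrow> real) \<Rightarrow> ('a \<Rightarrow> real) \<Rightarrow> real" where
  "ip \<mu> u v = (LINT p|\<mu>. u p * v p)"

lemma ip_commute: "ip \<mu> u v = ip \<mu> v u"
  by (simp add: ip_def mult.commute)

lemma ip_add:
  assumes "u \<in> L2 \<mu>" "v \<in> L2 \<mu>" "w \<in> L2 \<mu>"
  shows "ip \<mu> (\<lambda>p. u p + v p) w = ip \<mu> u w + ip \<mu> v w"
  unfolding ip_def using L2_mult[OF assms(1,3)] L2_mult[OF assms(2,3)]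
  by (simp add: distrib_right)

lemma ip_scale: "ip \<mu> (\<lambda>p. c * u p) w = c * ip \<mu> u w"
  unfolding ip_def by (simp add: mult.assoc)

lemma ip_nonneg: "0 \<le> ip \<mu> u u"
  by (simp add: ip_def)

lemma ip_square: "ip \<mu> u u = (LINT p|\<mu>. (u p)\<^sup>2)"
  by (simp add: ip_def power2_eq_square)

lemma ip_eq_0:
  assumes "u \<in> L2 \<mu>"
  shows "ip \<mu> u u = 0 \<longleftrightarrow> (AE p in \<mu>. u p = 0)"
  using assms unfolding ip_square
  by (subst integral_nonneg_eq_0_iff_AE) (auto simp: L2_def)

lemma ip_cong_AE:
  assumes "AE p in \<mu>. u p = u' p" "u \<in> borel_measurable \<mu>" "u' \<in> borel_measurable \<mu>"
    "w \<in> borel_measurable \<mu>"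
  shows "ip \<mu> u w = ip \<mu> u' w"
  unfolding ip_def using assms by (intro integral_cong_AE) auto

text \<open>Four forms are instances: the L2 inner product, the energy, the form of
  \<open>1 + \<alpha> \<Delta>\<close> and \<open>(G u, w)\<close>. Vectors are functions on points,
  so even the L2 inner product is only semidefinite: it ignores null sets. The carrier is a set
  because these forms live on different subspaces of one function type.\<close>

locale semi_inner =
  fixes W :: "('a \<Rightarrow> real) set" and Q :: "('a \<Rightarrow> real) \<Rightarrow> ('a \<Rightarrow> real) \<Rightarrow> real"
  assumes W_add: "u \<in> W \<Longrightarrow> v \<in> W \<Longrightarrow> (\<lambda>p. u p + v p) \<in> W"
    and W_scale: "u \<in> W \<Longrightarrow> (\<lambda>p. c * u p) \<in> W"
    and Q_add: "u \<in> W \<Longrightarrow> v \<in> W \<Longrightarrow> w \<in> W \<Longrightarrow> Q (\<lambda>p. u p + v p) w = Q u w + Q v w"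
    and Q_scale: "u \<in> W \<Longrightarrow> w \<in> W \<Longrightarrow> Q (\<lambda>p. c * u p) w = c * Q u w"
    and Q_commute: "u \<in> W \<Longrightarrow> v \<in> W \<Longrightarrow> Q u v = Q v u"
    and Q_nonneg: "u \<in> W \<Longrightarrow> 0 \<le> Q u u"
begin

lemma W_diff: "u \<in> W \<Longrightarrow> v \<in> W \<Longrightarrow> (\<lambda>p. u p - v p) \<in> W"
  using W_add[of u "\<lambda>p. -1 * v p"] W_scale[of v "-1"] by simp

lemma Q_diff:
  assumes "u \<in> W" "v \<in> W" "w \<in> W"
  shows "Q (\<lambda>p. u p - v p) w = Q u w - Q v w"
proof -
  have "Q (\<lambda>p. u p + (-1) * v p) w = Q u w + Q (\<lambda>p. (-1) * v p) w"
    by (intro Q_add W_scale assms)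
  also have "\<dots> = Q u w - Q v w"
    unfolding Q_scale[OF assms(2,3)] by simp
  finally show ?thesis by simp
qed

lemma Q_add_right:
  assumes "u \<in> W" "v \<in> W" "w \<in> W"
  shows "Q w (\<lambda>p. u p + v p) = Q w u + Q w v"
  unfolding Q_commute[OF assms(3) W_add[OF assms(1,2)]] Q_add[OF assms]
  using assms by (simp add: Q_commute)

lemma Q_diff_right:
  assumes "u \<in> W" "v \<in> W" "w \<in> W"
  shows "Q w (\<lambda>p. u p - v p) = Q w u - Q w v"
  unfolding Q_commute[OF assms(3) W_diff[OF assms(1,2)]] Q_diff[OF assms]
  using assms by (simp add: Q_commute)

lemma Q_scale_right:
  assumes "u \<in> W" "w \<in> W"
  shows "Q w (\<lambda>p. c * u p) = c * Q w u"
  unfolding Q_commute[OF assms(2) W_scale[OF assms(1)]] Q_scale[OF assms]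
  using assms by (simp add: Q_commute)

lemmas Q_simps = Q_add Q_diff Q_scale Q_add_right Q_diff_right Q_scale_right W_add W_diff W_scale

lemma Q_Cauchy_Schwarz:
  assumes "u \<in> W" "v \<in> W"
  shows "(Q u v)\<^sup>2 \<le> Q u u * Q v v"
proof (rule quadratic_nonneg_imp)
  show "0 \<le> Q v v" by (rule Q_nonneg) fact
  fix t
  have "0 \<le> Q (\<lambda>p. u p + t * v p) (\<lambda>p. u p + t * v p)"
    using assms by (intro Q_nonneg W_add W_scale)
  also have "\<dots> = Q u u + 2 * t * Q u v + t\<^sup>2 * Q v v"
    using assms Q_commute[of u v] by (simp add: Q_simps algebra_simps power2_eq_square)
  finally show "0 \<le> Q u u + 2 * t * Q u v + t\<^sup>2 * Q v v" .
qed

lemma W_zero: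
  assumes "u \<in> W"
  shows "(\<lambda>p. 0) \<in> W"
  using W_scale[OF assms, of 0] by simp

lemma W_sum:
  assumes "finite I" "W \<noteq> {}" "\<And>i. i \<in> I \<Longrightarrow> f i \<in> W"
  shows "(\<lambda>p. \<Sum>i\<in>I. f i p) \<in> W"
  using assms
proof (induction I)
  case empty
  then show ?case using W_zero by auto
next
  case (insert i I)
  then show ?case using W_add[of "f i" "\<lambda>p. \<Sum>i\<in>I. f i p"] by simp
qed

end

lemma semi_inner_ip: "semi_inner (L2 \<mu>) (ip \<mu>)"
  by unfold_locales (simp_all add: L2_add L2_scale ip_add ip_scale ip_nonneg, rule ip_commute)

lemma ip_Cauchy_Schwarz:
  assumes "u \<in> L2 \<mu>" "v \<in> L2 \<mu>"
  shows "(ip \<mu> u v)\<^sup>2 \<le> ip \<mu> u u * ip \<mu> v v"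
  by (rule semi_inner.Q_Cauchy_Schwarz[OF semi_inner_ip assms])

section \<open>Closed forms and their resolvents\<close>

text \<open>A \<open>C\<^sup>1\<close> contraction that fixes exactly the nonnegative numbers: composition with it decreases
  the energy, which makes the resolvent positive.\<close>

definition exp_damp :: "real \<Rightarrow> real" where
  "exp_damp t = (if t \<ge> 0 then t else exp t - 1)"

lemma exp_damp_neg: "t < 0 \<Longrightarrow> t < exp_damp t \<and> exp_damp t < 0"
  using exp_minus_greater[of "-t"] by (auto simp: exp_damp_def)

text \<open>Abstract version of the Dirichlet energy on \<open>W\<^sup>1\<^sup>,\<^sup>2(M)\<close>.\<close>

locale closed_form = finite_measure \<mu> + semi_inner W B
  for \<mu> :: "'a measure" and W :: "('a \<Rightarrow> real) set" and B +
  assumes W_L2: "W \<subseteq> L2 \<mu>"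
    and one_in_W: "(\<lambda>p. 1) \<in> W"
    and B_one: "B (\<lambda>p. 1) (\<lambda>p. 1) = 0"
    and exp_damp_W: "u \<in> W \<Longrightarrow> (\<lambda>p. exp_damp (u p)) \<in> W"
    and B_exp_damp: "u \<in> W \<Longrightarrow> B (\<lambda>p. exp_damp (u p)) (\<lambda>p. exp_damp (u p)) \<le> B u u"
    and complete: "(\<And>k :: nat. f k \<in> W) \<Longrightarrow>
      (\<And>\<epsilon>. \<epsilon> > 0 \<Longrightarrow> \<exists>N. \<forall>k\<ge>N. \<forall>l\<ge>N.
         B (\<lambda>p. f k p - f l p) (\<lambda>p. f k p - f l p) + ip \<mu> (\<lambda>p. f k p - f l p) (\<lambda>p. f k p - f l p) < \<epsilon>) \<Longrightarrow>
      \<exists>u\<in>W. (\<lambda>k. B (\<lambda>p. f k p - u p) (\<lambda>p. f k p - u p) + ip \<mu> (\<lambda>p. f k p - u p) (\<lambda>p. f k p - u p)) \<longlonglongrightarrow> 0"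

locale form_resolvent = closed_form +
  fixes \<alpha> :: real
  assumes alpha_pos: "0 < \<alpha>"
begin

definition Q where "Q u v = \<alpha> * B u v + ip \<mu> u v"

lemma W_L2D: "u \<in> W \<Longrightarrow> u \<in> L2 \<mu>"
  using W_L2 by blast

sublocale L: semi_inner "L2 \<mu>" "ip \<mu>"
  by (rule semi_inner_ip)

sublocale Q: semi_inner W Q
proof
  fix u v w c
  assume [simp]: "u \<in> W"
  have [simp]: "u \<in> L2 \<mu>" by (simp add: W_L2D)
  show "(\<lambda>p. c * u p) \<in> W" by (rule W_scale) simp
  have "0 \<le> B u u" by (rule Q_nonneg) simp
  then show "0 \<le> Q u u" using alpha_pos ip_nonneg[of \<mu> u] by (simp add: Q_def)
  { assume [simp]: "w \<in> W"
    show "Q (\<lambda>p. c * u p) w = c * Q u w"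
      by (simp add: Q_def Q_scale ip_scale algebra_simps) }
  assume [simp]: "v \<in> W"
  have [simp]: "v \<in> L2 \<mu>" by (simp add: W_L2D)
  show "(\<lambda>p. u p + v p) \<in> W" by (rule W_add) simp_all
  show "Q u v = Q v u" using Q_commute[of u v] ip_commute[of \<mu> u v] by (simp add: Q_def)
  assume [simp]: "w \<in> W"
  have [simp]: "w \<in> L2 \<mu>" by (simp add: W_L2D)
  show "Q (\<lambda>p. u p + v p) w = Q u w + Q v w"
    by (simp add: Q_def Q_add ip_add algebra_simps)
qed

text \<open>The weak form of \<open>v + \<alpha> \<Delta> v = u\<close>. It is a relation because
  \<open>v\<close> is determined only up to null sets, and linearity holds exactly before a
  representative is chosen.\<close>

definition solves :: "('a \<Rightarrow> real) \<Rightarrow> ('a \<Rightarrow> real) \<Rightarrow> bool" where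
  "solves u v \<longleftrightarrow> v \<in> W \<and> (\<forall>z\<in>W. Q v z = ip \<mu> u z)"

text \<open>The direct method: the functional \<open>Q v v - 2 * ip \<mu> u v\<close> has the
  equation as its Euler-Lagrange equation. It is bounded below, a minimizing sequence is Cauchy by
  the parallelogram law, and the equation is obtained in the limit from approximate equations for
  the members of the sequence.\<close>

lemma solution_exists:
  assumes u: "u \<in> L2 \<mu>"
  shows "\<exists>v. solves u v"
proof -
  define N where "N v = Q v v - 2 * ip \<mu> u v" for v
  have B0: "0 \<le> B v v" if "v \<in> W" for v using Q_nonneg[OF that] .
  \<comment> \<open>Complete the square: \<open>N v\<close> is \<open>\<alpha> * B v v\<close> plus
    the squared distance of \<open>v\<close> and \<open>u\<close> minus
    \<open>ip \<mu> u u\<close>.\<close>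
  have lower: "- ip \<mu> u u \<le> N v" if "v \<in> W" for v
  proof -
    have "0 \<le> ip \<mu> (\<lambda>p. v p - u p) (\<lambda>p. v p - u p)" by (rule ip_nonneg)
    also have "\<dots> = ip \<mu> v v - 2 * ip \<mu> u v + ip \<mu> u u"
      using u W_L2D[OF that] ip_commute[of \<mu> u v]
      by (simp add: L.Q_diff L.Q_diff_right L.W_diff)
    finally have "0 \<le> ip \<mu> v v - 2 * ip \<mu> u v + ip \<mu> u u" .
    moreover have "0 \<le> \<alpha> * B v v" using B0[OF that] alpha_pos by simp
    ultimately show ?thesis unfolding N_def Q_def by linarith
  qed
  define I where "I = Inf (N ` W)"
  have bdd: "bdd_below (N ` W)" using lower by (auto simp: bdd_below_def)
  have ne: "N ` W \<noteq> {}" using one_in_W by auto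
  have I_le: "I \<le> N v" if "v \<in> W" for v
    unfolding I_def using bdd that by (simp add: cInf_lower)
  have "\<exists>v\<in>W. N v < I + 1 / Suc k" for k
    using cInf_lessD[OF ne, of "I + 1 / Suc k"] by (auto simp: I_def)
  then obtain f where fW: "\<And>k. f k \<in> W" and fN: "\<And>k. N (f k) < I + 1 / Suc k"
    by metis
  \<comment> \<open>The midpoint of \<open>v\<close> and \<open>w\<close> is a competitor, and the
    quadratic part of \<open>N\<close> satisfies the parallelogram law.\<close>
  have parallelogram: "Q (\<lambda>p. v p - w p) (\<lambda>p. v p - w p) \<le> 2 * N v + 2 * N w - 4 * I"
    if vw: "v \<in> W" "w \<in> W" for v w
  proof -
    let ?m = "\<lambda>p. (1/2) * (v p + w p)"
    have L: "v \<in> L2 \<mu>" "w \<in> L2 \<mu>" using vw W_L2D by auto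
    have "ip \<mu> u ?m = (ip \<mu> u v + ip \<mu> u w) / 2"
      using ip_scale[of \<mu> "1/2" "\<lambda>p. v p + w p" u] ip_add[OF L u]
      by (simp add: ip_commute[of \<mu> u])
    moreover have "Q ?m ?m = (Q v v + 2 * Q v w + Q w w) / 4"
      using vw Q.Q_commute[of v w] Q.Q_scale[of "\<lambda>p. v p + w p" ?m "1/2"]
        Q.Q_scale_right[of "\<lambda>p. v p + w p" "\<lambda>p. v p + w p" "1/2"]
      by (simp only: Q.W_add Q.W_scale Q.Q_add Q.Q_add_right) (simp add: field_simps)
    moreover have "Q (\<lambda>p. v p - w p) (\<lambda>p. v p - w p) = Q v v - 2 * Q v w + Q w w"
      using vw Q.Q_commute[of v w] by (simp add: Q.Q_diff Q.Q_diff_right Q.W_diff)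
    moreover have "I \<le> N ?m"
      by (intro I_le Q.W_scale Q.W_add vw)
    ultimately show ?thesis by (simp add: N_def field_simps)
  qed
  have "\<exists>v\<in>W. (\<lambda>k. B (\<lambda>p. f k p - v p) (\<lambda>p. f k p - v p) + ip \<mu> (\<lambda>p. f k p - v p) (\<lambda>p. f k p - v p)) \<longlonglongrightarrow> 0"
  proof (rule complete[OF fW])
    fix \<epsilon> :: real assume "\<epsilon> > 0"
    \<comment> \<open>Completeness is stated for \<open>B + ip\<close>, so the bound on
      \<open>Q\<close> is divided by the smaller of its two weights.\<close>
    define d where "d = min \<alpha> 1"
    have d: "d > 0" "d \<le> \<alpha>" "d \<le> 1" using alpha_pos by (auto simp: d_def)
    obtain K :: nat where K: "4 / (Suc K) < d * \<epsilon>"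
    proof -
      obtain K :: nat where "4 / (d * \<epsilon>) < real K" using reals_Archimedean2 by blast
      then have "4 < real K * (d * \<epsilon>)" using d \<open>\<epsilon> > 0\<close> by (simp add: field_simps)
      also have "\<dots> \<le> real (Suc K) * (d * \<epsilon>)"
        using d \<open>\<epsilon> > 0\<close> by (intro mult_right_mono) auto
      finally have "4 / (Suc K) < d * \<epsilon>" by (simp add: field_simps)
      then show ?thesis by (rule that)
    qed
    show "\<exists>N. \<forall>k\<ge>N. \<forall>l\<ge>N.
         B (\<lambda>p. f k p - f l p) (\<lambda>p. f k p - f l p) + ip \<mu> (\<lambda>p. f k p - f l p) (\<lambda>p. f k p - f l p) < \<epsilon>"
    proof (intro exI allI impI)
      fix k l assume kl: "K \<le> k" "K \<le> l"
      let ?z = "\<lambda>p. f k p - f l p"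
      have z: "?z \<in> W" by (intro Q.W_diff fW)
      have "1 / Suc k \<le> 1 / Suc K" "1 / Suc l \<le> 1 / Suc K" using kl by (auto simp: field_simps)
      then have "Q ?z ?z < 4 / Suc K"
        using parallelogram[OF fW fW, of k l] fN[of k] fN[of l] by simp
      then have "Q ?z ?z < d * \<epsilon>" using K by simp
      moreover have "d * B ?z ?z \<le> \<alpha> * B ?z ?z" "d * ip \<mu> ?z ?z \<le> 1 * ip \<mu> ?z ?z"
        using d B0[OF z] ip_nonneg[of \<mu> ?z] by (intro mult_right_mono; simp)+
      ultimately have "d * (B ?z ?z + ip \<mu> ?z ?z) < d * \<epsilon>" by (simp add: Q_def distrib_left)
      then show "B ?z ?z + ip \<mu> ?z ?z < \<epsilon>" using d by simp
    qed
  qed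
  then obtain v where v: "v \<in> W" and
    lim: "(\<lambda>k. B (\<lambda>p. f k p - v p) (\<lambda>p. f k p - v p) + ip \<mu> (\<lambda>p. f k p - v p) (\<lambda>p. f k p - v p)) \<longlonglongrightarrow> 0"
    by blast
  have limQ: "(\<lambda>k. Q (\<lambda>p. f k p - v p) (\<lambda>p. f k p - v p)) \<longlonglongrightarrow> 0"
  proof (rule tendsto_sandwich[OF _ _ tendsto_const])
    show "(\<lambda>k. max \<alpha> 1 * (B (\<lambda>p. f k p - v p) (\<lambda>p. f k p - v p) + ip \<mu> (\<lambda>p. f k p - v p) (\<lambda>p. f k p - v p))) \<longlonglongrightarrow> 0"
      using tendsto_mult_left[OF lim, of "max \<alpha> 1"] by simp
    show "\<forall>\<^sub>F k in sequentially. 0 \<le> Q (\<lambda>p. f k p - v p) (\<lambda>p. f k p - v p)"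
      by (intro always_eventually allI Q.Q_nonneg Q.W_diff fW v)
    show "\<forall>\<^sub>F k in sequentially. Q (\<lambda>p. f k p - v p) (\<lambda>p. f k p - v p) \<le>
       max \<alpha> 1 * (B (\<lambda>p. f k p - v p) (\<lambda>p. f k p - v p) + ip \<mu> (\<lambda>p. f k p - v p) (\<lambda>p. f k p - v p))"
    proof (intro always_eventually allI)
      fix k
      let ?z = "\<lambda>p. f k p - v p"
      have z: "?z \<in> W" by (intro Q.W_diff fW v)
      have "\<alpha> * B ?z ?z \<le> max \<alpha> 1 * B ?z ?z" "1 * ip \<mu> ?z ?z \<le> max \<alpha> 1 * ip \<mu> ?z ?z"
        using B0[OF z] ip_nonneg[of \<mu> ?z] by (intro mult_right_mono; simp)+
      then show "Q ?z ?z \<le> max \<alpha> 1 * (B ?z ?z + ip \<mu> ?z ?z)" by (simp add: Q_def distrib_left)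
    qed
  qed
  have "Q v z = ip \<mu> u z" if z: "z \<in> W" for z
  proof -
    \<comment> \<open>\<open>f k\<close> is minimal up to \<open>1 / Suc k\<close>, so perturbing it
      by \<open>t * z\<close> gives a quadratic in \<open>t\<close> that is nonnegative after adding
      \<open>1 / Suc k\<close>; the discriminant bounds the defect in the equation.\<close>
    have variation: "(Q (f k) z - ip \<mu> u z)\<^sup>2 \<le> 1 / Suc k * Q z z" for k
    proof (rule quadratic_nonneg_imp)
      show "0 \<le> Q z z" by (rule Q.Q_nonneg) fact
      fix t
      let ?w = "\<lambda>p. f k p + t * z p"
      have tz: "(\<lambda>p. t * z p) \<in> W" by (rule W_scale) fact
      have w: "?w \<in> W" using fW tz by (rule W_add)
      have "Q ?w ?w = Q (f k) (f k) + 2 * t * Q (f k) z + t\<^sup>2 * Q z z"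
        using Q.Q_commute[OF fW z, of k] z fW[of k] tz
        by (simp add: Q.Q_simps algebra_simps power2_eq_square)
      moreover have "ip \<mu> u ?w = ip \<mu> u (f k) + t * ip \<mu> u z"
        using ip_add[OF W_L2D[OF fW] W_L2D[OF tz] u, of k] ip_scale[of \<mu> t z u]
        by (simp add: ip_commute[of \<mu> u])
      moreover have "I \<le> N ?w" using w by (rule I_le)
      moreover have "N (f k) < I + 1 / Suc k" by (rule fN)
      ultimately show "0 \<le> 1 / Suc k + 2 * t * (Q (f k) z - ip \<mu> u z) + t\<^sup>2 * Q z z"
        unfolding N_def by (simp add: algebra_simps)
    qed
    have "(\<lambda>k. (Q (f k) z - ip \<mu> u z)\<^sup>2) \<longlonglongrightarrow> 0"
    proof (rule tendsto_sandwich[OF _ _ tendsto_const])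
      show "(\<lambda>k. 1 / Suc k * Q z z) \<longlonglongrightarrow> 0"
        using tendsto_mult_right[OF LIMSEQ_inverse_real_of_nat, of "Q z z"] by (simp add: inverse_eq_divide)
    qed (use variation in auto)
    then have 1: "(\<lambda>k. Q (f k) z - ip \<mu> u z) \<longlonglongrightarrow> 0"
      by (simp add: power_tendsto_0_iff)
    have "(\<lambda>k. (Q (\<lambda>p. f k p - v p) z)\<^sup>2) \<longlonglongrightarrow> 0"
    proof (rule tendsto_sandwich[OF _ _ tendsto_const])
      show "(\<lambda>k. Q (\<lambda>p. f k p - v p) (\<lambda>p. f k p - v p) * Q z z) \<longlonglongrightarrow> 0"
        using tendsto_mult_right[OF limQ, of "Q z z"] by simp
      show "\<forall>\<^sub>F k in sequentially. (Q (\<lambda>p. f k p - v p) z)\<^sup>2 \<le> Q (\<lambda>p. f k p - v p) (\<lambda>p. f k p - v p) * Q z z"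
        by (intro always_eventually allI Q.Q_Cauchy_Schwarz Q.W_diff fW v z)
    qed auto
    then have 2: "(\<lambda>k. Q (f k) z - Q v z) \<longlonglongrightarrow> 0"
      using fW v z by (simp add: power_tendsto_0_iff Q.Q_diff)
    from tendsto_diff[OF 1 2] have "(\<lambda>k::nat. Q v z - ip \<mu> u z) \<longlonglongrightarrow> 0" by simp
    then show ?thesis by (simp add: LIMSEQ_const_iff)
  qed
  then show ?thesis using v by (auto simp: solves_def)
qed

text \<open>\<open>G = (1 + \<alpha> \<Delta>)\<^sup>-\<^sup>1\<close>\<close>

definition G :: "('a \<Rightarrow> real) \<Rightarrow> 'a \<Rightarrow> real" where
  "G u = (SOME v. solves u v)"

lemma G_solves: "u \<in> L2 \<mu> \<Longrightarrow> solves u (G u)"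
  unfolding G_def using someI_ex[OF solution_exists] .

lemma G_W: "u \<in> L2 \<mu> \<Longrightarrow> G u \<in> W"
  using G_solves by (auto simp: solves_def)

lemma G_L2: "u \<in> L2 \<mu> \<Longrightarrow> G u \<in> L2 \<mu>"
  using G_W W_L2D by blast

lemma G_eq: "u \<in> L2 \<mu> \<Longrightarrow> z \<in> W \<Longrightarrow> Q (G u) z = ip \<mu> u z"
  using G_solves by (auto simp: solves_def)

section \<open>Uniqueness, linearity and positivity of the resolvent\<close>

lemma Q_eq_0:
  assumes "z \<in> W" "Q z z \<le> 0"
  shows "AE p in \<mu>. z p = 0"
proof -
  have "0 \<le> \<alpha> * B z z" using Q_nonneg[OF assms(1)] alpha_pos by simp
  then have "ip \<mu> z z = 0"
    using assms(2) ip_nonneg[of \<mu> z] unfolding Q_def by linarith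
  then show ?thesis using ip_eq_0[OF W_L2D[OF assms(1)]] by simp
qed

lemma solves_unique:
  assumes "solves u v" "solves u v'"
  shows "AE p in \<mu>. v p = v' p"
proof -
  have v: "v \<in> W" "v' \<in> W" using assms by (auto simp: solves_def)
  have "Q (\<lambda>p. v p - v' p) (\<lambda>p. v p - v' p) = 0"
    using assms v Q.W_diff[OF v] by (simp add: Q.Q_diff solves_def)
  then have "AE p in \<mu>. v p - v' p = 0"
    by (intro Q_eq_0 Q.W_diff v) simp
  then show ?thesis by eventually_elim simp
qed

lemma solves_add:
  assumes "solves u v" "solves u' v'" "u \<in> L2 \<mu>" "u' \<in> L2 \<mu>"
  shows "solves (\<lambda>p. u p + u' p) (\<lambda>p. v p + v' p)"
  using assms by (auto simp: solves_def Q.Q_add ip_add W_L2D intro: Q.W_add)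

lemma solves_scale:
  assumes "solves u v"
  shows "solves (\<lambda>p. c * u p) (\<lambda>p. c * v p)"
  using assms by (auto simp: solves_def Q.Q_scale ip_scale intro: Q.W_scale)

lemma solves_sum:
  assumes "finite I" "\<And>i. i \<in> I \<Longrightarrow> solves (f i) (v i)" "\<And>i. i \<in> I \<Longrightarrow> f i \<in> L2 \<mu>"
  shows "solves (\<lambda>p. \<Sum>i\<in>I. f i p) (\<lambda>p. \<Sum>i\<in>I. v i p)"
  using assms
proof (induction I)
  case empty
  have "Q (\<lambda>p. 0 * 1) z = 0" if "z \<in> W" for z
    using Q.Q_scale[OF one_in_W that, of 0] by simp
  then show ?case using Q.W_zero[OF one_in_W] by (auto simp: solves_def ip_def)
next
  case (insert i I)
  then show ?case
    using solves_add[of "f i" "v i" "\<lambda>p. \<Sum>i\<in>I. f i p" "\<lambda>p. \<Sum>i\<in>I. v i p"]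
      L2_sum[of I f \<mu>] by simp
qed

text \<open>For \<open>u \<ge> 0\<close>, composing \<open>v\<close> with \<open>exp_damp\<close>
  raises neither the energy nor the distance to \<open>u\<close>, so it yields another minimizer of
  the functional behind the equation. Minimizers agree almost everywhere, and
  \<open>exp_damp\<close> fixes no negative number.\<close>

lemma solves_positive:
  assumes sol: "solves u v" and u: "u \<in> L2 \<mu>" and pos: "AE p in \<mu>. 0 \<le> u p"
  shows "AE p in \<mu>. 0 \<le> v p"
proof -
  let ?w = "\<lambda>p. exp_damp (v p)"
  let ?z = "\<lambda>p. exp_damp (v p) - v p"
  have v: "v \<in> W" using sol by (simp add: solves_def)
  have w: "?w \<in> W" using v by (rule exp_damp_W)
  have z: "?z \<in> W" using Q.W_diff[OF w v] .
  have L: "v \<in> L2 \<mu>" "?w \<in> L2 \<mu>" using v w W_L2D by auto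
  have "ip \<mu> (\<lambda>p. ?w p - u p) (\<lambda>p. ?w p - u p) \<le> ip \<mu> (\<lambda>p. v p - u p) (\<lambda>p. v p - u p)"
    unfolding ip_def
  proof (rule integral_mono_AE)
    show "AE p in \<mu>. (exp_damp (v p) - u p) * (exp_damp (v p) - u p) \<le> (v p - u p) * (v p - u p)"
      using pos
    proof eventually_elim
      case (elim p)
      show ?case
      proof (cases "v p \<ge> 0")
        case True
        then show ?thesis by (simp add: exp_damp_def)
      next
        case False
        \<comment> \<open>The new value lies between \<open>v p\<close> and 0, hence closer to
          \<open>u p \<ge> 0\<close>.\<close>
        then have "v p < exp_damp (v p)" "exp_damp (v p) < 0" using exp_damp_neg[of "v p"] by auto
        then show ?thesis
          using elim mult_mono[of "u p - exp_damp (v p)" "u p - v p" "u p - exp_damp (v p)" "u p - v p"]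
          by (simp add: algebra_simps)
      qed
    qed
  qed (use L u in \<open>auto intro!: L2_mult L2_diff\<close>)
  moreover have "ip \<mu> (\<lambda>p. ?w p - u p) (\<lambda>p. ?w p - u p) = ip \<mu> ?w ?w - 2 * ip \<mu> u ?w + ip \<mu> u u"
    using L u ip_commute[of \<mu> ?w u] by (simp add: L.Q_diff L.Q_diff_right L.W_diff)
  moreover have "ip \<mu> (\<lambda>p. v p - u p) (\<lambda>p. v p - u p) = ip \<mu> v v - 2 * ip \<mu> u v + ip \<mu> u u"
    using L u ip_commute[of \<mu> v u] by (simp add: L.Q_diff L.Q_diff_right L.W_diff)
  moreover have "\<alpha> * B ?w ?w \<le> \<alpha> * B v v"
    using B_exp_damp[OF v] alpha_pos by simp
  ultimately have "Q ?w ?w - 2 * ip \<mu> u ?w \<le> Q v v - 2 * ip \<mu> u v"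
    unfolding Q_def by linarith
  moreover have "Q v ?w = ip \<mu> u ?w" "Q v v = ip \<mu> u v"
    using sol v w by (auto simp: solves_def)
  moreover have "Q ?z ?z = Q ?w ?w - 2 * Q v ?w + Q v v"
    using v w Q.Q_commute[OF v w] by (simp add: Q.Q_diff Q.Q_diff_right Q.W_diff)
  \<comment> \<open>By the equation for \<open>v\<close>, the expansion of \<open>Q ?z ?z\<close> is
    the difference of the values of the functional at \<open>?w\<close> and at
    \<open>v\<close>.\<close>
  ultimately have "Q ?z ?z \<le> 0" by simp
  from Q_eq_0[OF z this] show ?thesis
  proof eventually_elim
    case (elim p)
    then show ?case using exp_damp_neg[of "v p"] by force
  qed
qed

lemma B_one_left:
  assumes "z \<in> W"
  shows "B (\<lambda>p. 1) z = 0"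
  using Q_Cauchy_Schwarz[OF one_in_W assms] B_one by simp

lemma solves_one: "solves (\<lambda>p. 1) (\<lambda>p. 1)"
  using one_in_W by (auto simp: solves_def Q_def B_one_left)

lemma one_L2: "(\<lambda>p. 1) \<in> L2 \<mu>"
  using one_in_W W_L2D by blast

lemma G_one: "AE p in \<mu>. G (\<lambda>p. 1) p = 1"
  using solves_unique[OF G_solves solves_one] one_L2 by simp

lemma G_nonneg:
  assumes "u \<in> L2 \<mu>" "AE p in \<mu>. 0 \<le> u p"
  shows "AE p in \<mu>. 0 \<le> G u p"
  using solves_positive[OF G_solves] assms by blast

text \<open>Positivity applied to \<open>1 - u\<close>, because the constant 1 solves its own
  equation.\<close>

lemma G_le_one:
  assumes "u \<in> L2 \<mu>" "AE p in \<mu>. u p \<le> 1"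
  shows "AE p in \<mu>. G u p \<le> 1"
proof -
  have "solves (\<lambda>p. 1 + (-1) * u p) (\<lambda>p. 1 + (-1) * G u p)"
    using assms by (intro solves_add solves_one solves_scale G_solves one_L2 L2_scale)
  moreover have "(\<lambda>p. 1 + (-1) * u p) \<in> L2 \<mu>"
    using assms by (intro L2_add one_L2 L2_scale)
  moreover have "AE p in \<mu>. 0 \<le> 1 + (-1) * u p" using assms(2) by simp
  ultimately have "AE p in \<mu>. 0 \<le> 1 + (-1) * G u p" by (rule solves_positive)
  then show ?thesis by eventually_elim simp
qed

abbreviation g where "g u w \<equiv> ip \<mu> (G u) w"

text \<open>Testing the equation for \<open>G w\<close> with \<open>G u\<close>. The right-hand side
  is symmetric, and nonnegative on the diagonal, which makes \<open>g\<close> a semidefinite form on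
  all of L2.\<close>

lemma g_eq_Q: "u \<in> L2 \<mu> \<Longrightarrow> w \<in> L2 \<mu> \<Longrightarrow> g u w = Q (G w) (G u)"
  using G_eq[of w "G u"] G_W[of u] ip_commute[of \<mu> w "G u"] by simp

lemma g_commute: "u \<in> L2 \<mu> \<Longrightarrow> w \<in> L2 \<mu> \<Longrightarrow> g u w = g w u"
  using Q.Q_commute[OF G_W[of u] G_W[of w]] by (simp add: g_eq_Q)

sublocale g: semi_inner "L2 \<mu>" g
proof
  fix u v w :: "'a \<Rightarrow> real" and c :: real
  assume u: "u \<in> L2 \<mu>"
  show "(\<lambda>p. c * u p) \<in> L2 \<mu>" using u by (rule L2_scale)
  show "0 \<le> g u u" using u by (simp add: g_eq_Q Q.Q_nonneg G_W)
  { assume w: "w \<in> L2 \<mu>"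
    show "g (\<lambda>p. c * u p) w = c * g u w"
      using u w g_commute[OF L2_scale[OF u, of c] w] g_commute[OF w u]
      by (simp add: L.Q_scale_right G_L2) }
  assume v: "v \<in> L2 \<mu>"
  show "(\<lambda>p. u p + v p) \<in> L2 \<mu>" using u v by (rule L2_add)
  show "g u v = g v u" using u v by (rule g_commute)
  assume w: "w \<in> L2 \<mu>"
  show "g (\<lambda>p. u p + v p) w = g u w + g v w"
    using u v w g_commute[OF L2_add[OF u v] w] g_commute[OF w u] g_commute[OF w v]
    by (simp add: L.Q_add_right G_L2)
qed

lemma g_one: "w \<in> L2 \<mu> \<Longrightarrow> g (\<lambda>p. 1) w = (LINT p|\<mu>. w p)"
proof -
  assume w: "w \<in> L2 \<mu>"
  have "g (\<lambda>p. 1) w = ip \<mu> (\<lambda>p. 1) w"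
    using G_one w G_L2[OF one_L2] by (intro ip_cong_AE) (auto simp: L2_measurable)
  then show ?thesis by (simp add: ip_def)
qed

text \<open>The loss \<open>(u - G u, u)\<close> splits exactly into the energy of the smoothed
  function and the squared smoothing error. The second term later absorbs the error made by
  replacing \<open>u\<close> by \<open>G u\<close> in the potential term.\<close>

lemma energy_identity:
  assumes u: "u \<in> L2 \<mu>"
  shows "ip \<mu> u u - g u u = \<alpha> * B (G u) (G u) + ip \<mu> (\<lambda>p. u p - G u p) (\<lambda>p. u p - G u p)"
proof -
  have "ip \<mu> (\<lambda>p. u p - G u p) (\<lambda>p. u p - G u p) = ip \<mu> u u - 2 * g u u + ip \<mu> (G u) (G u)"
    using u G_L2[OF u] ip_commute[of \<mu> u "G u"] by (simp add: L.Q_diff L.Q_diff_right L.W_diff)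
  moreover have "\<alpha> * B (G u) (G u) + ip \<mu> (G u) (G u) = g u u"
    using g_eq_Q[OF u u] by (simp add: Q_def)
  ultimately show ?thesis by linarith
qed

lemma G_contraction:
  assumes u: "u \<in> L2 \<mu>"
  shows "ip \<mu> (G u) (G u) \<le> ip \<mu> u u" "g u u \<le> ip \<mu> u u"
proof -
  have b: "0 \<le> \<alpha> * B (G u) (G u)" using Q_nonneg[OF G_W[OF u]] alpha_pos by simp
  then show 1: "g u u \<le> ip \<mu> u u"
    using energy_identity[OF u] ip_nonneg[of \<mu> "\<lambda>p. u p - G u p"] by simp
  have "ip \<mu> (G u) (G u) \<le> g u u"
    using g_eq_Q[OF u u] b by (simp add: Q_def)
  then show "ip \<mu> (G u) (G u) \<le> ip \<mu> u u" using 1 by simp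
qed

text \<open>The form \<open>(u - G u, u) / \<alpha>\<close> approximates \<open>B\<close> from below.\<close>

lemma approximate_energy_le:
  assumes w: "w \<in> W"
  shows "ip \<mu> w w - g w w \<le> \<alpha> * B w w"
proof -
  have L: "w \<in> L2 \<mu>" using w by (rule W_L2D)
  \<comment> \<open>\<open>\<alpha> * b\<close> is \<open>(w - G w, w)\<close>. The energy identity
    gives \<open>B (G w) (G w) \<le> b\<close>, and Cauchy-Schwarz then gives
    \<open>b\<^sup>2 \<le> b * B w w\<close>.\<close>
  define b where "b = B (G w) w"
  have ab: "\<alpha> * b = ip \<mu> w w - g w w"
    using G_eq[OF L w] by (simp add: Q_def b_def)
  have "\<alpha> * B (G w) (G w) \<le> \<alpha> * b"
    using energy_identity[OF L] ip_nonneg[of \<mu> "\<lambda>p. w p - G w p"] ab by simp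
  then have le: "B (G w) (G w) \<le> b" using alpha_pos by simp
  have nn: "0 \<le> B (G w) (G w)" "0 \<le> B w w" using Q_nonneg w G_W[OF L] by auto
  have "b\<^sup>2 \<le> B (G w) (G w) * B w w"
    unfolding b_def by (rule Q_Cauchy_Schwarz[OF G_W[OF L] w])
  also have "\<dots> \<le> b * B w w" using le nn by (intro mult_right_mono) auto
  finally have "b * b \<le> b * B w w" by (simp add: power2_eq_square)
  then have "b \<le> B w w" using le nn by (cases "b = 0") auto
  then show ?thesis using alpha_pos ab[symmetric] by simp
qed

text \<open>If \<open>G\<close> has a kernel, the left-hand side is the double integral of
  \<open>k(x) l(y) (w(x) - w(y))\<^sup>2\<close> against it.\<close>

lemma g_square_difference:
  assumes [measurable]: "k \<in> borel_measurable \<mu>" "l \<in> borel_measurable \<mu>" "w \<in> borel_measurable \<mu>"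
    and k: "\<And>p. 0 \<le> k p" "\<And>p. k p \<le> 1" and l: "\<And>p. 0 \<le> l p" "\<And>p. l p \<le> 1"
    and w: "\<And>p. \<bar>w p\<bar> \<le> c"
  shows "0 \<le> g (\<lambda>p. k p * (w p)\<^sup>2) l - 2 * g (\<lambda>p. k p * w p) (\<lambda>p. l p * w p) + g k (\<lambda>p. l p * (w p)\<^sup>2)"
proof -
  have c: "0 \<le> c" using w[of undefined] by linarith
  have w2: "(w p)\<^sup>2 \<le> c\<^sup>2" for p using power_mono[OF w[of p] abs_ge_zero, of 2] by simp
  have bd: "f \<in> L2 \<mu>" if "f \<in> borel_measurable \<mu>" "\<And>p. \<bar>f p\<bar> \<le> d" for f and d :: real
    using that by (intro L2_bounded[of _ d]) auto
  have mono: "\<bar>r * s\<bar> \<le> d" if "0 \<le> r" "r \<le> 1" "\<bar>s\<bar> \<le> d" for r s d :: real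
    using mult_mono[of "\<bar>r\<bar>" 1 "\<bar>s\<bar>" d] that by (simp add: abs_mult)
  have kL: "k \<in> L2 \<mu>" using k by (intro bd[of _ 1]) (auto simp: abs_le_iff intro: order_trans[of _ 0])
  have lL: "l \<in> L2 \<mu>" using l by (intro bd[of _ 1]) (auto simp: abs_le_iff intro: order_trans[of _ 0])
  have kwL: "(\<lambda>p. k p * w p) \<in> L2 \<mu>" using k w by (intro bd[of _ c] mono) auto
  have lwL: "(\<lambda>p. l p * w p) \<in> L2 \<mu>" using l w by (intro bd[of _ c] mono) auto
  have kw2L: "(\<lambda>p. k p * (w p)\<^sup>2) \<in> L2 \<mu>" using k w2 by (intro bd[of _ "c\<^sup>2"] mono) auto
  have lw2L: "(\<lambda>p. l p * (w p)\<^sup>2) \<in> L2 \<mu>" using l w2 by (intro bd[of _ "c\<^sup>2"] mono) auto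
  \<comment> \<open>For fixed \<open>a\<close> this is \<open>G\<close> applied to
    \<open>k * (w - a)\<^sup>2\<close>, hence nonnegative almost everywhere. Inserting
    \<open>a = w p\<close> afterwards plays the role of a kernel: the square then compares the
    values of \<open>w\<close> at two points.\<close>
  define P where "P p a = G (\<lambda>p. k p * (w p)\<^sup>2) p + (-2 * a) * G (\<lambda>p. k p * w p) p + a\<^sup>2 * G k p" for p a
  have "AE p in \<mu>. 0 \<le> P p a" for a
  proof (rule solves_positive)
    show "solves (\<lambda>p. k p * (w p)\<^sup>2 + (-2 * a) * (k p * w p) + a\<^sup>2 * k p) (\<lambda>p. P p a)"
      unfolding P_def by (intro solves_add solves_scale G_solves L2_add L2_scale kL kwL kw2L)
    show "(\<lambda>p. k p * (w p)\<^sup>2 + (-2 * a) * (k p * w p) + a\<^sup>2 * k p) \<in> L2 \<mu>"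
      by (intro L2_add L2_scale kL kwL kw2L)
    have "k p * (w p)\<^sup>2 + (-2 * a) * (k p * w p) + a\<^sup>2 * k p = k p * (w p - a)\<^sup>2" for p
      by (simp add: power2_diff algebra_simps)
    then show "AE p in \<mu>. 0 \<le> k p * (w p)\<^sup>2 + (-2 * a) * (k p * w p) + a\<^sup>2 * k p"
      using k by simp
  qed
  \<comment> \<open>The exceptional null set depends on \<open>a\<close>, and only countably many
    may be united. Continuity in \<open>a\<close> recovers the real value
    \<open>w p\<close>.\<close>
  then have "AE p in \<mu>. \<forall>a\<in>\<rat>. 0 \<le> P p a"
    by (intro AE_ball_countable[THEN iffD2]) (auto simp: countable_rat)
  then have AE: "AE p in \<mu>. 0 \<le> P p (w p)"
  proof eventually_elim
    case (elim p)
    have "closed {a. 0 \<le> P p a}"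
      unfolding P_def by (intro closed_Collect_le continuous_intros)
    then have "closure \<rat> \<subseteq> {a. 0 \<le> P p a}" using elim by (intro closure_minimal) auto
    then show ?case by (auto simp: Rats_closure_real)
  qed
  have "0 \<le> (LINT p|\<mu>. l p * P p (w p))"
    using AE l by (intro integral_nonneg_AE) (auto elim!: eventually_mono)
  also have "\<dots> = (LINT p|\<mu>. G (\<lambda>p. k p * (w p)\<^sup>2) p * l p - 2 * (G (\<lambda>p. k p * w p) p * (l p * w p))
      + G k p * (l p * (w p)\<^sup>2))"
    by (simp add: P_def algebra_simps)
  also have "\<dots> = g (\<lambda>p. k p * (w p)\<^sup>2) l - 2 * g (\<lambda>p. k p * w p) (\<lambda>p. l p * w p) + g k (\<lambda>p. l p * (w p)\<^sup>2)"
    unfolding ip_def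
    using L2_mult[OF G_L2[OF kw2L] lL] L2_mult[OF G_L2[OF kwL] lwL] L2_mult[OF G_L2[OF kL] lw2L]
    by simp
  finally show ?thesis .
qed

text \<open>\<open>g\<close> is dominated by the L2 norm, so Cauchy-Schwarz makes it continuous
  along L2 convergence; the diagonal case expands \<open>g\<close> of the difference.\<close>

lemma g_tendsto:
  assumes f: "\<And>k. f k \<in> L2 \<mu>" and u: "u \<in> L2 \<mu>"
    and lim: "(\<lambda>k. ip \<mu> (\<lambda>p. f k p - u p) (\<lambda>p. f k p - u p)) \<longlonglongrightarrow> 0"
    and w: "w \<in> L2 \<mu>"
  shows "(\<lambda>k. g (f k) w) \<longlonglongrightarrow> g u w" "(\<lambda>k. g (f k) (f k)) \<longlonglongrightarrow> g u u"
proof -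
  have zL: "(\<lambda>p. f k p - u p) \<in> L2 \<mu>" for k by (intro L2_diff f u)
  have lim2: "(\<lambda>k. g (\<lambda>p. f k p - u p) (\<lambda>p. f k p - u p)) \<longlonglongrightarrow> 0"
    using G_contraction(2)[OF zL] g.Q_nonneg[OF zL]
    by (intro tendsto_sandwich[OF _ _ tendsto_const lim]) (auto intro!: always_eventually)
  have *: "(\<lambda>k. g (f k) w) \<longlonglongrightarrow> g u w" if w: "w \<in> L2 \<mu>" for w
  proof -
    have "(\<lambda>k. (g (\<lambda>p. f k p - u p) w)\<^sup>2) \<longlonglongrightarrow> 0"
    proof (rule tendsto_sandwich[OF _ _ tendsto_const])
      show "(\<lambda>k. g (\<lambda>p. f k p - u p) (\<lambda>p. f k p - u p) * g w w) \<longlonglongrightarrow> 0"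
        using tendsto_mult_right[OF lim2, of "g w w"] by simp
      show "\<forall>\<^sub>F k in sequentially. (g (\<lambda>p. f k p - u p) w)\<^sup>2 \<le> g (\<lambda>p. f k p - u p) (\<lambda>p. f k p - u p) * g w w"
        by (intro always_eventually allI g.Q_Cauchy_Schwarz zL w)
    qed auto
    then have "(\<lambda>k. g (f k) w - g u w) \<longlonglongrightarrow> 0"
      using f u w by (simp add: power_tendsto_0_iff g.Q_diff)
    then show ?thesis by (simp add: LIM_zero_iff)
  qed
  show "(\<lambda>k. g (f k) w) \<longlonglongrightarrow> g u w" by (rule *) fact
  have "(\<lambda>k. g (\<lambda>p. f k p - u p) (\<lambda>p. f k p - u p) + 2 * g (f k) u - g u u) \<longlonglongrightarrow> 0 + 2 * g u u - g u u"
    by (intro tendsto_intros lim2 * u)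
  moreover have "g (\<lambda>p. f k p - u p) (\<lambda>p. f k p - u p) + 2 * g (f k) u - g u u = g (f k) (f k)" for k
    using f u g_commute[OF f u, of k] by (simp add: g.Q_diff g.Q_diff_right g.W_diff)
  ultimately show "(\<lambda>k. g (f k) (f k)) \<longlonglongrightarrow> g u u" by simp
qed

lemma bounded_L2: "f \<in> borel_measurable \<mu> \<Longrightarrow> (\<And>p. \<bar>f p\<bar> \<le> c) \<Longrightarrow> f \<in> L2 \<mu>" for c :: real
  by (rule L2_bounded[of _ c]) auto

text \<open>If \<open>G\<close> has a kernel, the two sides differ by half the double integral of
  \<open>(1 - h(x) h(y)) (w(x) - w(y))\<^sup>2\<close> against it.\<close>

lemma ground_state_bounded:
  assumes [measurable]: "h \<in> borel_measurable \<mu>" "w \<in> borel_measurable \<mu>"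
    and h: "\<And>p. 0 \<le> h p" "\<And>p. h p \<le> 1" and w: "\<And>p. \<bar>w p\<bar> \<le> c"
  shows "g h (\<lambda>p. h p * (w p)\<^sup>2) + g w w \<le> ip \<mu> w w + g (\<lambda>p. h p * w p) (\<lambda>p. h p * w p)"
proof -
  have c: "0 \<le> c" using w[of undefined] by linarith
  have w2: "(w p)\<^sup>2 \<le> c\<^sup>2" for p using power_mono[OF w[of p] abs_ge_zero, of 2] by simp
  have mono: "\<bar>r * s\<bar> \<le> d" if "0 \<le> r" "r \<le> 1" "\<bar>s\<bar> \<le> d" for r s d :: real
    using mult_mono[of "\<bar>r\<bar>" 1 "\<bar>s\<bar>" d] that by (simp add: abs_mult)
  have hL: "h \<in> L2 \<mu>" using h by (intro bounded_L2[of _ 1]) (auto simp: abs_le_iff intro: order_trans[of _ 0])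
  have wL: "w \<in> L2 \<mu>" using w by (intro bounded_L2[of _ c]) auto
  have w2L: "(\<lambda>p. (w p)\<^sup>2) \<in> L2 \<mu>" using w2 by (intro bounded_L2[of _ "c\<^sup>2"]) auto
  have hwL: "(\<lambda>p. h p * w p) \<in> L2 \<mu>" using h w by (intro bounded_L2[of _ c] mono) auto
  have hw2L: "(\<lambda>p. h p * (w p)\<^sup>2) \<in> L2 \<mu>" using h w2 by (intro bounded_L2[of _ "c\<^sup>2"] mono) auto
  \<comment> \<open>The weight \<open>1 - h(x) h(y)\<close> is the sum of \<open>1 - h(y)\<close>
    and \<open>(1 - h(x)) h(y)\<close>. Each summand is a product of a function of \<open>x\<close>
    and a function of \<open>y\<close> with values between 0 and 1, as
    \<open>g_square_difference\<close> demands.\<close>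
  have 1: "0 \<le> g (\<lambda>p. 1 * (w p)\<^sup>2) (\<lambda>p. 1 - h p) - 2 * g (\<lambda>p. 1 * w p) (\<lambda>p. (1 - h p) * w p)
    + g (\<lambda>p. 1) (\<lambda>p. (1 - h p) * (w p)\<^sup>2)"
    by (rule g_square_difference) (use h w in auto)
  have 2: "0 \<le> g (\<lambda>p. (1 - h p) * (w p)\<^sup>2) h - 2 * g (\<lambda>p. (1 - h p) * w p) (\<lambda>p. h p * w p)
    + g (\<lambda>p. 1 - h p) (\<lambda>p. h p * (w p)\<^sup>2)"
    by (rule g_square_difference) (use h w in auto)
  have e1: "(\<lambda>p. (1 - h p) * w p) = (\<lambda>p. w p - h p * w p)"
    "(\<lambda>p. (1 - h p) * (w p)\<^sup>2) = (\<lambda>p. (w p)\<^sup>2 - h p * (w p)\<^sup>2)" by (auto simp: algebra_simps)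
  note L = hL wL w2L hwL hw2L one_L2
  \<comment> \<open>\<open>G\<close> fixes the constant 1, so pairing \<open>w\<^sup>2\<close> with
    1 gives back the squared L2 norm.\<close>
  have i1: "g (\<lambda>p. 1) (\<lambda>p. (w p)\<^sup>2) = ip \<mu> w w" "g (\<lambda>p. (w p)\<^sup>2) (\<lambda>p. 1) = ip \<mu> w w"
    using g_one[OF w2L] g_commute[OF w2L one_L2] by (auto simp: ip_square)
  have c1: "g (\<lambda>p. h p * (w p)\<^sup>2) h = g h (\<lambda>p. h p * (w p)\<^sup>2)" by (rule g_commute) fact+
  have c2: "g (\<lambda>p. h p * w p) w = g w (\<lambda>p. h p * w p)" by (rule g_commute) fact+
  show ?thesis
    using 1 2 unfolding e1 using L c1 c2
    by (simp add: g.Q_diff g.Q_diff_right g.W_diff i1)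
qed

text \<open>Truncation at height \<open>k\<close> reduces to bounded \<open>w\<close>. All terms
  converge, because \<open>h\<close> and \<open>G h\<close> are bounded by 1.\<close>

lemma ground_state:
  assumes [measurable]: "h \<in> borel_measurable \<mu>"
    and h: "\<And>p. 0 \<le> h p" "\<And>p. h p \<le> 1" and w: "w \<in> L2 \<mu>"
  shows "(LINT p|\<mu>. h p * G h p * (w p)\<^sup>2) + g w w \<le> ip \<mu> w w + g (\<lambda>p. h p * w p) (\<lambda>p. h p * w p)"
proof -
  have [measurable]: "w \<in> borel_measurable \<mu>" using w by (rule L2_measurable)
  have hL: "h \<in> L2 \<mu>" using h by (intro bounded_L2[of _ 1]) (auto simp: abs_le_iff intro: order_trans[of _ 0])
  have [measurable]: "G h \<in> borel_measurable \<mu>" using G_L2[OF hL] by (rule L2_measurable)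
  have G1: "AE p in \<mu>. 0 \<le> G h p \<and> G h p \<le> 1"
    using G_nonneg[OF hL] G_le_one[OF hL] h by (intro AE_conjI) auto
  define f where "f k p = max (- real k) (min (real k) (w p))" for k p
  have [measurable]: "f k \<in> borel_measurable \<mu>" for k unfolding f_def by measurable
  have f_le: "\<bar>f k p\<bar> \<le> \<bar>w p\<bar>" "\<bar>f k p\<bar> \<le> real k" for k p unfolding f_def by auto
  have f_lim: "(\<lambda>k. f k p) \<longlonglongrightarrow> w p" for p
  proof -
    obtain N :: nat where "\<bar>w p\<bar> < N" using reals_Archimedean2 by blast
    then have "w p = f k p" if "k \<ge> N" for k using that unfolding f_def by auto
    then have "\<forall>\<^sub>F k in sequentially. w p = f k p" by (auto intro: eventually_sequentiallyI[of N])
    then show ?thesis by (rule Lim_transform_eventually[OF tendsto_const])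
  qed
  have fL: "f k \<in> L2 \<mu>" for k using f_le(2) by (intro bounded_L2[of _ k]) auto
  have f2: "(f k p)\<^sup>2 \<le> (w p)\<^sup>2" for k p using f_le(1) abs_le_square_iff by blast
  have hw2: "(h p * r)\<^sup>2 \<le> r\<^sup>2" for p r
    using h[of p] mult_mono[of "(h p)\<^sup>2" 1 "r\<^sup>2" "r\<^sup>2"] by (simp add: power_mult_distrib power_le_one)
  have hbd: "AE p in \<mu>. \<bar>h p\<bar> \<le> 1" using h by (auto simp: abs_le_iff intro: order_trans[of _ 0])
  have hfL: "(\<lambda>p. h p * f k p) \<in> L2 \<mu>" for k
    by (rule L2_bounded_mult[OF fL _ hbd]) simp
  have hwL: "(\<lambda>p. h p * w p) \<in> L2 \<mu>"
    by (rule L2_bounded_mult[OF w _ hbd]) simp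
  have w2i: "integrable \<mu> (\<lambda>p. (w p)\<^sup>2)" using w by (rule L2_square)
  have dist: "(\<lambda>k. ip \<mu> (\<lambda>p. f k p - w p) (\<lambda>p. f k p - w p)) \<longlonglongrightarrow> (LINT p|\<mu>. 0)"
    unfolding ip_square
  proof (rule integral_dominated_convergence[where w = "\<lambda>p. (w p)\<^sup>2"])
    show "AE p in \<mu>. (\<lambda>k. (f k p - w p)\<^sup>2) \<longlonglongrightarrow> 0"
      using tendsto_power[OF tendsto_diff[OF f_lim tendsto_const], of _ "2"] f_lim 
      by (intro AE_I2) (force intro!: tendsto_null_power simp: LIM_zero_iff)
    have "\<bar>f k p - w p\<bar> \<le> \<bar>w p\<bar>" for k p unfolding f_def by auto
    then show "AE p in \<mu>. norm ((f k p - w p)\<^sup>2) \<le> (w p)\<^sup>2" for k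
      by (simp add: abs_le_square_iff)
  qed (use w2i in auto)
  have hdist: "(\<lambda>k. ip \<mu> (\<lambda>p. h p * f k p - h p * w p) (\<lambda>p. h p * f k p - h p * w p)) \<longlonglongrightarrow> 0"
  proof (rule tendsto_sandwich[OF _ _ tendsto_const dist[simplified]])
    show "\<forall>\<^sub>F k in sequentially. ip \<mu> (\<lambda>p. h p * f k p - h p * w p) (\<lambda>p. h p * f k p - h p * w p)
       \<le> ip \<mu> (\<lambda>p. f k p - w p) (\<lambda>p. f k p - w p)"
      unfolding ip_square
      by (intro always_eventually allI integral_mono L2_square L2_diff fL w hfL hwL)
        (use hw2 in \<open>simp flip: right_diff_distrib\<close>)
  qed (auto intro!: always_eventually ip_nonneg)
  have lim1: "(\<lambda>k. LINT p|\<mu>. h p * G h p * (f k p)\<^sup>2) \<longlonglongrightarrow> (LINT p|\<mu>. h p * G h p * (w p)\<^sup>2)"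
  proof (rule integral_dominated_convergence[where w = "\<lambda>p. (w p)\<^sup>2"])
    show "AE p in \<mu>. (\<lambda>k. h p * G h p * (f k p)\<^sup>2) \<longlonglongrightarrow> h p * G h p * (w p)\<^sup>2"
      by (intro AE_I2 tendsto_intros f_lim)
    show "AE p in \<mu>. norm (h p * G h p * (f k p)\<^sup>2) \<le> (w p)\<^sup>2" for k
      using G1
    proof eventually_elim
      case (elim p)
      then have "h p * G h p \<le> 1" "0 \<le> h p * G h p" using h[of p] by (auto intro: mult_le_one)
      then have "h p * G h p * (f k p)\<^sup>2 \<le> 1 * (w p)\<^sup>2" using f2[of k p] by (intro mult_mono) auto
      then show ?case using elim h[of p] by simp
    qed
  qed (use w2i in auto)
  have lim2: "(\<lambda>k. ip \<mu> (f k) (f k)) \<longlonglongrightarrow> ip \<mu> w w"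
    unfolding ip_square
  proof (rule integral_dominated_convergence[where w = "\<lambda>p. (w p)\<^sup>2"])
    show "AE p in \<mu>. (\<lambda>k. (f k p)\<^sup>2) \<longlonglongrightarrow> (w p)\<^sup>2"
      by (intro AE_I2 tendsto_intros f_lim)
  qed (use w2i f2 in auto)
  have "(LINT p|\<mu>. h p * G h p * (f k p)\<^sup>2) + g (f k) (f k)
     \<le> ip \<mu> (f k) (f k) + g (\<lambda>p. h p * f k p) (\<lambda>p. h p * f k p)" for k
    using ground_state_bounded[of h "f k" k] h f_le(2)
    by (simp add: ip_def mult_ac)
  then show ?thesis
    by (intro LIMSEQ_le[OF tendsto_add[OF lim1 g_tendsto(2)[OF fL w dist[simplified] w]]
        tendsto_add[OF lim2 g_tendsto(2)[OF hfL hwL hdist w]]]) auto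
qed

text \<open>The iteration \<open>h \<mapsto> min h (G h / D)\<close>, started at \<open>1\<close>, decreases \<open>(D h, h) - (G h, h)\<close>.\<close>

lemma obstacle_solution:
  assumes [measurable]: "D \<in> borel_measurable \<mu>"
    and D: "\<And>p. 0 < D p" "\<And>p. D p \<le> d"
  obtains h where "h \<in> borel_measurable \<mu>" "\<And>p. 0 \<le> h p" "\<And>p. h p \<le> 1"
    "AE p in \<mu>. h p * D p * h p \<le> h p * G h p"
    "(LINT p|\<mu>. D p * (h p)\<^sup>2) - g h h \<le> (LINT p|\<mu>. D p) - measure \<mu> (space \<mu>)"
proof -
  \<comment> \<open>The outer \<open>max 0\<close> acts only on the null set where \<open>G\<close>
    of the iterate is negative; with it the bounds 0 and 1 hold at every point.\<close>
  define H where "H = rec_nat (\<lambda>p. 1 :: real) (\<lambda>_ u p. max 0 (min (u p) (G u p / D p)))"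
  have H_0: "H 0 = (\<lambda>p. 1)" by (simp add: H_def)
  have H_Suc: "H (Suc k) = (\<lambda>p. max 0 (min (H k p) (G (H k) p / D p)))" for k by (simp add: H_def)
  define J where "J u = (LINT p|\<mu>. D p * (u p)\<^sup>2) - g u u" for u
  have H_bd: "0 \<le> H k p \<and> H k p \<le> 1" for k p
    by (induction k) (auto simp: H_0 H_Suc)
  have H_dec: "H (Suc k) p \<le> H k p" for k p
    using H_bd[of k p] by (auto simp: H_Suc)
  have H_meas[measurable]: "H k \<in> borel_measurable \<mu>" for k
  proof (induction k)
    case (Suc k)
    have "H k \<in> L2 \<mu>" using Suc H_bd[of k] by (intro bounded_L2[of _ 1]) (auto simp: abs_le_iff intro: order_trans[of _ 0])
    from L2_measurable[OF G_L2[OF this]] Suc show ?case unfolding H_Suc by simp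
  qed (simp add: H_0)
  have HL: "H k \<in> L2 \<mu>" for k
    using H_bd[of k] by (intro bounded_L2[of _ 1]) (auto simp: abs_le_iff intro: order_trans[of _ 0])
  have GH[measurable]: "G (H k) \<in> borel_measurable \<mu>" for k by (intro L2_measurable G_L2 HL)
  have GH0: "AE p in \<mu>. 0 \<le> G (H k) p" for k using G_nonneg[OF HL[of k]] H_bd[of k] by simp
  have D_bd: "AE p in \<mu>. \<bar>D p\<bar> \<le> d" using D by (auto simp: abs_of_pos)
  have DL: "(\<lambda>p. D p * u p) \<in> L2 \<mu>" if "u \<in> L2 \<mu>" for u
    by (rule L2_bounded_mult[OF that _ D_bd]) simp
  have Dsq: "integrable \<mu> (\<lambda>p. D p * (u p)\<^sup>2)" if "u \<in> L2 \<mu>" for u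
    using L2_mult[OF DL[OF that] that] by (simp add: power2_eq_square mult.assoc)
  \<comment> \<open>Semidefiniteness bounds \<open>g\<close> at the new iterate from below by its
    linearization at the old one. What remains is pointwise: where the iterates differ,
    \<open>D\<close> times the new one equals \<open>G\<close> of the old one, and the integrand is
    \<open>- D\<close> times the squared difference.\<close>
  have J_dec: "J (H (Suc k)) \<le> J (H k)" for k
  proof -
    let ?h = "H k" and ?h' = "H (Suc k)"
    have "0 \<le> g (\<lambda>p. ?h p - ?h' p) (\<lambda>p. ?h p - ?h' p)"
      by (rule g.Q_nonneg) (intro L2_diff HL)
    then have "2 * g ?h ?h' - g ?h ?h \<le> g ?h' ?h'"
      using HL[of k] HL[of "Suc k"] g_commute[OF HL HL, of k "Suc k"]
      by (simp add: g.Q_diff g.Q_diff_right g.W_diff)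
    moreover have "(LINT p|\<mu>. D p * (?h' p)\<^sup>2 - D p * (?h p)\<^sup>2 - 2 * (G ?h p * ?h' p) + 2 * (G ?h p * ?h p)) \<le> (LINT p|\<mu>. 0)"
    proof (rule integral_mono_AE)
      show "AE p in \<mu>. D p * (?h' p)\<^sup>2 - D p * (?h p)\<^sup>2 - 2 * (G ?h p * ?h' p) + 2 * (G ?h p * ?h p) \<le> 0"
        using GH0[of k]
      proof eventually_elim
        case (elim p)
        show ?case
        proof (cases "?h' p = ?h p")
          case False
          then have "?h' p < ?h p" using H_dec[of k p] by simp
          moreover have "?h' p = G ?h p / D p"
            using False H_bd[of k p] elim D(1)[of p] by (auto simp: H_Suc max_def min_def split: if_splits)
          then have "G ?h p = D p * ?h' p" using D(1)[of p] by (simp add: field_simps)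
          moreover have "D p * (?h' p)\<^sup>2 - D p * (?h p)\<^sup>2 - 2 * (D p * ?h' p * ?h' p) + 2 * (D p * ?h' p * ?h p)
            = - (D p * (?h p - ?h' p)\<^sup>2)"
            by (simp add: power2_eq_square algebra_simps)
          ultimately show ?thesis using D(1)[of p] by simp
        qed simp
      qed
    qed (use HL Dsq L2_mult[OF G_L2[OF HL] HL] in auto)
    moreover have "(LINT p|\<mu>. D p * (?h' p)\<^sup>2 - D p * (?h p)\<^sup>2 - 2 * (G ?h p * ?h' p) + 2 * (G ?h p * ?h p))
      = (LINT p|\<mu>. D p * (?h' p)\<^sup>2) - (LINT p|\<mu>. D p * (?h p)\<^sup>2) - 2 * g ?h ?h' + 2 * g ?h ?h"
      unfolding ip_def using Dsq[OF HL[of k]] Dsq[OF HL[of "Suc k"]] L2_mult[OF G_L2[OF HL] HL, of k] by simp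
    ultimately show ?thesis unfolding J_def by simp
  qed
  have J_le: "J (H k) \<le> J (\<lambda>p. 1)" for k
  proof (induction k)
    case (Suc k)
    then show ?case using J_dec[of k] by simp
  qed (simp add: H_0)
  have "\<exists>l. (\<lambda>k. H k p) \<longlonglongrightarrow> l" for p
    using H_dec H_bd by (metis decseq_convergent decseq_SucI)
  then obtain h where h_lim: "\<And>p. (\<lambda>k. H k p) \<longlonglongrightarrow> h p" by metis
  have dec: "decseq (\<lambda>k. H k p)" for p using H_dec by (intro decseq_SucI)
  have h_le: "h p \<le> H k p" for k p by (rule decseq_ge[OF dec h_lim])
  have h0: "0 \<le> h p" for p using H_bd by (intro LIMSEQ_le_const[OF h_lim]) auto
  have h1: "h p \<le> 1" for p using h_le[of p 0] by (simp add: H_0)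
  have [measurable]: "h \<in> borel_measurable \<mu>" by (rule borel_measurable_LIMSEQ_real[OF h_lim]) simp_all
  have hL: "h \<in> L2 \<mu>" using h0 h1 by (intro bounded_L2[of _ 1]) (auto simp: abs_le_iff intro: order_trans[of _ 0])
  have [measurable]: "G h \<in> borel_measurable \<mu>" by (intro L2_measurable G_L2 hL)
  have dist: "(\<lambda>k. ip \<mu> (\<lambda>p. H k p - h p) (\<lambda>p. H k p - h p)) \<longlonglongrightarrow> (LINT p|\<mu>. 0)"
    unfolding ip_square
  proof (rule integral_dominated_convergence[where w = "\<lambda>p. 1"])
    show "AE p in \<mu>. (\<lambda>k. (H k p - h p)\<^sup>2) \<longlonglongrightarrow> 0"
      using h_lim by (intro AE_I2 tendsto_null_power) (auto simp: LIM_zero_iff)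
    have "\<bar>H k p - h p\<bar> \<le> 1" for k p using H_bd[of k p] h_le[of p k] h0[of p] by auto
    then show "AE p in \<mu>. norm ((H k p - h p)\<^sup>2) \<le> 1" for k
      by (simp add: abs_square_le_1)
  qed auto
  have J_lim: "(\<lambda>k. J (H k)) \<longlonglongrightarrow> J h"
    unfolding J_def
  proof (rule tendsto_diff)
    show "(\<lambda>k. g (H k) (H k)) \<longlonglongrightarrow> g h h"
      by (rule g_tendsto(2)[OF HL hL dist[simplified] hL])
    show "(\<lambda>k. LINT p|\<mu>. D p * (H k p)\<^sup>2) \<longlonglongrightarrow> (LINT p|\<mu>. D p * (h p)\<^sup>2)"
    proof (rule integral_dominated_convergence[where w = "\<lambda>p. d"])
      show "AE p in \<mu>. (\<lambda>k. D p * (H k p)\<^sup>2) \<longlonglongrightarrow> D p * (h p)\<^sup>2"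
        by (intro AE_I2 tendsto_intros h_lim)
      show "AE p in \<mu>. norm (D p * (H k p)\<^sup>2) \<le> d" for k
      proof (intro AE_I2)
        fix p
        have "(H k p)\<^sup>2 \<le> 1" using H_bd[of k p] by (simp add: power_le_one)
        then have "D p * (H k p)\<^sup>2 \<le> d * 1" using D[of p] by (intro mult_mono) auto
        then show "norm (D p * (H k p)\<^sup>2) \<le> d" using D[of p] by simp
      qed
    qed auto
  qed
  have "J h \<le> J (\<lambda>p. 1)"
    by (rule LIMSEQ_le_const2[OF J_lim]) (use J_le in auto)
  then have Jh: "(LINT p|\<mu>. D p * (h p)\<^sup>2) - g h h \<le> (LINT p|\<mu>. D p) - measure \<mu> (space \<mu>)"
    using g_one[OF one_L2] by (simp add: J_def)
  let ?A = "{p \<in> space \<mu>. 0 < h p}"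
  have A[measurable]: "?A \<in> sets \<mu>" by measurable
  \<comment> \<open>The violation of the claim, taken as a test function: \<open>G (H k)\<close> is
    known to approach \<open>G h\<close> only through integrals. Passing to the limit in the
    integral against \<open>z\<close> shows that \<open>z\<close> has L2 norm 0.\<close>
  define z where "z p = max 0 (indicator ?A p * (D p * h p - G h p))" for p
  have z0: "0 \<le> z p" for p by (simp add: z_def)
  have [measurable]: "z \<in> borel_measurable \<mu>" unfolding z_def by measurable
  have zL: "z \<in> L2 \<mu>"
  proof -
    let ?b = "\<lambda>p. if 0 < D p * h p - G h p then indicator ?A p else 0 :: real"
    have "(\<lambda>p. ?b p * (D p * h p - G h p)) \<in> L2 \<mu>"
      by (rule L2_bounded_mult[OF L2_diff[OF DL[OF hL] G_L2[OF hL]], of _ 1]) (auto simp: indicator_def)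
    moreover have "(\<lambda>p. ?b p * (D p * h p - G h p)) = z"
      by (auto simp: z_def indicator_def)
    ultimately show ?thesis by simp
  qed
  have "(LINT p|\<mu>. D p * h p * z p) \<le> g (H k) z" for k
    unfolding ip_def
  proof (rule integral_mono_AE)
    show "integrable \<mu> (\<lambda>p. D p * h p * z p)" by (intro L2_mult DL hL zL)
    show "integrable \<mu> (\<lambda>p. G (H k) p * z p)" by (intro L2_mult G_L2 HL zL)
    show "AE p in \<mu>. D p * h p * z p \<le> G (H k) p * z p"
    proof (intro AE_I2)
      fix p
      show "D p * h p * z p \<le> G (H k) p * z p"
      proof (cases "0 < h p")
        case True
        \<comment> \<open>Where the limit is positive so is every iterate, and the recursion bounds
          the next iterate by \<open>G (H k) / D\<close>; the limit lies below it.\<close>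
        then have "0 < H (Suc k) p" using h_le[of p "Suc k"] by linarith
        then have "H (Suc k) p \<le> G (H k) p / D p" by (auto simp: H_Suc max_def split: if_splits)
        then have "h p \<le> G (H k) p / D p" using h_le[of p "Suc k"] by linarith
        then have "D p * h p \<le> G (H k) p" using D(1)[of p] by (simp add: field_simps)
        then show ?thesis using z0[of p] by (rule mult_right_mono)
      next
        case False
        then have "z p = 0" by (simp add: z_def)
        then show ?thesis by simp
      qed
    qed
  qed
  then have "(LINT p|\<mu>. D p * h p * z p) \<le> g h z"
    by (intro LIMSEQ_le_const[OF g_tendsto(1)[OF HL hL dist[simplified] zL]]) auto
  moreover have "(LINT p|\<mu>. (z p)\<^sup>2) = (LINT p|\<mu>. D p * h p * z p - G h p * z p)"
    by (intro Bochner_Integration.integral_cong) (auto simp: z_def power2_eq_square max_def indicator_def algebra_simps)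
  moreover have "\<dots> = (LINT p|\<mu>. D p * h p * z p) - g h z"
    unfolding ip_def by (intro Bochner_Integration.integral_diff L2_mult DL hL zL G_L2)
  ultimately have "ip \<mu> z z \<le> 0" by (simp add: ip_square)
  then have "AE p in \<mu>. z p = 0" using ip_eq_0[OF zL] ip_nonneg[of \<mu> z] by simp
  then have "AE p in \<mu>. h p * D p * h p \<le> h p * G h p"
    using AE_space
  proof eventually_elim
    case (elim p)
    show ?case
    proof (cases "0 < h p")
      case True
      then have "D p * h p \<le> G h p" using elim by (simp add: z_def max_def split: if_splits)
      then have "h p * (D p * h p) \<le> h p * G h p" using True by (intro mult_left_mono) auto
      then show ?thesis by (simp add: mult.assoc)
    next
      case False
      then have "h p = 0" using h0[of p] by simp
      then show ?thesis by simp
    qed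
  qed
  then show ?thesis using that[of h] h0 h1 Jh by simp
qed

text \<open>Here \<open>m\<close> is the dimension of the test spaces. The hypothesis on
  \<open>V\<^sub>0\<close> enters as \<open>large\<close>, with a slack \<open>\<epsilon>\<close>
  that avoids showing that a supremum over a test space is attained; the conclusion on
  \<open>V\<close> has no slack. The part \<open>\<alpha> * C\<^sup>2\<close> of
  \<open>\<kappa>\<close> pays for passing from \<open>u\<close> to \<open>G u\<close> in the
  potential term, the part \<open>\<alpha>\<close> pays for the slack.\<close>

lemma dominated_potential:
  fixes V\<^sub>0 :: "'a \<Rightarrow> real" and m :: nat and C \<kappa> :: real
  assumes [measurable]: "V\<^sub>0 \<in> borel_measurable \<mu>" and V\<^sub>0: "\<And>p. \<bar>V\<^sub>0 p\<bar> \<le> C"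
  defines "\<kappa> \<equiv> \<alpha> * (C\<^sup>2 + 1)"
  assumes small: "\<alpha> * (C + \<kappa>) < 1"
    and large: "\<And>b \<epsilon>. \<lbrakk>\<And>i. i < m \<Longrightarrow> b i \<in> W;
        \<And>a :: nat \<Rightarrow> real. AE p in \<mu>. (\<Sum>i<m. a i * b i p) = 0 \<Longrightarrow> \<forall>i<m. a i = 0; 0 < \<epsilon>\<rbrakk> \<Longrightarrow>
        \<exists>a. B (\<lambda>p. \<Sum>i<m. a i * b i p) (\<lambda>p. \<Sum>i<m. a i * b i p) - (LINT p|\<mu>. V\<^sub>0 p * (\<Sum>i<m. a i * b i p)\<^sup>2)
          \<ge> - \<epsilon> * ip \<mu> (\<lambda>p. \<Sum>i<m. a i * b i p) (\<lambda>p. \<Sum>i<m. a i * b i p) \<and>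
          \<not> (AE p in \<mu>. (\<Sum>i<m. a i * b i p) = 0)"
  obtains V where "V \<in> borel_measurable \<mu>" "AE p in \<mu>. 0 \<le> V p" "\<exists>C. AE p in \<mu>. V p \<le> C"
    "(LINT p|\<mu>. V\<^sub>0 p) - \<kappa> * measure \<mu> (space \<mu>) \<le> (LINT p|\<mu>. V p)"
    "\<And>b. \<lbrakk>\<And>i. i < m \<Longrightarrow> b i \<in> W;
        \<And>a :: nat \<Rightarrow> real. AE p in \<mu>. (\<Sum>i<m. a i * b i p) = 0 \<Longrightarrow> \<forall>i<m. a i = 0\<rbrakk> \<Longrightarrow>
        \<exists>a. (LINT p|\<mu>. V p * (\<Sum>i<m. a i * b i p)\<^sup>2) \<le> B (\<lambda>p. \<Sum>i<m. a i * b i p) (\<lambda>p. \<Sum>i<m. a i * b i p) \<and>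
          \<not> (AE p in \<mu>. (\<Sum>i<m. a i * b i p) = 0)"
proof -
  have C: "0 \<le> C" using V\<^sub>0[of undefined] by linarith
  have \<kappa>: "0 \<le> \<kappa>" using alpha_pos by (simp add: \<kappa>_def)
  define D where "D p = 1 - \<alpha> * (V\<^sub>0 p - \<kappa>)" for p
  have [measurable]: "D \<in> borel_measurable \<mu>" unfolding D_def by measurable
  have aV: "\<bar>\<alpha> * (V\<^sub>0 p - \<kappa>)\<bar> < 1" for p
  proof -
    have "\<alpha> * \<bar>V\<^sub>0 p - \<kappa>\<bar> \<le> \<alpha> * (C + \<kappa>)"
      using alpha_pos V\<^sub>0[of p] \<kappa> by (intro mult_left_mono) auto
    then have "\<alpha> * \<bar>V\<^sub>0 p - \<kappa>\<bar> < 1" using small by linarith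
    then show ?thesis using alpha_pos by (simp add: abs_mult)
  qed
  obtain h where [measurable]: "h \<in> borel_measurable \<mu>" and h: "\<And>p. 0 \<le> h p" "\<And>p. h p \<le> 1"
    and obst: "AE p in \<mu>. h p * D p * h p \<le> h p * G h p"
    and J: "(LINT p|\<mu>. D p * (h p)\<^sup>2) - g h h \<le> (LINT p|\<mu>. D p) - measure \<mu> (space \<mu>)"
  proof (rule obstacle_solution[of D 2])
    \<comment> \<open>\<open>small\<close> keeps \<open>\<alpha> * (V\<^sub>0 - \<kappa>)\<close>
      strictly between -1 and 1.\<close>
    show "0 < D p" "D p \<le> 2" for p using aV[of p] by (auto simp: D_def)
  qed auto
  have hL: "h \<in> L2 \<mu>" using h by (intro bounded_L2[of _ 1]) (auto simp: abs_le_iff intro: order_trans[of _ 0])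
  have [measurable]: "G h \<in> borel_measurable \<mu>" by (intro L2_measurable G_L2 hL)
  have h_bd: "AE p in \<mu>. \<bar>h p\<bar> \<le> 1" using h by (auto simp: abs_le_iff intro: order_trans[of _ 0])
  have G1: "AE p in \<mu>. 0 \<le> G h p \<and> G h p \<le> 1"
    using G_nonneg[OF hL] G_le_one[OF hL] h by (intro AE_conjI) auto
  define V where "V p = (h p * G h p - D p * (h p)\<^sup>2) / \<alpha>" for p
  have [measurable]: "V \<in> borel_measurable \<mu>" unfolding V_def by measurable
  have V0: "AE p in \<mu>. 0 \<le> V p"
    using obst by eventually_elim (use alpha_pos in \<open>simp add: V_def power2_eq_square mult_ac\<close>)
  have hG: "AE p in \<mu>. 0 \<le> h p * G h p \<and> h p * G h p \<le> 1"
    using G1 by eventually_elim (use h in \<open>auto intro: mult_le_one\<close>)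
  have VC: "AE p in \<mu>. V p \<le> 1 / \<alpha>"
    using hG
  proof eventually_elim
    case (elim p)
    have "0 \<le> D p * (h p)\<^sup>2" using aV[of p] by (simp add: D_def)
    then show ?case using elim alpha_pos by (simp add: V_def divide_right_mono)
  qed
  have Dhi: "integrable \<mu> (\<lambda>p. D p * (h p)\<^sup>2)"
  proof (rule integrable_const_bound[of _ 2])
    show "AE p in \<mu>. norm (D p * (h p)\<^sup>2) \<le> 2"
    proof (intro AE_I2)
      fix p
      have "\<bar>D p\<bar> \<le> 2" "(h p)\<^sup>2 \<le> 1" using aV[of p] h[of p] by (auto simp: D_def power_le_one)
      then have "\<bar>D p\<bar> * (h p)\<^sup>2 \<le> 2 * 1" by (intro mult_mono) auto
      then show "norm (D p * (h p)\<^sup>2) \<le> 2" by (simp add: abs_mult)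
    qed
  qed simp
  have V0i: "integrable \<mu> V\<^sub>0" by (rule integrable_const_bound[of _ C]) (use V\<^sub>0 in auto)
  \<comment> \<open>The functional of the obstacle problem is \<open>- \<alpha>\<close> times the
    integral of \<open>V\<close> at \<open>h\<close>, and \<open>- \<alpha>\<close> times the
    integral of \<open>V\<^sub>0 - \<kappa>\<close> at the constant 1. Its decrease is therefore the
    bound on the integral of \<open>V\<close>.\<close>
  have "(LINT p|\<mu>. V p) = (g h h - (LINT p|\<mu>. D p * (h p)\<^sup>2)) / \<alpha>"
    unfolding V_def ip_def using Dhi L2_mult[OF hL G_L2[OF hL]] by (simp add: mult.commute)
  moreover have "(LINT p|\<mu>. D p) = measure \<mu> (space \<mu>) - \<alpha> * ((LINT p|\<mu>. V\<^sub>0 p) - \<kappa> * measure \<mu> (space \<mu>))"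
    unfolding D_def using V0i by simp
  ultimately have "\<alpha> * ((LINT p|\<mu>. V\<^sub>0 p) - \<kappa> * measure \<mu> (space \<mu>)) \<le> \<alpha> * (LINT p|\<mu>. V p)"
    using J alpha_pos by simp
  then have IV: "(LINT p|\<mu>. V\<^sub>0 p) - \<kappa> * measure \<mu> (space \<mu>) \<le> (LINT p|\<mu>. V p)"
    using alpha_pos by simp
  \<comment> \<open>By the definition of \<open>V\<close>, the two sides differ by the gain in
    \<open>ground_state\<close> plus the gain in \<open>approximate_energy_le\<close>.\<close>
  have transfer: "ip \<mu> (\<lambda>p. h p * w p) (\<lambda>p. h p * w p) - g (\<lambda>p. h p * w p) (\<lambda>p. h p * w p)
      - \<alpha> * (LINT p|\<mu>. (V\<^sub>0 p - \<kappa>) * (h p * w p)\<^sup>2) \<le> \<alpha> * (B w w - (LINT p|\<mu>. V p * (w p)\<^sup>2))"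
    if w: "w \<in> W" for w
  proof -
    have wL: "w \<in> L2 \<mu>" using w by (rule W_L2D)
    have [measurable]: "w \<in> borel_measurable \<mu>" using wL by (rule L2_measurable)
    have hwL: "(\<lambda>p. h p * w p) \<in> L2 \<mu>" by (rule L2_bounded_mult[OF wL _ h_bd]) simp
    have i1: "integrable \<mu> (\<lambda>p. h p * G h p * (w p)\<^sup>2)"
    proof -
      have "AE p in \<mu>. \<bar>h p * G h p\<bar> \<le> 1" using hG by eventually_elim simp
      from L2_mult[OF L2_bounded_mult[OF wL _ this] wL] show ?thesis
        by (simp add: power2_eq_square mult_ac)
    qed
    have i2: "integrable \<mu> (\<lambda>p. (V\<^sub>0 p - \<kappa>) * (h p * w p)\<^sup>2)"
    proof -
      have "\<bar>V\<^sub>0 p - \<kappa>\<bar> \<le> C + \<kappa>" for p using V\<^sub>0[of p] \<kappa> by auto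
      then have "AE p in \<mu>. \<bar>V\<^sub>0 p - \<kappa>\<bar> \<le> C + \<kappa>" by auto
      from L2_mult[OF L2_bounded_mult[OF hwL _ this] hwL] show ?thesis
        by (simp add: power2_eq_square mult_ac)
    qed
    have i3: "integrable \<mu> (\<lambda>p. (h p * w p)\<^sup>2)" using hwL by (rule L2_square)
    have "(LINT p|\<mu>. \<alpha> * (V p * (w p)\<^sup>2)) =
      (LINT p|\<mu>. h p * G h p * (w p)\<^sup>2 - (h p * w p)\<^sup>2 + \<alpha> * ((V\<^sub>0 p - \<kappa>) * (h p * w p)\<^sup>2))"
      using alpha_pos by (intro Bochner_Integration.integral_cong)
        (auto simp: V_def D_def field_simps power2_eq_square)
    also have "\<dots> = (LINT p|\<mu>. h p * G h p * (w p)\<^sup>2) - ip \<mu> (\<lambda>p. h p * w p) (\<lambda>p. h p * w p)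
      + \<alpha> * (LINT p|\<mu>. (V\<^sub>0 p - \<kappa>) * (h p * w p)\<^sup>2)"
      unfolding ip_square using i1 i2 i3 by simp
    finally have eq: "\<alpha> * (LINT p|\<mu>. V p * (w p)\<^sup>2) = (LINT p|\<mu>. h p * G h p * (w p)\<^sup>2)
      - ip \<mu> (\<lambda>p. h p * w p) (\<lambda>p. h p * w p) + \<alpha> * (LINT p|\<mu>. (V\<^sub>0 p - \<kappa>) * (h p * w p)\<^sup>2)"
      by simp
    have "(LINT p|\<mu>. h p * G h p * (w p)\<^sup>2) + g w w \<le> ip \<mu> w w + g (\<lambda>p. h p * w p) (\<lambda>p. h p * w p)"
      by (rule ground_state[OF _ h wL]) simp
    moreover have "ip \<mu> w w - g w w \<le> \<alpha> * B w w" by (rule approximate_energy_le[OF w])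
    ultimately show ?thesis unfolding right_diff_distrib eq by linarith
  qed
  have main: "\<exists>a. (LINT p|\<mu>. V p * (\<Sum>i<m. a i * b i p)\<^sup>2) \<le> B (\<lambda>p. \<Sum>i<m. a i * b i p) (\<lambda>p. \<Sum>i<m. a i * b i p) \<and>
          \<not> (AE p in \<mu>. (\<Sum>i<m. a i * b i p) = 0)"
    if b: "\<And>i. i < m \<Longrightarrow> b i \<in> W"
      and indep: "\<And>a :: nat \<Rightarrow> real. AE p in \<mu>. (\<Sum>i<m. a i * b i p) = 0 \<Longrightarrow> \<forall>i<m. a i = 0" for b
  proof -
    have bL: "b i \<in> L2 \<mu>" if "i < m" for i using b[OF that] by (rule W_L2D)
    have hbL: "(\<lambda>p. h p * b i p) \<in> L2 \<mu>" if "i < m" for i by (rule L2_bounded_mult[OF bL[OF that] _ h_bd]) simp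
    \<comment> \<open>\<open>h * b i\<close> lies in L2 only; \<open>G\<close> moves it into
      \<open>W\<close>, where \<open>large\<close> applies. For coefficients \<open>a\<close>, the
      function \<open>v a\<close> is a representative of \<open>G (u a)\<close> that is exactly
      linear in \<open>a\<close>.\<close>
    define b' where "b' i = G (\<lambda>p. h p * b i p)" for i
    define w where "w a p = (\<Sum>i<m. a i * b i p)" for a p
    define u where "u a p = h p * w a p" for a p
    define v where "v a p = (\<Sum>i<m. a i * b' i p)" for a p
    have wW: "w a \<in> W" for a
      unfolding w_def using one_in_W b by (intro W_sum W_scale) auto
    have uL: "u a \<in> L2 \<mu>" for a
      unfolding u_def by (rule L2_bounded_mult[OF W_L2D[OF wW] _ h_bd]) simp
    have [measurable]: "u a \<in> borel_measurable \<mu>" for a using uL by (rule L2_measurable)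
    have "solves (\<lambda>p. \<Sum>i<m. a i * (h p * b i p)) (v a)" for a
      unfolding v_def b'_def by (intro solves_sum solves_scale G_solves hbL L2_scale) auto
    moreover have "(\<lambda>p. \<Sum>i<m. a i * (h p * b i p)) = u a" for a
      by (auto simp: u_def w_def sum_distrib_left mult_ac)
    ultimately have sol: "solves (u a) (v a)" for a by simp
    have [measurable]: "G (u a) \<in> borel_measurable \<mu>" for a by (intro L2_measurable G_L2 uL)
    have vW: "v a \<in> W" for a using sol by (auto simp: solves_def)
    have vL: "v a \<in> L2 \<mu>" for a using vW by (rule W_L2D)
    have [measurable]: "v a \<in> borel_measurable \<mu>" for a using vL by (rule L2_measurable)
    have transfer': "ip \<mu> (u a) (u a) - g (u a) (u a) - \<alpha> * (LINT p|\<mu>. (V\<^sub>0 p - \<kappa>) * (u a p)\<^sup>2)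
      \<le> \<alpha> * (B (w a) (w a) - (LINT p|\<mu>. V p * (w a p)\<^sup>2))" for a
      using transfer[OF wW[of a]] unfolding u_def .
    have Gv: "AE p in \<mu>. G (u a) p = v a p" for a by (rule solves_unique[OF G_solves[OF uL] sol])
    have int_u: "integrable \<mu> (\<lambda>p. f p * (u a p)\<^sup>2)" "integrable \<mu> (\<lambda>p. f p * (v a p)\<^sup>2)"
      if [measurable]: "f \<in> borel_measurable \<mu>" and f: "\<And>p. \<bar>f p\<bar> \<le> c" for f c a
    proof -
      have "AE p in \<mu>. \<bar>f p\<bar> \<le> c" using f by simp
      from L2_mult[OF L2_bounded_mult[OF uL _ this] uL] L2_mult[OF L2_bounded_mult[OF vL _ this] vL]
      show "integrable \<mu> (\<lambda>p. f p * (u a p)\<^sup>2)" "integrable \<mu> (\<lambda>p. f p * (v a p)\<^sup>2)"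
        by (simp_all add: power2_eq_square mult_ac)
    qed
    have "\<exists>a. (LINT p|\<mu>. V p * (w a p)\<^sup>2) \<le> B (w a) (w a) \<and> \<not> (AE p in \<mu>. w a p = 0)"
    proof (cases "\<forall>a. (AE p in \<mu>. v a p = 0) \<longrightarrow> (\<forall>i<m. a i = 0)")
      \<comment> \<open>Nonzero coefficients with \<open>G (u a) = 0\<close> almost everywhere
        already give a witness: the \<open>g\<close> term vanishes and
        \<open>\<alpha> * (V\<^sub>0 - \<kappa>) < 1\<close>.\<close>
      case False
      then obtain a where va: "AE p in \<mu>. v a p = 0" and "\<not> (\<forall>i<m. a i = 0)" by blast
      then have wa: "\<not> (AE p in \<mu>. w a p = 0)" using indep[of a] by (auto simp: w_def)
      have "AE p in \<mu>. G (u a) p = 0" using Gv[of a] va by eventually_elim simp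
      then have "g (u a) (u a) = ip \<mu> (\<lambda>p. 0) (u a)"
        by (intro ip_cong_AE) auto
      then have g0: "g (u a) (u a) = 0" by (simp add: ip_def)
      have "\<alpha> * (LINT p|\<mu>. (V\<^sub>0 p - \<kappa>) * (u a p)\<^sup>2) = (LINT p|\<mu>. \<alpha> * (V\<^sub>0 p - \<kappa>) * (u a p)\<^sup>2)"
        by (simp add: mult.assoc)
      also have "\<dots> \<le> (LINT p|\<mu>. (u a p)\<^sup>2)"
      proof (rule integral_mono)
        show "integrable \<mu> (\<lambda>p. \<alpha> * (V\<^sub>0 p - \<kappa>) * (u a p)\<^sup>2)"
          using aV by (intro int_u(1)[of _ 1]) (auto intro: less_imp_le)
        show "integrable \<mu> (\<lambda>p. (u a p)\<^sup>2)" by (intro L2_square uL)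
        fix p
        have "\<alpha> * (V\<^sub>0 p - \<kappa>) \<le> 1" using aV[of p] by linarith
        then show "\<alpha> * (V\<^sub>0 p - \<kappa>) * (u a p)\<^sup>2 \<le> (u a p)\<^sup>2"
          using mult_right_mono[of "\<alpha> * (V\<^sub>0 p - \<kappa>)" 1 "(u a p)\<^sup>2"] by simp
      qed
      finally have "0 \<le> \<alpha> * (B (w a) (w a) - (LINT p|\<mu>. V p * (w a p)\<^sup>2))"
        using transfer'[of a] g0 by (simp add: ip_square)
      then show ?thesis using wa alpha_pos by (auto simp: zero_le_mult_iff)
    next
      case True
      have "b' i \<in> W" if "i < m" for i unfolding b'_def by (rule G_W[OF hbL[OF that]])
      \<comment> \<open>The slack is set to \<open>\<alpha>\<close>, so that after multiplication by
        \<open>\<alpha>\<close> it is of the order \<open>\<alpha>\<^sup>2\<close> of the other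
        error.\<close>
      then obtain a where a: "- \<alpha> * ip \<mu> (v a) (v a) \<le> B (v a) (v a) - (LINT p|\<mu>. V\<^sub>0 p * (v a p)\<^sup>2)"
        and va: "\<not> (AE p in \<mu>. v a p = 0)"
        using large[of b' \<alpha>] True alpha_pos unfolding v_def by auto
      have wa: "\<not> (AE p in \<mu>. w a p = 0)"
      proof
        assume "AE p in \<mu>. w a p = 0"
        then have "\<forall>i<m. a i = 0" unfolding w_def by (rule indep)
        then show False using va by (simp add: v_def)
      qed
      have BG: "B (G (u a)) (G (u a)) = B (v a) (v a)"
        and ipG: "ip \<mu> (\<lambda>p. u a p - G (u a) p) (\<lambda>p. u a p - G (u a) p) = (LINT p|\<mu>. (u a p - v a p)\<^sup>2)"
        and ipv: "ip \<mu> (v a) (v a) \<le> ip \<mu> (u a) (u a)"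
      proof -
        have "g (u a) (u a) = ip \<mu> (v a) (u a)"
          using Gv by (intro ip_cong_AE) auto
        moreover have 1: "ip \<mu> (G (u a)) (G (u a)) = ip \<mu> (v a) (v a)"
          unfolding ip_def using Gv[of a] by (intro integral_cong_AE) auto
        moreover have "Q (v a) (v a) = ip \<mu> (u a) (v a)" using sol[of a] vW[of a] by (simp add: solves_def)
        ultimately have "\<alpha> * B (G (u a)) (G (u a)) = \<alpha> * B (v a) (v a)"
          using g_eq_Q[OF uL uL, of a a] ip_commute[of \<mu> "u a" "v a"] unfolding Q_def by linarith
        then show "B (G (u a)) (G (u a)) = B (v a) (v a)" using alpha_pos by simp
        show "ip \<mu> (\<lambda>p. u a p - G (u a) p) (\<lambda>p. u a p - G (u a) p) = (LINT p|\<mu>. (u a p - v a p)\<^sup>2)"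
          unfolding ip_square using Gv[of a]
          by (intro integral_cong_AE) auto
        show "ip \<mu> (v a) (v a) \<le> ip \<mu> (u a) (u a)" using G_contraction(1)[OF uL[of a]] 1 by simp
      qed
      have "\<alpha> * (LINT p|\<mu>. V\<^sub>0 p * (u a p)\<^sup>2) \<le>
        (LINT p|\<mu>. \<alpha> * (V\<^sub>0 p * (v a p)\<^sup>2) + (u a p - v a p)\<^sup>2 + \<alpha>\<^sup>2 * C\<^sup>2 / 4 * (2 * (u a p)\<^sup>2 + 2 * (v a p)\<^sup>2))"
        unfolding integral_mult_right_zero[symmetric]
      proof (rule integral_mono)
        show "integrable \<mu> (\<lambda>p. \<alpha> * (V\<^sub>0 p * (u a p)\<^sup>2))"
          using int_u(1)[of V\<^sub>0 C] V\<^sub>0 by simp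
        show "integrable \<mu> (\<lambda>p. \<alpha> * (V\<^sub>0 p * (v a p)\<^sup>2) + (u a p - v a p)\<^sup>2 + \<alpha>\<^sup>2 * C\<^sup>2 / 4 * (2 * (u a p)\<^sup>2 + 2 * (v a p)\<^sup>2))"
          using int_u(2)[of V\<^sub>0 C] V\<^sub>0 L2_square[OF uL] L2_square[OF vL] L2_square[OF L2_diff[OF uL vL]] by simp
        fix p
        show "\<alpha> * (V\<^sub>0 p * (u a p)\<^sup>2) \<le> \<alpha> * (V\<^sub>0 p * (v a p)\<^sup>2) + (u a p - v a p)\<^sup>2
          + \<alpha>\<^sup>2 * C\<^sup>2 / 4 * (2 * (u a p)\<^sup>2 + 2 * (v a p)\<^sup>2)"
        proof -
          \<comment> \<open>The change \<open>\<alpha> V\<^sub>0 (u\<^sup>2 - v\<^sup>2)\<close> of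
            the potential term is \<open>t * (x * y)\<close>. Young's inequality bounds it by
            \<open>x\<^sup>2\<close>, the smoothing error of the energy identity, plus a term of
            order \<open>\<alpha>\<^sup>2\<close>.\<close>
          define x y t where "x = u a p - v a p" and "y = u a p + v a p" and "t = \<alpha> * V\<^sub>0 p"
          have "t\<^sup>2 \<le> (\<alpha> * C)\<^sup>2"
            unfolding t_def using V\<^sub>0[of p] alpha_pos C by (simp add: abs_mult flip: abs_le_square_iff)
          then have "t\<^sup>2 * y\<^sup>2 \<le> (\<alpha> * C)\<^sup>2 * y\<^sup>2" by (intro mult_right_mono) auto
          moreover have "0 \<le> (x - t * y / 2)\<^sup>2" by simp
          ultimately have "t * (x * y) \<le> x\<^sup>2 + \<alpha>\<^sup>2 * C\<^sup>2 / 4 * y\<^sup>2"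
            by (simp add: power2_diff power_mult_distrib power_divide algebra_simps)
          moreover have "y\<^sup>2 \<le> 2 * (u a p)\<^sup>2 + 2 * (v a p)\<^sup>2"
            using zero_le_power2[of x] unfolding x_def y_def power2_diff power2_sum by linarith
          then have "\<alpha>\<^sup>2 * C\<^sup>2 / 4 * y\<^sup>2 \<le> \<alpha>\<^sup>2 * C\<^sup>2 / 4 * (2 * (u a p)\<^sup>2 + 2 * (v a p)\<^sup>2)"
            by (intro mult_left_mono) auto
          moreover have "t * (x * y) = \<alpha> * (V\<^sub>0 p * (u a p)\<^sup>2) - \<alpha> * (V\<^sub>0 p * (v a p)\<^sup>2)"
            unfolding t_def x_def y_def by (simp add: algebra_simps power2_eq_square)
          ultimately show ?thesis unfolding x_def by linarith
        qed
      qed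
      also have "\<dots> = \<alpha> * (LINT p|\<mu>. V\<^sub>0 p * (v a p)\<^sup>2) + (LINT p|\<mu>. (u a p - v a p)\<^sup>2)
        + \<alpha>\<^sup>2 * C\<^sup>2 / 4 * (2 * ip \<mu> (u a) (u a) + 2 * ip \<mu> (v a) (v a))"
        unfolding ip_square
        using int_u(2)[of V\<^sub>0 C] V\<^sub>0 L2_square[OF uL] L2_square[OF vL] L2_square[OF L2_diff[OF uL vL]] by simp
      also have "\<dots> \<le> \<alpha> * (LINT p|\<mu>. V\<^sub>0 p * (v a p)\<^sup>2) + (LINT p|\<mu>. (u a p - v a p)\<^sup>2)
        + \<alpha>\<^sup>2 * C\<^sup>2 / 4 * (4 * ip \<mu> (u a) (u a))"
        using ipv by (intro add_left_mono mult_left_mono) auto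
      finally have 1: "\<alpha> * (LINT p|\<mu>. V\<^sub>0 p * (u a p)\<^sup>2) \<le> \<alpha> * (LINT p|\<mu>. V\<^sub>0 p * (v a p)\<^sup>2)
        + (LINT p|\<mu>. (u a p - v a p)\<^sup>2) + \<alpha>\<^sup>2 * C\<^sup>2 * ip \<mu> (u a) (u a)" by simp
      have 2: "(LINT p|\<mu>. (V\<^sub>0 p - \<kappa>) * (u a p)\<^sup>2) = (LINT p|\<mu>. V\<^sub>0 p * (u a p)\<^sup>2) - \<kappa> * ip \<mu> (u a) (u a)"
        unfolding ip_square left_diff_distrib using int_u(1)[of V\<^sub>0 C] V\<^sub>0 L2_square[OF uL] by simp
      have 3: "ip \<mu> (u a) (u a) - g (u a) (u a) = \<alpha> * B (v a) (v a) + (LINT p|\<mu>. (u a p - v a p)\<^sup>2)"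
        using energy_identity[OF uL[of a]] BG ipG by simp
      have "\<alpha> * (- \<alpha> * ip \<mu> (v a) (v a)) \<le> \<alpha> * (B (v a) (v a) - (LINT p|\<mu>. V\<^sub>0 p * (v a p)\<^sup>2))"
        using a alpha_pos by (intro mult_left_mono) auto
      then have 4: "- (\<alpha>\<^sup>2 * ip \<mu> (v a) (v a)) \<le> \<alpha> * B (v a) (v a) - \<alpha> * (LINT p|\<mu>. V\<^sub>0 p * (v a p)\<^sup>2)"
        by (simp add: algebra_simps power2_eq_square)
      have 5: "\<alpha>\<^sup>2 * ip \<mu> (v a) (v a) \<le> \<alpha>\<^sup>2 * ip \<mu> (u a) (u a)"
        using ipv by (intro mult_left_mono) auto
      \<comment> \<open>The gain from the shift is exactly the sum of the two errors of order
        \<open>\<alpha>\<^sup>2\<close>, from Young's inequality and from the slack.\<close>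
      have 6: "\<alpha> * (\<kappa> * ip \<mu> (u a) (u a)) = \<alpha>\<^sup>2 * C\<^sup>2 * ip \<mu> (u a) (u a) + \<alpha>\<^sup>2 * ip \<mu> (u a) (u a)"
        by (simp add: \<kappa>_def algebra_simps power2_eq_square)
      have "0 \<le> \<alpha> * (B (w a) (w a) - (LINT p|\<mu>. V p * (w a p)\<^sup>2))"
        using transfer'[of a] 1 3 4 5 6 unfolding 2 right_diff_distrib by linarith
      then show ?thesis using wa alpha_pos by (auto simp: zero_le_mult_iff)
    qed
    then show ?thesis unfolding w_def .
  qed
  show ?thesis
    by (rule that[of V]) (use V0 VC IV main in auto)
qed

end

section \<open>Test functions\<close>

lemma Ck_on_Suc_I:
  assumes "\<And>x. (f has_derivative f' x) (at x)" "\<And>v. Ck_on k UNIV (\<lambda>x. f' x v)"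
  shows "Ck_on (Suc k) UNIV f"
proof -
  have "frechet_derivative f (at x) = f' x" for x
    using frechet_derivative_at[OF assms(1)] by simp
  then show ?thesis using assms by (auto simp: differentiable_def)
qed

lemma Ck_on_const: "Ck_on k UNIV (\<lambda>x. c)"
proof (induction k arbitrary: c)
  case (Suc k)
  show ?case by (rule Ck_on_Suc_I[where f' = "\<lambda>x v. 0"]) (auto intro: Suc)
qed simp

lemma Ck_on_SucD:
  assumes "Ck_on (Suc k) UNIV f"
  shows "Ck_on k UNIV f"
  using assms
proof (induction k arbitrary: f)
  case 0
  then show ?case by (auto intro!: differentiable_imp_continuous_on simp: differentiable_on_def)
next
  case (Suc k)
  then show ?case by auto
qed

lemma Ck_on_add:
  assumes "Ck_on k UNIV f" "Ck_on k UNIV g"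
  shows "Ck_on k UNIV (\<lambda>x. f x + g x)"
  using assms
proof (induction k arbitrary: f g)
  case 0
  then show ?case by (auto intro: continuous_on_add)
next
  case (Suc k)
  then have d: "(f has_derivative frechet_derivative f (at x)) (at x)" "(g has_derivative frechet_derivative g (at x)) (at x)" for x
    by (simp_all add: frechet_derivative_works[symmetric])
  show ?case
    by (rule Ck_on_Suc_I[OF has_derivative_add[OF d]]) (use Suc in auto)
qed

lemma Ck_on_mult:
  fixes f g :: "'e::euclidean_space \<Rightarrow> real"
  assumes "Ck_on k UNIV f" "Ck_on k UNIV g"
  shows "Ck_on k UNIV (\<lambda>x. f x * g x)"
  using assms
proof (induction k arbitrary: f g)
  case 0
  then show ?case by (auto intro: continuous_on_mult)
next
  case (Suc k)
  then have d: "(f has_derivative frechet_derivative f (at x)) (at x)" "(g has_derivative frechet_derivative g (at x)) (at x)" for x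
    by (simp_all add: frechet_derivative_works[symmetric])
  show ?case
    by (rule Ck_on_Suc_I[OF has_derivative_mult[OF d]])
      (use Suc Ck_on_SucD[OF Suc.prems(1)] Ck_on_SucD[OF Suc.prems(2)] in \<open>auto intro!: Ck_on_add Suc.IH\<close>)
qed

lemma Ck_on_prod:
  fixes f :: "'i \<Rightarrow> 'e::euclidean_space \<Rightarrow> real"
  assumes "\<And>i. i \<in> I \<Longrightarrow> Ck_on k UNIV (f i)"
  shows "Ck_on k UNIV (\<lambda>x. \<Prod>i\<in>I. f i x)"
  using assms
  by (induction I rule: infinite_finite_induct) (auto intro: Ck_on_const Ck_on_mult)

lemma Ck_on_translate:
  assumes "Ck_on k UNIV f"
  shows "Ck_on k UNIV (\<lambda>x. f (x - h))"
  using assms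
proof (induction k arbitrary: f)
  case 0
  then show ?case by (auto intro!: continuous_on_compose2[of UNIV f] continuous_intros)
next
  case (Suc k)
  then have "(f has_derivative frechet_derivative f (at x)) (at x)" for x
    by (simp add: frechet_derivative_works[symmetric])
  then have d: "((\<lambda>x. f (x - h)) has_derivative frechet_derivative f (at (x - h))) (at x)" for x
    by (rule has_derivative_compose[of "\<lambda>x. x - h" "\<lambda>x. x", rotated]) (auto intro!: derivative_eq_intros)
  show ?case
    by (rule Ck_on_Suc_I[OF d]) (use Suc in auto)
qed

text \<open>The family of functions \<open>p(1/t) exp(-c/t)\<close>, extended by \<open>0\<close>, is closed under differentiation.\<close>

definition flat :: "real \<Rightarrow> real poly \<Rightarrow> real \<Rightarrow> real" where
  "flat c p t = (if 0 < t then poly p (1 / t) * exp (- c / t) else 0)"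

lemma poly_times_exp_tendsto_0:
  fixes c :: real
  assumes "0 < c"
  shows "((\<lambda>s. poly p s * exp (- c * s)) \<longlongrightarrow> 0) at_top"
proof -
  have "((\<lambda>s. s ^ k * exp (- c * s)) \<longlongrightarrow> 0) at_top" for k
  proof -
    have "((\<lambda>s. (1 / c ^ k) * ((c * s) ^ k / exp (c * s))) \<longlongrightarrow> (1 / c ^ k) * 0) at_top"
      using assms by (intro tendsto_mult_left filterlim_compose[OF tendsto_power_div_exp_0]
        filterlim_tendsto_pos_mult_at_top[OF tendsto_const _ filterlim_ident])
    moreover have "(1 / c ^ k) * ((c * s) ^ k / exp (c * s)) = s ^ k * exp (- c * s)" for s
      using assms by (simp add: power_mult_distrib exp_minus field_simps)
    ultimately show ?thesis by simp
  qed
  then have "((\<lambda>s. \<Sum>i\<le>degree p. coeff p i * (s ^ i * exp (- c * s))) \<longlongrightarrow> (\<Sum>i\<le>degree p. coeff p i * 0)) at_top"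
    by (intro tendsto_sum tendsto_mult_left)
  then show ?thesis by (simp add: poly_altdef sum_distrib_right mult.assoc)
qed

text \<open>This is the difference quotient at 0, so the derivative there is 0. Division by
  \<open>t\<close> is absorbed into the polynomial: \<open>pCons 0 p\<close> is \<open>p\<close>
  times the variable.\<close>

lemma flat_tendsto_0:
  assumes "0 < c"
  shows "((\<lambda>t. flat c p t / t) \<longlongrightarrow> 0) (at 0)"
proof -
  have "((\<lambda>t. poly (pCons 0 p) (inverse t) * exp (- c * inverse t)) \<longlongrightarrow> 0) (at_right 0)"
    by (rule filterlim_compose[OF poly_times_exp_tendsto_0[OF assms] filterlim_inverse_at_top_right])
  then have "((\<lambda>t. flat c p t / t) \<longlongrightarrow> 0) (at_right 0)"
    by (rule Lim_transform_eventually)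
      (auto simp: eventually_at_right_field flat_def field_simps intro!: exI[of _ 1])
  moreover have "((\<lambda>t. flat c p t / t) \<longlongrightarrow> 0) (at_left 0)"
    by (rule Lim_transform_eventually[OF tendsto_const])
      (auto simp: eventually_at_left_field flat_def intro!: exI[of _ "-1"])
  ultimately show ?thesis by (simp add: filterlim_split_at)
qed

text \<open>With \<open>s = 1/t\<close>, the derivative of \<open>p(s) exp(-c s)\<close> with
  respect to \<open>t\<close> is \<open>s\<^sup>2 (c p(s) - p'(s)) exp(-c s)\<close>; the two
  \<open>pCons 0\<close> are the factor \<open>s\<^sup>2\<close>.\<close>

lemma flat_has_derivative:
  assumes c: "0 < c"
  shows "(flat c p has_field_derivative flat c (pCons 0 (pCons 0 (smult c p - pderiv p))) t) (at t)"
proof (cases t "0::real" rule: linorder_cases)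
  case less
  have "((\<lambda>t. 0) has_field_derivative 0) (at t)" by simp
  then have "(flat c p has_field_derivative 0) (at t)"
    by (rule DERIV_cong_ev[THEN iffD1, rotated -1])
      (use less in \<open>auto simp: flat_def intro!: eventually_mono[OF eventually_nhds_in_open[of "{..<0}"]]\<close>)
  then show ?thesis using less by (simp add: flat_def)
next
  case equal
  have "((\<lambda>h. (flat c p (0 + h) - flat c p 0) / h) \<longlongrightarrow> 0) (at 0)"
    using flat_tendsto_0[OF c, of p] by (simp add: flat_def)
  then show ?thesis using equal by (simp add: DERIV_def flat_def)
next
  case greater
  have "((\<lambda>t. poly p (1 / t) * exp (- c / t)) has_field_derivative
    flat c (pCons 0 (pCons 0 (smult c p - pderiv p))) t) (at t)"
    using greater by (auto intro!: derivative_eq_intros simp: flat_def field_simps power2_eq_square)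
  then show ?thesis
    by (rule DERIV_cong_ev[THEN iffD1, rotated -1])
      (use greater in \<open>auto simp: flat_def intro!: eventually_mono[OF eventually_nhds_in_open[of "{0<..}"]]\<close>)
qed

lemma Ck_on_flat:
  assumes "0 < c"
  shows "Ck_on k UNIV (\<lambda>x::'e::euclidean_space. flat c p (x \<bullet> w + d))"
proof (induction k arbitrary: p)
  case 0
  have "continuous_on UNIV (flat c p)"
    using DERIV_continuous_on[OF flat_has_derivative[OF assms]] by blast
  then show ?case by (auto intro!: continuous_on_compose2[of UNIV "flat c p"] continuous_intros)
next
  case (Suc k)
  have "((\<lambda>x::'e. flat c p (x \<bullet> w + d)) has_derivative
    (\<lambda>v. flat c (pCons 0 (pCons 0 (smult c p - pderiv p))) (x \<bullet> w + d) * (v \<bullet> w))) (at x)" for x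
    by (rule has_derivative_compose[OF _ flat_has_derivative[OF assms, unfolded has_field_derivative_def]])
      (auto intro!: derivative_eq_intros)
  then show ?case by (rule Ck_on_Suc_I) (intro Ck_on_mult Ck_on_const Suc)
qed

text \<open>A product of factors \<open>exp (-1 / ((k+1) t))\<close>, one for each face of the box,
  where \<open>t\<close> is the distance to the face. As \<open>k\<close> grows it tends to the
  indicator of the open box, while each member is smooth and vanishes outside the box.\<close>

definition box_bump :: "real ^ 'n \<Rightarrow> real ^ 'n \<Rightarrow> nat \<Rightarrow> real ^ 'n::finite \<Rightarrow> real" where
  "box_bump a b k x = (\<Prod>i\<in>UNIV. flat (1 / Suc k) 1 (x $ i - a $ i) * flat (1 / Suc k) 1 (b $ i - x $ i))"

lemma smooth_box_bump: "smooth_on UNIV (box_bump a b k)"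
proof -
  have "Ck_on l UNIV (\<lambda>x. flat (1 / Suc k) 1 (x $ i - a $ i) * flat (1 / Suc k) 1 (b $ i - x $ i))" for l i
    using Ck_on_mult[OF Ck_on_flat[of "1 / Suc k" l 1 "axis i (1::real)" "- a $ i"]
        Ck_on_flat[of "1 / Suc k" l 1 "- axis i (1::real)" "b $ i"]]
    by (simp add: inner_axis)
  then show ?thesis unfolding smooth_on_def box_bump_def by (auto intro: Ck_on_prod)
qed

lemma flat_bounds:
  assumes "0 < c"
  shows "0 \<le> flat c 1 t" "flat c 1 t \<le> 1" "0 < t \<Longrightarrow> 0 < flat c 1 t"
  using assms by (auto simp: flat_def)

lemma box_bump_bounds: "0 \<le> box_bump a b k x" "box_bump a b k x \<le> 1"
  unfolding box_bump_def
  by (auto intro!: prod_nonneg prod_le_1 mult_nonneg_nonneg mult_le_one flat_bounds)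

lemma box_bump_outside:
  assumes "x \<notin> box a b"
  shows "box_bump a b k x = 0"
proof -
  obtain i where "x $ i \<le> a $ i \<or> b $ i \<le> x $ i"
    using assms by (auto simp: mem_box_cart not_less)
  then have "flat (1 / Suc k) 1 (x $ i - a $ i) * flat (1 / Suc k) 1 (b $ i - x $ i) = 0"
    by (auto simp: flat_def)
  then show ?thesis unfolding box_bump_def by (intro prod_zero) auto
qed

lemma flat_tendsto_1:
  assumes "0 < t"
  shows "(\<lambda>k. flat (1 / Suc k) 1 t) \<longlonglongrightarrow> 1"
proof -
  have "(\<lambda>k. inverse (real (Suc k)) * (- 1 / t)) \<longlonglongrightarrow> 0 * (- 1 / t)"
    by (rule tendsto_mult_right[OF LIMSEQ_inverse_real_of_nat])
  then have "(\<lambda>k. exp (inverse (real (Suc k)) * (- 1 / t))) \<longlonglongrightarrow> exp (0 * (- 1 / t))"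
    by (rule tendsto_exp)
  then show ?thesis using assms by (simp add: flat_def field_simps)
qed

lemma box_bump_tendsto:
  fixes x :: "real ^ 'n::finite"
  shows "(\<lambda>k. box_bump a b k x) \<longlonglongrightarrow> indicator (box a b) x"
proof (cases "x \<in> box a b")
  case True
  then have "(\<lambda>k. flat (1 / Suc k) 1 (x $ i - a $ i) * flat (1 / Suc k) 1 (b $ i - x $ i)) \<longlonglongrightarrow> 1 * 1" for i
    by (intro tendsto_mult flat_tendsto_1) (auto simp: mem_box_cart)
  then have "(\<lambda>k. box_bump a b k x) \<longlonglongrightarrow> (\<Prod>i\<in>(UNIV :: 'n set). 1 * 1)"
    unfolding box_bump_def by (rule tendsto_prod)
  then show ?thesis using True by simp
next
  case False
  then show ?thesis by (simp add: box_bump_outside)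
qed

lemma test_function_box_bump:
  assumes "cbox a b \<subseteq> W"
  shows "test_function_on W (box_bump a b k)"
  unfolding test_function_on_def
  using assms box_subset_cbox[of a b]
  by (intro conjI exI[of _ "cbox a b"] smooth_box_bump allI impI box_bump_outside) auto

section \<open>Derivatives, supports and bounds of test functions\<close>

lemma test_function_onD:
  assumes "test_function_on W \<eta>"
  shows "(\<eta> has_derivative frechet_derivative \<eta> (at x)) (at x)"
    "continuous_on UNIV (\<lambda>x. frechet_derivative \<eta> (at x) v)"
    "continuous_on UNIV \<eta>"
proof -
  have "Ck_on (Suc 0) UNIV \<eta>" "Ck_on 0 UNIV \<eta>" using assms unfolding test_function_on_def smooth_on_def by blast+
  then show "(\<eta> has_derivative frechet_derivative \<eta> (at x)) (at x)"
    "continuous_on UNIV (\<lambda>x. frechet_derivative \<eta> (at x) v)" "continuous_on UNIV \<eta>"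
    by (auto simp: frechet_derivative_works[symmetric])
qed

lemma test_function_on_support:
  assumes "test_function_on W \<eta>"
  obtains K where "compact K" "K \<subseteq> W" "\<And>x. x \<notin> K \<Longrightarrow> \<eta> x = 0"
    "\<And>x. x \<notin> K \<Longrightarrow> frechet_derivative \<eta> (at x) v = 0"
proof -
  obtain K where K: "compact K" "K \<subseteq> W" "\<And>x. x \<notin> K \<Longrightarrow> \<eta> x = 0"
    using assms by (auto simp: test_function_on_def)
  moreover have "frechet_derivative \<eta> (at x) v = 0" if "x \<notin> K" for x
  proof -
    have "((\<lambda>x. 0) has_derivative (\<lambda>v. 0)) (at x)" by simp
    then have "(\<eta> has_derivative (\<lambda>v. 0)) (at x)"
      by (rule has_derivative_transform_within_open[of _ _ _ _ "- K"])
        (use K that in \<open>auto intro: compact_imp_closed\<close>)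
    from frechet_derivative_at[OF this] show ?thesis by metis
  qed
  ultimately show ?thesis using that by blast
qed

lemma test_function_on_bound:
  assumes "test_function_on W \<eta>"
  obtains c where "0 \<le> c" "\<And>x. \<bar>\<eta> x\<bar> \<le> c" "\<And>x. \<bar>frechet_derivative \<eta> (at x) v\<bar> \<le> c"
proof -
  obtain K where K: "compact K" "\<And>x. x \<notin> K \<Longrightarrow> \<eta> x = 0"
    "\<And>x. x \<notin> K \<Longrightarrow> frechet_derivative \<eta> (at x) v = 0"
    using test_function_on_support[OF assms, of v] by metis
  note D = test_function_onD[OF assms]
  have "bounded (\<eta> ` K)" "bounded ((\<lambda>x. frechet_derivative \<eta> (at x) v) ` K)"
    using D K by (auto intro!: compact_imp_bounded compact_continuous_image intro: continuous_on_subset)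
  then have "\<exists>c. \<forall>x\<in>K. \<bar>\<eta> x\<bar> \<le> c" "\<exists>c. \<forall>x\<in>K. \<bar>frechet_derivative \<eta> (at x) v\<bar> \<le> c"
    unfolding bounded_iff by auto
  then obtain c1 c2 where c: "\<forall>x\<in>K. \<bar>\<eta> x\<bar> \<le> c1" "\<forall>x\<in>K. \<bar>frechet_derivative \<eta> (at x) v\<bar> \<le> c2"
    by blast
  show ?thesis
  proof (rule that[of "\<bar>c1\<bar> + \<bar>c2\<bar>"])
    fix x
    show "\<bar>\<eta> x\<bar> \<le> \<bar>c1\<bar> + \<bar>c2\<bar>"
      using c(1) K(2)[of x] by (cases "x \<in> K") auto
    show "\<bar>frechet_derivative \<eta> (at x) v\<bar> \<le> \<bar>c1\<bar> + \<bar>c2\<bar>"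
      using c(2) K(3)[of x] by (cases "x \<in> K") auto
  qed auto
qed

lemma test_function_on_translate:
  assumes "test_function_on W \<eta>"
  shows "smooth_on UNIV (\<lambda>x. \<eta> (x - h))"
    "frechet_derivative (\<lambda>x. \<eta> (x - h)) (at x) = frechet_derivative \<eta> (at (x - h))"
proof -
  show "smooth_on UNIV (\<lambda>x. \<eta> (x - h))"
    using assms by (auto simp: test_function_on_def smooth_on_def intro: Ck_on_translate)
  have "((\<lambda>x. \<eta> (x - h)) has_derivative frechet_derivative \<eta> (at (x - h))) (at x)"
    by (rule has_derivative_compose[of "\<lambda>x. x - h" "\<lambda>x. x", rotated])
      (auto intro!: derivative_eq_intros test_function_onD(1)[OF assms(1)])
  from frechet_derivative_at[OF this]
  show "frechet_derivative (\<lambda>x. \<eta> (x - h)) (at x) = frechet_derivative \<eta> (at (x - h))" by simp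
qed

lemma borel_measurable_test_function:
  assumes "test_function_on W \<eta>"
  shows "\<eta> \<in> borel_measurable borel" "(\<lambda>x. frechet_derivative \<eta> (at x) v) \<in> borel_measurable borel"
  using test_function_onD[OF assms] by (auto intro: borel_measurable_continuous_onI)

section \<open>The fundamental lemma of the calculus of variations\<close>

text \<open>Open boxes form an intersection-stable generator of the Borel sets, so a Dynkin argument
  extends the vanishing of the integral to all Borel sets. The integral over the whole space comes
  first, for the complements.\<close>

lemma integrable_lborel_zero_on_boxes:
  fixes F :: "'e::euclidean_space \<Rightarrow> real"
  assumes F: "integrable lborel F" and box: "\<And>a b. (LINT x:box a b|lborel. F x) = 0"
  shows "AE x in lborel. F x = 0"
proof (rule density_unique_real[OF F])
  have int: "set_integrable lborel A F" if "A \<in> sets borel" for A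
    using that F unfolding set_integrable_def by (intro integrable_mult_indicator) auto
  have univ: "(LINT x|lborel. F x) = 0"
  proof -
    have "(\<lambda>k. LINT x:box (- real k *\<^sub>R One) (real k *\<^sub>R One)|lborel. F x) \<longlonglongrightarrow>
       (LINT x:(\<Union>k. box (- real k *\<^sub>R One) (real k *\<^sub>R One))|lborel. F x)"
      by (rule set_integral_cont_up) (auto intro!: int incseq_SucI subset_box_imp simp: algebra_simps)
    then have "(LINT x:(\<Union>k. box (- real k *\<^sub>R One) (real k *\<^sub>R One))|lborel. F x) = 0"
      by (simp add: box LIMSEQ_const_iff)
    then show ?thesis by (simp add: UN_box_eq_UNIV set_lebesgue_integral_def)
  qed
  fix A :: "'e set" assume "A \<in> sets lborel"
  then have A: "A \<in> sigma_sets UNIV (range (\<lambda>(a, b). box a b))"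
    by (simp add: borel_eq_box)
  have "Int_stable (range (\<lambda>(a, b). box a b :: 'e set))"
    by (auto simp: Int_stable_def box_Int_box)
  moreover have "range (\<lambda>(a, b). box a b :: 'e set) \<subseteq> Pow UNIV" by auto
  moreover note A
  ultimately have "(LINT x:A|lborel. F x) = 0"
  proof (induction rule: sigma_sets_induct_disjoint)
    case (basic A)
    then show ?case using box by auto
  next
    case empty
    show ?case by (simp add: set_lebesgue_integral_def)
  next
    case (compl A)
    then have A: "A \<in> sets borel" by (simp add: borel_eq_box)
    have "(LINT x:UNIV - A|lborel. F x) = (LINT x|lborel. F x - indicator A x *\<^sub>R F x)"
      unfolding set_lebesgue_integral_def
      by (intro Bochner_Integration.integral_cong) (auto simp: indicator_def)
    also have "\<dots> = (LINT x|lborel. F x) - (LINT x:A|lborel. F x)"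
      using F int[OF A] unfolding set_lebesgue_integral_def set_integrable_def by simp
    finally show ?case using compl univ by simp
  next
    case (union B)
    then have B: "B i \<in> sets borel" for i by (auto simp: borel_eq_box subset_eq)
    have "(LINT x:(\<Union>i. B i)|lborel. F x) = (\<Sum>i. (LINT x:B i|lborel. F x))"
      using B union.hyps int[of "\<Union>i. B i"]
      by (intro lebesgue_integral_countable_add) (auto simp: disjoint_family_on_def)
    then show ?case using union by simp
  qed
  then show "(LINT x:A|lborel. F x) = (LINT x:A|lborel. 0)" by simp
qed simp

lemma AE_open_if_AE_cbox:
  fixes W :: "'e::euclidean_space set"
  assumes "open W" and "\<And>a b. cbox a b \<subseteq> W \<Longrightarrow> AE x in lborel. x \<in> cbox a b \<longrightarrow> P x"
  shows "AE x in lborel. x \<in> W \<longrightarrow> P x"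
proof -
  obtain D where D: "countable D" "D \<subseteq> Pow W" "\<And>X. X \<in> D \<Longrightarrow> \<exists>a b. X = cbox a b" "\<Union>D = W"
    using open_countable_Union_open_cbox[OF assms(1)] by blast
  have "AE x in lborel. x \<in> X \<longrightarrow> P x" if "X \<in> D" for X
    using D(2) D(3)[OF that] that assms(2) by blast
  then have "AE x in lborel. \<forall>X\<in>D. x \<in> X \<longrightarrow> P x"
    using D(1) by (intro AE_ball_countable') auto
  then show ?thesis using D(4) by (auto elim!: eventually_mono)
qed

text \<open>The bumps converge boundedly to indicators of open boxes, and every open box inside
  \<open>cbox a0 b0\<close> is reached in this way. The boundary of \<open>cbox a0 b0\<close> is a
  null set.\<close>

lemma fundamental_lemma_cbox:
  fixes f :: "real ^ 'n::finite \<Rightarrow> real"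
  assumes int: "set_integrable lborel (cbox a0 b0) f"
    and zero: "\<And>a b k. cbox a b \<subseteq> cbox a0 b0 \<Longrightarrow> (LINT x:cbox a0 b0|lborel. f x * box_bump a b k x) = 0"
  shows "AE x in lborel. x \<in> cbox a0 b0 \<longrightarrow> f x = 0"
proof -
  let ?F = "\<lambda>x. indicator (cbox a0 b0) x * f x"
  have F: "integrable lborel ?F" using int by (simp add: set_integrable_def)
  have [measurable]: "box_bump a b k \<in> borel_measurable borel" for a b :: "real ^ 'n" and k
    using test_function_box_bump[of a b UNIV k] borel_measurable_test_function by blast
  have null: "AE x in lborel. x \<in> cbox a0 b0 \<longrightarrow> x \<in> box a0 b0"
  proof -
    have "cbox a0 b0 - box a0 b0 \<in> null_sets lebesgue"
      using negligible_frontier_interval by (simp add: negligible_iff_null_sets)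
    then have "cbox a0 b0 - box a0 b0 \<in> null_sets lborel"
      by (subst (asm) null_sets_completion_iff) auto
    then have "AE x in lborel. x \<notin> cbox a0 b0 - box a0 b0" by (rule AE_not_in)
    then show ?thesis by eventually_elim auto
  qed
  have "AE x in lborel. ?F x = 0"
  proof (rule integrable_lborel_zero_on_boxes[OF F])
    fix a b :: "real ^ 'n"
    obtain a' b' where ab: "box a b \<inter> box a0 b0 = box a' b'"
      unfolding box_Int_box by blast
    have "(LINT x:box a b|lborel. ?F x) = (LINT x|lborel. ?F x * indicator (box a' b') x)"
      unfolding set_lebesgue_integral_def
    proof (rule integral_cong_AE)
      show "AE x in lborel. indicator (box a b) x *\<^sub>R ?F x = ?F x * indicator (box a' b') x"
        using null by eventually_elim (auto simp: indicator_def simp flip: ab)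
    qed (use F in auto)
    also have "\<dots> = 0"
    proof (cases "box a' b' = {}")
      case False
      have "box a' b' \<subseteq> cbox a0 b0" using ab box_subset_cbox[of a0 b0] by blast
      then have sub: "cbox a' b' \<subseteq> cbox a0 b0" using False by (simp add: subset_box box_ne_empty)
      have "(\<lambda>k. LINT x|lborel. ?F x * box_bump a' b' k x) \<longlonglongrightarrow> (LINT x|lborel. ?F x * indicator (box a' b') x)"
      proof (rule integral_dominated_convergence[where w = "\<lambda>x. \<bar>?F x\<bar>"])
        show "AE x in lborel. (\<lambda>k. ?F x * box_bump a' b' k x) \<longlonglongrightarrow> ?F x * indicator (box a' b') x"
          by (intro AE_I2 tendsto_mult_left box_bump_tendsto)
        show "AE x in lborel. norm (?F x * box_bump a' b' k x) \<le> \<bar>?F x\<bar>" for k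
          using box_bump_bounds[of a' b' k] by (intro AE_I2) (simp add: abs_mult mult_left_le)
      qed (use F in auto)
      moreover have "(LINT x|lborel. ?F x * box_bump a' b' k x) = 0" for k
        using zero[OF sub, of k] by (simp add: set_lebesgue_integral_def mult.assoc)
      ultimately show ?thesis by (simp add: LIMSEQ_const_iff)
    qed simp
    finally show "(LINT x:box a b|lborel. ?F x) = 0" .
  qed
  then show ?thesis by eventually_elim (auto simp: indicator_def)
qed

lemma fundamental_lemma:
  fixes f :: "real ^ 'n::finite \<Rightarrow> real"
  assumes W: "open W" and int: "\<And>K. compact K \<Longrightarrow> K \<subseteq> W \<Longrightarrow> set_integrable lborel K f"
    and zero: "\<And>\<eta>. test_function_on W \<eta> \<Longrightarrow> (LINT x:W|lborel. f x * \<eta> x) = 0"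
  shows "AE x in lborel. x \<in> W \<longrightarrow> f x = 0"
proof (rule AE_open_if_AE_cbox[OF W])
  fix a0 b0 assume sub: "cbox a0 b0 \<subseteq> W"
  show "AE x in lborel. x \<in> cbox a0 b0 \<longrightarrow> f x = 0"
  proof (rule fundamental_lemma_cbox)
    show "set_integrable lborel (cbox a0 b0) f" using sub by (intro int) auto
    fix a b k assume ab: "cbox a b \<subseteq> cbox a0 b0"
    have "(LINT x:cbox a0 b0|lborel. f x * box_bump a b k x) = (LINT x:W|lborel. f x * box_bump a b k x)"
      unfolding set_lebesgue_integral_def
      using sub ab box_bump_outside[of _ a b k] box_subset_cbox[of a b]
      by (intro Bochner_Integration.integral_cong) (auto simp: indicator_def)
    also have "\<dots> = 0" using sub ab by (intro zero test_function_box_bump) auto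
    finally show "(LINT x:cbox a0 b0|lborel. f x * box_bump a b k x) = 0" .
  qed
qed

section \<open>Uniqueness of weak gradients\<close>

lemma AE_vec_iff:
  fixes f g :: "'a \<Rightarrow> real ^ 'n::finite"
  shows "(AE x in \<mu>. P x \<longrightarrow> f x = g x) \<longleftrightarrow> (\<forall>i. AE x in \<mu>. P x \<longrightarrow> f x $ i = g x $ i)" (is "?l = ?r")
proof
  assume ?l then show ?r by (intro allI) (erule eventually_mono, simp)
next
  assume ?r
  then have "AE x in \<mu>. \<forall>i\<in>UNIV. P x \<longrightarrow> f x $ i = g x $ i"
    by (intro AE_ball_countable'[OF _ countable_finite[OF finite_class.finite_UNIV]]) (erule spec)
  then show ?l by (rule eventually_mono) (simp only: vec_eq_iff UNIV_I simp_thms ball_UNIV, blast)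
qed

lemma set_integrable_vec_nth:
  fixes G :: "'a \<Rightarrow> real ^ 'n::finite"
  assumes "set_integrable \<mu> K G"
  shows "set_integrable \<mu> K (\<lambda>x. G x $ i)"
  using integrable_bounded_linear[OF bounded_linear_vec_nth assms[unfolded set_integrable_def], of i]
  by (simp add: set_integrable_def)

lemma set_integrable_mult_test_function:
  fixes f :: "real ^ 'n::finite \<Rightarrow> real"
  assumes "\<And>K. compact K \<Longrightarrow> K \<subseteq> W \<Longrightarrow> set_integrable lborel K f" "test_function_on W \<eta>"
  shows "set_integrable lborel W (\<lambda>x. f x * \<eta> x)" "set_integrable lborel W (\<lambda>x. f x * frechet_derivative \<eta> (at x) v)"
proof -
  obtain K where K: "compact K" "K \<subseteq> W" "\<And>x. x \<notin> K \<Longrightarrow> \<eta> x = 0"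
    "\<And>x. x \<notin> K \<Longrightarrow> frechet_derivative \<eta> (at x) v = 0"
    using test_function_on_support[OF assms(2), of v] by metis
  obtain c where c: "\<And>x. \<bar>\<eta> x\<bar> \<le> c" "\<And>x. \<bar>frechet_derivative \<eta> (at x) v\<bar> \<le> c"
    using test_function_on_bound[OF assms(2), of v] by metis
  note [measurable] = borel_measurable_test_function[OF assms(2)]
  have F: "integrable lborel (\<lambda>x. indicator K x * f x)"
    using assms(1)[OF K(1,2)] by (simp add: set_integrable_def)
  have *: "integrable lborel (\<lambda>x. (indicator K x * f x) * h x)"
    if h: "\<And>x. \<bar>h x\<bar> \<le> c" and [measurable]: "h \<in> borel_measurable borel" for h
  proof (rule Bochner_Integration.integrable_bound[of _ "\<lambda>x. c * (indicator K x * f x)"])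
    show "AE x in lborel. norm (indicator K x * f x * h x) \<le> norm (c * (indicator K x * f x))"
    proof (intro AE_I2)
      fix x
      have "\<bar>h x\<bar> \<le> \<bar>c\<bar>" using h[of x] by linarith
      then show "norm (indicator K x * f x * h x) \<le> norm (c * (indicator K x * f x))"
        by (simp add: abs_mult mult.commute mult_right_mono mult.assoc mult_left_mono)
    qed
  qed (use F in auto)
  have "(\<lambda>x. indicator W x *\<^sub>R (f x * h x)) = (\<lambda>x. (indicator K x * f x) * h x)"
    if "\<And>x. x \<notin> K \<Longrightarrow> h x = 0" for h
    using that K(2) by (auto simp: indicator_def fun_eq_iff)
  then show "set_integrable lborel W (\<lambda>x. f x * \<eta> x)" "set_integrable lborel W (\<lambda>x. f x * frechet_derivative \<eta> (at x) v)"
    unfolding set_integrable_def using *[of \<eta>] *[of "\<lambda>x. frechet_derivative \<eta> (at x) v"] c K by auto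
qed

lemma weak_gradient_on_unique:
  fixes f :: "real ^ 'n::finite \<Rightarrow> real"
  assumes W: "open W" and "weak_gradient_on W f G" "weak_gradient_on W f G'"
  shows "AE x in lborel. x \<in> W \<longrightarrow> G x = G' x"
  unfolding AE_vec_iff
proof
  fix i
  have G: "set_integrable lborel K (\<lambda>x. G x $ i)" "set_integrable lborel K (\<lambda>x. G' x $ i)"
    if "compact K" "K \<subseteq> W" for K
    using assms that unfolding weak_gradient_on_def by (auto intro: set_integrable_vec_nth)
  have "AE x in lborel. x \<in> W \<longrightarrow> G x $ i - G' x $ i = 0"
  proof (rule fundamental_lemma[OF W])
    show "set_integrable lborel K (\<lambda>x. G x $ i - G' x $ i)" if "compact K" "K \<subseteq> W" for K
      using G[OF that] by (rule set_integral_diff(1))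
    fix \<eta> assume \<eta>: "test_function_on W \<eta>"
    have "(LINT x:W|lborel. (G x $ i - G' x $ i) * \<eta> x) = (LINT x:W|lborel. G x $ i * \<eta> x) - (LINT x:W|lborel. G' x $ i * \<eta> x)"
      unfolding left_diff_distrib
      by (intro set_integral_diff(2) set_integrable_mult_test_function(1)[OF _ \<eta>] G)
    also have "\<dots> = 0"
    proof -
      have "(LINT x:W|lborel. f x * frechet_derivative \<eta> (at x) (axis i 1)) = - (LINT x:W|lborel. G x $ i * \<eta> x)"
        "(LINT x:W|lborel. f x * frechet_derivative \<eta> (at x) (axis i 1)) = - (LINT x:W|lborel. G' x $ i * \<eta> x)"
        using assms(2,3) \<eta> unfolding weak_gradient_on_def by blast+
      then show ?thesis by simp
    qed
    finally show "(LINT x:W|lborel. (G x $ i - G' x $ i) * \<eta> x) = 0" .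
  qed
  then show "AE x in lborel. x \<in> W \<longrightarrow> G x $ i = G' x $ i" by eventually_elim simp
qed

section \<open>Continuity of translations\<close>

lemma
  fixes F :: "'e::euclidean_space \<Rightarrow> real"
  assumes "integrable lborel F"
  shows integrable_lborel_translate: "integrable lborel (\<lambda>x. F (x + h))"
    and integral_lborel_translate: "(LINT x|lborel. F (x + h)) = (LINT x|lborel. F x)"
proof -
  have F: "F \<in> borel_measurable borel" using assms by auto
  have "integrable (distr lborel borel ((+) h)) F" using assms by (simp add: lborel_distr_plus)
  then show "integrable lborel (\<lambda>x. F (x + h))"
    using F by (subst (asm) integrable_distr_eq) (auto simp: add.commute)
  have "(LINT x|lborel. F x) = (LINT x|distr lborel borel ((+) h). F x)" by (simp add: lborel_distr_plus)
  also have "\<dots> = (LINT x|lborel. F (x + h))"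
    using F by (subst integral_distr) (auto simp: add.commute)
  finally show "(LINT x|lborel. F (x + h)) = (LINT x|lborel. F x)" by simp
qed

text \<open>Continuity at 0 of translations in L1, in sequential form so that dominated convergence
  applies.\<close>

definition translation_continuous :: "('e::euclidean_space \<Rightarrow> real) \<Rightarrow> bool" where
  "translation_continuous F \<longleftrightarrow>
    (\<forall>h :: nat \<Rightarrow> 'e. h \<longlonglongrightarrow> 0 \<longrightarrow> (\<lambda>k. LINT x|lborel. \<bar>F (x + h k) - F x\<bar>) \<longlonglongrightarrow> 0)"

text \<open>Translations preserve the L1 norm, so three errors of size \<open>e / 3\<close> suffice:
  two from the approximation of \<open>F\<close> and of its translate, one from the translation of
  \<open>F'\<close>.\<close>

lemma translation_continuous_closure:
  fixes F :: "'e::euclidean_space \<Rightarrow> real"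
  assumes F: "integrable lborel F"
    and approx: "\<And>e. 0 < e \<Longrightarrow> \<exists>F'. integrable lborel F' \<and> translation_continuous F' \<and> (LINT x|lborel. \<bar>F x - F' x\<bar>) < e"
  shows "translation_continuous F"
  unfolding translation_continuous_def
proof (intro allI impI)
  fix h :: "nat \<Rightarrow> 'e" assume h: "h \<longlonglongrightarrow> 0"
  show "(\<lambda>k. LINT x|lborel. \<bar>F (x + h k) - F x\<bar>) \<longlonglongrightarrow> 0"
  proof (rule LIMSEQ_I)
    fix e :: real assume "0 < e"
    then obtain F' where F': "integrable lborel F'" "translation_continuous F'" "(LINT x|lborel. \<bar>F x - F' x\<bar>) < e / 3"
      using approx[of "e / 3"] by auto
    obtain N where N: "\<And>k. N \<le> k \<Longrightarrow> (LINT x|lborel. \<bar>F' (x + h k) - F' x\<bar>) < e / 3"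
      using F'(2) h LIMSEQ_D[of "\<lambda>k. LINT x|lborel. \<bar>F' (x + h k) - F' x\<bar>" 0 "e / 3"] \<open>0 < e\<close>
      unfolding translation_continuous_def by fastforce
    have "(LINT x|lborel. \<bar>F (x + h k) - F x\<bar>) < e" if "N \<le> k" for k
    proof -
      have int: "integrable lborel (\<lambda>x. F x - F' x)" using F F' by simp
      note t = integrable_lborel_translate[OF F, of "h k"] integrable_lborel_translate[OF F'(1), of "h k"]
        integrable_lborel_translate[OF int, of "h k"]
      have "(LINT x|lborel. \<bar>F (x + h k) - F x\<bar>) \<le>
        (LINT x|lborel. \<bar>F (x + h k) - F' (x + h k)\<bar> + \<bar>F' (x + h k) - F' x\<bar> + \<bar>F x - F' x\<bar>)"
        using F F' t int by (intro integral_mono) auto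
      also have "\<dots> = (LINT x|lborel. \<bar>F (x + h k) - F' (x + h k)\<bar>) + (LINT x|lborel. \<bar>F' (x + h k) - F' x\<bar>)
          + (LINT x|lborel. \<bar>F x - F' x\<bar>)"
        using F F' t int by simp
      also have "(LINT x|lborel. \<bar>F (x + h k) - F' (x + h k)\<bar>) = (LINT x|lborel. \<bar>F x - F' x\<bar>)"
        using integral_lborel_translate[of "\<lambda>x. \<bar>F x - F' x\<bar>" "h k"] int by simp
      finally show ?thesis using N[OF that] F'(3) by simp
    qed
    then show "\<exists>N. \<forall>k\<ge>N. norm ((LINT x|lborel. \<bar>F (x + h k) - F x\<bar>) - 0) < e" by auto
  qed
qed

text \<open>For indicators the L1 distance is twice the measure of \<open>U\<close> minus twice the
  measure of its overlap with the translate. Openness makes the indicator of the overlap converge to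
  1 at each point of \<open>U\<close>, and it is 0 elsewhere.\<close>

lemma translation_continuous_open:
  fixes U :: "'e::euclidean_space set"
  assumes U: "open U" "emeasure lborel U < \<infinity>"
  shows "translation_continuous (\<lambda>x. indicator U x)"
  unfolding translation_continuous_def
proof (intro allI impI)
  fix h :: "nat \<Rightarrow> 'e" assume h: "h \<longlonglongrightarrow> 0"
  let ?I = "indicator U :: 'e \<Rightarrow> real"
  have int: "integrable lborel ?I" using U by (simp add: integrable_real_indicator)
  note t = integrable_lborel_translate[OF int]
  have int2: "integrable lborel (\<lambda>x. ?I (x + h k) * ?I x)" for k
    using t[of "h k"] int by (intro Bochner_Integration.integrable_bound[OF int] AE_I2) (auto split: split_indicator)
  have "(\<lambda>k. LINT x|lborel. ?I (x + h k) * ?I x) \<longlonglongrightarrow> (LINT x|lborel. ?I x)"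
  proof (rule integral_dominated_convergence[where w = ?I])
    show "AE x in lborel. (\<lambda>k. ?I (x + h k) * ?I x) \<longlonglongrightarrow> ?I x"
    proof (intro AE_I2)
      fix x
      show "(\<lambda>k. ?I (x + h k) * ?I x) \<longlonglongrightarrow> ?I x"
      proof (cases "x \<in> U")
        case True
        have "(\<lambda>k. x + h k) \<longlonglongrightarrow> x + 0" by (intro tendsto_intros h)
        then have "\<forall>\<^sub>F k in sequentially. x + h k \<in> U"
          using U(1) True by (intro topological_tendstoD) auto
        then have "\<forall>\<^sub>F k in sequentially. ?I x = ?I (x + h k) * ?I x"
          by eventually_elim (use True in simp)
        then show ?thesis by (rule Lim_transform_eventually[OF tendsto_const])
      qed simp
    qed
    show "AE x in lborel. norm (?I (x + h k) * ?I x) \<le> ?I x" for k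
      by (intro AE_I2) (auto simp: indicator_def)
  qed (use int int2 in auto)
  then have "(\<lambda>k. 2 * (LINT x|lborel. ?I x) - 2 * (LINT x|lborel. ?I (x + h k) * ?I x)) \<longlonglongrightarrow>
     2 * (LINT x|lborel. ?I x) - 2 * (LINT x|lborel. ?I x)"
    by (intro tendsto_intros)
  moreover have "(LINT x|lborel. \<bar>?I (x + h k) - ?I x\<bar>) =
     2 * (LINT x|lborel. ?I x) - 2 * (LINT x|lborel. ?I (x + h k) * ?I x)" for k
  proof -
    have "(LINT x|lborel. \<bar>?I (x + h k) - ?I x\<bar>) = (LINT x|lborel. ?I (x + h k) + ?I x - 2 * (?I (x + h k) * ?I x))"
      by (intro Bochner_Integration.integral_cong) (auto simp: indicator_def)
    also have "\<dots> = (LINT x|lborel. ?I (x + h k)) + (LINT x|lborel. ?I x) - 2 * (LINT x|lborel. ?I (x + h k) * ?I x)"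
      using int t[of "h k"] int2[of k] by simp
    finally show ?thesis using integral_lborel_translate[OF int, of "h k"] by simp
  qed
  ultimately show "(\<lambda>k. LINT x|lborel. \<bar>?I (x + h k) - ?I x\<bar>) \<longlonglongrightarrow> 0" by simp
qed

text \<open>Outer regularity provides an open superset of finite measure that is L1 close to
  \<open>A\<close>.\<close>

lemma translation_continuous_indicator:
  fixes A :: "'e::euclidean_space set"
  assumes A: "A \<in> sets borel" "emeasure lborel A < \<infinity>"
  shows "translation_continuous (\<lambda>x. indicator A x)"
proof (rule translation_continuous_closure)
  show "integrable lborel (indicator A :: 'e \<Rightarrow> real)" using A by (simp add: integrable_real_indicator)
  fix e :: real assume "0 < e"
  then obtain U where U: "open U" "A \<subseteq> U" "emeasure lborel (U - A) < ennreal e"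
    using outer_regular_lborel[of A e] A by auto
  have [measurable]: "U \<in> sets borel" using U by simp
  have "emeasure lborel U \<le> emeasure lborel (U - A) + emeasure lborel A"
    using A U emeasure_subadditive[of "U - A" lborel A] by (simp add: Un_absorb2)
  also have "\<dots> < \<infinity>" using A less_trans[OF U(3) ennreal_less_top] by simp
  finally have fin: "emeasure lborel U < \<infinity>" .
  have "(LINT x|lborel. \<bar>indicator A x - indicator U x\<bar>) = (LINT x|lborel. indicator (U - A) x :: real)"
    using U by (intro Bochner_Integration.integral_cong) (auto simp: indicator_def)
  also have "\<dots> = measure lborel (U - A)" by simp
  also have "\<dots> < e" using U(3) \<open>0 < e\<close> by (simp add: measure_def enn2real_less_iff less_trans[OF U(3) ennreal_less_top])
  finally show "\<exists>F'. integrable lborel F' \<and> translation_continuous F' \<and> (LINT x|lborel. \<bar>indicator A x - F' x\<bar>) < e"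
    using translation_continuous_open[OF U(1) fin] fin
    by (intro exI[of _ "indicator U"]) (auto simp: integrable_real_indicator)
qed

lemma translation_continuous_integrable:
  fixes F :: "'e::euclidean_space \<Rightarrow> real"
  assumes "integrable lborel F"
  shows "translation_continuous F"
  using assms
proof (induction rule: integrable_induct)
  case (base A c)
  show ?case
    unfolding translation_continuous_def
  proof (intro allI impI)
    fix h :: "nat \<Rightarrow> 'e" assume h: "h \<longlonglongrightarrow> 0"
    have "(\<lambda>k. \<bar>c\<bar> * (LINT x|lborel. \<bar>indicator A (x + h k) - indicator A x\<bar>)) \<longlonglongrightarrow> \<bar>c\<bar> * 0"
      using translation_continuous_indicator[of A] base h
      by (intro tendsto_mult_left) (auto simp: translation_continuous_def)
    moreover have "\<bar>indicator A (x + h k) *\<^sub>R c - indicator A x *\<^sub>R c\<bar> = \<bar>c\<bar> * \<bar>indicator A (x + h k) - indicator A x\<bar>" for x k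
      unfolding scaleR_diff_left[symmetric] by (simp add: abs_mult)
    ultimately show "(\<lambda>k. LINT x|lborel. \<bar>indicator A (x + h k) *\<^sub>R c - indicator A x *\<^sub>R c\<bar>) \<longlonglongrightarrow> 0"
      by simp
  qed
next
  case (add f g)
  show ?case
    unfolding translation_continuous_def
  proof (intro allI impI)
    fix h :: "nat \<Rightarrow> 'e" assume h: "h \<longlonglongrightarrow> 0"
    note t = integrable_lborel_translate[OF add(1)] integrable_lborel_translate[OF add(2)]
    show "(\<lambda>k. LINT x|lborel. \<bar>(f (x + h k) + g (x + h k)) - (f x + g x)\<bar>) \<longlonglongrightarrow> 0"
    proof (rule tendsto_sandwich[OF _ _ tendsto_const])
      show "(\<lambda>k. (LINT x|lborel. \<bar>f (x + h k) - f x\<bar>) + (LINT x|lborel. \<bar>g (x + h k) - g x\<bar>)) \<longlonglongrightarrow> 0"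
        using add(3,4) h by (intro tendsto_add_zero) (auto simp: translation_continuous_def)
      show "\<forall>\<^sub>F k in sequentially. (LINT x|lborel. \<bar>(f (x + h k) + g (x + h k)) - (f x + g x)\<bar>)
        \<le> (LINT x|lborel. \<bar>f (x + h k) - f x\<bar>) + (LINT x|lborel. \<bar>g (x + h k) - g x\<bar>)"
      proof (intro always_eventually allI)
        fix k
        have "(LINT x|lborel. \<bar>(f (x + h k) + g (x + h k)) - (f x + g x)\<bar>)
          \<le> (LINT x|lborel. \<bar>f (x + h k) - f x\<bar> + \<bar>g (x + h k) - g x\<bar>)"
          using t add(1,2) by (intro integral_mono) auto
        also have "\<dots> = (LINT x|lborel. \<bar>f (x + h k) - f x\<bar>) + (LINT x|lborel. \<bar>g (x + h k) - g x\<bar>)"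
          using t add(1,2) by simp
        finally show "(LINT x|lborel. \<bar>(f (x + h k) + g (x + h k)) - (f x + g x)\<bar>)
        \<le> (LINT x|lborel. \<bar>f (x + h k) - f x\<bar>) + (LINT x|lborel. \<bar>g (x + h k) - g x\<bar>)" .
      qed
    qed auto
  qed
next
  case (lim f s)
  show ?case
  proof (rule translation_continuous_closure)
    show "integrable lborel f" by fact
    fix e :: real assume "0 < e"
    have "(\<lambda>i. LINT x|lborel. \<bar>f x - s i x\<bar>) \<longlonglongrightarrow> (LINT x|(lborel :: 'e measure). 0)"
    proof (rule integral_dominated_convergence[where w = "\<lambda>x. 3 * \<bar>f x\<bar>"])
      show "AE x in lborel. (\<lambda>i. \<bar>f x - s i x\<bar>) \<longlonglongrightarrow> 0"
      proof (intro AE_I2)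
        fix x :: 'e
        have "(\<lambda>i. f x - s i x) \<longlonglongrightarrow> f x - f x" using lim by (intro tendsto_intros) auto
        then show "(\<lambda>i. \<bar>f x - s i x\<bar>) \<longlonglongrightarrow> 0" by (intro tendsto_rabs_zero) simp
      qed
      show "AE x in lborel. norm \<bar>f x - s i x\<bar> \<le> 3 * \<bar>f x\<bar>" for i
      proof (intro AE_I2)
        fix x :: 'e
        have "\<bar>s i x\<bar> \<le> 2 * \<bar>f x\<bar>" using lim(3)[of x i] by simp
        then show "norm \<bar>f x - s i x\<bar> \<le> 3 * \<bar>f x\<bar>" by simp
      qed
    qed (use lim in auto)
    then obtain i where "(LINT x|lborel. \<bar>f x - s i x\<bar>) < e"
      using LIMSEQ_D[of _ 0 e] \<open>0 < e\<close> by fastforce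
    then show "\<exists>F'. integrable lborel F' \<and> translation_continuous F' \<and> (LINT x|lborel. \<bar>f x - F' x\<bar>) < e"
      using lim by blast
  qed
qed

text \<open>Uniformity in \<open>h\<close>, by contradiction: bad vectors of norm below
  \<open>1 / Suc k\<close> would form a sequence tending to 0.\<close>

lemma translation_small:
  fixes F :: "'e::euclidean_space \<Rightarrow> real"
  assumes F: "integrable lborel F" and "0 < e"
  shows "\<exists>d>0. \<forall>h. norm h < d \<longrightarrow> (LINT x|lborel. \<bar>F (x + h) - F x\<bar>) < e"
proof (rule ccontr)
  assume "\<not> ?thesis"
  then have "\<exists>h. norm h < 1 / Suc k \<and> e \<le> (LINT x|lborel. \<bar>F (x + h) - F x\<bar>)" for k
    by (meson not_less of_nat_0_less_iff zero_less_Suc zero_less_divide_1_iff)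
  then obtain h where h: "\<And>k. norm (h k) < 1 / Suc k" "\<And>k. e \<le> (LINT x|lborel. \<bar>F (x + h k) - F x\<bar>)"
    by metis
  have "h \<longlonglongrightarrow> 0"
    by (rule Lim_null_comparison[OF _ LIMSEQ_inverse_real_of_nat])
      (use h(1) in \<open>auto intro!: always_eventually less_imp_le simp: inverse_eq_divide\<close>)
  then have "(\<lambda>k. LINT x|lborel. \<bar>F (x + h k) - F x\<bar>) \<longlonglongrightarrow> 0"
    using translation_continuous_integrable[OF F] by (auto simp: translation_continuous_def)
  then have "e \<le> 0" by (rule LIMSEQ_le_const) (use h(2) in auto)
  then show False using \<open>0 < e\<close> by simp
qed

section \<open>The chain rule for weak gradients\<close>

text \<open>A bound on the L1 norms of the slices that is uniform in \<open>s\<close> gives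
  integrability on the product with the bounded interval \<open>{0..t}\<close>, hence every form of
  Fubini.\<close>

lemma fubini_strip:
  fixes H :: "real \<times> 'e::euclidean_space \<Rightarrow> real"
  assumes [measurable]: "H \<in> borel_measurable (lborel \<Otimes>\<^sub>M lborel)"
    and int: "\<And>s. s \<in> {0..t} \<Longrightarrow> integrable lborel (\<lambda>x. H (s, x))"
    and bound: "\<And>s. s \<in> {0..t} \<Longrightarrow> (LINT x|lborel. \<bar>H (s, x)\<bar>) \<le> C"
  shows "AE x in lborel. integrable lborel (\<lambda>s. H (s, x) * indicator {0..t} s)"
    and "integrable lborel (\<lambda>x. LINT s|lborel. H (s, x) * indicator {0..t} s)"
    and "integrable lborel (\<lambda>s. (LINT x|lborel. H (s, x)) * indicator {0..t} s)"
    and "(LINT x|lborel. LINT s|lborel. H (s, x) * indicator {0..t} s) =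
      (LINT s|lborel. (LINT x|lborel. H (s, x)) * indicator {0..t} s)"
proof -
  let ?H = "\<lambda>(s, x). H (s, x) * indicator {0..t} s"
  have C: "integrable lborel (\<lambda>s. C * indicator {0..t} s)"
    by (intro integrable_mult_right integrable_real_indicator) (auto simp: emeasure_lborel_Icc_eq)
  have H: "integrable (lborel \<Otimes>\<^sub>M lborel) ?H"
  proof (rule lborel_pair.Fubini_integrable)
    show "?H \<in> borel_measurable (lborel \<Otimes>\<^sub>M lborel)" by measurable
    show "integrable lborel (\<lambda>s. LINT x|lborel. norm (?H (s, x)))"
    proof (rule Bochner_Integration.integrable_bound[OF C])
      show "(\<lambda>s. LINT x|lborel. norm (?H (s, x))) \<in> borel_measurable lborel" by measurable
      show "AE s in lborel. norm (LINT x|lborel. norm (?H (s, x))) \<le> norm (C * indicator {0..t} s)"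
        using bound by (intro AE_I2) (force simp: indicator_def)
    qed
    show "AE s in lborel. integrable lborel (\<lambda>x. ?H (s, x))"
      using int by (intro AE_I2) (auto simp: indicator_def)
  qed
  show "AE x in lborel. integrable lborel (\<lambda>s. H (s, x) * indicator {0..t} s)"
    using lborel_pair.AE_integrable_snd[OF H] by simp
  show "integrable lborel (\<lambda>x. LINT s|lborel. H (s, x) * indicator {0..t} s)"
    using lborel_pair.integrable_snd[OF H] by simp
  show "integrable lborel (\<lambda>s. (LINT x|lborel. H (s, x)) * indicator {0..t} s)"
    using lborel_pair.integrable_fst[OF H] by simp
  show "(LINT x|lborel. LINT s|lborel. H (s, x) * indicator {0..t} s) =
      (LINT s|lborel. (LINT x|lborel. H (s, x)) * indicator {0..t} s)"
    using lborel_pair.Fubini_integral[OF H] by simp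
qed

text \<open>The integral of \<open>D\<close> along the segment from \<open>x\<close> to
  \<open>x + t *\<^sub>R e\<close>. If \<open>D\<close> is the derivative of \<open>F\<close> in
  direction \<open>e\<close>, it is the increment of \<open>F\<close> for almost every
  \<open>x\<close>.\<close>

definition path_integral :: "('e::euclidean_space \<Rightarrow> real) \<Rightarrow> 'e \<Rightarrow> real \<Rightarrow> 'e \<Rightarrow> real" where
  "path_integral D e t x = (LINT s|lborel. D (x + s *\<^sub>R e) * indicator {0..t} s)"

lemma integral_path_integral:
  fixes D :: "'e::euclidean_space \<Rightarrow> real"
  assumes D: "integrable lborel D" and [measurable]: "\<psi> \<in> borel_measurable borel" and \<psi>: "\<And>x. \<bar>\<psi> x\<bar> \<le> c"
  shows "integrable lborel (path_integral D e t)"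
    and "(LINT x|lborel. path_integral D e t x * \<psi> x) =
      (LINT s|lborel. (LINT x|lborel. D (x + s *\<^sub>R e) * \<psi> x) * indicator {0..t} s)"
proof -
  have [measurable]: "D \<in> borel_measurable borel" using D by auto
  have i: "integrable lborel (\<lambda>x. D (x + s *\<^sub>R e))" for s by (rule integrable_lborel_translate[OF D])
  have b: "(LINT x|lborel. \<bar>D (x + s *\<^sub>R e)\<bar>) = (LINT x|lborel. \<bar>D x\<bar>)" for s
    using integral_lborel_translate[of "\<lambda>x. \<bar>D x\<bar>"] D by simp
  have "integrable lborel (\<lambda>x. LINT s|lborel. (\<lambda>p. D (snd p + fst p *\<^sub>R e)) (s, x) * indicator {0..t} s)"
    by (rule fubini_strip(2)[where C = "LINT x|lborel. \<bar>D x\<bar>"]) (use i b in auto)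
  then show "integrable lborel (path_integral D e t)" by (simp add: path_integral_def[abs_def])
  have i2: "integrable lborel (\<lambda>x. D (x + s *\<^sub>R e) * \<psi> x)" for s
  proof (rule Bochner_Integration.integrable_bound[of _ "\<lambda>x. c * D (x + s *\<^sub>R e)"])
    show "AE x in lborel. norm (D (x + s *\<^sub>R e) * \<psi> x) \<le> norm (c * D (x + s *\<^sub>R e))"
    proof (intro AE_I2)
      fix x
      have "\<bar>\<psi> x\<bar> \<le> \<bar>c\<bar>" using \<psi>[of x] by linarith
      then show "norm (D (x + s *\<^sub>R e) * \<psi> x) \<le> norm (c * D (x + s *\<^sub>R e))"
        by (simp add: abs_mult mult.commute mult_right_mono)
    qed
  qed (use i in auto)
  have c: "0 \<le> c" using \<psi>[of undefined] by linarith
  have b2: "(LINT x|lborel. \<bar>D (x + s *\<^sub>R e) * \<psi> x\<bar>) \<le> c * (LINT x|lborel. \<bar>D x\<bar>)" for s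
  proof -
    have "(LINT x|lborel. \<bar>D (x + s *\<^sub>R e) * \<psi> x\<bar>) \<le> (LINT x|lborel. c * \<bar>D (x + s *\<^sub>R e)\<bar>)"
    proof (rule integral_mono)
      show "\<bar>D (x + s *\<^sub>R e) * \<psi> x\<bar> \<le> c * \<bar>D (x + s *\<^sub>R e)\<bar>" for x
        using mult_right_mono[OF \<psi>[of x] abs_ge_zero[of "D (x + s *\<^sub>R e)"]] by (simp add: abs_mult mult.commute)
    qed (use integrable_abs[OF i2] i in auto)
    then show ?thesis using b by simp
  qed
  have "(LINT x|lborel. LINT s|lborel. (\<lambda>p. D (snd p + fst p *\<^sub>R e) * \<psi> (snd p)) (s, x) * indicator {0..t} s) =
    (LINT s|lborel. (LINT x|lborel. (\<lambda>p. D (snd p + fst p *\<^sub>R e) * \<psi> (snd p)) (s, x)) * indicator {0..t} s)"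
    by (rule fubini_strip(4)[where C = "c * (LINT x|lborel. \<bar>D x\<bar>)"]) (use i2 b2 in auto)
  moreover have "(LINT s|lborel. (D (x + s *\<^sub>R e) * \<psi> x) * indicator {0..t} s) = path_integral D e t x * \<psi> x" for x
    unfolding path_integral_def by (subst integral_mult_left_zero[symmetric]) (simp add: mult_ac)
  ultimately show "(LINT x|lborel. path_integral D e t x * \<psi> x) =
      (LINT s|lborel. (LINT x|lborel. D (x + s *\<^sub>R e) * \<psi> x) * indicator {0..t} s)"
    by simp
qed

text \<open>Minkowski's inequality for integrals: the L1 norm of an integral over \<open>s\<close>
  of the functions \<open>D (x + s *\<^sub>R e) - D x\<close> is at most the integral of their L1
  norms.\<close>

lemma path_integral_approx:
  fixes D :: "'e::euclidean_space \<Rightarrow> real"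
  assumes D: "integrable lborel D" and t: "0 \<le> t"
    and small: "\<And>s. 0 \<le> s \<Longrightarrow> s \<le> t \<Longrightarrow> (LINT x|lborel. \<bar>D (x + s *\<^sub>R e) - D x\<bar>) \<le> \<delta>"
  shows "(LINT x|lborel. \<bar>path_integral D e t x - t * D x\<bar>) \<le> t * \<delta>"
proof -
  have [measurable]: "D \<in> borel_measurable borel" using D by auto
  have i: "integrable lborel (\<lambda>x. D (x + s *\<^sub>R e))" for s by (rule integrable_lborel_translate[OF D])
  have b: "(LINT x|lborel. \<bar>D (x + s *\<^sub>R e)\<bar>) = (LINT x|lborel. \<bar>D x\<bar>)" for s
    using integral_lborel_translate[of "\<lambda>x. \<bar>D x\<bar>"] D by simp
  have A: "AE x in lborel. integrable lborel (\<lambda>s. (\<lambda>p. D (snd p + fst p *\<^sub>R e)) (s, x) * indicator {0..t} s)"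
    by (rule fubini_strip(1)[where C = "LINT x|lborel. \<bar>D x\<bar>"]) (use i b in auto)
  let ?H = "\<lambda>p. \<bar>D (snd p + fst p *\<^sub>R e) - D (snd p)\<bar>"
  have H1: "AE x in lborel. integrable lborel (\<lambda>s. ?H (s, x) * indicator {0..t} s)"
    by (rule fubini_strip(1)[where C = \<delta>]) (use i D small in auto)
  have H2: "integrable lborel (\<lambda>s. (LINT x|lborel. ?H (s, x)) * indicator {0..t} s)"
    by (rule fubini_strip(3)[where C = \<delta>]) (use i D small in auto)
  have H3: "(LINT x|lborel. LINT s|lborel. ?H (s, x) * indicator {0..t} s) =
      (LINT s|lborel. (LINT x|lborel. ?H (s, x)) * indicator {0..t} s)"
    by (rule fubini_strip(4)[where C = \<delta>]) (use i D small in auto)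
  have ind: "integrable lborel (\<lambda>s::real. indicator {0..t} s :: real)"
    by (intro integrable_real_indicator) (auto simp: emeasure_lborel_Icc_eq)
  have "(LINT x|lborel. \<bar>path_integral D e t x - t * D x\<bar>) \<le> (LINT x|lborel. LINT s|lborel. ?H (s, x) * indicator {0..t} s)"
  proof (rule integral_mono_AE)
    show "integrable lborel (\<lambda>x. \<bar>path_integral D e t x - t * D x\<bar>)"
      using integral_path_integral(1)[OF D, of "\<lambda>x. 0" 0 e t] D by auto
    show "AE x in lborel. \<bar>path_integral D e t x - t * D x\<bar> \<le> (LINT s|lborel. ?H (s, x) * indicator {0..t} s)"
      using A H1
    proof eventually_elim
      case (elim x)
      have "(LINT s|lborel. D x * indicator {0..t} s) = t * D x" using t by simp
      then have "path_integral D e t x - t * D x = (LINT s|lborel. D (x + s *\<^sub>R e) * indicator {0..t} s - D x * indicator {0..t} s)"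
        using elim(1) ind t unfolding path_integral_def by simp
      also have "\<bar>\<dots>\<bar> \<le> (LINT s|lborel. \<bar>D (x + s *\<^sub>R e) * indicator {0..t} s - D x * indicator {0..t} s\<bar>)"
        by (rule integral_abs_bound)
      also have "\<dots> = (LINT s|lborel. ?H (s, x) * indicator {0..t} s)"
        by (intro Bochner_Integration.integral_cong) (auto simp: indicator_def)
      finally show ?case .
    qed
  qed (rule fubini_strip(2)[where C = \<delta>], use i D small in auto)
  also have "\<dots> \<le> (LINT s|lborel. \<delta> * indicator {0..t} s)"
    unfolding H3
  proof (rule integral_mono)
    show "(LINT x|lborel. ?H (s, x)) * indicator {0..t} s \<le> \<delta> * indicator {0..t} s" for s
      using small[of s] by (auto simp: indicator_def)
  qed (use H2 ind in auto)
  also have "\<dots> = t * \<delta>" using t by simp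
  finally show ?thesis .
qed

lemma test_function_line_derivative:
  assumes "test_function_on W \<eta>"
  shows "((\<lambda>s. \<eta> (x - s *\<^sub>R e)) has_real_derivative - frechet_derivative \<eta> (at (x - s *\<^sub>R e)) e) (at s)"
proof -
  have d: "(\<eta> has_derivative frechet_derivative \<eta> (at (x - s *\<^sub>R e))) (at (x - s *\<^sub>R e))"
    by (rule test_function_onD(1)[OF assms])
  have "((\<lambda>s. \<eta> (x - s *\<^sub>R e)) has_derivative (\<lambda>h. frechet_derivative \<eta> (at (x - s *\<^sub>R e)) (- (h *\<^sub>R e)))) (at s)"
    by (rule has_derivative_compose[where f = "\<lambda>s. x - s *\<^sub>R e" and g = \<eta>, OF _ d])
      (auto intro!: derivative_eq_intros)
  moreover have "(\<lambda>h. frechet_derivative \<eta> (at (x - s *\<^sub>R e)) (- (h *\<^sub>R e))) = (*) (- frechet_derivative \<eta> (at (x - s *\<^sub>R e)) e)"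
    using linear_simps[OF has_derivative_bounded_linear[OF d]] by (simp add: fun_eq_iff)
  ultimately show ?thesis by (simp only: has_field_derivative_def)
qed

text \<open>The identity is tested against \<open>\<psi>\<close>. Translation invariance moves the
  shift to \<open>\<psi>\<close>, the weak derivative moves the differentiation to
  \<open>\<psi>\<close>, and for \<open>\<psi>\<close> it is the fundamental theorem of calculus
  along a line. \<open>F\<close> and \<open>D\<close> will be cut-off functions, so the relation
  between them is demanded only for the translates that occur.\<close>

lemma difference_eq_path_integral:
  fixes F D :: "real ^ 'n::finite \<Rightarrow> real"
  assumes U: "open U" and F: "integrable lborel F" and D: "integrable lborel D" and t: "0 \<le> t"
    and parts: "\<And>\<psi> s. \<lbrakk>test_function_on U \<psi>; 0 \<le> s; s \<le> t\<rbrakk> \<Longrightarrow>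
      (LINT x|lborel. F x * frechet_derivative \<psi> (at (x - s *\<^sub>R e)) e) = - (LINT x|lborel. D x * \<psi> (x - s *\<^sub>R e))"
  shows "AE x in lborel. x \<in> U \<longrightarrow> F (x + t *\<^sub>R e) - F x = path_integral D e t x"
proof -
  have P: "integrable lborel (path_integral D e t)" by (rule integral_path_integral(1)[OF D, of "\<lambda>x. 0" 0]) auto
  have Ft: "integrable lborel (\<lambda>x. F (x + t *\<^sub>R e))" by (rule integrable_lborel_translate[OF F])
  have [measurable]: "F \<in> borel_measurable borel" "D \<in> borel_measurable borel" using F D by auto
  have Q: "integrable lborel (\<lambda>x. F (x + t *\<^sub>R e) - F x - path_integral D e t x)"
    using P F Ft by auto
  have "AE x in lborel. x \<in> U \<longrightarrow> F (x + t *\<^sub>R e) - F x - path_integral D e t x = 0"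
  proof (rule fundamental_lemma[OF U])
    show "set_integrable lborel K (\<lambda>x. F (x + t *\<^sub>R e) - F x - path_integral D e t x)" if "compact K" for K
      unfolding set_integrable_def using that Q
      by (intro integrable_mult_indicator) (auto intro: borel_closed compact_imp_closed)
    fix \<psi> assume \<psi>: "test_function_on U \<psi>"
    note [measurable] = borel_measurable_test_function[OF \<psi>]
    obtain c where c: "\<And>x. \<bar>\<psi> x\<bar> \<le> c" "\<And>x. \<bar>frechet_derivative \<psi> (at x) e\<bar> \<le> c"
      using test_function_on_bound[OF \<psi>, of e] by metis
    have bi: "integrable lborel (\<lambda>x. f x * \<psi> (x - s *\<^sub>R e))"
      "integrable lborel (\<lambda>x. f x * frechet_derivative \<psi> (at (x - s *\<^sub>R e)) e)"
      if f: "integrable lborel f" for f s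
    proof -
      have [measurable]: "f \<in> borel_measurable borel" using f by auto
      have *: "integrable lborel (\<lambda>x. f x * h x)" if [measurable]: "h \<in> borel_measurable borel" and h: "\<And>x. \<bar>h x\<bar> \<le> c" for h
      proof (rule Bochner_Integration.integrable_bound[of _ "\<lambda>x. c * f x"])
        show "AE x in lborel. norm (f x * h x) \<le> norm (c * f x)"
        proof (intro AE_I2)
          fix x
          have "\<bar>h x\<bar> \<le> \<bar>c\<bar>" using h[of x] by linarith
          then show "norm (f x * h x) \<le> norm (c * f x)"
            using mult_right_mono[of "\<bar>h x\<bar>" "\<bar>c\<bar>" "\<bar>f x\<bar>"] by (simp add: abs_mult mult.commute)
        qed
      qed (use f in auto)
      show "integrable lborel (\<lambda>x. f x * \<psi> (x - s *\<^sub>R e))"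
        "integrable lborel (\<lambda>x. f x * frechet_derivative \<psi> (at (x - s *\<^sub>R e)) e)"
        by (rule *, use c in measurable)+
    qed
    have shift: "(LINT x|lborel. f (x + s *\<^sub>R e) * \<psi> x) = (LINT x|lborel. f x * \<psi> (x - s *\<^sub>R e))"
      if "integrable lborel f" for f s
      using integral_lborel_translate[OF bi(1)[OF that, of s], of "s *\<^sub>R e"] by simp
    have "(LINT x|lborel. path_integral D e t x * \<psi> x) =
      (LINT s|lborel. (LINT x|lborel. D (x + s *\<^sub>R e) * \<psi> x) * indicator {0..t} s)"
      by (rule integral_path_integral(2)[OF D _ c(1)]) measurable
    also have "\<dots> = (LINT s|lborel. (LINT x|lborel. - F x * frechet_derivative \<psi> (at (x - s *\<^sub>R e)) e) * indicator {0..t} s)"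
    proof (intro Bochner_Integration.integral_cong refl)
      fix s
      show "(LINT x|lborel. D (x + s *\<^sub>R e) * \<psi> x) * indicator {0..t} s =
        (LINT x|lborel. - F x * frechet_derivative \<psi> (at (x - s *\<^sub>R e)) e) * indicator {0..t} s"
        using parts[OF \<psi>, of s] shift[OF D, of s] by (auto simp: indicator_def)
    qed
    also have "\<dots> = (LINT x|lborel. LINT s|lborel. (- F x * frechet_derivative \<psi> (at (x - s *\<^sub>R e)) e) * indicator {0..t} s)"
    proof -
      let ?H = "\<lambda>p. - F (snd p) * frechet_derivative \<psi> (at (snd p - fst p *\<^sub>R e)) e"
      have "(LINT x|lborel. LINT s|lborel. ?H (s, x) * indicator {0..t} s) =
        (LINT s|lborel. (LINT x|lborel. ?H (s, x)) * indicator {0..t} s)"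
      proof (rule fubini_strip(4)[where C = "LINT x|lborel. c * \<bar>F x\<bar>"])
        have "(\<lambda>p::real \<times> (real ^ 'n). frechet_derivative \<psi> (at (snd p - fst p *\<^sub>R e)) e) \<in> borel_measurable (lborel \<Otimes>\<^sub>M lborel)"
          by (rule measurable_compose[OF _ borel_measurable_test_function(2)[OF \<psi>]]) measurable
        then show "?H \<in> borel_measurable (lborel \<Otimes>\<^sub>M lborel)" by measurable
        fix s
        show "integrable lborel (\<lambda>x. ?H (s, x))" using bi(2)[OF F, of s] by simp
        show "(LINT x|lborel. \<bar>?H (s, x)\<bar>) \<le> (LINT x|lborel. c * \<bar>F x\<bar>)"
        proof (rule integral_mono)
          show "\<bar>?H (s, x)\<bar> \<le> c * \<bar>F x\<bar>" for x
            using mult_right_mono[OF c(2)[of "x - s *\<^sub>R e"] abs_ge_zero[of "F x"]] by (simp add: abs_mult mult.commute)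
          show "integrable lborel (\<lambda>x. \<bar>?H (s, x)\<bar>)" using integrable_abs[OF bi(2)[OF F, of s]] by (simp add: abs_mult)
        qed (use F in auto)
      qed
      then show ?thesis by simp
    qed
    \<comment> \<open>After the exchange only \<open>\<psi>\<close> depends on \<open>s\<close>, so
      the inner integral is a classical one.\<close>
    also have "\<dots> = (LINT x|lborel. F x * (\<psi> (x - t *\<^sub>R e) - \<psi> x))"
    proof (intro Bochner_Integration.integral_cong refl)
      fix x
      have "(LINT s|lborel. - frechet_derivative \<psi> (at (x - s *\<^sub>R e)) e * indicator {0..t} s) = \<psi> (x - t *\<^sub>R e) - \<psi> (x - 0 *\<^sub>R e)"
      proof (rule integral_FTC_Icc_real[OF t test_function_line_derivative[OF \<psi>]])
        fix s
        have "continuous_on UNIV (\<lambda>s. - frechet_derivative \<psi> (at (x - s *\<^sub>R e)) e)"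
          by (intro continuous_on_minus continuous_on_compose2[OF test_function_onD(2)[OF \<psi>]]) (auto intro!: continuous_intros)
        then show "isCont (\<lambda>s. - frechet_derivative \<psi> (at (x - s *\<^sub>R e)) e) s"
          by (simp add: continuous_on_eq_continuous_at)
      qed
      moreover have "(LINT s|lborel. (- F x * frechet_derivative \<psi> (at (x - s *\<^sub>R e)) e) * indicator {0..t} s) =
        F x * (LINT s|lborel. - frechet_derivative \<psi> (at (x - s *\<^sub>R e)) e * indicator {0..t} s)"
        by (subst integral_mult_right_zero[symmetric]) (simp add: mult.assoc)
      ultimately show "(LINT s|lborel. (- F x * frechet_derivative \<psi> (at (x - s *\<^sub>R e)) e) * indicator {0..t} s) = F x * (\<psi> (x - t *\<^sub>R e) - \<psi> x)"
        by simp
    qed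
    also have "\<dots> = (LINT x|lborel. (F (x + t *\<^sub>R e) - F x) * \<psi> x)"
      using bi(1)[OF F, of t] bi(1)[OF F, of 0] bi(1)[OF Ft, of 0] shift[OF F, of t]
      by (simp add: left_diff_distrib right_diff_distrib)
    finally have "(LINT x|lborel. (F (x + t *\<^sub>R e) - F x - path_integral D e t x) * \<psi> x) = 0"
      using bi(1)[OF F, of 0] bi(1)[OF Ft, of 0] bi(1)[OF P, of 0] by (simp add: left_diff_distrib)
    moreover have "\<psi> x = 0" if "x \<notin> U" for x
      using \<psi> that unfolding test_function_on_def by blast
    then have "indicator U x *\<^sub>R ((F (x + t *\<^sub>R e) - F x - path_integral D e t x) * \<psi> x)
      = (F (x + t *\<^sub>R e) - F x - path_integral D e t x) * \<psi> x" for x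
      by (auto simp: indicator_def)
    ultimately show "(LINT x:U|lborel. (F (x + t *\<^sub>R e) - F x - path_integral D e t x) * \<psi> x) = 0"
      unfolding set_lebesgue_integral_def by (simp only:)
  qed
  then show ?thesis by eventually_elim simp
qed

text \<open>The mean value theorem bounds the quotients by the supremum of the derivative, uniformly
  in \<open>k\<close>, so dominated convergence applies.\<close>

lemma test_function_difference_quotient:
  fixes F :: "real ^ 'n::finite \<Rightarrow> real"
  assumes \<eta>: "test_function_on W \<eta>" and F: "integrable lborel F"
    and t: "t \<longlonglongrightarrow> 0" "\<And>k. t k > 0"
  shows "(\<lambda>k. LINT x|lborel. F x * ((\<eta> (x - t k *\<^sub>R e) - \<eta> x) / t k)) \<longlonglongrightarrow>
    - (LINT x|lborel. F x * frechet_derivative \<eta> (at x) e)"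
proof -
  note [measurable] = borel_measurable_test_function[OF \<eta>]
  have [measurable]: "F \<in> borel_measurable borel" using F by auto
  obtain c where c: "\<And>x. \<bar>\<eta> x\<bar> \<le> c" "\<And>x. \<bar>frechet_derivative \<eta> (at x) e\<bar> \<le> c"
    using test_function_on_bound[OF \<eta>, of e] by metis
  have q: "\<bar>(\<eta> (x - t k *\<^sub>R e) - \<eta> x) / t k\<bar> \<le> c" for x k
  proof -
    obtain s where "\<eta> (x - t k *\<^sub>R e) - \<eta> (x - 0 *\<^sub>R e) = (t k - 0) * (- frechet_derivative \<eta> (at (x - s *\<^sub>R e)) e)"
      using MVT2[of 0 "t k" "\<lambda>s. \<eta> (x - s *\<^sub>R e)" "\<lambda>s. - frechet_derivative \<eta> (at (x - s *\<^sub>R e)) e"]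
        t(2) test_function_line_derivative[OF \<eta>] by blast
    then have "(\<eta> (x - t k *\<^sub>R e) - \<eta> x) / t k = - frechet_derivative \<eta> (at (x - s *\<^sub>R e)) e"
      using t(2)[of k] by simp
    then show ?thesis using c(2)[of "x - s *\<^sub>R e"] by simp
  qed
  have "(\<lambda>k. LINT x|lborel. F x * ((\<eta> (x - t k *\<^sub>R e) - \<eta> x) / t k)) \<longlonglongrightarrow>
    (LINT x|lborel. F x * - frechet_derivative \<eta> (at x) e)"
  proof (rule integral_dominated_convergence[where w = "\<lambda>x. c * \<bar>F x\<bar>"])
    show "AE x in lborel. (\<lambda>k. F x * ((\<eta> (x - t k *\<^sub>R e) - \<eta> x) / t k)) \<longlonglongrightarrow> F x * - frechet_derivative \<eta> (at x) e"
    proof (intro AE_I2 tendsto_mult_left)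
      fix x
      have "(\<lambda>h. (\<eta> (x - (0 + h) *\<^sub>R e) - \<eta> (x - 0 *\<^sub>R e)) / h) \<midarrow>0\<rightarrow> - frechet_derivative \<eta> (at (x - 0 *\<^sub>R e)) e"
        using test_function_line_derivative[OF \<eta>, of x e 0] unfolding DERIV_def .
      moreover have "filterlim t (at 0) sequentially"
        using t by (auto simp: filterlim_at less_imp_neq intro!: always_eventually) (metis less_irrefl)
      ultimately show "(\<lambda>k. (\<eta> (x - t k *\<^sub>R e) - \<eta> x) / t k) \<longlonglongrightarrow> - frechet_derivative \<eta> (at x) e"
        using filterlim_compose[of _ _ "at 0" t sequentially] by fastforce
    qed
    show "AE x in lborel. norm (F x * ((\<eta> (x - t k *\<^sub>R e) - \<eta> x) / t k)) \<le> c * \<bar>F x\<bar>" for k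
    proof (intro AE_I2)
      fix x
      have "\<bar>F x\<bar> * \<bar>(\<eta> (x - t k *\<^sub>R e) - \<eta> x) / t k\<bar> \<le> \<bar>F x\<bar> * c" by (intro mult_left_mono q) simp
      then show "norm (F x * ((\<eta> (x - t k *\<^sub>R e) - \<eta> x) / t k)) \<le> c * \<bar>F x\<bar>"
        by (simp add: abs_mult mult.commute)
    qed
  qed (use F in auto)
  then show ?thesis by simp
qed


text \<open>By translation invariance every difference quotient of \<open>\<eta>\<close> has
  integral 0, and the derivative is their limit.\<close>

lemma integral_test_function_derivative:
  fixes \<eta> :: "real ^ 'n::finite \<Rightarrow> real"
  assumes \<eta>: "test_function_on W \<eta>"
  shows "(LINT x|lborel. frechet_derivative \<eta> (at x) e) = 0"
proof -
  note [measurable] = borel_measurable_test_function[OF \<eta>]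
  obtain K where K: "compact K" "\<And>x. x \<notin> K \<Longrightarrow> \<eta> x = 0" "\<And>x. x \<notin> K \<Longrightarrow> frechet_derivative \<eta> (at x) e = 0"
    using test_function_on_support[OF \<eta>, of e] by metis
  \<comment> \<open>Large enough to contain the supports of all translates by
    \<open>t k *\<^sub>R e\<close>, since \<open>t k \<le> 1\<close>. Its indicator serves as the
    integrable \<open>F\<close> in the limit of the difference quotients.\<close>
  define K' where "K' = {x + y | x y. x \<in> K \<and> y \<in> cball 0 (norm e)}"
  have K': "compact K'" unfolding K'_def by (intro compact_sums K compact_cball)
  have sub: "K \<subseteq> K'" unfolding K'_def by force
  have int: "integrable lborel (indicator K' :: _ \<Rightarrow> real)"
    using K' by (intro integrable_real_indicator emeasure_compact_finite) (auto intro: borel_closed compact_imp_closed)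
  obtain c where c: "\<And>x. \<bar>\<eta> x\<bar> \<le> c" using test_function_on_bound[OF \<eta>, of e] by metis
  have i: "integrable lborel \<eta>"
  proof (rule Bochner_Integration.integrable_bound[of _ "\<lambda>x. c * indicator K' x"])
    show "AE x in lborel. norm (\<eta> x) \<le> norm (c * indicator K' x)"
      using K(2) sub c by (intro AE_I2) (auto simp: indicator_def intro: order_trans[OF _ abs_ge_self])
  qed (use int in auto)
  define t where "t k = 1 / real (Suc k)" for k
  have t: "t \<longlonglongrightarrow> 0" "t k > 0" for k
    unfolding t_def using LIMSEQ_inverse_real_of_nat by (auto simp: inverse_eq_divide)
  have "indicator K' x * ((\<eta> (x - t k *\<^sub>R e) - \<eta> x) / t k) = (\<eta> (x - t k *\<^sub>R e) - \<eta> x) / t k" for x k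
  proof (cases "x \<in> K'")
    case False
    have "x - t k *\<^sub>R e \<notin> K"
    proof
      assume "x - t k *\<^sub>R e \<in> K"
      moreover have "norm (t k *\<^sub>R e) \<le> norm e"
        using mult_right_mono[of "t k" 1 "norm e"] by (simp add: t_def)
      ultimately have "x - t k *\<^sub>R e + t k *\<^sub>R e \<in> K'" unfolding K'_def by force
      then show False using False by simp
    qed
    then show ?thesis using False sub K(2) by auto
  qed simp
  moreover have "(LINT x|lborel. (\<eta> (x - t k *\<^sub>R e) - \<eta> x) / t k) = 0" for k
    using integrable_lborel_translate[OF i, of "- t k *\<^sub>R e"] integral_lborel_translate[OF i, of "- t k *\<^sub>R e"] i by simp
  ultimately have "(LINT x|lborel. indicator K' x * ((\<eta> (x - t k *\<^sub>R e) - \<eta> x) / t k)) = 0" for k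
    by (simp only:)
  then have "(\<lambda>k::nat. 0) \<longlonglongrightarrow> - (LINT x|lborel. indicator K' x * frechet_derivative \<eta> (at x) e)"
    using test_function_difference_quotient[OF \<eta> int t, of e] by (simp only:)
  moreover have "indicator K' x * frechet_derivative \<eta> (at x) e = frechet_derivative \<eta> (at x) e" for x
    using K(3)[of x] sub by (auto simp: indicator_def)
  ultimately show ?thesis by (simp add: LIMSEQ_const_iff)
qed

section \<open>Weak gradients of constants, compositions, sums and limits\<close>

lemma test_function_set_integral:
  assumes "test_function_on W \<eta>"
  shows "(LINT x:W|lborel. f x * \<eta> x) = (LINT x|lborel. f x * \<eta> x)"
    "(LINT x:W|lborel. f x * frechet_derivative \<eta> (at x) v) = (LINT x|lborel. f x * frechet_derivative \<eta> (at x) v)"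
proof -
  obtain K where K: "K \<subseteq> W" "\<And>x. x \<notin> K \<Longrightarrow> \<eta> x = 0" "\<And>x. x \<notin> K \<Longrightarrow> frechet_derivative \<eta> (at x) v = 0"
    using test_function_on_support[OF assms, of v] by metis
  then show "(LINT x:W|lborel. f x * \<eta> x) = (LINT x|lborel. f x * \<eta> x)"
    "(LINT x:W|lborel. f x * frechet_derivative \<eta> (at x) v) = (LINT x|lborel. f x * frechet_derivative \<eta> (at x) v)"
    unfolding set_lebesgue_integral_def
    by (intro Bochner_Integration.integral_cong; force simp: indicator_def)+
qed

lemma weak_gradient_on_const:
  fixes W :: "(real ^ 'n::finite) set"
  shows "weak_gradient_on W (\<lambda>x. c) (\<lambda>x. 0)"
  unfolding weak_gradient_on_def
proof (intro conjI allI impI)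
  fix K :: "(real ^ 'n) set" assume "compact K"
  then show "set_integrable lborel K (\<lambda>x. c)"
    unfolding set_integrable_def using borel_integrable_compact[of K "\<lambda>x. c"] by auto
  show "set_integrable lborel K (\<lambda>x. 0 :: real ^ 'n)" by (simp add: set_integrable_def)
next
  fix \<eta> :: "real ^ 'n \<Rightarrow> real" and i assume \<eta>: "test_function_on W \<eta>"
  show "(LINT x:W|lborel. c * frechet_derivative \<eta> (at x) (axis i 1)) = - (LINT x:W|lborel. (0 :: real ^ 'n) $ i * \<eta> x)"
    unfolding test_function_set_integral[OF \<eta>] by (simp add: integral_test_function_derivative[OF \<eta>])
qed

text \<open>The value at \<open>y k = a\<close> is the continuous extension of the quotient, so that
  sequences hitting \<open>a\<close> are covered.\<close>

lemma contraction_difference_quotient_tendsto: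
  fixes \<phi> :: "real \<Rightarrow> real"
  assumes d: "(\<phi> has_real_derivative \<phi>') (at a)" and y: "y \<longlonglongrightarrow> a"
  shows "(\<lambda>k. if y k = a then \<phi>' else (\<phi> (y k) - \<phi> a) / (y k - a)) \<longlonglongrightarrow> \<phi>'"
proof -
  let ?g = "\<lambda>z. if z = a then \<phi>' else (\<phi> z - \<phi> a) / (z - a)"
  have "((\<lambda>z. (\<phi> z - \<phi> a) / (z - a)) \<longlongrightarrow> \<phi>') (at a)"
    using d by (simp add: has_field_derivative_iff)
  then have "(?g \<longlongrightarrow> ?g a) (at a)"
    by (subst tendsto_cong[where g = "\<lambda>z. (\<phi> z - \<phi> a) / (z - a)"]) (auto simp: eventually_at_filter)
  then have "isCont ?g a" by (simp add: isCont_def)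
  from isCont_tendsto_compose[OF this y] show ?thesis by simp
qed

text \<open>The increment of \<open>\<phi> (F x)\<close> is the increment of \<open>F\<close> times
  a quotient \<open>q\<close> bounded by 1. Along suitable steps \<open>q\<close> tends to
  \<open>\<phi>' (F x)\<close> almost everywhere, and the increments of \<open>F\<close> divided by
  the step are averages of \<open>D\<close>, which tend to \<open>D\<close> in L1.\<close>

lemma weak_derivative_compose:
  fixes F D :: "real ^ 'n::finite \<Rightarrow> real"
  assumes F: "integrable lborel F" and D: "integrable lborel D" and r: "0 < r"
    and diff: "\<And>t. \<lbrakk>0 < t; t < r\<rbrakk> \<Longrightarrow> AE x in lborel. x \<in> U \<longrightarrow> F (x + t *\<^sub>R e) - F x = path_integral D e t x"
    and \<phi>: "\<And>a. (\<phi> has_real_derivative \<phi>' a) (at a)" and \<phi>0: "\<phi> 0 = 0"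
    and \<phi>'b: "\<And>a. \<bar>\<phi>' a\<bar> \<le> 1" and [measurable]: "\<phi>' \<in> borel_measurable borel"
    and \<eta>: "test_function_on U \<eta>"
  shows "(LINT x|lborel. \<phi> (F x) * frechet_derivative \<eta> (at x) e) = - (LINT x|lborel. \<phi>' (F x) * D x * \<eta> x)"
proof -
  note [measurable] = borel_measurable_test_function[OF \<eta>]
  have [measurable]: "F \<in> borel_measurable borel" "D \<in> borel_measurable borel" using F D by auto
  have "continuous_on UNIV \<phi>" by (rule DERIV_continuous_on[OF \<phi>]) 
  then have [measurable]: "\<phi> \<in> borel_measurable borel" by (rule borel_measurable_continuous_onI)
  obtain c where c: "\<And>x. \<bar>\<eta> x\<bar> \<le> c"
    using test_function_on_bound[OF \<eta>, of e] by metis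
  have \<eta>U: "\<eta> x = 0" if "x \<notin> U" for x using \<eta> that unfolding test_function_on_def by blast
  have lip: "\<bar>\<phi> b - \<phi> a\<bar> \<le> \<bar>b - a\<bar>" for a b
    using field_differentiable_bound[of UNIV \<phi> \<phi>' 1 b a] \<phi> \<phi>'b by simp
  have \<phi>F: "integrable lborel (\<lambda>x. \<phi> (F x))"
    by (rule Bochner_Integration.integrable_bound[OF F]) (use lip[of _ 0] \<phi>0 in auto)
  \<comment> \<open>L1 continuity of translations gives pointwise convergence only along a
    subsequence. Adding 2 keeps every step below \<open>r\<close>, also for index 0.\<close>
  obtain s :: "nat \<Rightarrow> nat" where s: "strict_mono s"
    and ae: "AE x in lborel. (\<lambda>k. F (x + (r / real (s k + 2)) *\<^sub>R e) - F x) \<longlonglongrightarrow> 0"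
  proof -
    have "(\<lambda>k. (r / real (k + 2)) *\<^sub>R e) \<longlonglongrightarrow> 0 *\<^sub>R e"
      by (intro tendsto_intros) real_asymp
    then have "(\<lambda>k. LINT x|lborel. norm (F (x + (r / real (k + 2)) *\<^sub>R e) - F x)) \<longlonglongrightarrow> 0"
      using translation_continuous_integrable[OF F] unfolding translation_continuous_def by simp
    moreover have "integrable lborel (\<lambda>x. F (x + (r / real (k + 2)) *\<^sub>R e) - F x)" for k
      using integrable_lborel_translate[OF F] F by auto
    ultimately show ?thesis
      using tendsto_L1_AE_subseq[of lborel "\<lambda>k x. F (x + (r / real (k + 2)) *\<^sub>R e) - F x"] that by blast
  qed
  define t where "t k = r / real (s k + 2)" for k
  have t_pos: "0 < t k" and t_r: "t k < r" for k using r by (auto simp: t_def divide_less_eq)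
  have t0: "t \<longlonglongrightarrow> 0"
  proof -
    have "(\<lambda>k. r / real (k + 2)) \<longlonglongrightarrow> 0" by real_asymp
    from LIMSEQ_subseq_LIMSEQ[OF this s] show ?thesis by (simp add: t_def[abs_def] o_def)
  qed
  have Flim: "AE x in lborel. (\<lambda>k. F (x + t k *\<^sub>R e)) \<longlonglongrightarrow> F x"
    using ae by eventually_elim (simp add: t_def LIM_zero_iff)
  define A where "A k x = path_integral D e (t k) x / t k" for k x
  have Ai: "integrable lborel (A k)" for k
    unfolding A_def using integral_path_integral(1)[OF D, of "\<lambda>x. 0" 0 e "t k"] by auto
  have A_lim: "(\<lambda>k. LINT x|lborel. \<bar>A k x - D x\<bar>) \<longlonglongrightarrow> 0"
  proof (rule LIMSEQ_I)
    fix \<epsilon> :: real assume "0 < \<epsilon>"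
    then obtain d where d: "0 < d" "\<And>h. norm h < d \<Longrightarrow> (LINT x|lborel. \<bar>D (x + h) - D x\<bar>) < \<epsilon> / 2"
      using translation_small[OF D, of "\<epsilon> / 2"] by auto
    have "(\<lambda>k. norm (t k *\<^sub>R e)) \<longlonglongrightarrow> norm (0 *\<^sub>R e)" by (intro tendsto_intros t0)
    then have "(\<lambda>k. norm (t k *\<^sub>R e)) \<longlonglongrightarrow> 0" by simp
    then have "\<forall>\<^sub>F k in sequentially. norm (t k *\<^sub>R e) < d" using d(1) by (rule order_tendstoD(2))
    then obtain N where N: "\<And>k. N \<le> k \<Longrightarrow> norm (t k *\<^sub>R e) < d" unfolding eventually_sequentially by blast
    show "\<exists>N. \<forall>k\<ge>N. norm ((LINT x|lborel. \<bar>A k x - D x\<bar>) - 0) < \<epsilon>"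
    proof (intro exI[of _ N] allI impI)
      fix k assume "N \<le> k"
      have "(LINT x|lborel. \<bar>D (x + u *\<^sub>R e) - D x\<bar>) \<le> \<epsilon> / 2" if "0 \<le> u" "u \<le> t k" for u
      proof -
        have "norm (u *\<^sub>R e) \<le> norm (t k *\<^sub>R e)" using that by (auto intro: mult_right_mono)
        then show ?thesis using N[OF \<open>N \<le> k\<close>] d(2)[of "u *\<^sub>R e"] by simp
      qed
      then have "(LINT x|lborel. \<bar>path_integral D e (t k) x - t k * D x\<bar>) \<le> t k * (\<epsilon> / 2)"
        using t_pos[of k] by (intro path_integral_approx D) auto
      moreover have "(LINT x|lborel. \<bar>A k x - D x\<bar>) = (LINT x|lborel. \<bar>path_integral D e (t k) x - t k * D x\<bar>) / t k"
      proof -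
        have "\<bar>A k x - D x\<bar> = \<bar>path_integral D e (t k) x - t k * D x\<bar> / t k" for x
        proof -
          have "A k x - D x = (path_integral D e (t k) x - t k * D x) / t k"
            using t_pos[of k] by (simp add: A_def field_simps)
          then show ?thesis using t_pos[of k] by (simp add: abs_divide)
        qed
        then show ?thesis by simp
      qed
      ultimately have "(LINT x|lborel. \<bar>A k x - D x\<bar>) \<le> t k * (\<epsilon> / 2) / t k"
        using t_pos[of k] by (simp only: divide_right_mono less_imp_le)
      then have "(LINT x|lborel. \<bar>A k x - D x\<bar>) \<le> \<epsilon> / 2"
        using t_pos[of k] by simp
      then show "norm ((LINT x|lborel. \<bar>A k x - D x\<bar>) - 0) < \<epsilon>" using \<open>0 < \<epsilon>\<close> by simp
    qed
  qed
  define q where "q k x = (if F (x + t k *\<^sub>R e) = F x then \<phi>' (F x)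
    else (\<phi> (F (x + t k *\<^sub>R e)) - \<phi> (F x)) / (F (x + t k *\<^sub>R e) - F x))" for k x
  have [measurable]: "q k \<in> borel_measurable borel" for k unfolding q_def by measurable
  have q1: "\<bar>q k x\<bar> \<le> 1" for k x
    using lip[of "F (x + t k *\<^sub>R e)" "F x"] \<phi>'b by (auto simp: q_def abs_divide divide_le_eq)
  have q_lim: "AE x in lborel. (\<lambda>k. q k x) \<longlonglongrightarrow> \<phi>' (F x)"
    using Flim by eventually_elim (simp add: q_def contraction_difference_quotient_tendsto[OF \<phi>])
  have bm: "integrable lborel (\<lambda>x. f x * h x)"
    if f: "integrable lborel f" and [measurable]: "h \<in> borel_measurable borel" and h: "\<And>x. \<bar>h x\<bar> \<le> C" for f h and C :: real
  proof (rule Bochner_Integration.integrable_bound[of _ "\<lambda>x. C * f x"])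
    show "AE x in lborel. norm (f x * h x) \<le> norm (C * f x)"
    proof (intro AE_I2)
      fix x
      have "\<bar>h x\<bar> \<le> \<bar>C\<bar>" using h[of x] by linarith
      then show "norm (f x * h x) \<le> norm (C * f x)"
        using mult_right_mono[of "\<bar>h x\<bar>" "\<bar>C\<bar>" "\<bar>f x\<bar>"] by (simp add: abs_mult mult.commute)
    qed
  qed (use f in auto)
  \<comment> \<open>The shift is moved from \<open>\<eta>\<close> to \<open>F\<close>; on
    \<open>U\<close>, which contains the support of \<open>\<eta>\<close>, the increments of
    \<open>F\<close> are path integrals by \<open>diff\<close>.\<close>
  have key: "(LINT x|lborel. \<phi> (F x) * ((\<eta> (x - t k *\<^sub>R e) - \<eta> x) / t k)) = (LINT x|lborel. q k x * A k x * \<eta> x)" for k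
  proof -
    have i1: "integrable lborel (\<lambda>x. \<phi> (F x) * \<eta> (x - t k *\<^sub>R e))"
      by (rule bm[OF \<phi>F _ c]) measurable
    have i2: "integrable lborel (\<lambda>x. \<phi> (F x) * \<eta> x)" by (rule bm[OF \<phi>F _ c]) measurable
    have i3: "integrable lborel (\<lambda>x. \<phi> (F (x + t k *\<^sub>R e)) * \<eta> x)"
      by (rule bm[OF integrable_lborel_translate[OF \<phi>F] _ c]) measurable
    have "(LINT x|lborel. \<phi> (F x) * ((\<eta> (x - t k *\<^sub>R e) - \<eta> x) / t k)) =
      ((LINT x|lborel. \<phi> (F x) * \<eta> (x - t k *\<^sub>R e)) - (LINT x|lborel. \<phi> (F x) * \<eta> x)) / t k"
      using i1 i2 by (simp add: right_diff_distrib diff_divide_distrib)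
    also have "(LINT x|lborel. \<phi> (F x) * \<eta> (x - t k *\<^sub>R e)) = (LINT x|lborel. \<phi> (F (x + t k *\<^sub>R e)) * \<eta> x)"
      using integral_lborel_translate[OF i1, of "t k *\<^sub>R e"] by simp
    also have "((LINT x|lborel. \<phi> (F (x + t k *\<^sub>R e)) * \<eta> x) - (LINT x|lborel. \<phi> (F x) * \<eta> x)) / t k
      = (LINT x|lborel. (\<phi> (F (x + t k *\<^sub>R e)) - \<phi> (F x)) / t k * \<eta> x)"
      using i2 i3 by (simp add: left_diff_distrib diff_divide_distrib)
    also have "\<dots> = (LINT x|lborel. q k x * A k x * \<eta> x)"
    proof (rule integral_cong_AE)
      show "AE x in lborel. (\<phi> (F (x + t k *\<^sub>R e)) - \<phi> (F x)) / t k * \<eta> x = q k x * A k x * \<eta> x"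
        using diff[OF t_pos t_r, of k]
      proof eventually_elim
        case (elim x)
        show ?case
        proof (cases "x \<in> U")
          case True
          then have "A k x = (F (x + t k *\<^sub>R e) - F x) / t k" using elim by (simp add: A_def)
          then show ?thesis by (simp add: q_def)
        qed (simp add: \<eta>U)
      qed
      have "A k \<in> borel_measurable borel" using Ai[of k] by auto
      then show "(\<lambda>x. q k x * A k x * \<eta> x) \<in> borel_measurable lborel" by measurable
    qed measurable
    finally show ?thesis .
  qed
  have lim1: "(\<lambda>k. LINT x|lborel. q k x * A k x * \<eta> x) \<longlonglongrightarrow> - (LINT x|lborel. \<phi> (F x) * frechet_derivative \<eta> (at x) e)"
    using test_function_difference_quotient[OF \<eta> \<phi>F t0 t_pos, of e] unfolding key .
  have Am[measurable]: "A k \<in> borel_measurable borel" for k using Ai[of k] by auto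
  \<comment> \<open>The product of \<open>q\<close> and \<open>A\<close> is split through
    \<open>D\<close>: the part with \<open>A - D\<close> vanishes by L1 convergence with bounded
    factors, the part with \<open>D\<close> converges by domination.\<close>
  have lim2: "(\<lambda>k. LINT x|lborel. q k x * (A k x - D x) * \<eta> x) \<longlonglongrightarrow> 0"
  proof (rule Lim_null_comparison)
    show "(\<lambda>k. c * (LINT x|lborel. \<bar>A k x - D x\<bar>)) \<longlonglongrightarrow> 0" using tendsto_mult_left[OF A_lim, of c] by simp
    show "\<forall>\<^sub>F k in sequentially. norm (LINT x|lborel. q k x * (A k x - D x) * \<eta> x) \<le> c * (LINT x|lborel. \<bar>A k x - D x\<bar>)"
    proof (intro always_eventually allI)
      fix k
      have AD: "integrable lborel (\<lambda>x. A k x - D x)" using Ai D by auto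
      have "norm (LINT x|lborel. q k x * (A k x - D x) * \<eta> x) \<le> (LINT x|lborel. c * \<bar>A k x - D x\<bar>)"
      proof (rule Bochner_Integration.integral_norm_bound_integral)
        have "integrable lborel (\<lambda>x. (A k x - D x) * (q k x * \<eta> x))"
        proof (rule bm[OF AD])
          fix x
          show "\<bar>q k x * \<eta> x\<bar> \<le> 1 * c" unfolding abs_mult by (intro mult_mono q1 c) auto
        qed measurable
        then show "integrable lborel (\<lambda>x. q k x * (A k x - D x) * \<eta> x)" by (simp add: mult_ac)
        fix x
        have "\<bar>q k x\<bar> * \<bar>\<eta> x\<bar> \<le> 1 * c" by (intro mult_mono q1 c) auto
        from mult_right_mono[OF this abs_ge_zero[of "A k x - D x"]]
        show "norm (q k x * (A k x - D x) * \<eta> x) \<le> c * \<bar>A k x - D x\<bar>" by (simp add: abs_mult mult_ac)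
      qed (use AD in auto)
      then show "norm (LINT x|lborel. q k x * (A k x - D x) * \<eta> x) \<le> c * (LINT x|lborel. \<bar>A k x - D x\<bar>)" by simp
    qed
  qed
  have lim3: "(\<lambda>k. LINT x|lborel. q k x * D x * \<eta> x) \<longlonglongrightarrow> (LINT x|lborel. \<phi>' (F x) * D x * \<eta> x)"
  proof (rule integral_dominated_convergence[where w = "\<lambda>x. c * \<bar>D x\<bar>"])
    show "AE x in lborel. (\<lambda>k. q k x * D x * \<eta> x) \<longlonglongrightarrow> \<phi>' (F x) * D x * \<eta> x"
      using q_lim by eventually_elim (intro tendsto_intros)
    show "AE x in lborel. norm (q k x * D x * \<eta> x) \<le> c * \<bar>D x\<bar>" for k
    proof (intro AE_I2)
      fix x
      have "\<bar>q k x\<bar> * \<bar>\<eta> x\<bar> \<le> 1 * c" by (intro mult_mono q1 c) auto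
      from mult_right_mono[OF this abs_ge_zero[of "D x"]]
      show "norm (q k x * D x * \<eta> x) \<le> c * \<bar>D x\<bar>" by (simp add: abs_mult mult_ac)
    qed
  qed (use D in auto)
  have "(LINT x|lborel. q k x * (A k x - D x) * \<eta> x) + (LINT x|lborel. q k x * D x * \<eta> x) = (LINT x|lborel. q k x * A k x * \<eta> x)" for k
  proof -
    have q\<eta>: "\<bar>q k x * \<eta> x\<bar> \<le> 1 * c" for x unfolding abs_mult by (intro mult_mono q1 c) auto
    have "integrable lborel (\<lambda>x. A k x * (q k x * \<eta> x))" by (rule bm[OF Ai _ q\<eta>]) measurable
    moreover have "integrable lborel (\<lambda>x. D x * (q k x * \<eta> x))" by (rule bm[OF D _ q\<eta>]) measurable
    ultimately show ?thesis by (simp add: algebra_simps)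
  qed
  then have "(\<lambda>k. LINT x|lborel. q k x * A k x * \<eta> x) \<longlonglongrightarrow> 0 + (LINT x|lborel. \<phi>' (F x) * D x * \<eta> x)"
    using tendsto_add[OF lim2 lim3] by simp
  from LIMSEQ_unique[OF lim1 this] show ?thesis by simp
qed


lemma test_function_on_translate':
  assumes \<psi>: "test_function_on U \<psi>" and sub: "\<And>x. x \<in> U \<Longrightarrow> x + h \<in> W"
  shows "test_function_on W (\<lambda>x. \<psi> (x - h))"
proof -
  obtain K where K: "compact K" "K \<subseteq> U" "\<And>x. x \<notin> K \<Longrightarrow> \<psi> x = 0" using \<psi> by (auto simp: test_function_on_def)
  have "compact ((\<lambda>x. x + h) ` K)" by (intro compact_continuous_image continuous_intros K)
  moreover have "(\<lambda>x. x + h) ` K \<subseteq> W" using K(2) sub by auto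
  moreover have "\<psi> (x - h) = 0" if "x \<notin> (\<lambda>x. x + h) ` K" for x
    using K(3)[of "x - h"] that by (metis diff_add_cancel image_eqI)
  ultimately show ?thesis
    using test_function_on_translate(1)[OF \<psi>] unfolding test_function_on_def by blast
qed

text \<open>Localization: \<open>f\<close> and \<open>G\<close> are cut off by the indicator of a
  compact neighbourhood \<open>K'\<close> of the support of \<open>\<eta>\<close>. This spoils the
  weak derivative only across the boundary of \<open>K'\<close>, which test functions supported in
  the smaller set \<open>U\<close> and shifted by at most \<open>r / 2\<close> do not see.\<close>

lemma weak_gradient_on_compose:
  fixes W :: "(real ^ 'n::finite) set"
  assumes W: "open W" and wg: "weak_gradient_on W f G"
    and \<phi>: "\<And>a. (\<phi> has_real_derivative \<phi>' a) (at a)" and \<phi>0: "\<phi> 0 = 0"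
    and \<phi>'b: "\<And>a. \<bar>\<phi>' a\<bar> \<le> 1" and [measurable]: "\<phi>' \<in> borel_measurable borel"
  shows "weak_gradient_on W (\<lambda>x. \<phi> (f x)) (\<lambda>x. \<phi>' (f x) *\<^sub>R G x)"
  unfolding weak_gradient_on_def
proof (intro conjI allI impI)
  have "continuous_on UNIV \<phi>" by (rule DERIV_continuous_on[OF \<phi>]) 
  then have [measurable]: "\<phi> \<in> borel_measurable borel" by (rule borel_measurable_continuous_onI)
  have lip: "\<bar>\<phi> a\<bar> \<le> \<bar>a\<bar>" for a
    using field_differentiable_bound[of UNIV \<phi> \<phi>' 1 0 a] \<phi> \<phi>'b \<phi>0 by simp
  { fix K :: "(real ^ 'n) set" assume K: "compact K" "K \<subseteq> W"
    have f: "integrable lborel (\<lambda>x. indicator K x * f x)" and G: "integrable lborel (\<lambda>x. indicator K x *\<^sub>R G x)"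
      using wg K by (auto simp: weak_gradient_on_def set_integrable_def)
    have [measurable]: "(\<lambda>x. indicator K x * f x) \<in> borel_measurable borel" using f by auto
    have Gm: "(\<lambda>x. indicator K x *\<^sub>R G x) \<in> borel_measurable lborel" using G by auto
    have "integrable lborel (\<lambda>x. \<phi> (indicator K x * f x))"
      by (rule Bochner_Integration.integrable_bound[OF f]) (use lip in auto)
    \<comment> \<open>\<open>\<phi> 0 = 0\<close> lets \<open>\<phi>\<close> commute with the
      cut-off. For \<open>\<phi>'\<close> the cut-off of the factor \<open>G\<close> has the same
      effect.\<close>
    moreover have "\<phi> (indicator K x * f x) = indicator K x *\<^sub>R \<phi> (f x)" for x
      using \<phi>0 by (auto simp: indicator_def)
    ultimately show "set_integrable lborel K (\<lambda>x. \<phi> (f x))" by (simp add: set_integrable_def)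
    have "integrable lborel (\<lambda>x. \<phi>' (indicator K x * f x) *\<^sub>R (indicator K x *\<^sub>R G x))"
    proof (rule Bochner_Integration.integrable_bound[OF G])
      show "AE x in lborel. norm (\<phi>' (indicator K x * f x) *\<^sub>R (indicator K x *\<^sub>R G x)) \<le> norm (indicator K x *\<^sub>R G x)"
      proof (intro AE_I2)
        fix x
        show "norm (\<phi>' (indicator K x * f x) *\<^sub>R (indicator K x *\<^sub>R G x)) \<le> norm (indicator K x *\<^sub>R G x)"
          unfolding norm_scaleR[of "\<phi>' (indicator K x * f x)"]
          using mult_right_mono[OF \<phi>'b norm_ge_zero, of "indicator K x * f x" "indicator K x *\<^sub>R G x"] by simp
      qed
      show "(\<lambda>x. \<phi>' (indicator K x * f x) *\<^sub>R (indicator K x *\<^sub>R G x)) \<in> borel_measurable lborel"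
        by (rule borel_measurable_scaleR[OF _ Gm]) measurable
    qed
    moreover have "\<phi>' (indicator K x * f x) *\<^sub>R (indicator K x *\<^sub>R G x) = indicator K x *\<^sub>R (\<phi>' (f x) *\<^sub>R G x)" for x
      by (auto simp: indicator_def)
    ultimately show "set_integrable lborel K (\<lambda>x. \<phi>' (f x) *\<^sub>R G x)" by (simp only: set_integrable_def) }
  fix \<eta> :: "real ^ 'n \<Rightarrow> real" and i assume \<eta>: "test_function_on W \<eta>"
  obtain K where K: "compact K" "K \<subseteq> W" "\<And>x. x \<notin> K \<Longrightarrow> \<eta> x = 0"
    using \<eta> by (auto simp: test_function_on_def)
  obtain r where r: "0 < r" "\<And>x y. x \<in> K \<Longrightarrow> norm y \<le> r \<Longrightarrow> x + y \<in> W"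
  proof (cases "K = {} \<or> W = UNIV")
    case True
    then show ?thesis using that[of 1] by auto
  next
    case False
    then have "0 < setdist K (- W)"
      using K W setdist_gt_0_compact_closed[of K "- W"] by auto
    moreover have "x + y \<in> W" if "x \<in> K" "norm y \<le> setdist K (- W) / 2" for x y
    proof (rule ccontr)
      assume "x + y \<notin> W"
      then have "setdist K (- W) \<le> dist x (x + y)" using that by (intro setdist_le_dist) auto
      then show False using that \<open>0 < setdist K (- W)\<close> by (simp add: dist_norm)
    qed
    ultimately show ?thesis using that[of "setdist K (- W) / 2"] by auto
  qed
  define K' where "K' = {x + y | x y. x \<in> K \<and> y \<in> cball 0 r}"
  define U where "U = (\<Union>x\<in>K. ball x (r / 2))"
  have K': "compact K'" unfolding K'_def by (intro compact_sums K compact_cball)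
  have K'W: "K' \<subseteq> W" using r unfolding K'_def by auto
  have U: "open U" unfolding U_def by auto
  have KU: "K \<subseteq> U" unfolding U_def using r(1) by force
  have U_shift: "x + h \<in> K'" if x: "x \<in> U" and h: "norm h \<le> r / 2" for x h
  proof -
    obtain z where z: "z \<in> K" "dist z x < r / 2" using x unfolding U_def UN_iff mem_ball by blast
    have "norm ((x - z) + h) \<le> r"
      using z(2) h norm_triangle_ineq[of "x - z" h] by (simp add: dist_norm norm_minus_commute)
    then have "z + ((x - z) + h) \<in> K'" unfolding K'_def using z(1) by (intro CollectI exI conjI refl) auto
    then show ?thesis by (simp add: algebra_simps)
  qed
  let ?e = "axis i 1 :: real ^ 'n"
  define F where "F x = indicator K' x * f x" for x
  define D where "D x = indicator K' x * G x $ i" for x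
  have F: "integrable lborel F"
    using wg K' K'W by (simp add: F_def[abs_def] weak_gradient_on_def set_integrable_def)
  have "set_integrable lborel K' (\<lambda>x. G x $ i)"
    using wg K' K'W by (auto simp: weak_gradient_on_def intro: set_integrable_vec_nth)
  then have D: "integrable lborel D" by (simp add: D_def[abs_def] set_integrable_def)
  have KK': "K \<subseteq> K'" using U_shift[of _ 0] KU r(1) by auto
  have parts: "(LINT x|lborel. F x * frechet_derivative \<psi> (at (x - s *\<^sub>R ?e)) ?e) = - (LINT x|lborel. D x * \<psi> (x - s *\<^sub>R ?e))"
    if \<psi>: "test_function_on U \<psi>" and s: "0 \<le> s" "s \<le> r / 2" for \<psi> s
  proof -
    have h: "norm (s *\<^sub>R ?e) \<le> r / 2" using s by (simp add: norm_axis_1)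
    have t: "test_function_on W (\<lambda>x. \<psi> (x - s *\<^sub>R ?e))"
      using test_function_on_translate'[OF \<psi>] U_shift[OF _ h] K'W by blast
    obtain K0 where K0: "K0 \<subseteq> U" "\<And>x. x \<notin> K0 \<Longrightarrow> \<psi> x = 0" "\<And>x. x \<notin> K0 \<Longrightarrow> frechet_derivative \<psi> (at x) ?e = 0"
      using test_function_on_support[OF \<psi>, of ?e] by metis
    have supp: "\<psi> (x - s *\<^sub>R ?e) = 0" "frechet_derivative \<psi> (at (x - s *\<^sub>R ?e)) ?e = 0" if "x \<notin> K'" for x
    proof -
      have "x - s *\<^sub>R ?e \<notin> U" using U_shift[OF _ h, of "x - s *\<^sub>R ?e"] that by auto
      then have "x - s *\<^sub>R ?e \<notin> K0" using K0(1) by (rule contra_subsetD[rotated])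
      then show "\<psi> (x - s *\<^sub>R ?e) = 0" "frechet_derivative \<psi> (at (x - s *\<^sub>R ?e)) ?e = 0"
        using K0(2,3) by simp_all
    qed
    have "(LINT x|lborel. F x * frechet_derivative \<psi> (at (x - s *\<^sub>R ?e)) ?e) = (LINT x|lborel. f x * frechet_derivative \<psi> (at (x - s *\<^sub>R ?e)) ?e)"
      using supp(2) by (intro Bochner_Integration.integral_cong) (auto simp: F_def indicator_def)
    also have "\<dots> = - (LINT x|lborel. G x $ i * \<psi> (x - s *\<^sub>R ?e))"
    proof -
      have "(LINT x:W|lborel. f x * frechet_derivative (\<lambda>x. \<psi> (x - s *\<^sub>R ?e)) (at x) ?e) = - (LINT x:W|lborel. G x $ i * \<psi> (x - s *\<^sub>R ?e))"
        using wg t unfolding weak_gradient_on_def by blast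
      then show ?thesis
        unfolding test_function_set_integral[OF t] unfolding test_function_on_translate(2)[OF \<psi>] .
    qed
    also have "(LINT x|lborel. G x $ i * \<psi> (x - s *\<^sub>R ?e)) = (LINT x|lborel. D x * \<psi> (x - s *\<^sub>R ?e))"
      using supp(1) by (intro Bochner_Integration.integral_cong) (auto simp: D_def indicator_def)
    finally show ?thesis .
  qed
  have \<eta>U: "test_function_on U \<eta>" using \<eta> K KU unfolding test_function_on_def by blast
  have "(LINT x|lborel. \<phi> (F x) * frechet_derivative \<eta> (at x) ?e) = - (LINT x|lborel. \<phi>' (F x) * D x * \<eta> x)"
  proof (rule weak_derivative_compose[OF F D _ _ \<phi> \<phi>0 \<phi>'b _ \<eta>U])
    show "0 < r / 2" using r by simp
    fix t :: real assume "0 < t" "t < r / 2"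
    then show "AE x in lborel. x \<in> U \<longrightarrow> F (x + t *\<^sub>R ?e) - F x = path_integral D ?e t x"
      by (intro difference_eq_path_integral[OF U F D] parts) auto
  qed simp
  moreover have "frechet_derivative \<eta> (at x) ?e = 0" if "x \<notin> K'" for x
  proof -
    have "((\<lambda>x. 0) has_derivative (\<lambda>v. 0)) (at x)" by simp
    then have "(\<eta> has_derivative (\<lambda>v. 0)) (at x)"
      by (rule has_derivative_transform_within_open[of _ _ _ _ "- K"])
        (use K that KK' in \<open>auto intro: compact_imp_closed\<close>)
    from frechet_derivative_at[OF this] show ?thesis by metis
  qed
  then have "\<phi> (F x) * frechet_derivative \<eta> (at x) ?e = \<phi> (f x) * frechet_derivative \<eta> (at x) ?e" for x
    by (cases "x \<in> K'") (auto simp: F_def)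
  moreover have "\<phi>' (F x) * D x * \<eta> x = (\<phi>' (f x) *\<^sub>R G x) $ i * \<eta> x" for x
    using K(3)[of x] KK' by (cases "x \<in> K'") (auto simp: F_def D_def)
  ultimately show "(LINT x:W|lborel. \<phi> (f x) * frechet_derivative \<eta> (at x) ?e) = - (LINT x:W|lborel. (\<phi>' (f x) *\<^sub>R G x) $ i * \<eta> x)"
    unfolding test_function_set_integral[OF \<eta>] by simp
qed

lemma weak_gradient_on_add:
  fixes W :: "(real ^ 'n::finite) set"
  assumes "weak_gradient_on W f G" "weak_gradient_on W f' G'"
  shows "weak_gradient_on W (\<lambda>x. f x + f' x) (\<lambda>x. G x + G' x)"
  unfolding weak_gradient_on_def
proof (intro conjI allI impI)
  have f: "set_integrable lborel K f" "set_integrable lborel K G" and f': "set_integrable lborel K f'" "set_integrable lborel K G'"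
    if "compact K" "K \<subseteq> W" for K
    using assms that by (auto simp: weak_gradient_on_def)
  show "set_integrable lborel K (\<lambda>x. f x + f' x)" "set_integrable lborel K (\<lambda>x. G x + G' x)" if "compact K" "K \<subseteq> W" for K
    using f[OF that] f'[OF that] by (auto intro: set_integral_add(1))
  fix \<eta> :: "real ^ 'n \<Rightarrow> real" and i assume \<eta>: "test_function_on W \<eta>"
  have "(LINT x:W|lborel. (f x + f' x) * frechet_derivative \<eta> (at x) (axis i 1)) =
    (LINT x:W|lborel. f x * frechet_derivative \<eta> (at x) (axis i 1)) + (LINT x:W|lborel. f' x * frechet_derivative \<eta> (at x) (axis i 1))"
    unfolding distrib_right by (intro set_integral_add(2) set_integrable_mult_test_function(2)[OF _ \<eta>] f f')
  also have "\<dots> = - (LINT x:W|lborel. G x $ i * \<eta> x) - (LINT x:W|lborel. G' x $ i * \<eta> x)"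
    using assms \<eta> unfolding weak_gradient_on_def by simp
  also have "\<dots> = - (LINT x:W|lborel. (G x + G' x) $ i * \<eta> x)"
  proof -
    have "(LINT x:W|lborel. G x $ i * \<eta> x + G' x $ i * \<eta> x) = (LINT x:W|lborel. G x $ i * \<eta> x) + (LINT x:W|lborel. G' x $ i * \<eta> x)"
      by (intro set_integral_add(2) set_integrable_mult_test_function(1)[OF _ \<eta>] set_integrable_vec_nth f f')
    then show ?thesis by (simp add: distrib_right)
  qed
  finally show "(LINT x:W|lborel. (f x + f' x) * frechet_derivative \<eta> (at x) (axis i 1)) = - (LINT x:W|lborel. (G x + G' x) $ i * \<eta> x)" .
qed

lemma weak_gradient_on_scale:
  fixes W :: "(real ^ 'n::finite) set"
  assumes "weak_gradient_on W f G"
  shows "weak_gradient_on W (\<lambda>x. c * f x) (\<lambda>x. c *\<^sub>R G x)"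
  using assms unfolding weak_gradient_on_def
  by (auto simp: mult.assoc intro: set_integrable_mult_right set_integrable_scaleR_right)

text \<open>Test functions and their derivatives are bounded with compact support, so local L1
  convergence passes through both sides of the defining identity.\<close>

lemma weak_gradient_on_limit:
  fixes W :: "(real ^ 'n::finite) set"
  assumes wg: "\<And>k :: nat. weak_gradient_on W (f k) (G k)"
    and f: "\<And>K. compact K \<Longrightarrow> K \<subseteq> W \<Longrightarrow> set_integrable lborel K f'"
    and G: "\<And>K. compact K \<Longrightarrow> K \<subseteq> W \<Longrightarrow> set_integrable lborel K G'"
    and limf: "\<And>K. compact K \<Longrightarrow> K \<subseteq> W \<Longrightarrow> (\<lambda>k. LINT x:K|lborel. \<bar>f k x - f' x\<bar>) \<longlonglongrightarrow> 0"
    and limG: "\<And>K. compact K \<Longrightarrow> K \<subseteq> W \<Longrightarrow> (\<lambda>k. LINT x:K|lborel. norm (G k x - G' x)) \<longlonglongrightarrow> 0"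
  shows "weak_gradient_on W f' G'"
  unfolding weak_gradient_on_def
proof (intro conjI allI impI f G)
  fix \<eta> :: "real ^ 'n \<Rightarrow> real" and i assume \<eta>: "test_function_on W \<eta>"
  let ?e = "axis i 1 :: real ^ 'n"
  note [measurable] = borel_measurable_test_function[OF \<eta>]
  obtain K where K: "compact K" "K \<subseteq> W" "\<And>x. x \<notin> K \<Longrightarrow> \<eta> x = 0"
    "\<And>x. x \<notin> K \<Longrightarrow> frechet_derivative \<eta> (at x) ?e = 0"
    using test_function_on_support[OF \<eta>, of ?e] by metis
  obtain c where c: "\<And>x. \<bar>\<eta> x\<bar> \<le> c" "\<And>x. \<bar>frechet_derivative \<eta> (at x) ?e\<bar> \<le> c"
    using test_function_on_bound[OF \<eta>, of ?e] by metis
  have conv: "(\<lambda>k. LINT x|lborel. h k x * \<theta> x) \<longlonglongrightarrow> (LINT x|lborel. h' x * \<theta> x)"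
    if h: "\<And>k. set_integrable lborel K (h k)" "set_integrable lborel K h'"
      and lim: "(\<lambda>k. LINT x:K|lborel. \<bar>h k x - h' x\<bar>) \<longlonglongrightarrow> 0"
      and \<theta>: "\<And>x. \<bar>\<theta> x\<bar> \<le> c" "\<And>x. x \<notin> K \<Longrightarrow> \<theta> x = 0" and [measurable]: "\<theta> \<in> borel_measurable borel"
    for h :: "nat \<Rightarrow> real ^ 'n \<Rightarrow> real" and h' \<theta>
  proof -
    have int: "integrable lborel (\<lambda>x. u x * \<theta> x)" if u: "set_integrable lborel K u" for u
    proof -
      have "integrable lborel (\<lambda>x. (indicator K x * u x) * \<theta> x)"
      proof (rule Bochner_Integration.integrable_bound[of _ "\<lambda>x. c * (indicator K x * u x)"])
        show "AE x in lborel. norm ((indicator K x * u x) * \<theta> x) \<le> norm (c * (indicator K x * u x))"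
        proof (intro AE_I2)
          fix x
          have "\<bar>\<theta> x\<bar> \<le> \<bar>c\<bar>" using \<theta>(1)[of x] by linarith
          from mult_right_mono[OF this abs_ge_zero[of "indicator K x * u x"]]
          show "norm ((indicator K x * u x) * \<theta> x) \<le> norm (c * (indicator K x * u x))"
            unfolding real_norm_def abs_mult by (simp add: mult.commute mult.left_commute)
        qed
      qed (use u in \<open>auto simp: set_integrable_def\<close>)
      moreover have "(indicator K x * u x) * \<theta> x = u x * \<theta> x" for x using \<theta>(2)[of x] by (auto simp: indicator_def)
      ultimately show ?thesis by simp
    qed
    have "(\<lambda>k. (LINT x|lborel. h k x * \<theta> x) - (LINT x|lborel. h' x * \<theta> x)) \<longlonglongrightarrow> 0"
    proof (rule Lim_null_comparison)
      show "(\<lambda>k. c * (LINT x:K|lborel. \<bar>h k x - h' x\<bar>)) \<longlonglongrightarrow> 0" using tendsto_mult_left[OF lim, of c] by simp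
      show "\<forall>\<^sub>F k in sequentially. norm ((LINT x|lborel. h k x * \<theta> x) - (LINT x|lborel. h' x * \<theta> x)) \<le> c * (LINT x:K|lborel. \<bar>h k x - h' x\<bar>)"
      proof (intro always_eventually allI)
        fix k
        have d: "set_integrable lborel K (\<lambda>x. h k x - h' x)" using h by (intro set_integral_diff(1)) auto
        have "(LINT x|lborel. h k x * \<theta> x) - (LINT x|lborel. h' x * \<theta> x) = (LINT x|lborel. (h k x - h' x) * \<theta> x)"
          using int[OF h(1), of k] int[OF h(2)] by (simp add: left_diff_distrib)
        also have "norm \<dots> \<le> (LINT x|lborel. c * (indicator K x * \<bar>h k x - h' x\<bar>))"
        proof (rule Bochner_Integration.integral_norm_bound_integral)
          show "integrable lborel (\<lambda>x. (h k x - h' x) * \<theta> x)" by (rule int[OF d])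
          show "integrable lborel (\<lambda>x. c * (indicator K x * \<bar>h k x - h' x\<bar>))"
            using integrable_abs[OF d[unfolded set_integrable_def]] by (simp add: abs_mult)
          fix x
          show "norm ((h k x - h' x) * \<theta> x) \<le> c * (indicator K x * \<bar>h k x - h' x\<bar>)"
            using \<theta>(2)[of x] mult_right_mono[OF \<theta>(1)[of x] abs_ge_zero[of "h k x - h' x"]]
            by (cases "x \<in> K") (auto simp: abs_mult mult.commute)
        qed
        also have "\<dots> = c * (LINT x:K|lborel. \<bar>h k x - h' x\<bar>)" by (simp add: set_lebesgue_integral_def)
        finally show "norm ((LINT x|lborel. h k x * \<theta> x) - (LINT x|lborel. h' x * \<theta> x)) \<le> c * (LINT x:K|lborel. \<bar>h k x - h' x\<bar>)" .
      qed
    qed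
    then show ?thesis by (simp add: LIM_zero_iff)
  qed
  have fk: "set_integrable lborel K (f k)" "set_integrable lborel K (G k)" for k
    using wg[of k] K by (auto simp: weak_gradient_on_def)
  have 1: "(\<lambda>k. LINT x|lborel. f k x * frechet_derivative \<eta> (at x) ?e) \<longlonglongrightarrow> (LINT x|lborel. f' x * frechet_derivative \<eta> (at x) ?e)"
    using K c by (intro conv fk f limf) auto
  have limGi: "(\<lambda>k. LINT x:K|lborel. \<bar>G k x $ i - G' x $ i\<bar>) \<longlonglongrightarrow> 0"
  proof (rule tendsto_sandwich[OF _ _ tendsto_const limG[OF K(1,2)]])
    show "\<forall>\<^sub>F k in sequentially. 0 \<le> (LINT x:K|lborel. \<bar>G k x $ i - G' x $ i\<bar>)"
      by (intro always_eventually allI) (auto simp: set_lebesgue_integral_def)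
    show "\<forall>\<^sub>F k in sequentially. (LINT x:K|lborel. \<bar>G k x $ i - G' x $ i\<bar>) \<le> (LINT x:K|lborel. norm (G k x - G' x))"
    proof (intro always_eventually allI set_integral_mono)
      fix k
      have d: "set_integrable lborel K (\<lambda>x. G k x - G' x)" using fk(2) G[OF K(1,2)] by (intro set_integral_diff(1)) auto
      show "set_integrable lborel K (\<lambda>x. norm (G k x - G' x))" using d by (rule set_integrable_norm)
      show "set_integrable lborel K (\<lambda>x. \<bar>G k x $ i - G' x $ i\<bar>)"
        using set_integrable_norm[OF set_integrable_vec_nth[OF d, of i]] by simp
      show "\<bar>G k x $ i - G' x $ i\<bar> \<le> norm (G k x - G' x)" for x
        using component_le_norm_cart[of "G k x - G' x" i] by simp
    qed
  qed
  have 2: "(\<lambda>k. LINT x|lborel. G k x $ i * \<eta> x) \<longlonglongrightarrow> (LINT x|lborel. G' x $ i * \<eta> x)"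
  proof (rule conv[of "\<lambda>k x. G k x $ i" "\<lambda>x. G' x $ i" \<eta>])
    show "set_integrable lborel K (\<lambda>x. G k x $ i)" for k by (rule set_integrable_vec_nth[OF fk(2)])
    show "set_integrable lborel K (\<lambda>x. G' x $ i)" by (rule set_integrable_vec_nth[OF G[OF K(1,2)]])
    show "(\<lambda>k. LINT x:K|lborel. \<bar>G k x $ i - G' x $ i\<bar>) \<longlonglongrightarrow> 0" by (rule limGi)
    show "\<bar>\<eta> x\<bar> \<le> c" for x by (rule c(1))
    show "\<eta> x = 0" if "x \<notin> K" for x by (rule K(3)[OF that])
  qed measurable
  have "(LINT x:W|lborel. f k x * frechet_derivative \<eta> (at x) ?e) = - (LINT x:W|lborel. G k x $ i * \<eta> x)" for k
    using wg[of k] \<eta> unfolding weak_gradient_on_def by blast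
  then have "(LINT x|lborel. f k x * frechet_derivative \<eta> (at x) ?e) = - (LINT x|lborel. G k x $ i * \<eta> x)" for k
    unfolding test_function_set_integral[OF \<eta>] .
  with 1 have "(\<lambda>k. - (LINT x|lborel. G k x $ i * \<eta> x)) \<longlonglongrightarrow> (LINT x|lborel. f' x * frechet_derivative \<eta> (at x) ?e)" by simp
  from LIMSEQ_unique[OF this tendsto_minus[OF 2]]
  show "(LINT x:W|lborel. f' x * frechet_derivative \<eta> (at x) ?e) = - (LINT x:W|lborel. G' x $ i * \<eta> x)"
    unfolding test_function_set_integral[OF \<eta>] .
qed

section \<open>Change of variables without an order on the index type\<close>

text \<open>The library proves the transformation formula for index types of class \<open>wellorder\<close>; every
  finite type has a copy in this class.\<close>

datatype 'n ordered_copy = Copy (original: 'n)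

instantiation ordered_copy :: (finite) linorder
begin

text \<open>The order is pulled back from an arbitrary injection into the natural numbers, chosen
  once for the type.\<close>

definition rank_copy :: "'a ordered_copy \<Rightarrow> nat" where
  "rank_copy x = (SOME f :: 'a \<Rightarrow> nat. inj f) (original x)"

definition less_eq_ordered_copy :: "'a ordered_copy \<Rightarrow> 'a ordered_copy \<Rightarrow> bool" where
  "less_eq_ordered_copy x y \<longleftrightarrow> rank_copy x \<le> rank_copy y"

definition less_ordered_copy :: "'a ordered_copy \<Rightarrow> 'a ordered_copy \<Rightarrow> bool" where
  "less_ordered_copy x y \<longleftrightarrow> rank_copy x < rank_copy y"

lemma inj_rank_copy: "inj (rank_copy :: 'a ordered_copy \<Rightarrow> nat)"
proof -
  have "\<exists>f :: 'a \<Rightarrow> nat. inj f"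
    using finite_imp_inj_to_nat_seg[of "UNIV :: 'a set"] by auto
  then have "inj (SOME f :: 'a \<Rightarrow> nat. inj f)" by (rule someI_ex)
  then show ?thesis
    by (intro injI) (auto simp: rank_copy_def intro!: ordered_copy.expand dest: injD)
qed

instance
  by standard (auto simp: less_eq_ordered_copy_def less_ordered_copy_def dest: injD[OF inj_rank_copy])

end

instance ordered_copy :: (finite) finite
proof
  have "(UNIV :: 'a ordered_copy set) = Copy ` UNIV" by (metis ordered_copy.exhaust surj_def)
  then show "finite (UNIV :: 'a ordered_copy set)" by (metis finite finite_imageI)
qed

instance ordered_copy :: (finite) wellorder
proof
  fix P :: "'a ordered_copy \<Rightarrow> bool" and a
  assume *: "\<And>x. (\<And>y. y < x \<Longrightarrow> P y) \<Longrightarrow> P x"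
  show "P a"
    by (induction a rule: measure_induct_rule[of rank_copy]) (auto intro: * simp: less_ordered_copy_def)
qed

lemma bij_Copy: "bij Copy"
  by (rule o_bij[of original]) auto

definition to_copy :: "real ^ 'n::finite \<Rightarrow> real ^ 'n ordered_copy" where
  "to_copy x = (\<chi> i. x $ original i)"

definition of_copy :: "real ^ 'n::finite ordered_copy \<Rightarrow> real ^ 'n" where
  "of_copy x = (\<chi> i. x $ Copy i)"

lemma of_to_copy [simp]: "of_copy (to_copy x) = x" "to_copy (of_copy y) = y"
  by (simp_all add: to_copy_def of_copy_def vec_eq_iff)

lemma linear_copy: "linear (to_copy :: real ^ 'n::finite \<Rightarrow> _)" "linear (of_copy :: real ^ 'n::finite ordered_copy \<Rightarrow> _)"
  by (auto intro!: linearI simp: to_copy_def of_copy_def vec_eq_iff)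

lemma continuous_copy: "continuous_on S to_copy" "continuous_on S' of_copy"
  using linear_copy by (auto intro: linear_continuous_on linear_linear[THEN iffD2] simp: linear_conv_bounded_linear)

lemma measurable_copy [measurable]: "to_copy \<in> borel_measurable borel" "of_copy \<in> borel_measurable borel"
  by (auto intro: borel_measurable_continuous_onI continuous_copy)

lemma Basis_vec_real: "(Basis :: (real ^ 'n::finite) set) = range (\<lambda>i. axis i 1)"
  by (auto simp: Basis_vec_def)

lemma emeasure_lborel_box_vec:
  fixes l u :: "real ^ 'n::finite"
  assumes "\<And>i. l $ i \<le> u $ i"
  shows "emeasure lborel (box l u) = ennreal (\<Prod>i\<in>UNIV. u $ i - l $ i)"
proof -
  have inj: "inj (\<lambda>i::'n. axis i (1::real))" by (auto simp: inj_def axis_eq_axis)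
  have "emeasure lborel (box l u) = ennreal (\<Prod>b\<in>Basis. (u - l) \<bullet> b)"
    using assms by (intro emeasure_lborel_box) (auto simp: Basis_vec_real inner_axis)
  then show ?thesis unfolding Basis_vec_real by (simp add: prod.reindex[OF inj] inner_axis)
qed

text \<open>Coordinates are only renamed, so boxes go to boxes with the same side lengths, and these
  determine Lebesgue measure.\<close>

lemma distr_lborel_copy: "distr lborel borel to_copy = (lborel :: (real ^ 'n::finite ordered_copy) measure)"
proof (rule lborel_eqI[symmetric])
  fix l u :: "real ^ 'n ordered_copy"
  assume "\<And>b. b \<in> Basis \<Longrightarrow> l \<bullet> b \<le> u \<bullet> b"
  from this[of "axis i 1" for i] have le: "l $ i \<le> u $ i" for i by (simp add: Basis_vec_real inner_axis)
  have inj: "inj (\<lambda>i::'n ordered_copy. axis i (1::real))" by (auto simp: inj_def axis_eq_axis)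
  have "to_copy -` box l u = box (of_copy l) (of_copy u)"
    unfolding set_eq_iff vimage_eq mem_box_cart to_copy_def of_copy_def
    by (auto, metis ordered_copy.sel, metis ordered_copy.sel, metis ordered_copy.collapse, metis ordered_copy.collapse)
  then have "emeasure (distr lborel borel to_copy) (box l u) = emeasure lborel (box (of_copy l) (of_copy u))"
    by (simp add: emeasure_distr)
  also have "\<dots> = ennreal (\<Prod>i\<in>UNIV. u $ Copy i - l $ Copy i)"
    using le by (subst emeasure_lborel_box_vec) (auto simp: of_copy_def)
  also have "(\<Prod>i\<in>UNIV. u $ Copy i - l $ Copy i) = (\<Prod>i\<in>UNIV. u $ i - l $ i)"
    using prod.reindex_bij_betw[OF bij_Copy, of "\<lambda>i. u $ i - l $ i"] by simp
  also have "\<dots> = (\<Prod>b\<in>Basis. (u - l) \<bullet> b)"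
    unfolding Basis_vec_real by (simp add: prod.reindex[OF inj] inner_axis)
  finally show "emeasure (distr lborel borel to_copy) (box l u) = ennreal (\<Prod>b\<in>Basis. (u - l) \<bullet> b)" .
qed simp

text \<open>Conjugation with \<open>Copy\<close> is a sign-preserving bijection between the
  permutations in the two Leibniz sums.\<close>

lemma det_copy:
  fixes A :: "real ^ 'n::finite ^ 'n"
  shows "det (\<chi> i j. A $ original i $ original j) = det A"
proof -
  let ?A = "\<chi> i j. A $ original i $ original j"
  let ?m = "map_permutation UNIV (Copy :: 'n \<Rightarrow> _)"
  have bij: "bij_betw ?m {p. p permutes UNIV} {p. p permutes UNIV}"
  proof (rule bij_betwI[where g = "map_permutation UNIV original"])
    show "?m \<in> {p. p permutes UNIV} \<rightarrow> {p. p permutes UNIV}"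
      using bij_Copy by (auto intro: map_permutation_permutes)
    show "map_permutation UNIV original \<in> {p. p permutes UNIV} \<rightarrow> {p. p permutes (UNIV :: 'n set)}"
      by (auto intro!: map_permutation_permutes bij_betw_byWitness[of _ Copy])
    show "map_permutation UNIV original (?m p) = p" if "p \<in> {p. p permutes UNIV}" for p
      using that bij_Copy by (intro map_permutation_compose_inv) auto
    show "?m (map_permutation UNIV original q) = q" if "q \<in> {p. p permutes UNIV}" for q
      using that by (intro map_permutation_compose_inv) (auto intro!: bij_betw_byWitness[of _ Copy])
  qed
  have app: "?m p (Copy i) = Copy (p i)" for p i
    by (rule map_permutation_apply[OF bij_is_inj[OF bij_Copy] UNIV_I])
  have "det ?A = (\<Sum>p | p permutes UNIV. of_int (sign (?m p)) * (\<Prod>i\<in>UNIV. ?A $ i $ ?m p i))"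
    unfolding det_def by (rule sum.reindex_bij_betw[OF bij, symmetric])
  also have "\<dots> = (\<Sum>p | p permutes UNIV. of_int (sign p) * (\<Prod>i\<in>UNIV. A $ i $ p i))"
  proof (rule sum.cong[OF refl])
    fix p :: "'n \<Rightarrow> 'n" assume "p \<in> {p. p permutes UNIV}"
    then have "sign (?m p) = sign p"
      by (intro sign_map_permutation bij_is_inj[OF bij_Copy]) auto
    moreover have "(\<Prod>i\<in>UNIV. ?A $ i $ ?m p i) = (\<Prod>i\<in>UNIV. ?A $ Copy i $ ?m p (Copy i))"
      by (rule prod.reindex_bij_betw[OF bij_Copy, symmetric])
    ultimately show "of_int (sign (?m p)) * (\<Prod>i\<in>UNIV. ?A $ i $ ?m p i) = of_int (sign p) * (\<Prod>i\<in>UNIV. A $ i $ p i)"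
      by (simp add: app)
  qed
  finally show ?thesis by (simp add: det_def)
qed

text \<open>For a nonnegative measurable function and finite \<open>b\<close>, having gauge integral
  \<open>b\<close> and having Lebesgue integral \<open>b\<close> are the same. Agreement for all
  finite \<open>b\<close> also settles the infinite case, in which no finite value occurs.\<close>

lemma has_integral_imp_nn_integral_eq:
  fixes f h :: "'e::euclidean_space \<Rightarrow> real"
  assumes S: "S \<in> sets borel" "T \<in> sets borel"
    and m: "(\<lambda>x. indicator S x * h x) \<in> borel_measurable borel" "(\<lambda>x. indicator T x * f x) \<in> borel_measurable borel"
    and nn: "\<And>x. 0 \<le> h x" "\<And>x. 0 \<le> f x"
    and eq: "\<And>b. (h has_integral b) S \<longleftrightarrow> (f has_integral b) T"
  shows "(\<integral>\<^sup>+x\<in>S. ennreal (h x) \<partial>lborel) = (\<integral>\<^sup>+x\<in>T. ennreal (f x) \<partial>lborel)"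
proof -
  have restrict: "((\<lambda>x. indicator A x * k x) has_integral b) UNIV \<longleftrightarrow> (k has_integral b) A" for A and k :: "'e \<Rightarrow> real" and b
  proof -
    have "(\<lambda>x. indicator A x * k x) = (\<lambda>x. if x \<in> A then k x else 0)" by (auto simp: indicator_def)
    then show ?thesis using has_integral_restrict_UNIV[of A k b] by (simp only:)
  qed
  have iff: "(\<integral>\<^sup>+x\<in>A. ennreal (k x) \<partial>lborel) = ennreal b \<longleftrightarrow> (k has_integral b) A"
    if k: "(\<lambda>x. indicator A x * k x) \<in> borel_measurable borel" "\<And>x. 0 \<le> k x" and b: "0 \<le> b" for A and k :: "'e \<Rightarrow> real" and b
  proof -
    have e: "(\<integral>\<^sup>+x\<in>A. ennreal (k x) \<partial>lborel) = (\<integral>\<^sup>+x. ennreal (indicator A x * k x) \<partial>lborel)"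
      by (intro nn_integral_cong) (auto simp: indicator_def)
    show ?thesis
    proof
      assume "(\<integral>\<^sup>+x\<in>A. ennreal (k x) \<partial>lborel) = ennreal b"
      then show "(k has_integral b) A"
        using nn_integral_has_integral[OF k(1), of b] k(2) b unfolding e restrict[of A k b] by simp
    next
      assume "(k has_integral b) A"
      then show "(\<integral>\<^sup>+x\<in>A. ennreal (k x) \<partial>lborel) = ennreal b"
        using nn_integral_has_integral_lborel[OF k(1), of b] k(2) unfolding e restrict[of A k b] by simp
    qed
  qed
  show ?thesis
  proof (cases "(\<integral>\<^sup>+x\<in>S. ennreal (h x) \<partial>lborel)")
    case (real b)
    then show ?thesis using iff[OF m(1) nn(1), of b] iff[OF m(2) nn(2), of b] eq by simp
  next
    case top
    show ?thesis
    proof (cases "(\<integral>\<^sup>+x\<in>T. ennreal (f x) \<partial>lborel)")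
      case (real b)
      then show ?thesis using iff[OF m(1) nn(1), of b] iff[OF m(2) nn(2), of b] eq by simp
    qed (use top in simp)
  qed
qed

lemma matrix_copy:
  fixes f :: "real ^ 'n::finite \<Rightarrow> real ^ 'n"
  shows "matrix (to_copy \<circ> f \<circ> of_copy) = (\<chi> i j. matrix f $ original i $ original j)"
proof -
  have *: "of_copy (axis j 1) = axis (original j) 1" for j :: "'n ordered_copy"
    by (auto simp: of_copy_def vec_eq_iff axis_def)
  have "matrix (to_copy \<circ> f \<circ> of_copy) $ i $ j = matrix f $ original i $ original j" for i j
    by (simp add: matrix_def to_copy_def *)
  then show ?thesis by (simp add: vec_eq_iff)
qed

text \<open>All maps are conjugated with the renaming of coordinates, which changes neither the
  determinants of the derivatives nor Lebesgue measure.\<close>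

lemma nn_integral_change_of_variables:
  fixes f :: "real ^ 'n::finite \<Rightarrow> real" and t s :: "real ^ 'n \<Rightarrow> real ^ 'n"
  assumes S: "S \<in> sets borel" and T: "T \<in> sets borel"
    and t: "\<And>x. x \<in> S \<Longrightarrow> (t has_derivative t' x) (at x)" "\<And>x. x \<in> S \<Longrightarrow> t x \<in> T \<and> s (t x) = x"
    and s: "\<And>y. y \<in> T \<Longrightarrow> (s has_derivative s' y) (at y)" "\<And>y. y \<in> T \<Longrightarrow> s y \<in> S \<and> t (s y) = y"
    and inv: "\<And>y. y \<in> T \<Longrightarrow> s' y \<circ> t' (s y) = id"
    and f0: "\<And>x. 0 \<le> f x"
    and m: "(\<lambda>x. indicator S x * (\<bar>det (matrix (t' x))\<bar> * f (t x))) \<in> borel_measurable borel"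
      "(\<lambda>x. indicator T x * f x) \<in> borel_measurable borel"
  shows "(\<integral>\<^sup>+x\<in>S. ennreal (\<bar>det (matrix (t' x))\<bar> * f (t x)) \<partial>lborel) = (\<integral>\<^sup>+x\<in>T. ennreal (f x) \<partial>lborel)"
proof -
  let ?c = "\<lambda>f :: real ^ 'n \<Rightarrow> real ^ 'n. to_copy \<circ> f \<circ> of_copy"
  let ?S = "of_copy -` S" and ?T = "of_copy -` T"
  have d1: "(to_copy has_derivative to_copy) (at x)" "(of_copy has_derivative of_copy) (at y)" for x :: "real ^ 'n" and y :: "real ^ 'n ordered_copy"
    using linear_copy by (auto intro!: bounded_linear_imp_has_derivative simp: linear_conv_bounded_linear)
  have dc: "(?c k has_derivative ?c k') (at x)" if "(k has_derivative k') (at (of_copy x))" for k k' x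
    using diff_chain_at[OF diff_chain_at[OF d1(2) that] d1(1)] by (simp add: o_assoc)
  have det: "det (matrix (?c k)) = det (matrix k)" for k
    by (simp add: matrix_copy det_copy)
  have trans: "(\<integral>\<^sup>+x. F (of_copy x) \<partial>lborel) = (\<integral>\<^sup>+x. F x \<partial>lborel)" if "F \<in> borel_measurable borel" for F :: "real ^ 'n \<Rightarrow> ennreal"
    unfolding distr_lborel_copy[symmetric] using that by (subst nn_integral_distr) auto
  have eq: "(\<integral>\<^sup>+x\<in>?S. ennreal (\<bar>det (matrix (t' (of_copy x)))\<bar> * f (t (of_copy x))) \<partial>lborel) = (\<integral>\<^sup>+x\<in>?T. ennreal (f (of_copy x)) \<partial>lborel)"
  proof (rule has_integral_imp_nn_integral_eq)
    show "?S \<in> sets borel" "?T \<in> sets borel"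
      using measurable_sets[OF measurable_copy(2) S] measurable_sets[OF measurable_copy(2) T] by auto
    show "(\<lambda>x. indicator ?S x * (\<bar>det (matrix (t' (of_copy x)))\<bar> * f (t (of_copy x)))) \<in> borel_measurable borel"
      using measurable_compose[OF measurable_copy(2) m(1)] by (simp add: indicator_def)
    show "(\<lambda>x. indicator ?T x * f (of_copy x)) \<in> borel_measurable borel"
      using measurable_compose[OF measurable_copy(2) m(2)] by (simp add: indicator_def)
    show "0 \<le> \<bar>det (matrix (t' (of_copy x)))\<bar> * f (t (of_copy x))" "0 \<le> f (of_copy x)" for x using f0 by auto
    fix b
    have "((\<lambda>x. \<bar>det (matrix (?c (t' (of_copy x))))\<bar> * (f \<circ> of_copy) (?c t x)) has_integral b) ?S \<longleftrightarrow> ((f \<circ> of_copy) has_integral b) ?T"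
    proof (rule cov_invertible_nonneg_eq[where g = "?c t" and g' = "\<lambda>x. ?c (t' (of_copy x))"
          and f = "f \<circ> of_copy" and S = ?S and T = ?T and h = "?c s" and h' = "\<lambda>y. ?c (s' (of_copy y))"])
      show "(?c t has_derivative ?c (t' (of_copy x))) (at x within ?S)" if "x \<in> ?S" for x
        by (rule has_derivative_at_withinI[OF dc[OF t(1)]]) (use that in simp)
      show "(?c s has_derivative ?c (s' (of_copy x))) (at x within ?T)" if "x \<in> ?T" for x
        by (rule has_derivative_at_withinI[OF dc[OF s(1)]]) (use that in simp)
      show "?c (s' (of_copy y)) \<circ> ?c (t' (of_copy (?c s y))) = id" if "y \<in> ?T" for y
        using fun_cong[OF inv[of "of_copy y"]] that by (auto simp: fun_eq_iff)
    qed (use t(2) s(2) f0 in auto)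
    then show "((\<lambda>x. \<bar>det (matrix (t' (of_copy x)))\<bar> * f (t (of_copy x))) has_integral b) ?S \<longleftrightarrow> ((\<lambda>x. f (of_copy x)) has_integral b) ?T"
      unfolding det by (simp add: o_def)
  qed
  have "(\<lambda>x. ennreal (k x) * indicator A x) = (\<lambda>x. ennreal (indicator A x * k x))" for A and k :: "real ^ 'n \<Rightarrow> real"
    by (auto simp: indicator_def)
  then have e: "(\<integral>\<^sup>+x\<in>A. ennreal (k x) \<partial>lborel) = (\<integral>\<^sup>+x\<in>of_copy -` A. ennreal (k (of_copy x)) \<partial>lborel)"
    if "(\<lambda>x. indicator A x * k x) \<in> borel_measurable borel" for A and k :: "real ^ 'n \<Rightarrow> real"
    using trans[of "\<lambda>x. ennreal (k x) * indicator A x"] that by (simp add: indicator_def)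
  show ?thesis unfolding e[OF m(1)] e[OF m(2)] by (rule eq)
qed

section \<open>The Riemannian volume\<close>

lemma det_continuous:
  assumes "continuous_on S (f :: 'b::topological_space \<Rightarrow> real ^ 'm::finite ^ 'm)"
  shows "continuous_on S (\<lambda>x. det (f x))"
  unfolding det_def by (intro continuous_intros assms)

lemma positive_definite_det_nonzero:
  fixes P :: "real ^ 'm::finite ^ 'm"
  assumes "\<And>v. v \<noteq> 0 \<Longrightarrow> 0 < v \<bullet> (P *v v)"
  shows "det P \<noteq> 0"
proof
  assume "det P = 0"
  then have "\<not> (\<exists>Q. Q ** P = mat 1)"
    using invertible_det_nz[of P] invertible_left_inverse[of P] by simp
  then obtain v where "v \<noteq> 0" "P *v v = 0" unfolding matrix_left_invertible_ker by auto
  then show False using assms[of v] by simp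
qed

text \<open>The segment from the identity to \<open>P\<close> consists of positive definite
  matrices, so the determinant has no zero on it and keeps its sign.\<close>

lemma positive_definite_det_pos:
  fixes P :: "real ^ 'm::finite ^ 'm"
  assumes P: "\<And>v. v \<noteq> 0 \<Longrightarrow> 0 < v \<bullet> (P *v v)"
  shows "0 < det P"
proof (rule ccontr)
  assume neg: "\<not> 0 < det P"
  let ?h = "\<lambda>t::real. (1 - t) *\<^sub>R mat 1 + t *\<^sub>R P"
  have "continuous_on {0..1} (\<lambda>t. det (?h t))"
    by (intro det_continuous continuous_intros)
  moreover have "det (?h 1) \<le> 0" "0 \<le> det (?h 0)" using neg by auto
  ultimately obtain t where t: "0 \<le> t" "t \<le> 1" "det (?h t) = 0"
    using IVT2'[of "\<lambda>t. det (?h t)" 1 0 0] by auto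
  have "0 < v \<bullet> (?h t *v v)" if v: "v \<noteq> 0" for v
  proof -
    have "?h t *v v = (1 - t) *\<^sub>R v + t *\<^sub>R (P *v v)"
      by (simp add: matrix_vector_mult_add_rdistrib scaleR_matrix_vector_assoc[symmetric])
    then have "v \<bullet> (?h t *v v) = (1 - t) * (v \<bullet> v) + t * (v \<bullet> (P *v v))"
      by (simp add: inner_add_right)
    moreover have "0 < v \<bullet> v" "0 < v \<bullet> (P *v v)" using v P by auto
    ultimately show ?thesis
      using t(1,2) by (cases "t = 0") (auto intro: add_nonneg_pos)
  qed
  from positive_definite_det_nonzero[OF this] t(3) show False by simp
qed

context closed_riemannian_manifold
begin

lemma closed_M: "closed M"
  using compact by (rule compact_imp_closed)

lemma borel_M [measurable]: "M \<in> sets borel"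
  using closed_M by (rule borel_closed)

lemma chart_facts:
  assumes "c \<in> A"
  shows chart_openin: "openin (top_of_set M) (fst c)"
    and chart_open: "open (snd c ` fst c)"
    and chart_cont: "continuous_on (fst c) (snd c)"
    and chart_inv_cont: "continuous_on (snd c ` fst c) (chart_inv c)"
    and chart_inv_left: "p \<in> fst c \<Longrightarrow> chart_inv c (snd c p) = p"
    and chart_inv_right: "x \<in> snd c ` fst c \<Longrightarrow> snd c (chart_inv c x) = x"
    and chart_inv_in: "x \<in> snd c ` fst c \<Longrightarrow> chart_inv c x \<in> fst c"
  using charts[OF assms] by (auto simp: is_chart_def homeomorphism_def)

lemma chart_subset: "c \<in> A \<Longrightarrow> fst c \<subseteq> M"
  using cover by auto

lemma chart_borel: "c \<in> A \<Longrightarrow> fst c \<in> sets borel"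
  using chart_openin[of c] borel_M by (auto simp: openin_open)

lemma chart_image_borel: "c \<in> A \<Longrightarrow> snd c ` fst c \<in> sets borel"
  using chart_open by auto

lemma chart_image_eq_vimage:
  assumes "c \<in> A" "B \<subseteq> fst c"
  shows "snd c ` B = {x \<in> snd c ` fst c. chart_inv c x \<in> B}"
  using assms chart_inv_left[OF assms(1)] chart_inv_right[OF assms(1)] by force

lemma measurable_chart_inv:
  assumes "c \<in> A"
  shows "chart_inv c \<in> measurable (restrict_space borel (snd c ` fst c)) borel"
  by (rule borel_measurable_continuous_on_restrict) (rule chart_inv_cont[OF assms])

lemma measurable_chart:
  assumes "c \<in> A"
  shows "snd c \<in> measurable (restrict_space borel (fst c)) borel"
  by (rule borel_measurable_continuous_on_restrict) (rule chart_cont[OF assms])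

lemma chart_image_sets:
  assumes c: "c \<in> A" and B: "B \<subseteq> fst c" "B \<in> sets borel"
  shows "snd c ` B \<in> sets borel"
proof -
  have "chart_inv c -` B \<inter> space (restrict_space borel (snd c ` fst c)) \<in> sets (restrict_space borel (snd c ` fst c))"
    by (rule measurable_sets[OF measurable_chart_inv[OF c] B(2)])
  moreover have "chart_inv c -` B \<inter> space (restrict_space borel (snd c ` fst c)) = snd c ` B"
    unfolding chart_image_eq_vimage[OF c B(1)] by (auto simp: space_restrict_space)
  ultimately show ?thesis
    using chart_image_borel[OF c] by (auto simp: sets_restrict_space)
qed

lemma metric_continuous:
  assumes "c \<in> A"
  shows "continuous_on (snd c ` fst c) (g c)"
  using metric_smooth[OF assms] unfolding smooth_on_def by (metis Ck_on.simps(1))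

lemma det_metric_pos:
  assumes c: "c \<in> A" and x: "x \<in> snd c ` fst c"
  shows "0 < det (g c x)"
  using metric_positive[OF c x] by (rule positive_definite_det_pos)

definition dens :: "('a, 'n) chart \<Rightarrow> real ^ 'n \<Rightarrow> real" where
  "dens c x = sqrt (det (g c x))"

lemma dens_continuous: "c \<in> A \<Longrightarrow> continuous_on (snd c ` fst c) (dens c)"
  unfolding dens_def by (intro continuous_intros det_continuous metric_continuous)

lemma dens_pos: "c \<in> A \<Longrightarrow> x \<in> snd c ` fst c \<Longrightarrow> 0 < dens c x"
  using det_metric_pos by (simp add: dens_def)

lemma dens_measurable:
  assumes "c \<in> A"
  shows "(\<lambda>x. indicator (snd c ` fst c) x * dens c x) \<in> borel_measurable borel"
  using borel_measurable_continuous_on_indicator[OF chart_image_borel dens_continuous] assms by simp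

lemma openin_overlap: "c \<in> A \<Longrightarrow> d \<in> A \<Longrightarrow> open (overlap c d)"
proof -
  assume c: "c \<in> A" and d: "d \<in> A"
  have "openin (top_of_set (fst c)) (fst c \<inter> fst d)"
    using chart_openin[OF d] chart_subset[OF c] by (auto simp: openin_open)
  then have "openin (top_of_set (snd c ` fst c)) (snd c ` (fst c \<inter> fst d))"
    using charts[OF c] homeomorphism_imp_open_map unfolding is_chart_def by blast
  then show ?thesis
    using chart_open[OF c] unfolding overlap_def by (simp add: openin_open_eq)
qed

lemma transition_derivative:
  assumes "c \<in> A" "d \<in> A" "x \<in> overlap c d"
  shows "(transition c d has_derivative frechet_derivative (transition c d) (at x)) (at x)"
proof -
  have "Ck_on (Suc 0) (overlap c d) (transition c d)"
    using smooth_transition[OF assms(1,2)] unfolding smooth_on_def by blast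
  then show ?thesis using assms(3) by (simp add: frechet_derivative_works[symmetric])
qed

lemma transition_apply: "c \<in> A \<Longrightarrow> p \<in> fst c \<Longrightarrow> transition c d (snd c p) = snd d p"
  by (simp add: transition_def chart_inv_left)

lemma transition_transition:
  assumes "c \<in> A" "d \<in> A" "x \<in> overlap c d"
  shows "transition c d x \<in> overlap d c" "transition d c (transition c d x) = x"
  using assms by (auto simp: overlap_def transition_apply)

lemma dens_transform:
  assumes "c \<in> A" "d \<in> A" "x \<in> overlap c d"
  shows "dens c x = \<bar>det (jacobian c d x)\<bar> * dens d (transition c d x)"
proof -
  have "det (g c x) = (det (jacobian c d x))\<^sup>2 * det (g d (transition c d x))"
    unfolding metric_transform[OF assms] by (simp add: det_mul power2_eq_square)
  then show ?thesis by (simp add: dens_def real_sqrt_mult)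
qed

definition chart_volume :: "('a, 'n) chart \<Rightarrow> 'a set \<Rightarrow> ennreal" where
  "chart_volume c B = (\<integral>\<^sup>+x\<in>snd c ` B. ennreal (dens c x) \<partial>lborel)"

text \<open>The change of variables formula for the transition map; \<open>dens_transform\<close>
  supplies the Jacobian factor.\<close>

lemma chart_volume_compatible:
  assumes c: "c \<in> A" and d: "d \<in> A" and B: "B \<in> sets borel" "B \<subseteq> fst c" "B \<subseteq> fst d"
  shows "chart_volume c B = chart_volume d B"
proof -
  have sub: "snd c ` B \<subseteq> overlap c d" "snd d ` B \<subseteq> overlap d c" using B by (auto simp: overlap_def)
  have "(\<integral>\<^sup>+x\<in>snd c ` B. ennreal (\<bar>det (matrix (frechet_derivative (transition c d) (at x)))\<bar> * (indicator (snd d ` fst d) (transition c d x) * dens d (transition c d x))) \<partial>lborel)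
    = (\<integral>\<^sup>+x\<in>snd d ` B. ennreal (indicator (snd d ` fst d) x * dens d x) \<partial>lborel)"
  proof (rule nn_integral_change_of_variables[where s = "transition d c" and s' = "\<lambda>y. frechet_derivative (transition d c) (at y)"])
    show "snd c ` B \<in> sets borel" "snd d ` B \<in> sets borel" using chart_image_sets c d B by auto
    show "(transition c d has_derivative frechet_derivative (transition c d) (at x)) (at x)" if "x \<in> snd c ` B" for x
      using that sub by (intro transition_derivative c d) auto
    show "(transition d c has_derivative frechet_derivative (transition d c) (at x)) (at x)" if "x \<in> snd d ` B" for x
      using that sub by (intro transition_derivative c d) auto
    show "transition c d x \<in> snd d ` B \<and> transition d c (transition c d x) = x" if "x \<in> snd c ` B" for x
      using that B by (auto simp: transition_apply c d subset_eq)
    show "transition d c x \<in> snd c ` B \<and> transition c d (transition d c x) = x" if "x \<in> snd d ` B" for x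
      using that B by (auto simp: transition_apply c d subset_eq)
    show "frechet_derivative (transition d c) (at y) \<circ> frechet_derivative (transition c d) (at (transition d c y)) = id"
      if y: "y \<in> snd d ` B" for y
    proof -
      have yo: "y \<in> overlap d c" using y sub by auto
      have x: "transition d c y \<in> overlap c d" "transition c d (transition d c y) = y"
        using transition_transition[OF d c yo] by auto
      let ?x = "transition d c y"
      have "(transition d c has_derivative frechet_derivative (transition d c) (at y)) (at (transition c d ?x))"
        using transition_derivative[OF d c yo] x(2) by simp
      from diff_chain_at[OF transition_derivative[OF c d x(1)] this]
      have 1: "(transition d c \<circ> transition c d has_derivative frechet_derivative (transition d c) (at y) \<circ> frechet_derivative (transition c d) (at ?x)) (at ?x)" .
      \<comment> \<open>The two transitions compose to the identity on the overlap only; as the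
        overlap is open, the derivative there is still the identity.\<close>
      have "(id has_derivative id) (at ?x)" by (rule has_derivative_id)
      then have "(transition d c \<circ> transition c d has_derivative id) (at ?x)"
        by (rule has_derivative_transform_within_open[OF _ openin_overlap[OF c d] x(1)])
          (use transition_transition(2)[OF c d] in auto)
      with 1 show ?thesis by (rule has_derivative_unique)
    qed
    \<comment> \<open>Outside its chart image \<open>dens d\<close> is arbitrary; the indicator
      makes the integrand nonnegative and Borel everywhere.\<close>
    show "0 \<le> indicator (snd d ` fst d) x * dens d x" for x
      using dens_pos[OF d, of x] by (auto simp: indicator_def)
    have [measurable]: "snd d ` B \<in> sets borel" "snd c ` B \<in> sets borel" using chart_image_sets c d B by auto
    show "(\<lambda>x. indicator (snd d ` B) x * (indicator (snd d ` fst d) x * dens d x)) \<in> borel_measurable borel"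
      using dens_measurable[OF d] by measurable
    have "(\<lambda>x. indicator (snd c ` B) x * (indicator (snd c ` fst c) x * dens c x)) \<in> borel_measurable borel"
      using dens_measurable[OF c] by measurable
    moreover have "indicator (snd c ` B) x * (indicator (snd c ` fst c) x * dens c x) =
      indicator (snd c ` B) x * (\<bar>det (matrix (frechet_derivative (transition c d) (at x)))\<bar> * (indicator (snd d ` fst d) (transition c d x) * dens d (transition c d x)))" for x
    proof (cases "x \<in> snd c ` B")
      case True
      then obtain p where p: "p \<in> B" "x = snd c p" by auto
      then have "transition c d x \<in> snd d ` fst d" using B by (auto simp: transition_apply c subset_eq)
      moreover have "x \<in> overlap c d" "x \<in> snd c ` fst c" using True sub B by auto
      ultimately show ?thesis using True dens_transform[OF c d, of x] by (simp add: jacobian_def)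
    qed simp
    ultimately show "(\<lambda>x. indicator (snd c ` B) x * (\<bar>det (matrix (frechet_derivative (transition c d) (at x)))\<bar> * (indicator (snd d ` fst d) (transition c d x) * dens d (transition c d x)))) \<in> borel_measurable borel"
      by simp
  qed
  moreover have "(\<integral>\<^sup>+x\<in>snd c ` B. ennreal (\<bar>det (matrix (frechet_derivative (transition c d) (at x)))\<bar> * (indicator (snd d ` fst d) (transition c d x) * dens d (transition c d x))) \<partial>lborel)
    = chart_volume c B"
    unfolding chart_volume_def
  proof (intro nn_integral_cong)
    fix x
    show "ennreal (\<bar>det (matrix (frechet_derivative (transition c d) (at x)))\<bar> * (indicator (snd d ` fst d) (transition c d x) * dens d (transition c d x))) * indicator (snd c ` B) x
      = ennreal (dens c x) * indicator (snd c ` B) x"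
    proof (cases "x \<in> snd c ` B")
      case True
      then obtain p where p: "p \<in> B" "x = snd c p" by auto
      then have "transition c d x \<in> snd d ` fst d" using B by (auto simp: transition_apply c subset_eq)
      moreover have "x \<in> overlap c d" using True sub by auto
      ultimately show ?thesis using True dens_transform[OF c d, of x] by (simp add: jacobian_def)
    qed simp
  qed
  moreover have "(\<integral>\<^sup>+x\<in>snd d ` B. ennreal (indicator (snd d ` fst d) x * dens d x) \<partial>lborel) = chart_volume d B"
    unfolding chart_volume_def using B by (intro nn_integral_cong) (auto simp: indicator_def)
  ultimately show ?thesis by simp
qed

lemma chart_volume_eq_emeasure:
  assumes c: "c \<in> A" and B: "B \<in> sets borel" "B \<subseteq> fst c"
  shows "chart_volume c B = emeasure (density lborel (\<lambda>x. ennreal (indicator (snd c ` fst c) x * dens c x))) (snd c ` B)"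
proof -
  have "chart_volume c B = (\<integral>\<^sup>+x\<in>snd c ` B. ennreal (indicator (snd c ` fst c) x * dens c x) \<partial>lborel)"
    unfolding chart_volume_def using B by (intro nn_integral_cong) (auto simp: indicator_def)
  then show ?thesis
    using chart_image_sets[OF c B(2,1)] dens_measurable[OF c] by (subst emeasure_density) auto
qed

lemma chart_volume_suminf:
  assumes c: "c \<in> A" and B: "\<And>i :: nat. B i \<in> sets borel" "\<And>i. B i \<subseteq> fst c" "disjoint_family B"
  shows "(\<Sum>i. chart_volume c (B i)) = chart_volume c (\<Union>i. B i)"
proof -
  have "snd c ` B i \<inter> snd c ` B j = {}" if "i \<noteq> j" for i j
  proof -
    have "B i \<inter> B j = {}" using B(3) that by (auto simp: disjoint_family_on_def)
    then show ?thesis using B(2)[of i] B(2)[of j] chart_inv_left[OF c] by (auto, metis IntI empty_iff subsetD)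
  qed
  then have "disjoint_family (\<lambda>i. snd c ` B i)" by (auto simp: disjoint_family_on_def)
  moreover have "range (\<lambda>i. snd c ` B i) \<subseteq> sets (density lborel (\<lambda>x. ennreal (indicator (snd c ` fst c) x * dens c x)))"
    using chart_image_sets[OF c B(2,1)] by auto
  ultimately have "(\<Sum>i. emeasure (density lborel (\<lambda>x. ennreal (indicator (snd c ` fst c) x * dens c x))) (snd c ` B i))
    = emeasure (density lborel (\<lambda>x. ennreal (indicator (snd c ` fst c) x * dens c x))) (\<Union>i. snd c ` B i)"
    by (intro suminf_emeasure)
  moreover have "(\<Union>i. B i) \<in> sets borel" "(\<Union>i. B i) \<subseteq> fst c" using B by auto
  ultimately show ?thesis
    using B(1,2) by (simp add: chart_volume_eq_emeasure[OF c] image_UN)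
qed

lemma chart_volume_empty: "chart_volume c {} = 0"
  by (simp add: chart_volume_def)

lemma finite_atlas:
  obtains N :: nat and e :: "nat \<Rightarrow> ('a, 'n) chart" where "\<And>i. i < N \<Longrightarrow> e i \<in> A" "(\<Union>i<N. fst (e i)) = M"
proof -
  have "\<exists>D\<subseteq>fst ` A. finite D \<and> M \<subseteq> \<Union>D"
  proof (rule compact[unfolded compact_eq_openin_cover, rule_format], intro conjI ballI)
    show "openin (top_of_set M) U" if "U \<in> fst ` A" for U using that chart_openin by auto
    show "M \<subseteq> \<Union>(fst ` A)" using cover by simp
  qed
  then obtain D where D: "D \<subseteq> fst ` A" "finite D" "M \<subseteq> \<Union>D" by blast
  then obtain C where C: "C \<subseteq> A" "finite C" "D = fst ` C" by (meson finite_subset_image)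
  obtain e :: "nat \<Rightarrow> _" where "bij_betw e {..<card C} C" using ex_bij_betw_nat_finite[OF C(2)] by (auto simp: atLeast0LessThan)
  then have e: "e ` {..<card C} = C" by (simp add: bij_betw_def)
  show ?thesis
  proof (rule that[of "card C" e])
    show "e i \<in> A" if "i < card C" for i using e C(1) that by auto
    show "(\<Union>i<card C. fst (e i)) = M"
    proof -
      have "(\<Union>i<card C. fst (e i)) = \<Union>(fst ` C)" using e by (metis image_image)
      moreover have "\<Union>(fst ` C) \<subseteq> M" using C(1) chart_subset by (intro UN_least) auto
      ultimately show ?thesis using C(3) D(3) by blast
    qed
  qed
qed

text \<open>Compactness leaves finitely many charts, and making their domains disjoint gives Borel
  pieces that each lie in one chart. It allows statements about \<open>M\<close> to be summed over
  charts.\<close>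

lemma atlas_partition:
  obtains N :: nat and e :: "nat \<Rightarrow> ('a, 'n) chart" and P :: "nat \<Rightarrow> 'a set"
  where "\<And>i. i < N \<Longrightarrow> e i \<in> A" "\<And>i. i < N \<Longrightarrow> P i \<subseteq> fst (e i)" "\<And>i. P i \<in> sets borel"
    "disjoint_family P" "(\<Union>i<N. P i) = M"
proof -
  obtain N :: nat and e :: "nat \<Rightarrow> ('a, 'n) chart" where e: "\<And>i. i < N \<Longrightarrow> e i \<in> A" "(\<Union>i<N. fst (e i)) = M"
    using finite_atlas by metis
  define U where "U i = (if i < N then fst (e i) else {})" for i
  have U: "U i \<in> sets borel" for i using e(1) chart_borel by (simp add: U_def)
  show ?thesis
  proof (rule that[of N e "disjointed U"])
    show "e i \<in> A" if "i < N" for i using e(1) that .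
    show "disjointed U i \<subseteq> fst (e i)" if "i < N" for i
      using disjointed_subset[of U i] that by (simp add: U_def)
    show "disjointed U i \<in> sets borel" for i
      using sets.range_disjointed_sets[of U borel] U by auto
    show "disjoint_family (disjointed U)" by (rule disjoint_family_disjointed)
    have "disjointed U i = {}" if "\<not> i < N" for i using disjointed_subset[of U i] that by (simp add: U_def)
    then have "(\<Union>i<N. disjointed U i) = (\<Union>i. disjointed U i)" by auto
    also have "\<dots> = (\<Union>i. U i)" by (rule UN_disjointed_eq)
    also have "\<dots> = M" using e(2) by (auto simp: U_def split: if_splits)
    finally show "(\<Union>i<N. disjointed U i) = M" .
  qed
qed

lemma sets_restrict_M: "B \<in> sets (restrict_space borel M) \<longleftrightarrow> B \<in> sets borel \<and> B \<subseteq> M"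
  using sets_restrict_space_iff[of M borel B] by (auto simp: borel_M)

lemma is_riemannian_volume_iff:
  "is_riemannian_volume M A g \<nu> \<longleftrightarrow> sets \<nu> = sets (restrict_space borel M) \<and>
    (\<forall>c\<in>A. \<forall>B\<in>sets borel. B \<subseteq> fst c \<longrightarrow> emeasure \<nu> B = chart_volume c B)"
proof -
  have "B \<in> sets \<nu> \<longleftrightarrow> B \<in> sets borel" if "sets \<nu> = sets (restrict_space borel M)" "c \<in> A" "B \<subseteq> fst c" for B c
    using that chart_subset[of c] by (auto simp: sets_restrict_M)
  then show ?thesis
    unfolding is_riemannian_volume_def chart_volume_def dens_def by blast
qed

text \<open>This justifies the \<open>THE\<close> in \<open>riemannian_volume\<close>. For
  existence, the chart volumes are added over a partition subordinate to the charts, and their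
  compatibility makes the sum correct in every chart. For uniqueness, the value on subsets of each
  piece is prescribed.\<close>

lemma riemannian_volume_exists_unique: "\<exists>!\<nu>. is_riemannian_volume M A g \<nu>"
proof -
  obtain N :: nat and e :: "nat \<Rightarrow> ('a, 'n) chart" and P :: "nat \<Rightarrow> 'a set"
    where e: "\<And>i. i < N \<Longrightarrow> e i \<in> A" and P: "\<And>i. i < N \<Longrightarrow> P i \<subseteq> fst (e i)" "\<And>i. P i \<in> sets borel"
      "disjoint_family P" "(\<Union>i<N. P i) = M"
    using atlas_partition by metis
  have Pd: "P i \<inter> P j = {}" if "i \<noteq> j" for i j using P(3) that by (auto simp: disjoint_family_on_def)
  define m where "m B = (\<Sum>i<N. chart_volume (e i) (B \<inter> P i))" for B
  define \<nu> where "\<nu> = measure_of M (sets (restrict_space borel M)) m"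
  have sets: "sets \<nu> = sets (restrict_space borel M)"
    using sets.sigma_sets_eq[of "restrict_space borel M"] sets.sets_into_space[of _ "restrict_space borel M"]
    unfolding \<nu>_def by (subst sets_measure_of) (auto simp: space_restrict_space)
  have em: "emeasure \<nu> B = m B" if B: "B \<in> sets borel" "B \<subseteq> M" for B
  proof (rule emeasure_measure_of[OF \<nu>_def])
    show "sets (restrict_space borel M) \<subseteq> Pow M" by (auto simp: sets_restrict_M)
    show "B \<in> sets \<nu>" using B by (simp add: sets sets_restrict_M)
    show "positive (sets \<nu>) m" by (simp add: positive_def m_def chart_volume_empty)
    show "countably_additive (sets \<nu>) m"
      unfolding countably_additive_def
    proof (intro allI impI)
      fix F :: "nat \<Rightarrow> 'a set" assume F: "range F \<subseteq> sets \<nu>" "disjoint_family F"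
      have Fb: "F j \<in> sets borel" for j
      proof -
        have "F j \<in> sets \<nu>" using F(1) by auto
        then show ?thesis by (simp add: sets sets_restrict_M)
      qed
      have "(\<Sum>j. chart_volume (e i) (F j \<inter> P i)) = chart_volume (e i) ((\<Union>j. F j) \<inter> P i)" if "i < N" for i
      proof -
        have "F j \<inter> P i \<in> sets borel" "F j \<inter> P i \<subseteq> fst (e i)" for j using Fb P(1)[OF that] P(2) by auto
        moreover have "disjoint_family (\<lambda>j. F j \<inter> P i)" using F(2) unfolding disjoint_family_on_def by blast
        ultimately have "(\<Sum>j. chart_volume (e i) (F j \<inter> P i)) = chart_volume (e i) (\<Union>j. F j \<inter> P i)"
          by (rule chart_volume_suminf[OF e[OF that]])
        then show ?thesis by simp
      qed
      then show "(\<Sum>j. m (F j)) = m (\<Union>j. F j)"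
        unfolding m_def by (subst suminf_sum) (auto intro: sum.cong)
    qed
  qed
  have split: "chart_volume c B = (\<Sum>i<N. chart_volume c (B \<inter> P i))" if c: "c \<in> A" and B: "B \<in> sets borel" "B \<subseteq> fst c" for c B
  proof -
    let ?F = "\<lambda>i. if i < N then B \<inter> P i else {}"
    have "(\<Sum>i. chart_volume c (?F i)) = chart_volume c (\<Union>i. ?F i)"
    proof (rule chart_volume_suminf[OF c])
      have "?F i \<inter> ?F j = {}" if "i \<noteq> j" for i j using Pd[OF that] by auto
      then show "disjoint_family ?F" by (simp add: disjoint_family_on_def)
    qed (use B P(2) in auto)
    moreover have "(\<Union>i. ?F i) = B" using P(4) B(2) chart_subset[OF c] by (auto split: if_splits)
    moreover have "(\<Sum>i. chart_volume c (?F i)) = (\<Sum>i<N. chart_volume c (?F i))"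
      by (intro suminf_finite) (auto simp: chart_volume_empty)
    ultimately show ?thesis by simp
  qed
  have "is_riemannian_volume M A g \<nu>"
    unfolding is_riemannian_volume_iff
  proof (intro conjI ballI impI sets)
    fix c B assume c: "c \<in> A" and B: "B \<in> sets borel" "B \<subseteq> fst c"
    have "emeasure \<nu> B = (\<Sum>i<N. chart_volume (e i) (B \<inter> P i))"
      using em[of B] B chart_subset[OF c] by (auto simp: m_def)
    also have "\<dots> = (\<Sum>i<N. chart_volume c (B \<inter> P i))"
      using B P c e by (intro sum.cong refl chart_volume_compatible) auto
    finally show "emeasure \<nu> B = chart_volume c B" using split[OF c B] by simp
  qed
  moreover have "\<nu>' = \<nu>" if "is_riemannian_volume M A g \<nu>'" for \<nu>'
  proof (rule measure_eqI)
    have s: "sets \<nu>' = sets (restrict_space borel M)"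
      and v: "\<And>c B. c \<in> A \<Longrightarrow> B \<in> sets borel \<Longrightarrow> B \<subseteq> fst c \<Longrightarrow> emeasure \<nu>' B = chart_volume c B"
      using that by (auto simp: is_riemannian_volume_iff)
    show "sets \<nu>' = sets \<nu>" by (simp add: s sets)
    fix B assume "B \<in> sets \<nu>'"
    then have B: "B \<in> sets borel" "B \<subseteq> M" by (auto simp: s sets_restrict_M)
    have "emeasure \<nu>' B = emeasure \<nu>' (\<Union>i<N. B \<inter> P i)" using B P(4) by (intro arg_cong[where f = "emeasure \<nu>'"]) auto
    also have "\<dots> = (\<Sum>i<N. emeasure \<nu>' (B \<inter> P i))"
    proof (rule sum_emeasure[symmetric])
      have "(B \<inter> P i) \<inter> (B \<inter> P j) = {}" if "i \<noteq> j" for i j using Pd[OF that] by auto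
      then show "disjoint_family_on (\<lambda>i. B \<inter> P i) {..<N}" by (simp add: disjoint_family_on_def)
    qed (use B P(2) in \<open>auto simp: s sets_restrict_M\<close>)
    also have "\<dots> = m B"
      unfolding m_def using B P e by (intro sum.cong refl v) auto
    finally show "emeasure \<nu>' B = emeasure \<nu> B" using em[OF B] by simp
  qed
  ultimately show ?thesis by blast
qed

section \<open>The volume measure in charts\<close>

abbreviation vol :: "'a measure" where "vol \<equiv> riemannian_volume M A g"

lemma is_riemannian_volume_vol: "is_riemannian_volume M A g vol"
  unfolding riemannian_volume_def by (rule theI'[OF riemannian_volume_exists_unique])

lemma sets_vol: "B \<in> sets vol \<longleftrightarrow> B \<in> sets borel \<and> B \<subseteq> M"
  using is_riemannian_volume_vol by (auto simp: is_riemannian_volume_iff sets_restrict_M)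

lemma sets_vol_eq: "sets vol = sets (restrict_space borel M)"
  using is_riemannian_volume_vol by (auto simp: is_riemannian_volume_iff)

lemma space_vol: "space vol = M"
  using sets_eq_imp_space_eq[OF sets_vol_eq] by (simp add: space_restrict_space)

lemma emeasure_vol: "c \<in> A \<Longrightarrow> B \<in> sets borel \<Longrightarrow> B \<subseteq> fst c \<Longrightarrow> emeasure vol B = chart_volume c B"
  using is_riemannian_volume_vol by (auto simp: is_riemannian_volume_iff)

lemma chart_sets_vol: "c \<in> A \<Longrightarrow> fst c \<in> sets vol"
  using chart_borel chart_subset by (simp add: sets_vol)

lemma borel_measurable_vol_iff: "f \<in> borel_measurable vol \<longleftrightarrow> f \<in> borel_measurable (restrict_space borel M)"
  by (simp add: measurable_cong_sets[OF sets_vol_eq refl])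

text \<open>The chart pushes the restricted volume forward to the measure with density
  \<open>dens c\<close>. The indicators extend the pulled-back function by 0 to a Borel function on
  the coordinate space.\<close>

lemma chart_nn_integral:
  assumes c: "c \<in> A" and f[measurable]: "f \<in> borel_measurable vol"
  shows "(\<lambda>x. f (chart_inv c x) * indicator (snd c ` fst c) x :: ennreal) \<in> borel_measurable borel"
    and "(\<integral>\<^sup>+p\<in>fst c. f p \<partial>vol) = (\<integral>\<^sup>+x. ennreal (indicator (snd c ` fst c) x * dens c x) * (f (chart_inv c x) * indicator (snd c ` fst c) x) \<partial>lborel)"
proof -
  let ?U = "fst c" and ?V = "snd c ` fst c"
  have ci: "chart_inv c \<in> measurable (restrict_space borel ?V) (restrict_space borel M)"
    using measurable_chart_inv[OF c] chart_inv_in[OF c] chart_subset[OF c]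
    by (intro measurable_restrict_space2) (auto simp: space_restrict_space)
  have "(\<lambda>x. f (chart_inv c x)) \<in> borel_measurable (restrict_space borel ?V)"
    using measurable_compose[OF ci] f by (simp add: borel_measurable_vol_iff)
  then show m: "(\<lambda>x. f (chart_inv c x) * indicator ?V x :: ennreal) \<in> borel_measurable borel"
    using chart_image_borel[OF c] by (subst (asm) borel_measurable_restrict_space_iff_ennreal) auto
  let ?\<nu> = "density lborel (\<lambda>x. ennreal (indicator ?V x * dens c x))"
  have [measurable]: "?U \<in> sets vol" by (rule chart_sets_vol[OF c])
  have sc: "snd c \<in> measurable (restrict_space vol ?U) borel"
    using measurable_chart[OF c] chart_subset[OF c]
    by (subst measurable_cong_sets[of _ "restrict_space borel ?U"]) (auto simp: sets_restrict_space sets_vol_eq image_image Int_absorb1 intro!: image_cong)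
  have "distr (restrict_space vol ?U) borel (snd c) = ?\<nu>"
  proof (rule measure_eqI)
    fix S assume "S \<in> sets (distr (restrict_space vol ?U) borel (snd c))"
    then have S: "S \<in> sets borel" by simp
    let ?B = "snd c -` S \<inter> ?U"
    have "?B \<in> sets (restrict_space vol ?U)"
      using measurable_sets[OF sc S] by (simp add: space_restrict_space space_vol Int_absorb1 Int_absorb2 chart_subset[OF c])
    then have B: "?B \<in> sets borel" "?B \<subseteq> ?U"
    proof -
      have "?U \<inter> space vol \<in> sets vol" by simp
      then have "?B \<in> sets vol" using \<open>?B \<in> sets (restrict_space vol ?U)\<close> by (simp add: sets_restrict_space_iff)
      then show "?B \<in> sets borel" by (simp add: sets_vol)
    qed auto
    have im: "snd c ` ?B = S \<inter> ?V" by auto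
    have "emeasure (distr (restrict_space vol ?U) borel (snd c)) S = emeasure (restrict_space vol ?U) ?B"
      using S sc by (subst emeasure_distr) (auto simp: space_restrict_space space_vol Int_absorb1 Int_absorb2 chart_subset[OF c])
    also have "\<dots> = chart_volume c ?B"
      using emeasure_vol[OF c B] by (subst emeasure_restrict_space) auto
    also have "\<dots> = emeasure ?\<nu> (S \<inter> ?V)"
      using chart_volume_eq_emeasure[OF c B] im by simp
    also have "\<dots> = emeasure ?\<nu> S"
      using S chart_image_borel[OF c] dens_measurable[OF c]
      by (subst (1 2) emeasure_density) (auto intro!: nn_integral_cong simp: indicator_def)
    finally show "emeasure (distr (restrict_space vol ?U) borel (snd c)) S = emeasure ?\<nu> S" .
  qed simp
  then have "(\<integral>\<^sup>+x. f (chart_inv c x) * indicator ?V x \<partial>?\<nu>) = (\<integral>\<^sup>+p. f (chart_inv c (snd c p)) * indicator ?V (snd c p) \<partial>restrict_space vol ?U)"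
    using m sc by (subst nn_integral_distr[symmetric]) auto
  also have "\<dots> = (\<integral>\<^sup>+p. f p \<partial>restrict_space vol ?U)"
    by (intro nn_integral_cong) (auto simp: space_restrict_space chart_inv_left[OF c])
  also have "\<dots> = (\<integral>\<^sup>+p\<in>?U. f p \<partial>vol)"
    by (rule nn_integral_restrict_space) simp
  finally show "(\<integral>\<^sup>+p\<in>?U. f p \<partial>vol) = (\<integral>\<^sup>+x. ennreal (indicator ?V x * dens c x) * (f (chart_inv c x) * indicator ?V x) \<partial>lborel)"
    using m dens_measurable[OF c] by (subst (asm) nn_integral_density) auto
qed

lemma compact_lower_bound:
  fixes f :: "'b::topological_space \<Rightarrow> real"
  assumes "compact K" "continuous_on K f" "\<And>x. x \<in> K \<Longrightarrow> 0 < f x"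
  obtains d where "0 < d" "\<And>x. x \<in> K \<Longrightarrow> d \<le> f x"
proof (cases "K = {}")
  case False
  then obtain x where "x \<in> K" "\<And>y. y \<in> K \<Longrightarrow> f x \<le> f y"
    using continuous_attains_inf[OF assms(1) _ assms(2)] by blast
  then show ?thesis using that[of "f x"] assms(3) by blast
qed (use that[of 1] in auto)

text \<open>The density is continuous and positive, hence bounded away from 0 on \<open>K\<close>;
  the resulting constant serves all \<open>f\<close> at once.\<close>

lemma chart_compact_integral_le:
  assumes c: "c \<in> A" and K: "compact K" "K \<subseteq> snd c ` fst c"
  obtains C where "0 \<le> C" "\<And>f :: 'a \<Rightarrow> ennreal. f \<in> borel_measurable vol \<Longrightarrow> (\<integral>\<^sup>+x\<in>K. f (chart_inv c x) \<partial>lborel) \<le> ennreal C * (\<integral>\<^sup>+p. f p \<partial>vol)"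
proof -
  obtain d where d: "0 < d" "\<And>x. x \<in> K \<Longrightarrow> d \<le> dens c x"
    using compact_lower_bound[OF K(1) continuous_on_subset[OF dens_continuous[OF c] K(2)]] dens_pos[OF c] K(2) by blast
  show ?thesis
  proof (rule that[of "1 / d"])
    show "0 \<le> 1 / d" using d by simp
    fix f :: "'a \<Rightarrow> ennreal" assume f: "f \<in> borel_measurable vol"
    let ?V = "snd c ` fst c"
    have "(\<integral>\<^sup>+x\<in>K. f (chart_inv c x) \<partial>lborel) \<le> (\<integral>\<^sup>+x. ennreal (1 / d) * (ennreal (indicator ?V x * dens c x) * (f (chart_inv c x) * indicator ?V x)) \<partial>lborel)"
    proof (intro nn_integral_mono)
      fix x
      show "f (chart_inv c x) * indicator K x \<le> ennreal (1 / d) * (ennreal (indicator ?V x * dens c x) * (f (chart_inv c x) * indicator ?V x))"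
      proof (cases "x \<in> K")
        case True
        then have "1 \<le> (1 / d) * dens c x" using d by (simp add: field_simps)
        then have "1 \<le> ennreal ((1 / d) * dens c x)" using ennreal_leI by fastforce
        then have "1 * f (chart_inv c x) \<le> ennreal ((1 / d) * dens c x) * f (chart_inv c x)" by (intro mult_right_mono) auto
        moreover have "ennreal ((1 / d) * dens c x) = ennreal (1 / d) * ennreal (dens c x)" using d(1) by (intro ennreal_mult') auto
        moreover have "x \<in> ?V" using True K(2) by auto
        ultimately show ?thesis using True by (simp add: mult.assoc)
      qed simp
    qed
    also have "\<dots> = ennreal (1 / d) * (\<integral>\<^sup>+p\<in>fst c. f p \<partial>vol)"
      using chart_nn_integral[OF c f] dens_measurable[OF c] by (subst nn_integral_cmult) auto
    also have "\<dots> \<le> ennreal (1 / d) * (\<integral>\<^sup>+p. f p \<partial>vol)"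
      by (intro mult_left_mono nn_integral_mono) (auto simp: indicator_def)
    finally show "(\<integral>\<^sup>+x\<in>K. f (chart_inv c x) \<partial>lborel) \<le> ennreal (1 / d) * (\<integral>\<^sup>+p. f p \<partial>vol)" .
  qed
qed

text \<open>Each point has a neighbourhood whose chart image lies in a closed ball on which the
  density is bounded; finitely many of these cover \<open>M\<close>.\<close>

lemma finite_measure_vol: "finite_measure vol"
proof
  have "\<exists>V. openin (top_of_set M) V \<and> p \<in> V \<and> emeasure vol V < \<infinity> \<and> V \<in> sets vol" if p: "p \<in> M" for p
  proof -
    obtain c where c: "c \<in> A" "p \<in> fst c" using cover p by blast
    let ?x = "snd c p"
    obtain r where r: "0 < r" "cball ?x r \<subseteq> snd c ` fst c"
      using chart_open[OF c(1)] c(2) open_contains_cball by blast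
    let ?V = "fst c \<inter> snd c -` ball ?x r"
    have "openin (top_of_set (fst c)) ?V"
      using chart_cont[OF c(1)] by (intro continuous_openin_preimage_gen) auto
    then have V: "openin (top_of_set M) ?V" using chart_openin[OF c(1)] by (rule openin_trans)
    then have Vb: "?V \<in> sets borel" using borel_M by (auto simp: openin_open)
    have "compact (cball ?x r)" by simp
    then obtain K where K: "\<And>x. x \<in> cball ?x r \<Longrightarrow> dens c x \<le> K"
      using compact_continuous_image[OF continuous_on_subset[OF dens_continuous[OF c(1)] r(2)]]
      by (metis bounded_has_Sup(1) compact_imp_bounded cSup_upper bounded_imp_bdd_above image_eqI)
    have "emeasure vol ?V = (\<integral>\<^sup>+x\<in>snd c ` ?V. ennreal (dens c x) \<partial>lborel)"
      using emeasure_vol[OF c(1) Vb] by (simp add: chart_volume_def)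
    also have "\<dots> \<le> (\<integral>\<^sup>+x. ennreal K * indicator (cball ?x r) x \<partial>lborel)"
      using K by (intro nn_integral_mono) (auto simp: indicator_def intro!: ennreal_leI)
    also have "\<dots> < \<infinity>"
      using emeasure_compact_finite[of "cball ?x r"] by (simp add: nn_integral_cmult_indicator ennreal_mult_less_top)
    finally show ?thesis using V Vb c(2) r(1) chart_subset[OF c(1)] by (intro exI[of _ ?V]) (auto simp: sets_vol)
  qed
  then obtain V where V: "\<And>p. p \<in> M \<Longrightarrow> openin (top_of_set M) (V p) \<and> p \<in> V p \<and> emeasure vol (V p) < \<infinity> \<and> V p \<in> sets vol"
    by metis
  have "\<exists>D\<subseteq>V ` M. finite D \<and> M \<subseteq> \<Union>D"
  proof (rule compact[unfolded compact_eq_openin_cover, rule_format], intro conjI ballI)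
    show "openin (top_of_set M) U" if "U \<in> V ` M" for U using that V by auto
    show "M \<subseteq> \<Union>(V ` M)" using V by auto
  qed
  then obtain D where D: "D \<subseteq> V ` M" "finite D" "M \<subseteq> \<Union>D" by blast
  have "emeasure vol (space vol) \<le> emeasure vol (\<Union>D)"
    using D V by (intro emeasure_mono) (auto simp: space_vol intro!: sets.finite_Union)
  also have "\<dots> \<le> (\<Sum>U\<in>D. emeasure vol U)"
    using emeasure_subadditive_finite[OF D(2), of "\<lambda>U. U" vol] D(1) V by auto
  also have "\<dots> < \<infinity>"
  proof -
    have "emeasure vol U < top" if "U \<in> D" for U using D(1) V that by auto
    then show ?thesis using D(2) by simp
  qed
  finally show "emeasure vol (space vol) \<noteq> \<infinity>" by simp
qed

text \<open>The density is positive on the chart image, so the chart preserves null sets in both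
  directions.\<close>

lemma AE_chart_iff:
  assumes c: "c \<in> A" and P: "{p \<in> M. P p} \<in> sets vol"
  shows "(AE p in vol. p \<in> fst c \<longrightarrow> P p) \<longleftrightarrow> (AE x in lborel. x \<in> snd c ` fst c \<longrightarrow> P (chart_inv c x))"
proof -
  let ?f = "\<lambda>p. indicator {p \<in> M. \<not> P p} p :: ennreal"
  let ?V = "snd c ` fst c"
  have "{p \<in> M. \<not> P p} = space vol - {p \<in> M. P p}" by (auto simp: space_vol)
  then have sets: "{p \<in> M. \<not> P p} \<in> sets vol" using P by simp
  then have f: "?f \<in> borel_measurable vol" by simp
  have [measurable]: "fst c \<in> sets vol" by (rule chart_sets_vol[OF c])
  have "(AE p in vol. p \<in> fst c \<longrightarrow> P p) \<longleftrightarrow> (AE p in vol. ?f p * indicator (fst c) p = 0)"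
    by (intro AE_cong) (auto simp: space_vol indicator_def)
  also have "\<dots> \<longleftrightarrow> (\<integral>\<^sup>+p\<in>fst c. ?f p \<partial>vol) = 0"
    using f by (subst nn_integral_0_iff_AE) auto
  also have "\<dots> \<longleftrightarrow> (AE x in lborel. ennreal (indicator ?V x * dens c x) * (?f (chart_inv c x) * indicator ?V x) = 0)"
    unfolding chart_nn_integral(2)[OF c f] using chart_nn_integral(1)[OF c f] dens_measurable[OF c]
    by (subst nn_integral_0_iff_AE) auto
  also have "\<dots> \<longleftrightarrow> (AE x in lborel. x \<in> ?V \<longrightarrow> P (chart_inv c x))"
  proof (intro AE_cong)
    fix x
    show "ennreal (indicator ?V x * dens c x) * (?f (chart_inv c x) * indicator ?V x) = 0 \<longleftrightarrow> (x \<in> ?V \<longrightarrow> P (chart_inv c x))"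
    proof (cases "x \<in> ?V")
      case True
      then have "chart_inv c x \<in> M" using chart_inv_in[OF c] chart_subset[OF c] by auto
      then show ?thesis using True dens_pos[OF c True] by (auto simp: indicator_def)
    qed simp
  qed
  finally show ?thesis .
qed

end

section \<open>One-forms and the Dirichlet energy\<close>

lemma matrix_inv_solves:
  fixes P :: "real ^ 'm::finite ^ 'm"
  assumes "det P \<noteq> 0"
  shows "P *v (matrix_inv P *v z) = z" "matrix_inv P *v (P *v z) = z"
proof -
  have "\<exists>Q. P ** Q = mat 1 \<and> Q ** P = mat 1"
    using assms invertible_det_nz[of P] by (auto simp: invertible_def)
  then have "P ** matrix_inv P = mat 1 \<and> matrix_inv P ** P = mat 1"
    unfolding matrix_inv_def by (rule someI_ex)
  then show "P *v (matrix_inv P *v z) = z" "matrix_inv P *v (P *v z) = z"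
    by (simp_all add: matrix_vector_mul_assoc)
qed

text \<open>Expresses the inverse through determinants in the entries, from which measurability in
  the base point can be read off.\<close>

lemma matrix_inv_cramer:
  fixes P :: "real ^ 'm::finite ^ 'm"
  assumes "det P \<noteq> 0"
  shows "matrix_inv P *v z = (\<chi> k. det (\<chi> i j. if j = k then z $ i else P $ i $ j) / det P)"
  using cramer[OF assms, of "matrix_inv P *v z" z] matrix_inv_solves(1)[OF assms] by blast

lemma symmetric_matrix_inner:
  fixes P :: "real ^ 'm::finite ^ 'm"
  assumes "transpose P = P"
  shows "(P *v x) \<bullet> y = x \<bullet> (P *v y)"
  using dot_lmul_matrix[of x P y] assms by (metis transpose_matrix_vector)

lemma borel_measurable_vec_nth:
  fixes f :: "'b \<Rightarrow> real ^ 'm::finite"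
  assumes "f \<in> borel_measurable N"
  shows "(\<lambda>x. f x $ i) \<in> borel_measurable N"
  using assms borel_measurable_continuous_onI[of "\<lambda>v :: real ^ 'm. v $ i"]
  by (intro measurable_compose[OF assms]) (auto intro: continuous_intros)

lemma borel_measurable_det:
  fixes f :: "'b \<Rightarrow> real ^ 'm::finite ^ 'm"
  assumes [measurable]: "\<And>i j. (\<lambda>x. f x $ i $ j) \<in> borel_measurable N"
  shows "(\<lambda>x. det (f x)) \<in> borel_measurable N"
  unfolding det_def by measurable

context closed_riemannian_manifold
begin

text \<open>The inner product that the metric induces on covectors: the polarization of
  \<open>one_form_normsq\<close> within one chart.\<close>

definition covector_inner :: "('a, 'n) chart \<Rightarrow> real ^ 'n \<Rightarrow> real ^ 'n \<Rightarrow> real ^ 'n \<Rightarrow> real" where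
  "covector_inner c x \<xi> \<zeta> = \<xi> \<bullet> (matrix_inv (g c x) *v \<zeta>)"

lemma covector_inner_linear:
  "covector_inner c x (\<xi> + \<xi>') \<zeta> = covector_inner c x \<xi> \<zeta> + covector_inner c x \<xi>' \<zeta>"
  "covector_inner c x \<zeta> (\<xi> + \<xi>') = covector_inner c x \<zeta> \<xi> + covector_inner c x \<zeta> \<xi>'"
  "covector_inner c x (r *\<^sub>R \<xi>) \<zeta> = r * covector_inner c x \<xi> \<zeta>"
  "covector_inner c x \<zeta> (r *\<^sub>R \<xi>) = r * covector_inner c x \<zeta> \<xi>"
  by (simp_all add: covector_inner_def inner_add_left inner_add_right matrix_vector_right_distrib matrix_vector_mult_scaleR)

lemma metric_inverse:
  assumes "c \<in> A" "x \<in> snd c ` fst c"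
  shows "g c x *v (matrix_inv (g c x) *v \<xi>) = \<xi>" "matrix_inv (g c x) *v (g c x *v \<xi>) = \<xi>"
  using matrix_inv_solves det_metric_pos[OF assms] by (metis less_irrefl)+

lemma covector_inner_eq:
  assumes "c \<in> A" "x \<in> snd c ` fst c"
  shows "covector_inner c x \<xi> \<zeta> = (matrix_inv (g c x) *v \<xi>) \<bullet> (g c x *v (matrix_inv (g c x) *v \<zeta>))"
  using symmetric_matrix_inner[OF metric_symmetric[OF assms], of "matrix_inv (g c x) *v \<xi>" "matrix_inv (g c x) *v \<zeta>"]
  by (simp add: covector_inner_def metric_inverse[OF assms])

lemma covector_inner_commute:
  assumes "c \<in> A" "x \<in> snd c ` fst c"
  shows "covector_inner c x \<xi> \<zeta> = covector_inner c x \<zeta> \<xi>"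
  unfolding covector_inner_eq[OF assms]
  using symmetric_matrix_inner[OF metric_symmetric[OF assms], of "matrix_inv (g c x) *v \<zeta>" "matrix_inv (g c x) *v \<xi>"]
  by (simp add: inner_commute)

lemma covector_inner_nonneg:
  assumes "c \<in> A" "x \<in> snd c ` fst c"
  shows "0 \<le> covector_inner c x \<xi> \<xi>"
  unfolding covector_inner_eq[OF assms]
  using metric_positive[OF assms, of "matrix_inv (g c x) *v \<xi>"]
  by (cases "matrix_inv (g c x) *v \<xi> = 0") (auto intro: less_imp_le)

lemma metric_positive_Cauchy_Schwarz:
  assumes c: "c \<in> A" "x \<in> snd c ` fst c"
  shows "(y \<bullet> (g c x *v v))\<^sup>2 \<le> (y \<bullet> (g c x *v y)) * (v \<bullet> (g c x *v v))"
proof (rule quadratic_nonneg_imp)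
  have pos: "0 \<le> w \<bullet> (g c x *v w)" for w
    using metric_positive[OF c, of w] by (cases "w = 0") (auto intro: less_imp_le)
  show "0 \<le> v \<bullet> (g c x *v v)" by (rule pos)
  fix t :: real
  have "v \<bullet> (g c x *v y) = y \<bullet> (g c x *v v)"
    using symmetric_matrix_inner[OF metric_symmetric[OF c], of v y] by (simp add: inner_commute)
  then have "(y + t *\<^sub>R v) \<bullet> (g c x *v (y + t *\<^sub>R v)) = y \<bullet> (g c x *v y) + 2 * t * (y \<bullet> (g c x *v v)) + t\<^sup>2 * (v \<bullet> (g c x *v v))"
    by (simp add: matrix_vector_right_distrib matrix_vector_mult_scaleR inner_add_left inner_add_right power2_eq_square algebra_simps)
  then show "0 \<le> y \<bullet> (g c x *v y) + 2 * t * (y \<bullet> (g c x *v v)) + t\<^sup>2 * (v \<bullet> (g c x *v v))"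
    using pos[of "y + t *\<^sub>R v"] by simp
qed

text \<open>With \<open>v = g\<inverse> \<xi>\<close>, the Cauchy-Schwarz inequality bounds \<open>\<bar>\<xi>\<bar>\<^sup>4 = (\<xi> \<bullet> g v)\<^sup>2\<close>.\<close>

lemma norm_le_covector_inner:
  assumes c: "c \<in> A" "x \<in> snd c ` fst c" and L: "onorm ((*v) (g c x)) \<le> L"
  shows "(norm \<xi>)\<^sup>2 \<le> L * covector_inner c x \<xi> \<xi>"
proof (cases "\<xi> = 0")
  case True
  then show ?thesis by (simp add: covector_inner_def)
next
  case False
  let ?v = "matrix_inv (g c x) *v \<xi>"
  have gv: "g c x *v ?v = \<xi>" by (rule metric_inverse(1)[OF c])
  have q: "?v \<bullet> (g c x *v ?v) = covector_inner c x \<xi> \<xi>" using covector_inner_eq[OF c, of \<xi> \<xi>] by simp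
  have "(\<xi> \<bullet> \<xi>)\<^sup>2 \<le> (\<xi> \<bullet> (g c x *v \<xi>)) * covector_inner c x \<xi> \<xi>"
    using metric_positive_Cauchy_Schwarz[OF c, of \<xi> ?v] q unfolding gv by simp
  also have "\<dots> \<le> (L * (norm \<xi>)\<^sup>2) * covector_inner c x \<xi> \<xi>"
  proof (rule mult_right_mono)
    have "\<xi> \<bullet> (g c x *v \<xi>) \<le> norm \<xi> * norm (g c x *v \<xi>)" by (rule norm_cauchy_schwarz)
    also have "norm (g c x *v \<xi>) \<le> L * norm \<xi>"
      using onorm[OF matrix_vector_mul_bounded_linear, of "g c x" \<xi>] mult_right_mono[OF L norm_ge_zero[of \<xi>]] by linarith
    then have "norm \<xi> * norm (g c x *v \<xi>) \<le> norm \<xi> * (L * norm \<xi>)" by (intro mult_left_mono) auto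
    finally show "\<xi> \<bullet> (g c x *v \<xi>) \<le> L * (norm \<xi>)\<^sup>2" by (simp add: power2_eq_square mult_ac)
  qed (rule covector_inner_nonneg[OF c])
  finally have le: "(norm \<xi>)\<^sup>2 * (norm \<xi>)\<^sup>2 \<le> (norm \<xi>)\<^sup>2 * (L * covector_inner c x \<xi> \<xi>)"
    by (simp add: power2_norm_eq_inner[symmetric] power2_eq_square mult_ac)
  have "0 < (norm \<xi>)\<^sup>2" using False by simp
  with le show ?thesis by (rule mult_left_le_imp_le)
qed

lemma metric_onorm_bound:
  assumes c: "c \<in> A" and K: "compact K" "K \<subseteq> snd c ` fst c"
  obtains L where "0 < L" "\<And>x. x \<in> K \<Longrightarrow> onorm ((*v) (g c x)) \<le> L"
proof -
  have "bounded (g c ` K)"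
    by (intro compact_imp_bounded compact_continuous_image continuous_on_subset[OF metric_continuous[OF c]] K)
  then obtain b where b: "\<And>x. x \<in> K \<Longrightarrow> norm (g c x) \<le> b" unfolding bounded_iff by auto
  show ?thesis
  proof (rule that[of "real CARD('n) * real CARD('n) * \<bar>b\<bar> + 1"])
    fix x assume "x \<in> K"
    have "\<bar>g c x $ i $ j\<bar> \<le> \<bar>b\<bar>" for i j
    proof -
      have "\<bar>g c x $ i $ j\<bar> \<le> norm (g c x $ i)" by (rule component_le_norm_cart)
      also have "\<dots> \<le> norm (g c x)" by (rule Finite_Cartesian_Product.norm_nth_le)
      finally show ?thesis using b[OF \<open>x \<in> K\<close>] by linarith
    qed
    then have "onorm ((*v) (g c x)) \<le> real CARD('n) * real CARD('n) * \<bar>b\<bar>"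
      by (rule onorm_le_matrix_component)
    then show "onorm ((*v) (g c x)) \<le> real CARD('n) * real CARD('n) * \<bar>b\<bar> + 1" by simp
  qed (auto intro: add_nonneg_pos)
qed

text \<open>Let \<open>v\<close> be the vector dual to the transformed \<open>\<zeta>\<close> in
  chart \<open>c\<close>. The transformation law of the metric says that the Jacobian maps
  \<open>v\<close> to the vector dual to \<open>\<zeta>\<close> in chart \<open>d\<close>, once the
  transposed Jacobian is cancelled; it is invertible because the metric in chart \<open>c\<close>
  has nonzero determinant. The pairing with \<open>\<xi>\<close> is then adjointness.\<close>

lemma covector_inner_transform:
  assumes c: "c \<in> A" and d: "d \<in> A" and x: "x \<in> overlap c d"
  shows "covector_inner c x (transpose (jacobian c d x) *v \<xi>) (transpose (jacobian c d x) *v \<zeta>) = covector_inner d (transition c d x) \<xi> \<zeta>"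
proof -
  let ?J = "jacobian c d x" and ?y = "transition c d x"
  have xc: "x \<in> snd c ` fst c" using x by (auto simp: overlap_def)
  have yd: "?y \<in> snd d ` fst d" using transition_transition(1)[OF c d x] by (auto simp: overlap_def)
  let ?v = "matrix_inv (g c x) *v (transpose ?J *v \<zeta>)"
  have "det ?J \<noteq> 0"
    using det_metric_pos[OF c xc] metric_transform[OF c d x] by (auto simp: det_mul)
  then have inj: "transpose ?J *v a = transpose ?J *v b \<Longrightarrow> a = b" for a b
    using matrix_inv_solves(2)[of "transpose ?J"] by (metis det_transpose)
  have "g c x *v ?v = transpose ?J *v \<zeta>" by (rule metric_inverse(1)[OF c xc])
  then have "transpose ?J *v (g d ?y *v (?J *v ?v)) = transpose ?J *v \<zeta>"
    unfolding metric_transform[OF c d x] by (simp add: matrix_vector_mul_assoc matrix_mul_assoc)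
  then have "g d ?y *v (?J *v ?v) = \<zeta>" by (rule inj)
  then have "matrix_inv (g d ?y) *v \<zeta> = ?J *v ?v" using metric_inverse(2)[OF d yd] by metis
  moreover have "(transpose ?J *v \<xi>) \<bullet> ?v = \<xi> \<bullet> (?J *v ?v)"
    by (metis dot_lmul_matrix transpose_matrix_vector)
  ultimately show ?thesis by (simp add: covector_inner_def)
qed

text \<open>The chart is chosen as in \<open>one_form_normsq\<close>, so that the diagonal agrees
  with it at every \<open>p\<close>.\<close>

definition form_inner where
  "form_inner \<omega> \<omega>' p = (let c = (SOME c. c \<in> A \<and> p \<in> fst c) in covector_inner c (snd c p) (\<omega> c (snd c p)) (\<omega>' c (snd c p)))"

lemma one_form_normsq_eq: "one_form_normsq A g \<omega> p = form_inner \<omega> \<omega> p"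
  by (simp add: one_form_normsq_def form_inner_def covector_inner_def Let_def)

lemma form_inner_chart:
  assumes "one_form A \<omega>" "one_form A \<omega>'" and d: "d \<in> A" "p \<in> fst d"
  shows "form_inner \<omega> \<omega>' p = covector_inner d (snd d p) (\<omega> d (snd d p)) (\<omega>' d (snd d p))"
proof -
  define c where "c = (SOME c. c \<in> A \<and> p \<in> fst c)"
  have c: "c \<in> A" "p \<in> fst c" using someI[of "\<lambda>c. c \<in> A \<and> p \<in> fst c" d] d by (auto simp: c_def)
  have x: "snd c p \<in> overlap c d" using c d by (auto simp: overlap_def)
  have t: "transition c d (snd c p) = snd d p" by (rule transition_apply[OF c])
  have "\<omega> c (snd c p) = transpose (jacobian c d (snd c p)) *v \<omega> d (snd d p)"
    "\<omega>' c (snd c p) = transpose (jacobian c d (snd c p)) *v \<omega>' d (snd d p)"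
    using assms(1,2) c d x t unfolding one_form_def by metis+
  then show ?thesis
    using covector_inner_transform[OF c(1) d(1) x] t by (simp add: form_inner_def c_def[symmetric] Let_def)
qed

text \<open>Only values on the chart image count, so the coefficients are extended by 0. The
  transformation law at every point makes pointwise inner products independent of the chart.\<close>

definition measurable_form where
  "measurable_form \<omega> \<longleftrightarrow> one_form A \<omega> \<and> (\<forall>c\<in>A. (\<lambda>x. indicator (snd c ` fst c) x *\<^sub>R \<omega> c x) \<in> borel_measurable borel)"

lemma measurable_form_one_form: "measurable_form \<omega> \<Longrightarrow> one_form A \<omega>"
  by (simp add: measurable_form_def)

lemma one_form_add: "one_form A \<omega> \<Longrightarrow> one_form A \<omega>' \<Longrightarrow> one_form A (\<lambda>c x. \<omega> c x + \<omega>' c x)"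
  unfolding one_form_def by (metis matrix_vector_right_distrib)

lemma one_form_scale: "one_form A \<omega> \<Longrightarrow> one_form A (\<lambda>c x. r *\<^sub>R \<omega> c x)"
  unfolding one_form_def by (metis matrix_vector_mult_scaleR)

lemma measurable_form_add:
  assumes "measurable_form \<omega>" "measurable_form \<omega>'"
  shows "measurable_form (\<lambda>c x. \<omega> c x + \<omega>' c x)"
  unfolding measurable_form_def scaleR_add_right
  using assms one_form_add[of \<omega> \<omega>'] by (intro conjI ballI borel_measurable_add) (simp_all add: measurable_form_def)

lemma measurable_form_scale:
  assumes "measurable_form \<omega>"
  shows "measurable_form (\<lambda>c x. r *\<^sub>R \<omega> c x)"
  unfolding measurable_form_def scaleR_left_commute[of _ r]
  using assms one_form_scale[of \<omega> r]
  by (intro conjI ballI borel_measurable_scaleR[OF borel_measurable_const]) (simp_all add: measurable_form_def)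

text \<open>Cramer's rule turns the inverse matrix into a rational expression in entries that are
  Borel after extension by 0. Outside the chart image the leading indicator makes the value
  0.\<close>

lemma covector_inner_measurable:
  assumes c: "c \<in> A" and m: "measurable_form \<omega>" "measurable_form \<omega>'"
  shows "(\<lambda>x. indicator (snd c ` fst c) x * covector_inner c x (\<omega> c x) (\<omega>' c x)) \<in> borel_measurable borel"
proof -
  let ?V = "snd c ` fst c"
  have [measurable]: "?V \<in> sets borel" by (rule chart_image_borel[OF c])
  have w: "(\<lambda>x. (indicator ?V x *\<^sub>R \<omega> c x) $ k) \<in> borel_measurable borel"
    "(\<lambda>x. (indicator ?V x *\<^sub>R \<omega>' c x) $ k) \<in> borel_measurable borel" for k
    using m c by (auto simp only: measurable_form_def intro!: borel_measurable_vec_nth)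
  have gm: "(\<lambda>x. indicator ?V x *\<^sub>R (g c x $ i $ j)) \<in> borel_measurable borel" for i j
    using borel_measurable_continuous_on_indicator[OF chart_image_borel[OF c], of "\<lambda>x. g c x $ i $ j"]
      continuous_on_component[OF continuous_on_component[OF metric_continuous[OF c]], of i j] by simp
  have "(\<lambda>x. indicator ?V x * (\<Sum>k\<in>UNIV. (indicator ?V x *\<^sub>R \<omega> c x) $ k *
     (det (\<chi> i j. if j = k then (indicator ?V x *\<^sub>R \<omega>' c x) $ i else indicator ?V x *\<^sub>R (g c x $ i $ j)) / det (\<chi> i j. indicator ?V x *\<^sub>R (g c x $ i $ j)))))
    \<in> borel_measurable borel"
  proof (intro borel_measurable_times borel_measurable_sum borel_measurable_divide borel_measurable_det)
    show "(\<lambda>x. (\<chi> i j. if j = k then (indicator ?V x *\<^sub>R \<omega>' c x) $ i else indicator ?V x *\<^sub>R (g c x $ i $ j)) $ i $ j) \<in> borel_measurable borel" for k i j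
      using w(2)[of i] gm[of i j] by (cases "j = k") auto
    show "(\<lambda>x. (\<chi> i j. indicator ?V x *\<^sub>R (g c x $ i $ j)) $ i $ j) \<in> borel_measurable borel" for i j
      using gm[of i j] by simp
  qed (use w in auto)
  moreover have "indicator ?V x * (\<Sum>k\<in>UNIV. (indicator ?V x *\<^sub>R \<omega> c x) $ k *
     (det (\<chi> i j. if j = k then (indicator ?V x *\<^sub>R \<omega>' c x) $ i else indicator ?V x *\<^sub>R (g c x $ i $ j)) / det (\<chi> i j. indicator ?V x *\<^sub>R (g c x $ i $ j))))
    = indicator ?V x * covector_inner c x (\<omega> c x) (\<omega>' c x)" for x
  proof (cases "x \<in> ?V")
    case True
    have "det (g c x) \<noteq> 0" using det_metric_pos[OF c True] by simp
    moreover have "indicator ?V x = (1 :: real)" using True by simp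
    ultimately show ?thesis
      unfolding covector_inner_def matrix_inv_cramer[OF \<open>det (g c x) \<noteq> 0\<close>]
      by (simp only: scaleR_one mult_1 inner_vec_def vec_nth_inverse vec_lambda_beta vec_lambda_eta vec_nth_inverse inner_real_def)
  qed simp
  ultimately show ?thesis by (simp only:)
qed

lemma measurable_vol_if_charts:
  fixes f :: "'a \<Rightarrow> real"
  assumes "\<And>c. c \<in> A \<Longrightarrow> \<exists>h\<in>borel_measurable borel. \<forall>p\<in>fst c. f p = h (snd c p)"
  shows "f \<in> borel_measurable vol"
proof -
  obtain N :: nat and e :: "nat \<Rightarrow> ('a, 'n) chart" and P :: "nat \<Rightarrow> 'a set"
    where e: "\<And>i. i < N \<Longrightarrow> e i \<in> A" and P: "\<And>i. i < N \<Longrightarrow> P i \<subseteq> fst (e i)" "\<And>i. P i \<in> sets borel"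
      "disjoint_family P" "(\<Union>i<N. P i) = M"
    using atlas_partition by metis
  have "f \<in> borel_measurable (restrict_space vol (fst (e i)))" if i: "i < N" for i
  proof -
    obtain h where h: "h \<in> borel_measurable borel" "\<forall>p\<in>fst (e i). f p = h (snd (e i) p)"
      using assms[OF e[OF i]] by blast
    have "sets (restrict_space vol (fst (e i))) = sets (restrict_space borel (fst (e i)))"
      using chart_subset[OF e[OF i]] by (auto simp: sets_restrict_space sets_vol_eq image_image Int_absorb1 intro!: image_cong)
    then have "snd (e i) \<in> measurable (restrict_space vol (fst (e i))) borel"
      using measurable_chart[OF e[OF i]] by (simp cong: measurable_cong_sets)
    from measurable_compose[OF this h(1)]
    show ?thesis using h(2) by (subst measurable_cong) (auto simp: space_restrict_space)
  qed
  note m = this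
  show ?thesis
  proof (rule measurable_piecewise_restrict[where C = "(\<lambda>i. fst (e i)) ` {..<N}"])
    show "countable ((\<lambda>i. fst (e i)) ` {..<N})" by simp
    show "X \<inter> space vol \<in> sets vol" if "X \<in> (\<lambda>i. fst (e i)) ` {..<N}" for X
      using that chart_sets_vol[OF e] by auto
    show "space vol \<subseteq> \<Union>((\<lambda>i. fst (e i)) ` {..<N})"
    proof
      fix p assume "p \<in> space vol"
      then obtain i where "i < N" "p \<in> P i" using P(4) unfolding space_vol by blast
      then show "p \<in> \<Union>((\<lambda>i. fst (e i)) ` {..<N})" using P(1) by blast
    qed
    show "f \<in> borel_measurable (restrict_space vol X)" if "X \<in> (\<lambda>i. fst (e i)) ` {..<N}" for X
      using that m by blast
  qed
qed

lemma form_inner_measurable: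
  assumes m: "measurable_form \<omega>" "measurable_form \<omega>'"
  shows "form_inner \<omega> \<omega>' \<in> borel_measurable vol"
proof (rule measurable_vol_if_charts)
  fix c assume c: "c \<in> A"
  show "\<exists>h\<in>borel_measurable borel. \<forall>p\<in>fst c. form_inner \<omega> \<omega>' p = h (snd c p)"
    using covector_inner_measurable[OF c m] form_inner_chart[OF measurable_form_one_form[OF m(1)] measurable_form_one_form[OF m(2)] c]
    by (intro bexI[of _ "\<lambda>x. indicator (snd c ` fst c) x * covector_inner c x (\<omega> c x) (\<omega>' c x)"]) auto
qed

lemma form_inner_linear:
  "form_inner (\<lambda>c x. \<omega> c x + \<omega>' c x) \<theta> p = form_inner \<omega> \<theta> p + form_inner \<omega>' \<theta> p"
  "form_inner \<theta> (\<lambda>c x. \<omega> c x + \<omega>' c x) p = form_inner \<theta> \<omega> p + form_inner \<theta> \<omega>' p"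
  "form_inner (\<lambda>c x. r *\<^sub>R \<omega> c x) \<theta> p = r * form_inner \<omega> \<theta> p"
  "form_inner \<theta> (\<lambda>c x. r *\<^sub>R \<omega> c x) p = r * form_inner \<theta> \<omega> p"
  by (simp_all add: form_inner_def covector_inner_linear Let_def)

lemma chosen_chart:
  assumes "p \<in> M"
  shows "(SOME c. c \<in> A \<and> p \<in> fst c) \<in> A" "p \<in> fst (SOME c. c \<in> A \<and> p \<in> fst c)"
proof -
  have "\<exists>c. c \<in> A \<and> p \<in> fst c" using assms cover by blast
  from someI_ex[OF this] show "(SOME c. c \<in> A \<and> p \<in> fst c) \<in> A" "p \<in> fst (SOME c. c \<in> A \<and> p \<in> fst c)" by auto
qed

lemma form_inner_commute: "p \<in> M \<Longrightarrow> form_inner \<omega> \<omega>' p = form_inner \<omega>' \<omega> p"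
  unfolding form_inner_def Let_def using chosen_chart[of p] by (intro covector_inner_commute) auto

lemma form_inner_nonneg: "p \<in> M \<Longrightarrow> 0 \<le> form_inner \<omega> \<omega> p"
  unfolding form_inner_def Let_def using chosen_chart[of p] by (intro covector_inner_nonneg) auto

lemma form_inner_le:
  assumes p: "p \<in> M"
  shows "\<bar>form_inner \<omega> \<omega>' p\<bar> \<le> form_inner \<omega> \<omega> p + form_inner \<omega>' \<omega>' p"
proof -
  have "0 \<le> form_inner (\<lambda>c x. \<omega> c x + \<omega>' c x) (\<lambda>c x. \<omega> c x + \<omega>' c x) p"
    "0 \<le> form_inner (\<lambda>c x. \<omega> c x + (-1) *\<^sub>R \<omega>' c x) (\<lambda>c x. \<omega> c x + (-1) *\<^sub>R \<omega>' c x) p"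
    "0 \<le> form_inner \<omega> \<omega> p" "0 \<le> form_inner \<omega>' \<omega>' p"
    by (intro form_inner_nonneg p)+
  then show ?thesis
    using form_inner_commute[OF p, of \<omega> \<omega>'] unfolding form_inner_linear abs_le_iff by linarith
qed

text \<open>Local integrability gives measurability on closed boxes, and countably many of them
  cover the chart image.\<close>

lemma weak_differential_measurable:
  assumes "is_weak_differential A u \<omega>"
  shows "measurable_form \<omega>"
  unfolding measurable_form_def
proof (intro conjI ballI)
  show "one_form A \<omega>" using assms by (simp add: is_weak_differential_def)
  fix c assume c: "c \<in> A"
  let ?V = "snd c ` fst c" and ?f = "\<lambda>x. indicator (snd c ` fst c) x *\<^sub>R \<omega> c x"
  have wg: "weak_gradient_on ?V (u \<circ> chart_inv c) (\<omega> c)" using assms c by (auto simp: is_weak_differential_def)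
  obtain D where D: "countable D" "D \<subseteq> Pow ?V" "\<And>X. X \<in> D \<Longrightarrow> \<exists>a b. X = cbox a b" "\<Union>D = ?V"
    using open_countable_Union_open_cbox[OF chart_open[OF c]] by blast
  show "?f \<in> borel_measurable borel"
  proof (rule measurable_piecewise_restrict[where C = "insert (- ?V) D"])
    show "countable (insert (- ?V) D)" using D by simp
    show "X \<inter> space borel \<in> sets borel" if "X \<in> insert (- ?V) D" for X
      using that D(3)[of X] chart_image_borel[OF c] by auto
    show "space borel \<subseteq> \<Union>(insert (- ?V) D)" using D(4) by auto
    fix X assume X: "X \<in> insert (- ?V) D"
    show "?f \<in> borel_measurable (restrict_space borel X)"
    proof (cases "X \<in> D")
      case True
      then obtain a b where "X = cbox a b" using D(3) by blast
      then have "set_integrable lborel X (\<omega> c)" using wg True D(2) by (auto simp: weak_gradient_on_def)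
      then have "(\<lambda>x. indicator X x *\<^sub>R \<omega> c x) \<in> borel_measurable borel" unfolding set_integrable_def by auto
      then have "(\<lambda>x. indicator X x *\<^sub>R \<omega> c x) \<in> borel_measurable (restrict_space borel X)" by (rule measurable_restrict_space1)
      then show ?thesis
        by (rule measurable_cong[THEN iffD1, rotated]) (use True D(2) in \<open>auto simp: space_restrict_space indicator_def\<close>)
    next
      case False
      then have "X = - ?V" using X by simp
      then have "?f x = 0" if "x \<in> space (restrict_space borel X)" for x using that by (simp add: space_restrict_space)
      then show ?thesis by (subst measurable_cong[where g = "\<lambda>x. 0"]) auto
    qed
  qed
qed

text \<open>The predicate \<open>Q\<close> may fail to be measurable, so its exceptional set is
  first enlarged to a Borel null set.\<close>

lemma AE_chart_push:
  assumes c: "c \<in> A" and Q: "AE x in lborel. x \<in> snd c ` fst c \<longrightarrow> Q x"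
  shows "AE p in vol. p \<in> fst c \<longrightarrow> Q (snd c p)"
proof -
  obtain N where N: "N \<in> null_sets lborel" "{x \<in> space lborel. \<not> (x \<in> snd c ` fst c \<longrightarrow> Q x)} \<subseteq> N"
    using Q unfolding eventually_ae_filter by blast
  let ?P = "\<lambda>p. p \<in> fst c \<longrightarrow> snd c p \<notin> N"
  have Nb: "N \<in> sets borel" using N(1) by auto
  have "snd c -` N \<inter> space (restrict_space borel (fst c)) \<in> sets (restrict_space borel (fst c))"
    by (rule measurable_sets[OF measurable_chart[OF c] Nb])
  then have "snd c -` N \<inter> fst c \<in> sets borel"
    using chart_borel[OF c] by (auto simp: sets_restrict_space space_restrict_space)
  then have "M - (snd c -` N \<inter> fst c) \<in> sets vol" by (auto simp: sets_vol)
  moreover have "{p \<in> M. ?P p} = M - (snd c -` N \<inter> fst c)" by auto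
  ultimately have "{p \<in> M. ?P p} \<in> sets vol" by simp
  note iff = AE_chart_iff[OF c this]
  have "AE x in lborel. x \<notin> N" using N(1) by (rule AE_not_in)
  then have "AE x in lborel. x \<in> snd c ` fst c \<longrightarrow> ?P (chart_inv c x)"
    by eventually_elim (auto simp: chart_inv_right[OF c] chart_inv_left[OF c])
  then have "AE p in vol. p \<in> fst c \<longrightarrow> ?P p" using iff by blast
  then show ?thesis
    by eventually_elim (use N(2) in auto)
qed

text \<open>The atlas may be uncountable, so null sets are united over a finite subatlas only. The
  conclusion therefore speaks of some chart around \<open>p\<close>, which suffices for quantities
  that do not depend on the chart.\<close>

lemma AE_vol_charts:
  assumes "\<And>c. c \<in> A \<Longrightarrow> AE x in lborel. x \<in> snd c ` fst c \<longrightarrow> Q c x"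
  shows "AE p in vol. \<exists>c\<in>A. p \<in> fst c \<and> Q c (snd c p)"
proof -
  obtain N :: nat and e :: "nat \<Rightarrow> ('a, 'n) chart" where e: "\<And>i. i < N \<Longrightarrow> e i \<in> A" "(\<Union>i<N. fst (e i)) = M"
    using finite_atlas by metis
  have "AE p in vol. \<forall>i\<in>{..<N}. p \<in> fst (e i) \<longrightarrow> Q (e i) (snd (e i) p)"
    using e(1) assms by (intro AE_ball_countable' AE_chart_push) auto
  then show ?thesis
    using AE_space
  proof eventually_elim
    case (elim p)
    then obtain i where "i < N" "p \<in> fst (e i)" using e(2) by (auto simp: space_vol)
    then show ?case using elim(1) e(1) by (intro bexI[of _ "e i"]) auto
  qed
qed

lemma weak_differential_unique:
  assumes "is_weak_differential A u \<omega>" "is_weak_differential A u \<omega>'"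
  shows "AE p in vol. \<exists>c\<in>A. p \<in> fst c \<and> \<omega> c (snd c p) = \<omega>' c (snd c p)"
proof (rule AE_vol_charts)
  fix c assume c: "c \<in> A"
  show "AE x in lborel. x \<in> snd c ` fst c \<longrightarrow> \<omega> c x = \<omega>' c x"
    by (rule weak_gradient_on_unique[OF chart_open[OF c], of "u \<circ> chart_inv c"])
      (use assms c in \<open>auto simp: is_weak_differential_def\<close>)
qed

text \<open>Hence the choice made by \<open>SOME\<close> in \<open>weak_differential\<close> does
  not influence the energy, which may be computed with any weak differential.\<close>

lemma form_inner_unique:
  assumes u: "is_weak_differential A u \<omega>" "is_weak_differential A u \<omega>'"
    and v: "is_weak_differential A v \<theta>" "is_weak_differential A v \<theta>'"
  shows "AE p in vol. form_inner \<omega> \<theta> p = form_inner \<omega>' \<theta>' p"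
  using weak_differential_unique[OF u] weak_differential_unique[OF v]
proof eventually_elim
  case (elim p)
  have o: "one_form A \<omega>" "one_form A \<omega>'" "one_form A \<theta>" "one_form A \<theta>'"
    using u v by (auto simp: is_weak_differential_def)
  obtain c d where c: "c \<in> A" "p \<in> fst c" "\<omega> c (snd c p) = \<omega>' c (snd c p)"
    and d: "d \<in> A" "p \<in> fst d" "\<theta> d (snd d p) = \<theta>' d (snd d p)"
    using elim by blast
  have "form_inner \<omega> \<theta> p = form_inner \<omega>' \<theta> p"
    using form_inner_chart[OF o(1,3) c(1,2)] form_inner_chart[OF o(2,3) c(1,2)] c(3) by simp
  also have "\<dots> = form_inner \<omega>' \<theta>' p"
    using form_inner_chart[OF o(2,3) d(1,2)] form_inner_chart[OF o(2,4) d(1,2)] d(3) by simp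
  finally show ?case .
qed

lemma is_weak_differential_add:
  assumes "is_weak_differential A u \<omega>" "is_weak_differential A v \<theta>"
  shows "is_weak_differential A (\<lambda>p. u p + v p) (\<lambda>c x. \<omega> c x + \<theta> c x)"
  using assms one_form_add[of \<omega> \<theta>] weak_gradient_on_add unfolding is_weak_differential_def o_def by blast

lemma is_weak_differential_scale:
  assumes "is_weak_differential A u \<omega>"
  shows "is_weak_differential A (\<lambda>p. r * u p) (\<lambda>c x. r *\<^sub>R \<omega> c x)"
  using assms one_form_scale[of \<omega> r] weak_gradient_on_scale unfolding is_weak_differential_def o_def by blast

lemma is_weak_differential_diff:
  assumes "is_weak_differential A u \<omega>" "is_weak_differential A v \<theta>"
  shows "is_weak_differential A (\<lambda>p. u p - v p) (\<lambda>c x. \<omega> c x - \<theta> c x)"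
  using is_weak_differential_add[OF assms(1) is_weak_differential_scale[OF assms(2), of "-1"]] by simp

section \<open>The Dirichlet energy as a semidefinite form\<close>

abbreviation Sob :: "('a \<Rightarrow> real) set" where "Sob \<equiv> W12 M A g"

definition energy :: "('a \<Rightarrow> real) \<Rightarrow> ('a \<Rightarrow> real) \<Rightarrow> real" where
  "energy u v = (LINT p|vol. form_inner (weak_differential A u) (weak_differential A v) p)"

lemma dirichlet_energy_eq: "dirichlet_energy M A g u = energy u u"
  by (simp add: dirichlet_energy_def energy_def one_form_normsq_eq)

lemma one_form_normsq_eq': "one_form_normsq A g \<omega> = form_inner \<omega> \<omega>"
  by (rule ext) (rule one_form_normsq_eq)

lemma form_inner_integrable:
  assumes m: "measurable_form \<omega>" "measurable_form \<theta>"
    and i: "integrable vol (form_inner \<omega> \<omega>)" "integrable vol (form_inner \<theta> \<theta>)"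
  shows "integrable vol (form_inner \<omega> \<theta>)"
proof (rule Bochner_Integration.integrable_bound)
  show "integrable vol (\<lambda>p. form_inner \<omega> \<omega> p + form_inner \<theta> \<theta> p)" using i by simp
  show "form_inner \<omega> \<theta> \<in> borel_measurable vol" by (rule form_inner_measurable[OF m])
  show "AE p in vol. norm (form_inner \<omega> \<theta> p) \<le> norm (form_inner \<omega> \<omega> p + form_inner \<theta> \<theta> p)"
    using AE_space
  proof eventually_elim
    case (elim p)
    then have "p \<in> M" by (simp add: space_vol)
    then show ?case using form_inner_le[of p \<omega> \<theta>] by simp
  qed
qed

lemma Sob_I:
  assumes "u \<in> L2 vol" "is_weak_differential A u \<omega>" "integrable vol (form_inner \<omega> \<omega>)"
  shows "u \<in> Sob"
  using assms by (auto simp: W12_def L2_def one_form_normsq_eq')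

lemma Sob_D:
  assumes "u \<in> Sob"
  shows "u \<in> L2 vol" "is_weak_differential A u (weak_differential A u)"
    "is_weak_differential A u \<omega> \<Longrightarrow> integrable vol (form_inner \<omega> \<omega>)"
proof -
  obtain \<theta> where \<theta>: "is_weak_differential A u \<theta>" "integrable vol (form_inner \<theta> \<theta>)"
    using assms by (auto simp: W12_def one_form_normsq_eq')
  show "u \<in> L2 vol" using assms by (auto simp: W12_def L2_def)
  show "is_weak_differential A u (weak_differential A u)"
    unfolding weak_differential_def using someI[of "is_weak_differential A u", OF \<theta>(1)] .
  assume \<omega>: "is_weak_differential A u \<omega>"
  have m: "measurable_form \<omega>" by (rule weak_differential_measurable[OF \<omega>])
  show "integrable vol (form_inner \<omega> \<omega>)"
    by (rule integrable_cong_AE_imp[OF \<theta>(2) form_inner_measurable[OF m m] form_inner_unique[OF \<theta>(1) \<omega> \<theta>(1) \<omega>]])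
qed

lemma energy_eq:
  assumes "u \<in> Sob" "v \<in> Sob" "is_weak_differential A u \<omega>" "is_weak_differential A v \<theta>"
  shows "energy u v = (LINT p|vol. form_inner \<omega> \<theta> p)" "integrable vol (form_inner \<omega> \<theta>)"
proof -
  have m: "measurable_form \<omega>" "measurable_form \<theta>" "measurable_form (weak_differential A u)" "measurable_form (weak_differential A v)"
    using assms Sob_D weak_differential_measurable by blast+
  show "energy u v = (LINT p|vol. form_inner \<omega> \<theta> p)"
    unfolding energy_def
    by (rule integral_cong_AE[OF form_inner_measurable[OF m(3,4)] form_inner_measurable[OF m(1,2)]
        form_inner_unique[OF Sob_D(2)[OF assms(1)] assms(3) Sob_D(2)[OF assms(2)] assms(4)]])
  show "integrable vol (form_inner \<omega> \<theta>)"
    by (rule form_inner_integrable[OF m(1,2) Sob_D(3)[OF assms(1,3)] Sob_D(3)[OF assms(2,4)]])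
qed

lemma Sob_add:
  assumes "u \<in> Sob" "v \<in> Sob"
  shows "(\<lambda>p. u p + v p) \<in> Sob"
proof -
  let ?\<omega> = "weak_differential A u" and ?\<theta> = "weak_differential A v"
  note d = Sob_D(2)[OF assms(1)] Sob_D(2)[OF assms(2)]
  show ?thesis
  proof (rule Sob_I[OF L2_add[OF Sob_D(1)[OF assms(1)] Sob_D(1)[OF assms(2)]] is_weak_differential_add[OF d]])
    show "integrable vol (form_inner (\<lambda>c x. ?\<omega> c x + ?\<theta> c x) (\<lambda>c x. ?\<omega> c x + ?\<theta> c x))"
      unfolding form_inner_linear[abs_def]
      using energy_eq(2)[OF assms(1,1) d(1,1)] energy_eq(2)[OF assms(1,2) d(1,2)] energy_eq(2)[OF assms(2,1) d(2,1)] energy_eq(2)[OF assms(2,2) d(2,2)]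
      by (intro Bochner_Integration.integrable_add)
  qed
qed

lemma Sob_scale:
  assumes "u \<in> Sob"
  shows "(\<lambda>p. r * u p) \<in> Sob"
proof (rule Sob_I[OF L2_scale[OF Sob_D(1)[OF assms]] is_weak_differential_scale[OF Sob_D(2)[OF assms]]])
  show "integrable vol (form_inner (\<lambda>c x. r *\<^sub>R weak_differential A u c x) (\<lambda>c x. r *\<^sub>R weak_differential A u c x))"
    unfolding form_inner_linear[abs_def] using Sob_D(3)[OF assms Sob_D(2)[OF assms]] by simp
qed

lemma semi_inner_energy: "semi_inner Sob energy"
proof
  fix u v w r
  assume u: "u \<in> Sob"
  show "(\<lambda>p. r * u p) \<in> Sob" by (rule Sob_scale[OF u])
  note du = Sob_D(2)[OF u]
  show "0 \<le> energy u u"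
    unfolding energy_def by (rule integral_nonneg_AE) (auto simp: space_vol intro!: AE_I2 form_inner_nonneg)
  { assume w: "w \<in> Sob"
    show "energy (\<lambda>p. r * u p) w = r * energy u w"
      unfolding energy_eq(1)[OF Sob_scale[OF u] w is_weak_differential_scale[OF du] Sob_D(2)[OF w]] energy_eq(1)[OF u w du Sob_D(2)[OF w]]
      form_inner_linear[abs_def] by simp }
  assume v: "v \<in> Sob"
  note dv = Sob_D(2)[OF v]
  show "(\<lambda>p. u p + v p) \<in> Sob" by (rule Sob_add[OF u v])
  show "energy u v = energy v u"
    unfolding energy_def by (intro Bochner_Integration.integral_cong refl form_inner_commute) (simp add: space_vol)
  assume w: "w \<in> Sob"
  note dw = Sob_D(2)[OF w]
  show "energy (\<lambda>p. u p + v p) w = energy u w + energy v w"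
    unfolding energy_eq(1)[OF Sob_add[OF u v] w is_weak_differential_add[OF du dv] dw] form_inner_linear
    using energy_eq[OF u w du dw] energy_eq[OF v w dv dw] by simp
qed

lemma is_weak_differential_one: "is_weak_differential A (\<lambda>p. 1) (\<lambda>c x. 0)"
  unfolding is_weak_differential_def one_form_def o_def using weak_gradient_on_const by (auto simp: matrix_vector_mult_0_right)

lemma one_Sob: "(\<lambda>p. 1) \<in> Sob" "energy (\<lambda>p. 1) (\<lambda>p. 1) = 0"
proof -
  have z: "form_inner (\<lambda>c x. 0) (\<lambda>c x. 0) = (\<lambda>p. 0)" by (auto simp: form_inner_def covector_inner_def)
  interpret finite_measure vol by (rule finite_measure_vol)
  show 1: "(\<lambda>p. 1) \<in> Sob"
    by (rule Sob_I[OF _ is_weak_differential_one]) (auto simp: L2_def z)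
  show "energy (\<lambda>p. 1) (\<lambda>p. 1) = 0"
    unfolding energy_eq(1)[OF 1 1 is_weak_differential_one is_weak_differential_one] z by simp
qed

lemma exp_damp_has_derivative: "(exp_damp has_real_derivative (if 0 \<le> t then 1 else exp t)) (at t)"
proof (cases t "0::real" rule: linorder_cases)
  case less
  have "((\<lambda>t. exp t - 1) has_real_derivative exp t) (at t)" by (auto intro!: derivative_eq_intros)
  then have "(exp_damp has_real_derivative exp t) (at t)"
    by (rule DERIV_cong_ev[THEN iffD1, rotated -1])
      (use less in \<open>auto simp: exp_damp_def intro!: eventually_mono[OF eventually_nhds_in_open[of "{..<0}"]]\<close>)
  then show ?thesis using less by simp
next
  case greater
  have "((\<lambda>t. t) has_real_derivative 1) (at t)" by simp
  then have "(exp_damp has_real_derivative 1) (at t)"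
    by (rule DERIV_cong_ev[THEN iffD1, rotated -1])
      (use greater in \<open>auto simp: exp_damp_def intro!: eventually_mono[OF eventually_nhds_in_open[of "{0<..}"]]\<close>)
  then show ?thesis using greater by simp
next
  case equal
  have "((\<lambda>h::real. (exp h - 1) / h) \<longlongrightarrow> 1) (at 0)"
    using DERIV_exp[of "0::real"] by (simp add: DERIV_def)
  then have "((\<lambda>h::real. (exp h - 1) / h) \<longlongrightarrow> 1) (at_left 0)" by (rule tendsto_within_subset) auto
  then have "((\<lambda>h. exp_damp h / h) \<longlongrightarrow> 1) (at_left 0)"
    by (rule Lim_transform_eventually) (auto simp: eventually_at_left_field exp_damp_def intro!: exI[of _ "-1"])
  moreover have "((\<lambda>h. exp_damp h / h) \<longlongrightarrow> 1) (at_right 0)"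
    by (rule Lim_transform_eventually[OF tendsto_const])
      (auto simp: eventually_at_right_field exp_damp_def intro!: exI[of _ "1"])
  ultimately have "((\<lambda>h. exp_damp h / h) \<longlongrightarrow> 1) (at 0)" by (simp add: filterlim_split_at)
  then show ?thesis using equal by (simp add: DERIV_def exp_damp_def)
qed

text \<open>By the chain rule the differential is multiplied by the derivative of
  \<open>exp_damp\<close> at \<open>u\<close>, a number between 0 and 1, so its norm decreases at
  every point. The factor is a function on \<open>M\<close>, so the product still obeys the
  transformation law.\<close>

lemma exp_damp_Sob:
  assumes u: "u \<in> Sob"
  shows "(\<lambda>p. exp_damp (u p)) \<in> Sob" "energy (\<lambda>p. exp_damp (u p)) (\<lambda>p. exp_damp (u p)) \<le> energy u u"
proof -
  let ?\<phi>' = "\<lambda>t::real. if 0 \<le> t then 1 else exp t"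
  let ?\<omega> = "weak_differential A u"
  let ?\<theta> = "\<lambda>c x. ?\<phi>' (u (chart_inv c x)) *\<^sub>R ?\<omega> c x"
  note du = Sob_D(2)[OF u]
  have oneform: "one_form A ?\<omega>" using du by (simp add: is_weak_differential_def)
  have \<phi>': "?\<phi>' \<in> borel_measurable borel" by measurable
  have \<phi>'1: "\<bar>?\<phi>' t\<bar> \<le> 1" "0 \<le> ?\<phi>' t" for t by auto
  have d: "is_weak_differential A (\<lambda>p. exp_damp (u p)) ?\<theta>"
    unfolding is_weak_differential_def
  proof (intro conjI ballI)
    show "one_form A ?\<theta>"
      unfolding one_form_def
    proof (intro ballI)
      fix c d x assume c: "c \<in> A" and d: "d \<in> A" and x: "x \<in> overlap c d"
      obtain p where p: "p \<in> fst c" "p \<in> fst d" "x = snd c p" using x by (auto simp: overlap_def)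
      have "chart_inv c x = p" "chart_inv d (transition c d x) = p"
        using p c d by (simp_all add: chart_inv_left transition_apply)
      moreover have "?\<omega> c x = transpose (jacobian c d x) *v ?\<omega> d (transition c d x)"
        using oneform c d x unfolding one_form_def by blast
      ultimately show "?\<theta> c x = transpose (jacobian c d x) *v ?\<theta> d (transition c d x)"
        by (simp add: matrix_vector_mult_scaleR)
    qed
    fix c assume c: "c \<in> A"
    have "weak_gradient_on (snd c ` fst c) (\<lambda>x. exp_damp ((u \<circ> chart_inv c) x)) (\<lambda>x. ?\<phi>' ((u \<circ> chart_inv c) x) *\<^sub>R ?\<omega> c x)"
    proof (rule weak_gradient_on_compose[OF chart_open[OF c] _ exp_damp_has_derivative _ \<phi>'1(1) \<phi>'])
      show "weak_gradient_on (snd c ` fst c) (u \<circ> chart_inv c) (?\<omega> c)"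
        using du c unfolding is_weak_differential_def by blast
    qed (simp add: exp_damp_def)
    then show "weak_gradient_on (snd c ` fst c) ((\<lambda>p. exp_damp (u p)) \<circ> chart_inv c) (?\<theta> c)"
      by (simp only: o_def)
  qed
  have eq: "form_inner ?\<theta> ?\<theta> p = (?\<phi>' (u p))\<^sup>2 * form_inner ?\<omega> ?\<omega> p" if "p \<in> M" for p
  proof -
    have "chart_inv (SOME c. c \<in> A \<and> p \<in> fst c) (snd (SOME c. c \<in> A \<and> p \<in> fst c) p) = p"
      by (rule chart_inv_left[OF chosen_chart[OF that]])
    then show ?thesis unfolding form_inner_def Let_def covector_inner_linear by (simp add: power2_eq_square)
  qed
  have le: "form_inner ?\<theta> ?\<theta> p \<le> form_inner ?\<omega> ?\<omega> p" if "p \<in> M" for p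
  proof -
    have "(?\<phi>' (u p))\<^sup>2 \<le> 1" using \<phi>'1[of "u p"] by (simp add: abs_square_le_1)
    then show ?thesis using eq[OF that] form_inner_nonneg[OF that, of ?\<omega>] by (simp add: mult_left_le_one_le)
  qed
  have i: "integrable vol (form_inner ?\<omega> ?\<omega>)" by (rule Sob_D(3)[OF u du])
  have m: "measurable_form ?\<theta>" by (rule weak_differential_measurable[OF d])
  have i': "integrable vol (form_inner ?\<theta> ?\<theta>)"
  proof (rule Bochner_Integration.integrable_bound[OF i form_inner_measurable[OF m m]])
    show "AE p in vol. norm (form_inner ?\<theta> ?\<theta> p) \<le> norm (form_inner ?\<omega> ?\<omega> p)"
    proof (rule AE_I2)
      fix p assume "p \<in> space vol"
      then have "p \<in> M" by (simp add: space_vol)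
      then show "norm (form_inner ?\<theta> ?\<theta> p) \<le> norm (form_inner ?\<omega> ?\<omega> p)"
        using le[of p] form_inner_nonneg[of p ?\<omega>] form_inner_nonneg[of p ?\<theta>] by (simp only: real_norm_def abs_of_nonneg)
    qed
  qed
  have "(\<lambda>p. exp_damp (u p)) \<in> L2 vol"
  proof -
    have um: "u \<in> borel_measurable vol" using Sob_D(1)[OF u] by (rule L2_measurable)
    have "exp_damp \<in> borel_measurable borel" unfolding exp_damp_def by measurable
    from measurable_compose[OF um this] have e: "(\<lambda>p. exp_damp (u p)) \<in> borel_measurable vol" .
    have "\<bar>exp_damp t\<bar> \<le> \<bar>t\<bar>" for t using exp_damp_neg[of t] by (cases "0 \<le> t") (auto simp: exp_damp_def)
    then have "(exp_damp t)\<^sup>2 \<le> t\<^sup>2" for t by (simp add: abs_le_square_iff)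
    then show ?thesis
      using e Bochner_Integration.integrable_bound[OF L2_square[OF Sob_D(1)[OF u]], of "\<lambda>p. (exp_damp (u p))\<^sup>2"] by (auto simp: L2_def)
  qed
  then show s: "(\<lambda>p. exp_damp (u p)) \<in> Sob" by (rule Sob_I[OF _ d i'])
  show "energy (\<lambda>p. exp_damp (u p)) (\<lambda>p. exp_damp (u p)) \<le> energy u u"
    unfolding energy_eq(1)[OF s s d d] energy_eq(1)[OF u u du du]
    by (rule integral_mono_AE[OF i' i]) (auto simp: space_vol intro!: AE_I2 le)
qed

end

section \<open>Completeness of the Sobolev space\<close>

lemma summable_differences_Cauchy:
  fixes a :: "nat \<Rightarrow> 'b::banach"
  assumes "summable b" "\<And>j. norm (a (Suc j) - a j) \<le> b j"
  shows "Cauchy a"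
proof -
  have "summable (\<lambda>j. a (Suc j) - a j)"
    by (rule summable_comparison_test'[OF assms(1)]) (use assms(2) in auto)
  then have "(\<lambda>n. \<Sum>j<n. a (Suc j) - a j) \<longlonglongrightarrow> (\<Sum>j. a (Suc j) - a j)"
    by (rule summable_LIMSEQ)
  then have "(\<lambda>n. a n - a 0) \<longlonglongrightarrow> (\<Sum>j. a (Suc j) - a j)" by (simp only: sum_lessThan_telescope)
  from tendsto_add[OF this tendsto_const[of "a 0"]] show ?thesis
    by (simp add: LIMSEQ_imp_Cauchy)
qed

lemma AE_summable:
  fixes h :: "nat \<Rightarrow> 'b \<Rightarrow> real"
  assumes h: "\<And>j. integrable N (h j)" "\<And>j p. p \<in> space N \<Longrightarrow> 0 \<le> h j p"
    and c: "\<And>j. (LINT p|N. h j p) \<le> c j" "summable c"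
  shows "AE p in N. summable (\<lambda>j. h j p)"
proof -
  have [measurable]: "h j \<in> borel_measurable N" for j using h(1) by auto
  have c0: "0 \<le> c j" for j
    by (rule order_trans[OF integral_nonneg_AE c(1)]) (use h(2) in auto)
  have "(\<integral>\<^sup>+p. (\<Sum>j. ennreal (h j p)) \<partial>N) = (\<Sum>j. \<integral>\<^sup>+p. ennreal (h j p) \<partial>N)"
    by (rule nn_integral_suminf) simp
  also have "\<dots> \<le> (\<Sum>j. ennreal (c j))"
  proof (rule suminf_le)
    fix j
    have "(\<integral>\<^sup>+p. ennreal (h j p) \<partial>N) = ennreal (LINT p|N. h j p)"
      by (rule nn_integral_eq_integral[OF h(1)]) (use h(2) in auto)
    then show "(\<integral>\<^sup>+p. ennreal (h j p) \<partial>N) \<le> ennreal (c j)" using c(1)[of j] by (simp add: ennreal_leI)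
  qed auto
  also have "\<dots> < \<infinity>" using ennreal_suminf_neq_top[OF c(2) c0] by (simp add: less_top)
  finally have "AE p in N. (\<Sum>j. ennreal (h j p)) \<noteq> \<infinity>"
    by (intro nn_integral_PInf_AE) auto
  then show ?thesis
    using AE_space
  proof eventually_elim
    case (elim p)
    then show ?case using h(2) by (intro summable_suminf_not_top) auto
  qed
qed

lemma Fatou_bound:
  fixes h :: "nat \<Rightarrow> 'b \<Rightarrow> real"
  assumes h: "\<And>j. integrable N (h j)" "\<And>j p. p \<in> space N \<Longrightarrow> 0 \<le> h j p" "\<And>j. (LINT p|N. h j p) \<le> \<epsilon>"
    and lim: "AE p in N. (\<lambda>j. h j p) \<longlonglongrightarrow> h' p" and [measurable]: "h' \<in> borel_measurable N"
    and h'0: "\<And>p. p \<in> space N \<Longrightarrow> 0 \<le> h' p"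
  shows "integrable N h'" "(LINT p|N. h' p) \<le> \<epsilon>"
proof -
  have [measurable]: "h j \<in> borel_measurable N" for j using h(1) by auto
  have \<epsilon>0: "0 \<le> \<epsilon>" by (rule order_trans[OF integral_nonneg_AE h(3)[of 0]]) (use h(2) in auto)
  have "(\<integral>\<^sup>+p. ennreal (h' p) \<partial>N) = (\<integral>\<^sup>+p. liminf (\<lambda>j. ennreal (h j p)) \<partial>N)"
  proof (rule nn_integral_cong_AE)
    show "AE p in N. ennreal (h' p) = liminf (\<lambda>j. ennreal (h j p))"
      using lim
    proof eventually_elim
      case (elim p)
      then have "(\<lambda>j. ennreal (h j p)) \<longlonglongrightarrow> ennreal (h' p)" by (rule tendsto_ennrealI)
      then show ?case using lim_imp_Liminf[OF trivial_limit_sequentially] by metis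
    qed
  qed
  also have "\<dots> \<le> liminf (\<lambda>j. \<integral>\<^sup>+p. ennreal (h j p) \<partial>N)" by (rule nn_integral_liminf) simp
  also have "\<dots> \<le> ennreal \<epsilon>"
  proof -
    have "(\<integral>\<^sup>+p. ennreal (h j p) \<partial>N) = ennreal (LINT p|N. h j p)" for j
      by (rule nn_integral_eq_integral[OF h(1)]) (use h(2) in auto)
    then have le: "(\<integral>\<^sup>+p. ennreal (h j p) \<partial>N) \<le> ennreal \<epsilon>" for j using h(3)[of j] by (simp add: ennreal_leI)
    have "liminf (\<lambda>j. \<integral>\<^sup>+p. ennreal (h j p) \<partial>N) \<le> liminf (\<lambda>j. ennreal \<epsilon>)"
      by (rule Liminf_mono) (use le in auto)
    then show ?thesis by (simp add: Liminf_const)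
  qed
  finally have nn: "(\<integral>\<^sup>+p. ennreal (h' p) \<partial>N) \<le> ennreal \<epsilon>" .
  have "(\<integral>\<^sup>+p. ennreal (norm (h' p)) \<partial>N) = (\<integral>\<^sup>+p. ennreal (h' p) \<partial>N)"
    by (rule nn_integral_cong) (use h'0 in auto)
  then show i: "integrable N h'"
    using nn by (intro integrableI_bounded) (auto intro: le_less_trans)
  have "ennreal (LINT p|N. h' p) = (\<integral>\<^sup>+p. ennreal (h' p) \<partial>N)"
    by (rule nn_integral_eq_integral[OF i, symmetric]) (use h'0 in auto)
  then show "(LINT p|N. h' p) \<le> \<epsilon>" using nn \<epsilon>0 by (metis ennreal_le_iff)
qed

context closed_riemannian_manifold
begin

lemma chart_inv_measurable:
  fixes h :: "'a \<Rightarrow> real"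
  assumes c: "c \<in> A" and h: "h \<in> borel_measurable vol"
  shows "(\<lambda>x. indicator (snd c ` fst c) x * h (chart_inv c x)) \<in> borel_measurable borel"
proof -
  have ci: "chart_inv c \<in> measurable (restrict_space borel (snd c ` fst c)) (restrict_space borel M)"
    using measurable_chart_inv[OF c] chart_inv_in[OF c] chart_subset[OF c]
    by (intro measurable_restrict_space2) (auto simp: space_restrict_space)
  have "(\<lambda>x. h (chart_inv c x)) \<in> borel_measurable (restrict_space borel (snd c ` fst c))"
    using measurable_compose[OF ci] h by (simp add: borel_measurable_vol_iff)
  then show ?thesis
    using borel_measurable_restrict_space_iff[of "snd c ` fst c" borel "\<lambda>x. h (chart_inv c x)"] chart_image_borel[OF c] by simp
qed

lemma chart_L1_bound:
  assumes c: "c \<in> A" and K: "compact K" "K \<subseteq> snd c ` fst c"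
  obtains C where "0 \<le> C"
    "\<And>h :: 'a \<Rightarrow> real. integrable vol h \<Longrightarrow> set_integrable lborel K (\<lambda>x. h (chart_inv c x))"
    "\<And>h :: 'a \<Rightarrow> real. integrable vol h \<Longrightarrow> (LINT x:K|lborel. \<bar>h (chart_inv c x)\<bar>) \<le> C * (LINT p|vol. \<bar>h p\<bar>)"
proof -
  obtain C where C: "0 \<le> C" "\<And>f :: 'a \<Rightarrow> ennreal. f \<in> borel_measurable vol \<Longrightarrow> (\<integral>\<^sup>+x\<in>K. f (chart_inv c x) \<partial>lborel) \<le> ennreal C * (\<integral>\<^sup>+p. f p \<partial>vol)"
    using chart_compact_integral_le[OF c K] by metis
  have Kb[measurable]: "K \<in> sets borel" using K(1) by (auto intro: borel_closed compact_imp_closed)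
  have main: "set_integrable lborel K (\<lambda>x. h (chart_inv c x)) \<and> (LINT x:K|lborel. \<bar>h (chart_inv c x)\<bar>) \<le> C * (LINT p|vol. \<bar>h p\<bar>)"
    if h: "integrable vol h" for h :: "'a \<Rightarrow> real"
  proof -
    have hm[measurable]: "h \<in> borel_measurable vol" using h by auto
    note hc = chart_inv_measurable[OF c hm]
    have "(\<lambda>x. indicator K x * (indicator (snd c ` fst c) x * h (chart_inv c x))) \<in> borel_measurable borel"
      by (rule borel_measurable_times[OF _ hc]) simp
    moreover have "indicator K x * (indicator (snd c ` fst c) x * h (chart_inv c x)) = indicator K x *\<^sub>R h (chart_inv c x)" for x
      using K(2) by (auto simp: indicator_def)
    ultimately have m: "(\<lambda>x. indicator K x *\<^sub>R h (chart_inv c x)) \<in> borel_measurable borel" by (simp only:)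
    have "(\<integral>\<^sup>+x. ennreal (norm (indicator K x *\<^sub>R h (chart_inv c x))) \<partial>lborel) = (\<integral>\<^sup>+x\<in>K. ennreal \<bar>h (chart_inv c x)\<bar> \<partial>lborel)"
      by (intro nn_integral_cong) (auto simp: indicator_def)
    also have "\<dots> \<le> ennreal C * (\<integral>\<^sup>+p. ennreal \<bar>h p\<bar> \<partial>vol)"
      by (rule C(2)) measurable
    also have "(\<integral>\<^sup>+p. ennreal \<bar>h p\<bar> \<partial>vol) = ennreal (LINT p|vol. \<bar>h p\<bar>)"
      using h by (intro nn_integral_eq_integral) auto
    also have "ennreal C * ennreal (LINT p|vol. \<bar>h p\<bar>) = ennreal (C * (LINT p|vol. \<bar>h p\<bar>))"
      using C(1) by (simp add: ennreal_mult')
    finally have le: "(\<integral>\<^sup>+x. ennreal (norm (indicator K x *\<^sub>R h (chart_inv c x))) \<partial>lborel) \<le> ennreal (C * (LINT p|vol. \<bar>h p\<bar>))" .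
    have i: "integrable lborel (\<lambda>x. indicator K x *\<^sub>R h (chart_inv c x))"
      using m le by (intro integrableI_bounded) (auto intro: le_less_trans)
    have "ennreal (LINT x|lborel. norm (indicator K x *\<^sub>R h (chart_inv c x))) \<le> ennreal (C * (LINT p|vol. \<bar>h p\<bar>))"
      using le i by (subst nn_integral_eq_integral[symmetric]) auto
    then have "(LINT x|lborel. norm (indicator K x *\<^sub>R h (chart_inv c x))) \<le> C * (LINT p|vol. \<bar>h p\<bar>)"
      using C(1) by (subst (asm) ennreal_le_iff) auto
    moreover have "(LINT x:K|lborel. \<bar>h (chart_inv c x)\<bar>) = (LINT x|lborel. norm (indicator K x *\<^sub>R h (chart_inv c x)))"
      unfolding set_lebesgue_integral_def by (intro Bochner_Integration.integral_cong) (auto simp: indicator_def)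
    ultimately show ?thesis using i by (simp add: set_integrable_def)
  qed
  show ?thesis by (rule that[OF C(1)]) (use main in auto)
qed

lemma L1_le_L2:
  assumes h: "h \<in> L2 vol"
  shows "integrable vol h" "(LINT p|vol. \<bar>h p\<bar>)\<^sup>2 \<le> measure vol (space vol) * ip vol h h"
proof -
  interpret finite_measure vol by (rule finite_measure_vol)
  show "integrable vol h" using h by (rule L2_integrable)
  have h': "(\<lambda>p. \<bar>h p\<bar>) \<in> L2 vol" using h by (auto simp: L2_def)
  have "(\<lambda>p. 1) \<in> L2 vol" by (auto simp: L2_def)
  from ip_Cauchy_Schwarz[OF this h'] show "(LINT p|vol. \<bar>h p\<bar>)\<^sup>2 \<le> measure vol (space vol) * ip vol h h"
    by (simp add: ip_def)
qed

lemma covector_inner_tendsto: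
  assumes "(\<lambda>j. a j) \<longlonglongrightarrow> l"
  shows "(\<lambda>j. covector_inner c x (a j) (a j)) \<longlonglongrightarrow> covector_inner c x l l"
  unfolding covector_inner_def
  by (intro tendsto_inner assms bounded_linear.tendsto[OF matrix_vector_mul_bounded_linear])

text \<open>The default value 0 makes the transformation law hold at every point: coefficients in
  two charts are related by fixed matrices in both directions, so the charts agree on whether the
  sequence converges.\<close>

lemma one_form_limit:
  assumes "\<And>j. one_form A (\<omega> j)"
  shows "one_form A (\<lambda>c x. if Cauchy (\<lambda>j. \<omega> j c x) then lim (\<lambda>j. \<omega> j c x) else 0)"
  unfolding one_form_def
proof (intro ballI)
  fix c d x assume c: "c \<in> A" and d: "d \<in> A" and x: "x \<in> overlap c d"
  let ?y = "transition c d x"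
  note y = transition_transition[OF c d x]
  have lin: "Cauchy (\<lambda>j. P *v b j) \<and> lim (\<lambda>j. P *v b j) = P *v lim b" if "Cauchy b" for b :: "nat \<Rightarrow> real ^ 'n" and P :: "real ^ 'n ^ 'n"
  proof -
    have "b \<longlonglongrightarrow> lim b" using that by (simp add: Cauchy_convergent_iff convergent_LIMSEQ_iff)
    then have "(\<lambda>j. P *v b j) \<longlonglongrightarrow> P *v lim b" by (rule bounded_linear.tendsto[OF matrix_vector_mul_bounded_linear])
    then show ?thesis by (simp add: LIMSEQ_imp_Cauchy limI)
  qed
  have a: "\<omega> j c x = transpose (jacobian c d x) *v \<omega> j d ?y" for j
    using assms[of j] c d x unfolding one_form_def by blast
  have b: "\<omega> j d ?y = transpose (jacobian d c ?y) *v \<omega> j c x" for j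
    using assms[of j] c d y unfolding one_form_def by metis
  show "(if Cauchy (\<lambda>j. \<omega> j c x) then lim (\<lambda>j. \<omega> j c x) else 0) =
    transpose (jacobian c d x) *v (if Cauchy (\<lambda>j. \<omega> j d ?y) then lim (\<lambda>j. \<omega> j d ?y) else 0)"
  proof (cases "Cauchy (\<lambda>j. \<omega> j d ?y)")
    case True
    then show ?thesis using lin[OF True, of "transpose (jacobian c d x)", folded a] by (simp only: if_True)
  next
    case False
    have "\<not> Cauchy (\<lambda>j. \<omega> j c x)"
    proof
      assume "Cauchy (\<lambda>j. \<omega> j c x)"
      from lin[OF this, of "transpose (jacobian d c ?y)", folded b] show False using False by blast
    qed
    then show ?thesis using False by simp
  qed
qed

lemma measurable_form_limit:
  assumes "\<And>j. measurable_form (\<omega> j)"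
  shows "measurable_form (\<lambda>c x. if Cauchy (\<lambda>j. \<omega> j c x) then lim (\<lambda>j. \<omega> j c x) else 0)"
  unfolding measurable_form_def
proof (intro conjI ballI)
  show "one_form A (\<lambda>c x. if Cauchy (\<lambda>j. \<omega> j c x) then lim (\<lambda>j. \<omega> j c x) else 0)"
    by (rule one_form_limit) (rule measurable_form_one_form[OF assms])
  fix c assume c: "c \<in> A"
  let ?V = "snd c ` fst c"
  have m[measurable]: "(\<lambda>x. indicator ?V x *\<^sub>R \<omega> j c x) \<in> borel_measurable borel" for j
    using assms[of j] c by (auto simp: measurable_form_def)
  have "{x \<in> space borel. Cauchy (\<lambda>j. indicator ?V x *\<^sub>R \<omega> j c x)} \<in> sets borel" by (rule sets_Collect_Cauchy) (rule m)
  then have "(\<lambda>x. if Cauchy (\<lambda>j. indicator ?V x *\<^sub>R \<omega> j c x) then lim (\<lambda>j. indicator ?V x *\<^sub>R \<omega> j c x) else 0) \<in> borel_measurable borel"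
    by (intro measurable_If borel_measurable_lim_metric m) auto
  moreover have "(if Cauchy (\<lambda>j. indicator ?V x *\<^sub>R \<omega> j c x) then lim (\<lambda>j. indicator ?V x *\<^sub>R \<omega> j c x) else 0) =
    indicator ?V x *\<^sub>R (if Cauchy (\<lambda>j. \<omega> j c x) then lim (\<lambda>j. \<omega> j c x) else 0)" for x
    by (cases "x \<in> ?V") (simp_all add: LIMSEQ_imp_Cauchy[OF tendsto_const] limI[OF tendsto_const])
  ultimately show "(\<lambda>x. indicator ?V x *\<^sub>R (if Cauchy (\<lambda>j. \<omega> j c x) then lim (\<lambda>j. \<omega> j c x) else 0)) \<in> borel_measurable borel"
    by (simp only:)
qed

text \<open>The Riesz-Fischer argument for functions and forms together. A rapidly converging
  subsequence has pointwise limits \<open>u\<close> and \<open>\<theta>\<close>, Fatou's lemma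
  bounds the distance of the full sequence to them, and local L1 convergence in charts identifies
  \<open>\<theta>\<close> as a weak differential of \<open>u\<close>.\<close>

lemma Sob_complete:
  assumes f: "\<And>k :: nat. f k \<in> Sob"
    and cauchy: "\<And>\<epsilon>. \<epsilon> > 0 \<Longrightarrow> \<exists>N. \<forall>k\<ge>N. \<forall>l\<ge>N.
      energy (\<lambda>p. f k p - f l p) (\<lambda>p. f k p - f l p) + ip vol (\<lambda>p. f k p - f l p) (\<lambda>p. f k p - f l p) < \<epsilon>"
  shows "\<exists>u\<in>Sob. (\<lambda>k. energy (\<lambda>p. f k p - u p) (\<lambda>p. f k p - u p) + ip vol (\<lambda>p. f k p - u p) (\<lambda>p. f k p - u p)) \<longlonglongrightarrow> 0"
proof -
  interpret finite_measure vol by (rule finite_measure_vol)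
  define \<omega> where "\<omega> k = weak_differential A (f k)" for k
  have fL: "f k \<in> L2 vol" for k by (rule Sob_D(1)[OF f])
  have fm[measurable]: "f k \<in> borel_measurable vol" for k using fL by (rule L2_measurable)
  have \<omega>: "is_weak_differential A (f k) (\<omega> k)" for k unfolding \<omega>_def by (rule Sob_D(2)[OF f])
  have \<omega>m: "measurable_form (\<omega> k)" for k by (rule weak_differential_measurable[OF \<omega>])
  define fi where "fi \<theta> p = form_inner \<theta> \<theta> p" for \<theta> p
  have fi0: "0 \<le> fi \<theta> p" if "p \<in> space vol" for \<theta> p using that form_inner_nonneg by (simp add: fi_def space_vol)
  have sub_m: "measurable_form (\<lambda>c x. \<theta> c x - \<theta>' c x)" if "measurable_form \<theta>" "measurable_form \<theta>'" for \<theta> \<theta>'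
    using measurable_form_add[OF that(1) measurable_form_scale[OF that(2), of "-1"]] by simp
  have fim: "fi \<theta> \<in> borel_measurable vol" if "measurable_form \<theta>" for \<theta>
    unfolding fi_def[abs_def] using form_inner_measurable[OF that that] by (simp add: eta_contract_eq)
  \<comment> \<open>The density of the squared Sobolev distance of \<open>f k\<close> and
    \<open>f l\<close>.\<close>
  define \<delta> where "\<delta> k l p = fi (\<lambda>c x. \<omega> k c x - \<omega> l c x) p + (f k p - f l p)\<^sup>2" for k l p
  have diffS: "(\<lambda>p. f k p - f l p) \<in> Sob" for k l by (rule semi_inner.W_diff[OF semi_inner_energy f f])
  have diffL: "(\<lambda>p. f k p - f l p) \<in> L2 vol" for k l by (rule Sob_D(1)[OF diffS])
  have e: "energy (\<lambda>p. f k p - f l p) (\<lambda>p. f k p - f l p) = (LINT p|vol. fi (\<lambda>c x. \<omega> k c x - \<omega> l c x) p)"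
    "integrable vol (fi (\<lambda>c x. \<omega> k c x - \<omega> l c x))" for k l
    unfolding fi_def[abs_def]
    using energy_eq[OF diffS diffS is_weak_differential_diff[OF \<omega> \<omega>] is_weak_differential_diff[OF \<omega> \<omega>], of k l k l] by auto
  have \<delta>i: "integrable vol (\<delta> k l)" for k l
    unfolding \<delta>_def[abs_def] by (intro Bochner_Integration.integrable_add e(2) L2_square diffL)
  have \<delta>int: "(LINT p|vol. \<delta> k l p) = energy (\<lambda>p. f k p - f l p) (\<lambda>p. f k p - f l p) + ip vol (\<lambda>p. f k p - f l p) (\<lambda>p. f k p - f l p)" for k l
    unfolding \<delta>_def e(1) ip_square by (intro Bochner_Integration.integral_add e(2) L2_square diffL)
  have \<delta>0: "0 \<le> \<delta> k l p" if "p \<in> space vol" for k l p using fi0[OF that] by (simp add: \<delta>_def)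
  have "\<forall>j. \<exists>N. \<forall>k\<ge>N. \<forall>l\<ge>N. (LINT p|vol. \<delta> k l p) < (1/4)^j"
    unfolding \<delta>int using cauchy by simp
  then obtain N where N: "\<And>j k l. k \<ge> N j \<Longrightarrow> l \<ge> N j \<Longrightarrow> (LINT p|vol. \<delta> k l p) < (1/4)^j" by metis
  \<comment> \<open>Adding up the \<open>N i\<close> makes \<open>s\<close> monotone and at least
    \<open>N j\<close>, whatever the order of the \<open>N i\<close>; the summand \<open>j\<close>
    makes it tend to infinity.\<close>
  define s where "s j = j + (\<Sum>i\<le>j. N i)" for j :: nat
  have s1: "N j \<le> s j" for j unfolding s_def using member_le_sum[of j "{..j}" N] by auto
  have s2: "s j \<le> s (Suc j)" for j unfolding s_def by simp
  have s3: "j \<le> s j" for j unfolding s_def by simp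
  \<comment> \<open>The bound \<open>(1/4)^j\<close> leaves room for the weight \<open>2^j\<close>,
    which is used up below in passing to square roots.\<close>
  have AEsum: "AE p in vol. summable (\<lambda>j. 2^j * \<delta> (s (Suc j)) (s j) p)"
  proof (rule AE_summable)
    show "integrable vol (\<lambda>p. 2^j * \<delta> (s (Suc j)) (s j) p)" for j using \<delta>i by simp
    show "0 \<le> 2^j * \<delta> (s (Suc j)) (s j) p" if "p \<in> space vol" for j p using \<delta>0[OF that] by simp
    show "(LINT p|vol. 2^j * \<delta> (s (Suc j)) (s j) p) \<le> (1/2)^j" for j
    proof -
      have "(LINT p|vol. \<delta> (s (Suc j)) (s j) p) < (1/4)^j"
        by (rule N) (use s1[of j] s2[of j] in auto)
      then have "2^j * (LINT p|vol. \<delta> (s (Suc j)) (s j) p) \<le> 2^j * (1/4)^j" by (intro mult_left_mono) auto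
      then show ?thesis by (simp flip: power_mult_distrib)
    qed
    show "summable (\<lambda>j. (1/2::real)^j)" by (rule summable_geometric) simp
  qed
  define u where "u p = (if Cauchy (\<lambda>j. f (s j) p) then lim (\<lambda>j. f (s j) p) else 0)" for p
  define \<theta> where "\<theta> c x = (if Cauchy (\<lambda>j. \<omega> (s j) c x) then lim (\<lambda>j. \<omega> (s j) c x) else 0)" for c x
  have \<theta>m: "measurable_form \<theta>" unfolding \<theta>_def[abs_def] by (rule measurable_form_limit[OF \<omega>m])
  have um[measurable]: "u \<in> borel_measurable vol"
  proof -
    have "{p \<in> space vol. Cauchy (\<lambda>j. f (s j) p)} \<in> sets vol" by (rule sets_Collect_Cauchy) (rule fm)
    then show ?thesis unfolding u_def[abs_def] by (intro measurable_If borel_measurable_lim_metric fm) auto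
  qed
  define \<delta>' where "\<delta>' k p = fi (\<lambda>c x. \<omega> k c x - \<theta> c x) p + (f k p - u p)\<^sup>2" for k p
  have \<delta>'m: "\<delta>' k \<in> borel_measurable vol" for k
    unfolding \<delta>'_def[abs_def] using fim[OF sub_m[OF \<omega>m \<theta>m], of k] by measurable
  have \<delta>'0: "0 \<le> \<delta>' k p" if "p \<in> space vol" for k p using fi0[OF that] by (simp add: \<delta>'_def)
  have conv: "AE p in vol. \<forall>k. (\<lambda>j. \<delta> k (s j) p) \<longlonglongrightarrow> \<delta>' k p"
    using AEsum AE_space
  proof eventually_elim
    case (elim p)
    then have p: "p \<in> M" by (simp add: space_vol)
    then obtain c where c: "c \<in> A" "p \<in> fst c" using cover by blast
    let ?x = "snd c p" and ?d = "\<lambda>j. \<delta> (s (Suc j)) (s j) p"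
    have xc: "?x \<in> snd c ` fst c" using c by auto
    \<comment> \<open>Pointwise distances are controlled by the square root of \<open>?d j\<close>.
      Both terms of \<open>b j\<close> are summable and their product is \<open>?d j\<close>, so
      \<open>(b j)\<^sup>2\<close> is at least \<open>2 * ?d j\<close>.\<close>
    define b where "b j = 2^j * ?d j + (1/2)^j" for j
    have b: "summable b" unfolding b_def by (intro summable_add elim(1) summable_geometric) simp
    have sqrt_le: "sqrt (?d j) \<le> b j" for j
    proof (rule real_le_lsqrt)
      have d0: "0 \<le> ?d j" using \<delta>0[OF elim(2)] .
      show "0 \<le> b j" unfolding b_def using d0 by simp
      have "2 * (2^j * ?d j) * (1/2)^j = 2 * ?d j" by (simp add: power_one_over)
      moreover have "0 \<le> (2^j * ?d j)\<^sup>2" "0 \<le> ((1/2::real)^j)\<^sup>2" by simp_all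
      ultimately show "?d j \<le> (b j)\<^sup>2" unfolding b_def power2_sum using d0 by linarith
    qed
    have fiq: "fi (\<lambda>c x. \<omega> k c x - \<omega> l c x) p = covector_inner c ?x (\<omega> k c ?x - \<omega> l c ?x) (\<omega> k c ?x - \<omega> l c ?x)" for k l
      unfolding fi_def by (rule form_inner_chart[OF _ _ c]) (rule measurable_form_one_form[OF sub_m[OF \<omega>m \<omega>m]])+
    have fiq': "fi (\<lambda>c x. \<omega> k c x - \<theta> c x) p = covector_inner c ?x (\<omega> k c ?x - \<theta> c ?x) (\<omega> k c ?x - \<theta> c ?x)" for k
      unfolding fi_def by (rule form_inner_chart[OF _ _ c]) (rule measurable_form_one_form[OF sub_m[OF \<omega>m \<theta>m]])+
    have "Cauchy (\<lambda>j. f (s j) p)"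
    proof (rule summable_differences_Cauchy[OF b])
      fix j
      have "(f (s (Suc j)) p - f (s j) p)\<^sup>2 \<le> ?d j" using fi0[OF elim(2)] by (simp add: \<delta>_def)
      then have "\<bar>f (s (Suc j)) p - f (s j) p\<bar> \<le> sqrt (?d j)" by (rule real_le_rsqrt[of "\<bar>_\<bar>", simplified])
      then show "norm (f (s (Suc j)) p - f (s j) p) \<le> b j" using sqrt_le[of j] by simp
    qed
    then have ulim: "(\<lambda>j. f (s j) p) \<longlonglongrightarrow> u p" by (simp add: u_def Cauchy_convergent_iff convergent_LIMSEQ_iff)
    define L where "L = onorm ((*v) (g c ?x))"
    have L0: "0 \<le> L" unfolding L_def by (rule onorm_pos_le) (rule matrix_vector_mul_bounded_linear)
    have "Cauchy (\<lambda>j. \<omega> (s j) c ?x)"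
    proof (rule summable_differences_Cauchy[OF summable_mult[OF b, of "sqrt L"]])
      fix j
      let ?z = "\<omega> (s (Suc j)) c ?x - \<omega> (s j) c ?x"
      have "(norm ?z)\<^sup>2 \<le> L * covector_inner c ?x ?z ?z"
        by (rule norm_le_covector_inner[OF c(1) xc]) (simp add: L_def)
      also have "\<dots> \<le> L * ?d j" using L0 by (intro mult_left_mono) (auto simp: \<delta>_def fiq)
      finally have "norm ?z \<le> sqrt (L * ?d j)" by (rule real_le_rsqrt)
      also have "\<dots> \<le> sqrt L * b j" unfolding real_sqrt_mult using L0 sqrt_le[of j] by (intro mult_left_mono) auto
      finally show "norm ?z \<le> sqrt L * b j" .
    qed
    then have \<theta>lim: "(\<lambda>j. \<omega> (s j) c ?x) \<longlonglongrightarrow> \<theta> c ?x" by (simp add: \<theta>_def Cauchy_convergent_iff convergent_LIMSEQ_iff)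
    show ?case
      unfolding \<delta>_def \<delta>'_def fiq fiq'
      by (intro allI tendsto_add tendsto_power tendsto_diff tendsto_const ulim covector_inner_tendsto \<theta>lim)
  qed
  \<comment> \<open>Fatou's lemma in the second index of \<open>\<delta>\<close>. The shift by
    \<open>N0\<close> keeps all members of the subsequence in the range of the Cauchy bound.\<close>
  have small: "\<exists>N0. \<forall>k\<ge>N0. integrable vol (\<delta>' k) \<and> (LINT p|vol. \<delta>' k p) \<le> \<epsilon>" if \<epsilon>: "\<epsilon> > 0" for \<epsilon>
  proof -
    obtain N0 where N0: "\<And>k l. k \<ge> N0 \<Longrightarrow> l \<ge> N0 \<Longrightarrow> (LINT p|vol. \<delta> k l p) < \<epsilon>"
      using cauchy[OF \<epsilon>] unfolding \<delta>int by blast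
    have "integrable vol (\<delta>' k) \<and> (LINT p|vol. \<delta>' k p) \<le> \<epsilon>" if k: "k \<ge> N0" for k
    proof -
      have lim: "AE p in vol. (\<lambda>j. \<delta> k (s (j + N0)) p) \<longlonglongrightarrow> \<delta>' k p"
        using conv by eventually_elim (auto dest: spec[of _ k] intro: LIMSEQ_ignore_initial_segment)
      have le: "(LINT p|vol. \<delta> k (s (j + N0)) p) \<le> \<epsilon>" for j
        using N0[OF k, of "s (j + N0)"] s3[of "j + N0"] by simp
      show ?thesis
        using Fatou_bound[OF \<delta>i \<delta>0 le lim \<delta>'m \<delta>'0] by blast
    qed
    then show ?thesis by blast
  qed
  \<comment> \<open>Only from \<open>k0\<close> on is the distance to the limit known to be
    integrable, and this puts \<open>u\<close> into L2. The limits below therefore use the index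
    \<open>k + k0\<close>.\<close>
  obtain k0 where k0: "\<And>k. k \<ge> k0 \<Longrightarrow> integrable vol (\<delta>' k)" using small[of 1] by auto
  have parts: "integrable vol (fi (\<lambda>c x. \<omega> k c x - \<theta> c x))" "integrable vol (\<lambda>p. (f k p - u p)\<^sup>2)" if k: "k \<ge> k0" for k
  proof -
    show "integrable vol (fi (\<lambda>c x. \<omega> k c x - \<theta> c x))"
      by (rule Bochner_Integration.integrable_bound[OF k0[OF k] fim[OF sub_m[OF \<omega>m \<theta>m]]])
        (rule AE_I2, use fi0 in \<open>simp add: \<delta>'_def\<close>)
    show "integrable vol (\<lambda>p. (f k p - u p)\<^sup>2)"
      by (rule Bochner_Integration.integrable_bound[OF k0[OF k]]) (measurable, rule AE_I2, use fi0 in \<open>simp add: \<delta>'_def\<close>)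
  qed
  have fuL: "(\<lambda>p. f k p - u p) \<in> L2 vol" if "k \<ge> k0" for k
    using parts(2)[OF that] by (auto simp: L2_def)
  have uL: "u \<in> L2 vol"
    using L2_diff[OF fL fuL[OF order_refl], of k0] by simp
  have \<theta>i: "integrable vol (form_inner \<theta> \<theta>)"
  proof -
    \<comment> \<open>\<open>\<theta>\<close> is \<open>\<omega> k0\<close> plus an error of finite
      energy; the mixed terms are integrable because both squares are.\<close>
    let ?a = "\<omega> k0" and ?b = "\<lambda>c x. (-1) *\<^sub>R (\<omega> k0 c x - \<theta> c x)"
    have ab: "\<theta> = (\<lambda>c x. ?a c x + ?b c x)" by (auto simp: fun_eq_iff)
    have bm: "measurable_form ?b" by (rule measurable_form_scale[OF sub_m[OF \<omega>m \<theta>m]])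
    have ai: "integrable vol (form_inner ?a ?a)" by (rule Sob_D(3)[OF f \<omega>])
    have bi: "integrable vol (form_inner ?b ?b)"
      unfolding form_inner_linear[abs_def] using parts(1)[OF order_refl] by (simp add: fi_def[abs_def])
    have 1: "form_inner \<theta> \<theta> p = form_inner (\<lambda>c x. ?a c x + ?b c x) (\<lambda>c x. ?a c x + ?b c x) p" for p
      by (simp only: ab[symmetric])
    have 2: "form_inner (\<lambda>c x. ?a c x + ?b c x) (\<lambda>c x. ?a c x + ?b c x) p = form_inner ?a ?a p + form_inner ?b ?a p + (form_inner ?a ?b p + form_inner ?b ?b p)" for p
      by (simp only: form_inner_linear(1,2))
    have eq: "form_inner \<theta> \<theta> = (\<lambda>p. form_inner ?a ?a p + form_inner ?b ?a p + (form_inner ?a ?b p + form_inner ?b ?b p))" by (rule ext) (rule trans[OF 1 2])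
    show ?thesis
      unfolding eq by (intro Bochner_Integration.integrable_add ai bi
        form_inner_integrable[OF \<omega>m bm ai bi] form_inner_integrable[OF bm \<omega>m bi ai])
  qed
  have \<delta>'lim: "(\<lambda>k. LINT p|vol. \<delta>' k p) \<longlonglongrightarrow> 0"
  proof (rule LIMSEQ_I)
    fix r :: real assume "0 < r"
    then obtain N0 where "\<forall>k\<ge>N0. (LINT p|vol. \<delta>' k p) \<le> r / 2" using small[of "r / 2"] by auto
    moreover have "0 \<le> (LINT p|vol. \<delta>' k p)" for k by (rule integral_nonneg_AE) (use \<delta>'0 in auto)
    ultimately have "\<forall>k\<ge>N0. norm ((LINT p|vol. \<delta>' k p) - 0) < r" using \<open>0 < r\<close> by force
    then show "\<exists>N0. \<forall>k\<ge>N0. norm ((LINT p|vol. \<delta>' k p) - 0) < r" by blast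
  qed
  \<comment> \<open>Finite volume turns convergence in L2 into convergence in L1.\<close>
  have L1lim: "(\<lambda>k. LINT p|vol. \<bar>h (k + k0) p\<bar>) \<longlonglongrightarrow> 0"
    if h: "\<And>k. k \<ge> k0 \<Longrightarrow> h k \<in> L2 vol" and le: "\<And>k p. p \<in> space vol \<Longrightarrow> (h k p)\<^sup>2 \<le> \<delta>' k p" for h
  proof -
    let ?m = "measure vol (space vol)"
    have "(\<lambda>k. (LINT p|vol. \<bar>h (k + k0) p\<bar>)\<^sup>2) \<longlonglongrightarrow> 0"
    proof (rule tendsto_sandwich[OF _ _ tendsto_const])
      show "(\<lambda>k. ?m * (LINT p|vol. \<delta>' (k + k0) p)) \<longlonglongrightarrow> 0"
        using tendsto_mult_left[OF LIMSEQ_ignore_initial_segment[OF \<delta>'lim, of k0], of ?m] by simp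
      show "\<forall>\<^sub>F k in sequentially. (LINT p|vol. \<bar>h (k + k0) p\<bar>)\<^sup>2 \<le> ?m * (LINT p|vol. \<delta>' (k + k0) p)"
      proof (intro always_eventually allI)
        fix k
        have "ip vol (h (k + k0)) (h (k + k0)) \<le> (LINT p|vol. \<delta>' (k + k0) p)"
          unfolding ip_square using L2_square[OF h, of "k + k0"] k0[of "k + k0"] le by (intro integral_mono) auto
        then have "?m * ip vol (h (k + k0)) (h (k + k0)) \<le> ?m * (LINT p|vol. \<delta>' (k + k0) p)" by (intro mult_left_mono) auto
        then show "(LINT p|vol. \<bar>h (k + k0) p\<bar>)\<^sup>2 \<le> ?m * (LINT p|vol. \<delta>' (k + k0) p)"
          using L1_le_L2(2)[OF h, of "k + k0"] by simp
      qed
    qed auto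
    then show ?thesis by (simp add: power_tendsto_0_iff)
  qed
  define H where "H k p = sqrt (fi (\<lambda>c x. \<omega> k c x - \<theta> c x) p)" for k p
  have Hsq: "(H k p)\<^sup>2 = fi (\<lambda>c x. \<omega> k c x - \<theta> c x) p" if "p \<in> space vol" for k p
    using fi0[OF that] by (simp add: H_def)
  have HL: "H k \<in> L2 vol" if k: "k \<ge> k0" for k
  proof -
    have "H k \<in> borel_measurable vol"
      unfolding H_def[abs_def] using fim[OF sub_m[OF \<omega>m \<theta>m], of k] by measurable
    moreover have "integrable vol (\<lambda>p. (H k p)\<^sup>2)"
      using parts(1)[OF k] Hsq by (subst Bochner_Integration.integrable_cong[OF refl]) auto
    ultimately show ?thesis by (auto simp: L2_def)
  qed
  have lim1: "(\<lambda>k. LINT p|vol. \<bar>f (k + k0) p - u p\<bar>) \<longlonglongrightarrow> 0"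
    using fi0 by (intro L1lim[of "\<lambda>k p. f k p - u p"] fuL) (auto simp: \<delta>'_def)
  have lim2: "(\<lambda>k. LINT p|vol. \<bar>H (k + k0) p\<bar>) \<longlonglongrightarrow> 0"
    by (intro L1lim[of H] HL) (simp_all add: Hsq \<delta>'_def)
  have d: "is_weak_differential A u \<theta>"
    unfolding is_weak_differential_def
  proof (intro conjI ballI)
    show "one_form A \<theta>" by (rule measurable_form_one_form[OF \<theta>m])
    fix c assume c: "c \<in> A"
    let ?V = "snd c ` fst c"
    have wg: "weak_gradient_on ?V (f k \<circ> chart_inv c) (\<omega> k c)" for k
      using \<omega>[of k] c by (auto simp: is_weak_differential_def)
    \<comment> \<open>On a compact set, \<open>L\<close> compares the Euclidean norm of coefficients
      with the norm given by the metric, and \<open>C\<close> compares Lebesgue measure with the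
      volume.\<close>
    have G: "set_integrable lborel K (\<lambda>x. \<omega> (k + k0) c x - \<theta> c x) \<and>
      (LINT x:K|lborel. norm (\<omega> (k + k0) c x - \<theta> c x)) \<le> C * sqrt L * (LINT p|vol. \<bar>H (k + k0) p\<bar>)"
      if K: "compact K" "K \<subseteq> ?V"
        and L: "0 < L" "\<And>x. x \<in> K \<Longrightarrow> onorm ((*v) (g c x)) \<le> L"
        and C: "\<And>h :: 'a \<Rightarrow> real. integrable vol h \<Longrightarrow> set_integrable lborel K (\<lambda>x. h (chart_inv c x))"
          "\<And>h :: 'a \<Rightarrow> real. integrable vol h \<Longrightarrow> (LINT x:K|lborel. \<bar>h (chart_inv c x)\<bar>) \<le> C * (LINT p|vol. \<bar>h p\<bar>)"
      for K C L k
    proof -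
      let ?k = "k + k0"
      have Hi: "integrable vol (H ?k)" by (rule L1_le_L2(1)[OF HL]) simp
      have le: "norm (\<omega> ?k c x - \<theta> c x) \<le> sqrt L * \<bar>H ?k (chart_inv c x)\<bar>" if x: "x \<in> K" for x
      proof -
        have xV: "x \<in> ?V" using x K by auto
        let ?p = "chart_inv c x"
        have p: "?p \<in> fst c" "snd c ?p = x" using chart_inv_in[OF c xV] chart_inv_right[OF c xV] by auto
        have "fi (\<lambda>c x. \<omega> ?k c x - \<theta> c x) ?p = covector_inner c x (\<omega> ?k c x - \<theta> c x) (\<omega> ?k c x - \<theta> c x)"
          unfolding fi_def using form_inner_chart[OF _ _ c p(1)] measurable_form_one_form[OF sub_m[OF \<omega>m \<theta>m], of ?k] p(2) by simp
        then have "(norm (\<omega> ?k c x - \<theta> c x))\<^sup>2 \<le> L * fi (\<lambda>c x. \<omega> ?k c x - \<theta> c x) ?p"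
          using norm_le_covector_inner[OF c xV L(2)[OF x]] by simp
        then have "norm (\<omega> ?k c x - \<theta> c x) \<le> sqrt (L * fi (\<lambda>c x. \<omega> ?k c x - \<theta> c x) ?p)" by (rule real_le_rsqrt)
        also have "\<dots> = sqrt L * H ?k ?p" by (simp add: H_def real_sqrt_mult)
        also have "\<dots> \<le> sqrt L * \<bar>H ?k ?p\<bar>" using L(1) by (intro mult_left_mono) auto
        finally show ?thesis .
      qed
      have Hc: "set_integrable lborel K (\<lambda>x. sqrt L * \<bar>H ?k (chart_inv c x)\<bar>)"
        using C(1)[of "\<lambda>p. \<bar>H ?k p\<bar>"] Hi by (intro set_integrable_mult_right) auto
      have Kb: "K \<in> sets borel" using K(1) by (auto intro: borel_closed compact_imp_closed)
      have "(\<lambda>x. indicator K x *\<^sub>R (indicator ?V x *\<^sub>R (\<omega> ?k c x - \<theta> c x))) \<in> borel_measurable borel"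
        by (rule borel_measurable_scaleR) (use Kb sub_m[OF \<omega>m \<theta>m, of ?k] c in \<open>auto simp: measurable_form_def\<close>)
      moreover have "indicator K x *\<^sub>R (indicator ?V x *\<^sub>R (\<omega> ?k c x - \<theta> c x)) = indicator K x *\<^sub>R (\<omega> ?k c x - \<theta> c x)" for x
        using K(2) by (auto simp: indicator_def)
      ultimately have m: "(\<lambda>x. indicator K x *\<^sub>R (\<omega> ?k c x - \<theta> c x)) \<in> borel_measurable borel" by (simp only:)
      have i: "set_integrable lborel K (\<lambda>x. \<omega> ?k c x - \<theta> c x)"
        unfolding set_integrable_def
      proof (rule Bochner_Integration.integrable_bound[OF Hc[unfolded set_integrable_def]])
        show "AE x in lborel. norm (indicator K x *\<^sub>R (\<omega> ?k c x - \<theta> c x)) \<le> norm (indicator K x *\<^sub>R (sqrt L * \<bar>H ?k (chart_inv c x)\<bar>))"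
        proof (rule AE_I2)
          fix x
          show "norm (indicator K x *\<^sub>R (\<omega> ?k c x - \<theta> c x)) \<le> norm (indicator K x *\<^sub>R (sqrt L * \<bar>H ?k (chart_inv c x)\<bar>))"
            using le[of x] L(1) by (cases "x \<in> K") (auto simp: abs_mult)
        qed
      qed (use m in simp)
      have "(LINT x:K|lborel. norm (\<omega> ?k c x - \<theta> c x)) \<le> (LINT x:K|lborel. sqrt L * \<bar>H ?k (chart_inv c x)\<bar>)"
        by (rule set_integral_mono[OF set_integrable_norm[OF i] Hc le])
      also have "\<dots> = sqrt L * (LINT x:K|lborel. \<bar>H ?k (chart_inv c x)\<bar>)" by simp
      also have "\<dots> \<le> sqrt L * (C * (LINT p|vol. \<bar>H ?k p\<bar>))"
        using C(2)[OF Hi] L(1) by (intro mult_left_mono) auto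
      finally show ?thesis using i by (simp add: mult_ac)
    qed
    show "weak_gradient_on ?V (u \<circ> chart_inv c) (\<theta> c)"
    proof (rule weak_gradient_on_limit[where f = "\<lambda>k. f (k + k0) \<circ> chart_inv c" and G = "\<lambda>k. \<omega> (k + k0) c"])
      show "weak_gradient_on ?V (f (k + k0) \<circ> chart_inv c) (\<omega> (k + k0) c)" for k by (rule wg)
      fix K assume K: "compact K" "K \<subseteq> ?V"
      obtain L where L: "0 < L" "\<And>x. x \<in> K \<Longrightarrow> onorm ((*v) (g c x)) \<le> L" using metric_onorm_bound[OF c K] by metis
      obtain C where C: "0 \<le> C" "\<And>h :: 'a \<Rightarrow> real. integrable vol h \<Longrightarrow> set_integrable lborel K (\<lambda>x. h (chart_inv c x))"
        "\<And>h :: 'a \<Rightarrow> real. integrable vol h \<Longrightarrow> (LINT x:K|lborel. \<bar>h (chart_inv c x)\<bar>) \<le> C * (LINT p|vol. \<bar>h p\<bar>)"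
        using chart_L1_bound[OF c K] by metis
      note G' = G[OF K L C(2,3)]
      show "set_integrable lborel K (u \<circ> chart_inv c)"
        using C(2)[OF L1_le_L2(1)[OF uL]] by (simp add: o_def)
      show "set_integrable lborel K (\<theta> c)"
      proof -
        have "set_integrable lborel K (\<omega> (0 + k0) c)" using wg[of "0 + k0"] K by (auto simp: weak_gradient_on_def)
        from set_integral_diff(1)[OF this G'[of 0, THEN conjunct1]] show ?thesis by simp
      qed
      show "(\<lambda>k. LINT x:K|lborel. \<bar>(f (k + k0) \<circ> chart_inv c) x - (u \<circ> chart_inv c) x\<bar>) \<longlonglongrightarrow> 0"
      proof (rule tendsto_sandwich[OF _ _ tendsto_const])
        show "(\<lambda>k. C * (LINT p|vol. \<bar>f (k + k0) p - u p\<bar>)) \<longlonglongrightarrow> 0" using tendsto_mult_left[OF lim1, of C] by simp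
        show "\<forall>\<^sub>F k in sequentially. 0 \<le> (LINT x:K|lborel. \<bar>(f (k + k0) \<circ> chart_inv c) x - (u \<circ> chart_inv c) x\<bar>)"
          by (intro always_eventually allI) (auto simp: set_lebesgue_integral_def)
        show "\<forall>\<^sub>F k in sequentially. (LINT x:K|lborel. \<bar>(f (k + k0) \<circ> chart_inv c) x - (u \<circ> chart_inv c) x\<bar>) \<le> C * (LINT p|vol. \<bar>f (k + k0) p - u p\<bar>)"
          using C(3)[OF L1_le_L2(1)[OF fuL]] by (intro always_eventually allI) (simp add: o_def)
      qed
      show "(\<lambda>k. LINT x:K|lborel. norm (\<omega> (k + k0) c x - \<theta> c x)) \<longlonglongrightarrow> 0"
      proof (rule tendsto_sandwich[OF _ _ tendsto_const])
        show "(\<lambda>k. C * sqrt L * (LINT p|vol. \<bar>H (k + k0) p\<bar>)) \<longlonglongrightarrow> 0" using tendsto_mult_left[OF lim2, of "C * sqrt L"] by simp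
        show "\<forall>\<^sub>F k in sequentially. 0 \<le> (LINT x:K|lborel. norm (\<omega> (k + k0) c x - \<theta> c x))"
          by (intro always_eventually allI) (auto simp: set_lebesgue_integral_def)
        show "\<forall>\<^sub>F k in sequentially. (LINT x:K|lborel. norm (\<omega> (k + k0) c x - \<theta> c x)) \<le> C * sqrt L * (LINT p|vol. \<bar>H (k + k0) p\<bar>)"
          using G' by (intro always_eventually allI) blast
      qed
    qed
  qed
  have uS: "u \<in> Sob" by (rule Sob_I[OF uL d \<theta>i])
  have "energy (\<lambda>p. f k p - u p) (\<lambda>p. f k p - u p) + ip vol (\<lambda>p. f k p - u p) (\<lambda>p. f k p - u p) = (LINT p|vol. \<delta>' k p)" for k
  proof -
    have S: "(\<lambda>p. f k p - u p) \<in> Sob" by (rule semi_inner.W_diff[OF semi_inner_energy f uS])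
    note dd = is_weak_differential_diff[OF \<omega>[of k] d]
    show ?thesis
      unfolding \<delta>'_def ip_square fi_def energy_eq(1)[OF S S dd dd]
      by (rule Bochner_Integration.integral_add[symmetric, OF energy_eq(2)[OF S S dd dd] L2_square[OF Sob_D(1)[OF S]]])
  qed
  then show ?thesis using uS \<delta>'lim by (intro bexI[of _ u]) simp_all
qed

text \<open>The interface between the geometry and the abstract argument: the resolvent and its
  consequences are available for the energy through this instance.\<close>

theorem closed_form_energy: "closed_form vol Sob energy"
proof -
  interpret semi_inner Sob energy by (rule semi_inner_energy)
  interpret finite_measure vol by (rule finite_measure_vol)
  show ?thesis
    by unfold_locales (use Sob_D(1) one_Sob exp_damp_Sob Sob_complete in \<open>auto\<close>)
qed

section \<open>Comparison of the two variational quantities\<close>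

lemma vol_nontrivial: "\<not> (AE p in vol. False)"
proof
  assume AE: "AE p in vol. False"
  obtain c p where c: "c \<in> A" "p \<in> fst c" using nonempty cover by blast
  have "AE p in vol. p \<in> fst c \<longrightarrow> False" using AE by eventually_elim simp
  then have "AE x in lborel. x \<in> snd c ` fst c \<longrightarrow> False"
    using AE_chart_iff[OF c(1), of "\<lambda>_. False"] by simp
  then have "AE x in lborel. x \<notin> snd c ` fst c" by simp
  moreover have o: "open (snd c ` fst c)" using charts[OF c(1)] by (simp add: is_chart_def)
  ultimately have "snd c ` fst c \<in> null_sets lborel"
    by (subst AE_iff_null_sets) auto
  then have "negligible (snd c ` fst c)"
    by (simp add: negligible_iff_null_sets null_sets_completionI)
  then show False using open_not_negligible[OF o] c(2) by blast
qed

definition independent_family :: "nat \<Rightarrow> (nat \<Rightarrow> 'a \<Rightarrow> real) \<Rightarrow> bool" where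
  "independent_family k b \<longleftrightarrow> (\<forall>i<k. b i \<in> Sob) \<and>
     (\<forall>a :: nat \<Rightarrow> real. (AE p in vol. (\<Sum>i<k. a i * b i p) = 0) \<longrightarrow> (\<forall>i<k. a i = 0))"

lemma W12_subspace_iff:
  "W12_subspace M A g k F \<longleftrightarrow>
    (\<exists>b. independent_family k b \<and> F = range (\<lambda>(a :: nat \<Rightarrow> real) p. \<Sum>i<k. a i * b i p))"
  unfolding W12_subspace_def independent_family_def by blast

lemma Sob_combination:
  assumes "independent_family k b"
  shows "(\<lambda>p. \<Sum>i<k. a i * b i p) \<in> Sob"
  using assms semi_inner.W_sum[OF semi_inner_energy, of "{..<k}" "\<lambda>i p. a i * b i p"] Sob_scale one_Sob(1)
  by (auto simp: independent_family_def)

lemma energy_nonneg: "u \<in> Sob \<Longrightarrow> 0 \<le> energy u u"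
  using semi_inner.Q_nonneg[OF semi_inner_energy] by blast

lemma W12_subspace_Sob: "W12_subspace M A g k F \<Longrightarrow> u \<in> F \<Longrightarrow> u \<in> Sob"
  using Sob_combination by (auto simp: W12_subspace_iff)

lemma nonzero_square_pos:
  assumes "W12_subspace M A g k F" "u \<in> nonzero_elements vol F"
  shows "0 < (LINT p|vol. (u p)\<^sup>2)"
proof -
  have "u \<in> L2 vol" using assms W12_subspace_Sob Sob_D(1) by (auto simp: nonzero_elements_def)
  then have "ip vol u u \<noteq> 0" using assms(2) ip_eq_0 by (auto simp: nonzero_elements_def)
  then show ?thesis using ip_nonneg[of vol u] unfolding ip_square by linarith
qed

lemma LinftyE:
  assumes "V \<in> Linfty vol"
  obtains C where "0 \<le> C" "AE p in vol. \<bar>V p\<bar> \<le> C" "V \<in> borel_measurable vol"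
proof -
  obtain C where "AE p in vol. \<bar>V p\<bar> \<le> C" "V \<in> borel_measurable vol" using assms by (auto simp: Linfty_def)
  then show ?thesis by (intro that[of "max 0 C"]) (auto elim: eventually_mono)
qed

lemma Linfty_integrable:
  assumes "V \<in> Linfty vol"
  shows "integrable vol V"
proof -
  interpret finite_measure vol by (rule finite_measure_vol)
  from assms obtain C where "AE p in vol. \<bar>V p\<bar> \<le> C" "V \<in> borel_measurable vol" by (rule LinftyE)
  then show ?thesis by (intro integrable_const_bound[of _ C]) auto
qed

lemma Linfty_mult_square_integrable:
  assumes V: "V \<in> Linfty vol" and u: "u \<in> L2 vol"
  shows "integrable vol (\<lambda>p. V p * (u p)\<^sup>2)"
proof -
  from V obtain C where C: "AE p in vol. \<bar>V p\<bar> \<le> C" "V \<in> borel_measurable vol" by (rule LinftyE)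
  from L2_mult[OF L2_bounded_mult[OF u C(2,1)] u] show ?thesis by (simp add: power2_eq_square mult.assoc)
qed

text \<open>The eigenvalue is an infimum of suprema, so one nonzero element per test space suffices.
  The inequality without division covers the case of vanishing weighted norm, where the quotient is
  infinite by convention.\<close>

lemma weighted_eigenvalue_geI:
  assumes "\<And>b. independent_family (k + 1) b \<Longrightarrow>
      \<exists>a. r * (LINT p|vol. \<beta> p * (\<Sum>i<k+1. a i * b i p)\<^sup>2) \<le> energy (\<lambda>p. \<Sum>i<k+1. a i * b i p) (\<lambda>p. \<Sum>i<k+1. a i * b i p) \<and>
        \<not> (AE p in vol. (\<Sum>i<k+1. a i * b i p) = 0)"
    and \<beta>: "AE p in vol. 0 \<le> \<beta> p"
  shows "ereal r \<le> weighted_eigenvalue M A g \<beta> k"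
  unfolding weighted_eigenvalue_def Let_def
proof (rule INF_greatest)
  fix F assume "F \<in> {F. W12_subspace M A g (k + 1) F}"
  then obtain b where b: "independent_family (k + 1) b" and F: "F = range (\<lambda>(a :: nat \<Rightarrow> real) p. \<Sum>i<k+1. a i * b i p)"
    by (auto simp: W12_subspace_iff)
  obtain a where a: "r * (LINT p|vol. \<beta> p * (\<Sum>i<k+1. a i * b i p)\<^sup>2) \<le> energy (\<lambda>p. \<Sum>i<k+1. a i * b i p) (\<lambda>p. \<Sum>i<k+1. a i * b i p)"
    "\<not> (AE p in vol. (\<Sum>i<k+1. a i * b i p) = 0)"
    using assms(1)[OF b] by blast
  define w where "w = (\<lambda>p. \<Sum>i<k+1. a i * b i p)"
  let ?D = "LINT p|vol. (w p)\<^sup>2 * \<beta> p"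
  have wF: "w \<in> nonzero_elements vol F" using a(2) by (auto simp: nonzero_elements_def F w_def)
  have D0: "0 \<le> ?D" by (rule integral_nonneg_AE) (use \<beta> in \<open>eventually_elim, simp\<close>)
  have "r * ?D \<le> energy w w" using a(1) unfolding w_def by (simp only: mult.commute)
  then have "ereal r \<le> (if ?D = 0 then \<infinity> else ereal (dirichlet_energy M A g w / ?D))"
    using D0 by (auto simp: dirichlet_energy_eq pos_le_divide_eq)
  also have "\<dots> \<le> (SUP u\<in>nonzero_elements vol F. if (LINT p|vol. (u p)\<^sup>2 * \<beta> p) = 0 then \<infinity>
      else ereal (dirichlet_energy M A g u / (LINT p|vol. (u p)\<^sup>2 * \<beta> p)))"
    by (rule SUP_upper[OF wF])
  finally show "ereal r \<le> \<dots>" .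
qed

lemma weighted_eigenvalue_nonneg:
  assumes "AE p in vol. 0 \<le> \<beta> p"
  shows "0 \<le> weighted_eigenvalue M A g \<beta> k"
  unfolding zero_ereal_def
proof (rule weighted_eigenvalue_geI[OF _ assms])
  fix b assume b: "independent_family (k + 1) b"
  have "\<not> (AE p in vol. (\<Sum>i<k+1. 1 * b i p) = 0)"
    using b[unfolded independent_family_def, THEN conjunct2, rule_format, of "\<lambda>_. 1"] by auto
  then show "\<exists>a. 0 * (LINT p|vol. \<beta> p * (\<Sum>i<k+1. a i * b i p)\<^sup>2) \<le> energy (\<lambda>p. \<Sum>i<k+1. a i * b i p) (\<lambda>p. \<Sum>i<k+1. a i * b i p) \<and>
      \<not> (AE p in vol. (\<Sum>i<k+1. a i * b i p) = 0)"
    using energy_nonneg[OF Sob_combination[OF b, of "\<lambda>_. 1"]] by (intro exI[of _ "\<lambda>_. 1"]) simp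
qed

text \<open>Each test space has an element with quotient above \<open>t - \<delta>\<close>. Its
  deficit, \<open>\<delta>\<close> times the squared weighted norm, is at most
  \<open>\<epsilon>\<close> times the squared L2 norm because the weight is bounded; then
  \<open>\<epsilon>\<close> is arbitrary.\<close>

lemma schroedinger_eigenvalue_scaled_weight:
  assumes \<beta>: "\<beta> \<in> Linfty vol" "AE p in vol. 0 \<le> \<beta> p"
    and t: "0 \<le> t" "ereal t \<le> weighted_eigenvalue M A g \<beta> k"
  shows "0 \<le> schroedinger_eigenvalue M A g (\<lambda>p. t * \<beta> p) (k + 1)"
  unfolding schroedinger_eigenvalue_def Let_def
proof (rule INF_greatest)
  fix F assume "F \<in> {F. W12_subspace M A g (k + 1) F}"
  then have F: "W12_subspace M A g (k + 1) F" by simp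
  obtain C where C: "0 \<le> C" "AE p in vol. \<bar>\<beta> p\<bar> \<le> C" by (rule LinftyE[OF \<beta>(1)])
  let ?S = "SUP u\<in>nonzero_elements vol F. ereal ((dirichlet_energy M A g u - (LINT p|vol. t * \<beta> p * (u p)\<^sup>2)) / (LINT p|vol. (u p)\<^sup>2))"
  show "0 \<le> ?S"
  proof (rule ereal_le_epsilon2)
    fix \<epsilon> :: real assume \<epsilon>: "0 < \<epsilon>"
    \<comment> \<open>The summand 1 covers \<open>C = 0\<close>.\<close>
    define \<delta> where "\<delta> = \<epsilon> / (C + 1)"
    have \<delta>: "0 < \<delta>" "\<delta> * C \<le> \<epsilon>" using \<epsilon> C(1) by (auto simp: \<delta>_def field_simps)
    have "ereal (t - \<delta>) < ereal t" using \<delta> by simp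
    also have "\<dots> \<le> (SUP u\<in>nonzero_elements vol F. if (LINT p|vol. (u p)\<^sup>2 * \<beta> p) = 0 then \<infinity>
        else ereal (dirichlet_energy M A g u / (LINT p|vol. (u p)\<^sup>2 * \<beta> p)))"
      using t(2) F unfolding weighted_eigenvalue_def Let_def by (auto intro: order_trans INF_lower)
    finally obtain u where u: "u \<in> nonzero_elements vol F"
      and gt: "ereal (t - \<delta>) < (if (LINT p|vol. (u p)\<^sup>2 * \<beta> p) = 0 then \<infinity>
        else ereal (dirichlet_energy M A g u / (LINT p|vol. (u p)\<^sup>2 * \<beta> p)))"
      by (auto simp only: less_SUP_iff)
    let ?D = "LINT p|vol. (u p)\<^sup>2 * \<beta> p" and ?n = "LINT p|vol. (u p)\<^sup>2"
    have uS: "u \<in> Sob" using u W12_subspace_Sob[OF F] by (auto simp: nonzero_elements_def)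
    note uL = Sob_D(1)[OF uS]
    have n: "0 < ?n" by (rule nonzero_square_pos[OF F u])
    have D0: "0 \<le> ?D" by (rule integral_nonneg_AE) (use \<beta>(2) in \<open>eventually_elim, simp\<close>)
    have "?D \<le> (LINT p|vol. C * (u p)\<^sup>2)"
    proof (rule integral_mono_AE)
      show "integrable vol (\<lambda>p. (u p)\<^sup>2 * \<beta> p)"
        using Linfty_mult_square_integrable[OF \<beta>(1) uL] by (simp add: mult.commute)
      show "integrable vol (\<lambda>p. C * (u p)\<^sup>2)" using L2_square[OF uL] by simp
      show "AE p in vol. (u p)\<^sup>2 * \<beta> p \<le> C * (u p)\<^sup>2"
        using C(2) by eventually_elim (auto simp: mult.commute[of C] intro: mult_left_mono)
    qed
    then have DC: "?D \<le> C * ?n" by simp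
    have "(t - \<delta>) * ?D \<le> dirichlet_energy M A g u"
    proof (cases "?D = 0")
      case True
      then show ?thesis using energy_nonneg[OF uS] by (simp add: dirichlet_energy_eq)
    next
      case False
      then show ?thesis using gt D0 by (simp add: pos_less_divide_eq)
    qed
    moreover have "\<delta> * ?D \<le> \<epsilon> * ?n"
    proof -
      have "\<delta> * ?D \<le> \<delta> * (C * ?n)" using DC \<delta> by (intro mult_left_mono) auto
      also have "\<dots> \<le> \<epsilon> * ?n" using mult_right_mono[OF \<delta>(2), of ?n] n by (simp add: mult.assoc)
      finally show ?thesis .
    qed
    ultimately have "- \<epsilon> * ?n \<le> dirichlet_energy M A g u - t * ?D" by (simp add: algebra_simps)
    moreover have "(LINT p|vol. t * \<beta> p * (u p)\<^sup>2) = t * ?D"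
      by (subst Bochner_Integration.integral_mult_right_zero[symmetric]) (simp add: mult_ac)
    ultimately have "- \<epsilon> \<le> (dirichlet_energy M A g u - (LINT p|vol. t * \<beta> p * (u p)\<^sup>2)) / ?n"
      using n by (simp add: pos_le_divide_eq)
    then have "ereal (- \<epsilon>) \<le> ?S" by (intro SUP_upper2[OF u]) simp
    then show "0 \<le> ?S + ereal \<epsilon>"
      by (cases ?S) auto
  qed
qed

text \<open>\<open>dominated_potential\<close> in dimension \<open>k + 1\<close>, with
  \<open>\<alpha>\<close> so small that the loss in the integral is at most
  \<open>\<epsilon>\<close>. That the energy dominates the weighted norm somewhere in every test
  space means that the eigenvalue is at least 1.\<close>

lemma schroedinger_eigenvalue_nonneg_dominated:
  assumes V: "V \<in> Linfty vol" "0 \<le> schroedinger_eigenvalue M A g V (k + 1)" and \<epsilon>: "0 < \<epsilon>"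
  obtains \<beta> where "\<beta> \<in> Linfty vol" "AE p in vol. 0 \<le> \<beta> p" "1 \<le> weighted_eigenvalue M A g \<beta> k"
    "(LINT p|vol. V p) - \<epsilon> \<le> (LINT p|vol. \<beta> p)"
proof -
  obtain C where C: "0 \<le> C" "AE p in vol. \<bar>V p\<bar> \<le> C" and Vm[measurable]: "V \<in> borel_measurable vol" by (rule LinftyE[OF V(1)])
  \<comment> \<open>The bound has to hold at every point; the truncation changes \<open>V\<close> on
    a null set only.\<close>
  define V\<^sub>0 where "V\<^sub>0 p = max (- C) (min C (V p))" for p
  have V\<^sub>0: "AE p in vol. V p = V\<^sub>0 p" using C(2) by eventually_elim (auto simp: V\<^sub>0_def)
  have V\<^sub>0m[measurable]: "V\<^sub>0 \<in> borel_measurable vol" unfolding V\<^sub>0_def[abs_def] by measurable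
  have V\<^sub>0C: "\<bar>V\<^sub>0 p\<bar> \<le> C" for p using C(1) by (auto simp: V\<^sub>0_def)
  have int_V\<^sub>0: "(LINT p|vol. V p) = (LINT p|vol. V\<^sub>0 p)" by (rule integral_cong_AE[OF _ _ V\<^sub>0]) measurable
  let ?vol = "measure vol (space vol)"
  define \<delta> where "\<delta> = min (1/2) (\<epsilon> / (?vol + 1))"
  \<comment> \<open>Chosen so that \<open>\<alpha> * (C\<^sup>2 + C + 1) = \<delta>\<close>. This
    bounds \<open>\<kappa>\<close> by \<open>\<delta>\<close> and then, as
    \<open>\<kappa> \<le> 1\<close>, also the quantity in \<open>small\<close>.\<close>
  define \<alpha> where "\<alpha> = \<delta> / (C\<^sup>2 + C + 1)"
  have vol0: "0 \<le> ?vol" by simp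
  have \<delta>: "0 < \<delta>" "\<delta> \<le> 1/2"
    using \<epsilon> divide_pos_pos[OF \<epsilon> add_nonneg_pos[OF vol0 zero_less_one]] unfolding \<delta>_def by linarith+
  have \<delta>vol: "\<delta> * ?vol \<le> \<epsilon>"
  proof -
    have "\<delta> * ?vol \<le> \<epsilon> / (?vol + 1) * (?vol + 1)" using vol0 \<epsilon> by (intro mult_mono) (auto simp: \<delta>_def)
    also have "\<dots> = \<epsilon>" using add_nonneg_pos[OF vol0 zero_less_one] by simp
    finally show ?thesis .
  qed
  have C': "0 < C\<^sup>2 + C + 1" using C(1) by (simp add: add_nonneg_pos)
  have \<alpha>0: "0 < \<alpha>" unfolding \<alpha>_def using \<delta>(1) C' by simp
  have \<alpha>C: "\<alpha> * (C\<^sup>2 + C + 1) = \<delta>" unfolding \<alpha>_def using C' by simp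
  define \<kappa> where "\<kappa> = \<alpha> * (C\<^sup>2 + 1)"
  have \<kappa>: "\<kappa> \<le> \<delta>" unfolding \<kappa>_def \<alpha>C[symmetric] using \<alpha>0 C(1) by (intro mult_left_mono) auto
  have small: "\<alpha> * (C + \<alpha> * (C\<^sup>2 + 1)) < 1"
  proof -
    have "\<alpha> * (C + \<kappa>) \<le> \<alpha> * (C\<^sup>2 + C + 1)"
      using \<alpha>0 \<kappa> \<delta>(2) by (intro mult_left_mono) (auto intro: order_trans[of _ 1])
    then show ?thesis using \<alpha>C \<delta>(2) by (simp add: \<kappa>_def)
  qed
  interpret form_resolvent vol Sob energy \<alpha>
    by (intro form_resolvent.intro closed_form_energy form_resolvent_axioms.intro \<alpha>0)
  have large: "\<exists>a. energy (\<lambda>p. \<Sum>i<k+1. a i * b i p) (\<lambda>p. \<Sum>i<k+1. a i * b i p) - (LINT p|vol. V\<^sub>0 p * (\<Sum>i<k+1. a i * b i p)\<^sup>2)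
          \<ge> - \<eta> * ip vol (\<lambda>p. \<Sum>i<k+1. a i * b i p) (\<lambda>p. \<Sum>i<k+1. a i * b i p) \<and>
          \<not> (AE p in vol. (\<Sum>i<k+1. a i * b i p) = 0)"
    if b: "\<And>i. i < k + 1 \<Longrightarrow> b i \<in> Sob"
      "\<And>a :: nat \<Rightarrow> real. AE p in vol. (\<Sum>i<k+1. a i * b i p) = 0 \<Longrightarrow> \<forall>i<k+1. a i = 0" and \<eta>: "0 < \<eta>" for b and \<eta> :: real
  proof -
    have ind: "independent_family (k + 1) b" using b by (auto simp: independent_family_def)
    let ?F = "range (\<lambda>(a :: nat \<Rightarrow> real) p. \<Sum>i<k+1. a i * b i p)"
    have F: "W12_subspace M A g (k + 1) ?F" using ind by (auto simp: W12_subspace_iff)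
    \<comment> \<open>The supremum over the span is at least 0, so some element exceeds
      \<open>- \<eta>\<close>; this is the slack in \<open>dominated_potential\<close>.\<close>
    have "ereal (- \<eta>) < 0" using \<eta> by simp
    also have "\<dots> \<le> (SUP u\<in>nonzero_elements vol ?F. ereal ((dirichlet_energy M A g u - (LINT p|vol. V p * (u p)\<^sup>2)) / (LINT p|vol. (u p)\<^sup>2)))"
      using V(2) F unfolding schroedinger_eigenvalue_def Let_def by (auto intro: order_trans INF_lower)
    finally obtain u where u: "u \<in> nonzero_elements vol ?F"
      and gt: "- \<eta> < (dirichlet_energy M A g u - (LINT p|vol. V p * (u p)\<^sup>2)) / (LINT p|vol. (u p)\<^sup>2)"
      by (auto simp only: less_SUP_iff ereal_less_eq less_ereal.simps)
    have um[measurable]: "u \<in> borel_measurable vol"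
      using u W12_subspace_Sob[OF F] Sob_D(1) L2_measurable by (auto simp: nonzero_elements_def)
    have eq: "(LINT p|vol. V p * (u p)\<^sup>2) = (LINT p|vol. V\<^sub>0 p * (u p)\<^sup>2)"
      by (rule integral_cong_AE) (measurable, use V\<^sub>0 in \<open>eventually_elim, simp\<close>)
    have "- \<eta> * ip vol u u \<le> energy u u - (LINT p|vol. V\<^sub>0 p * (u p)\<^sup>2)"
      using gt nonzero_square_pos[OF F u] unfolding eq dirichlet_energy_eq ip_square
      by (simp add: pos_less_divide_eq)
    then show ?thesis using u unfolding nonzero_elements_def by blast
  qed
  show ?thesis
  proof (rule dominated_potential[OF V\<^sub>0m V\<^sub>0C small large])
    fix \<beta> assume \<beta>: "\<beta> \<in> borel_measurable vol" and \<beta>0: "AE p in vol. 0 \<le> \<beta> p" and \<beta>C: "\<exists>C. AE p in vol. \<beta> p \<le> C"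
      and int: "(LINT p|vol. V\<^sub>0 p) - \<alpha> * (C\<^sup>2 + 1) * ?vol \<le> (LINT p|vol. \<beta> p)"
      and dom: "\<And>b. \<lbrakk>\<And>i. i < k + 1 \<Longrightarrow> b i \<in> Sob;
          \<And>a :: nat \<Rightarrow> real. AE p in vol. (\<Sum>i<k+1. a i * b i p) = 0 \<Longrightarrow> \<forall>i<k+1. a i = 0\<rbrakk> \<Longrightarrow>
          \<exists>a. (LINT p|vol. \<beta> p * (\<Sum>i<k+1. a i * b i p)\<^sup>2) \<le> energy (\<lambda>p. \<Sum>i<k+1. a i * b i p) (\<lambda>p. \<Sum>i<k+1. a i * b i p) \<and>
            \<not> (AE p in vol. (\<Sum>i<k+1. a i * b i p) = 0)"
    show ?thesis
    proof (rule that)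
      obtain C' where "AE p in vol. \<beta> p \<le> C'" using \<beta>C by blast
      then have "AE p in vol. \<bar>\<beta> p\<bar> \<le> C'" using \<beta>0 by eventually_elim simp
      then show "\<beta> \<in> Linfty vol" using \<beta> by (auto simp: Linfty_def)
      show "AE p in vol. 0 \<le> \<beta> p" by (rule \<beta>0)
      show "1 \<le> weighted_eigenvalue M A g \<beta> k"
        unfolding one_ereal_def
      proof (rule weighted_eigenvalue_geI[OF _ \<beta>0], unfold mult_1)
        fix b assume "independent_family (k + 1) b"
        then have "\<And>i. i < k + 1 \<Longrightarrow> b i \<in> Sob"
          "\<And>a :: nat \<Rightarrow> real. AE p in vol. (\<Sum>i<k+1. a i * b i p) = 0 \<Longrightarrow> \<forall>i<k+1. a i = 0"
          unfolding independent_family_def by blast+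
        then show "\<exists>a. (LINT p|vol. \<beta> p * (\<Sum>i<k+1. a i * b i p)\<^sup>2) \<le> energy (\<lambda>p. \<Sum>i<k+1. a i * b i p) (\<lambda>p. \<Sum>i<k+1. a i * b i p) \<and>
            \<not> (AE p in vol. (\<Sum>i<k+1. a i * b i p) = 0)" by (rule dom)
      qed
      have "\<alpha> * (C\<^sup>2 + 1) * ?vol \<le> \<epsilon>"
        using mult_right_mono[OF \<kappa> vol0] \<delta>vol by (simp add: \<kappa>_def)
      then show "(LINT p|vol. V p) - \<epsilon> \<le> (LINT p|vol. \<beta> p)" using int int_V\<^sub>0 by simp
    qed
  qed
qed

lemma sup_potential_eq_sup_weight:
  "(SUP V\<in>{V \<in> Linfty vol. schroedinger_eigenvalue M A g V (k + 1) \<ge> 0}. ereal (LINT p|vol. V p)) =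
   (SUP \<beta>\<in>{\<beta> \<in> Linfty vol. (AE p in vol. \<beta> p \<ge> 0) \<and> \<not> (AE p in vol. \<beta> p = 0)}.
      weighted_eigenvalue M A g \<beta> k * ereal (LINT p|vol. \<beta> p))" (is "?L = ?R")
proof (rule antisym)
  have R: "weighted_eigenvalue M A g \<beta> k * ereal (LINT p|vol. \<beta> p) \<le> ?R"
    if "\<beta> \<in> Linfty vol" "AE p in vol. \<beta> p \<ge> 0" "\<not> (AE p in vol. \<beta> p = 0)" for \<beta>
    using that by (intro SUP_upper) auto
  \<comment> \<open>The constant weight 1 is admissible because the volume is nontrivial, so the
    right-hand side is nonnegative. This settles the case in which the dominating weight vanishes
    almost everywhere.\<close>
  have "0 \<le> weighted_eigenvalue M A g (\<lambda>_. 1) k * ereal (LINT p|vol. 1)"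
    by (intro ereal_0_le_mult weighted_eigenvalue_nonneg) auto
  also have "\<dots> \<le> ?R" by (rule R) (use vol_nontrivial in \<open>auto simp: Linfty_def\<close>)
  finally have R0: "0 \<le> ?R" .
  show "?L \<le> ?R"
  proof (rule SUP_least)
    fix V assume "V \<in> {V \<in> Linfty vol. schroedinger_eigenvalue M A g V (k + 1) \<ge> 0}"
    then have V: "V \<in> Linfty vol" "schroedinger_eigenvalue M A g V (k + 1) \<ge> 0" by auto
    show "ereal (LINT p|vol. V p) \<le> ?R"
    proof (rule ereal_le_epsilon2)
      fix \<epsilon> :: real assume "0 < \<epsilon>"
      from V this obtain \<beta> where \<beta>: "\<beta> \<in> Linfty vol" "AE p in vol. 0 \<le> \<beta> p" "1 \<le> weighted_eigenvalue M A g \<beta> k"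
        and le: "(LINT p|vol. V p) - \<epsilon> \<le> (LINT p|vol. \<beta> p)"
        by (rule schroedinger_eigenvalue_nonneg_dominated)
      have "ereal (LINT p|vol. \<beta> p) \<le> ?R"
      proof (cases "AE p in vol. \<beta> p = 0")
        case True
        then have "(LINT p|vol. \<beta> p) = 0" by (rule integral_eq_zero_AE)
        then show ?thesis using R0 by (simp add: zero_ereal_def)
      next
        case False
        have "1 * ereal (LINT p|vol. \<beta> p) \<le> weighted_eigenvalue M A g \<beta> k * ereal (LINT p|vol. \<beta> p)"
          using \<beta>(2,3) by (intro ereal_mult_right_mono) (auto intro: integral_nonneg_AE)
        also have "\<dots> \<le> ?R" by (rule R[OF \<beta>(1,2) False])
        finally show ?thesis by simp
      qed
      moreover have "ereal (LINT p|vol. V p) \<le> ereal (LINT p|vol. \<beta> p) + ereal \<epsilon>" using le by simp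
      ultimately show "ereal (LINT p|vol. V p) \<le> ?R + ereal \<epsilon>"
        using add_right_mono order_trans by blast
    qed
  qed
  show "?R \<le> ?L"
  proof (rule SUP_least)
    fix \<beta> assume "\<beta> \<in> {\<beta> \<in> Linfty vol. (AE p in vol. \<beta> p \<ge> 0) \<and> \<not> (AE p in vol. \<beta> p = 0)}"
    then have \<beta>: "\<beta> \<in> Linfty vol" "AE p in vol. \<beta> p \<ge> 0" "\<not> (AE p in vol. \<beta> p = 0)" by auto
    let ?I = "LINT p|vol. \<beta> p"
    have I0: "0 < ?I"
      using integral_nonneg_eq_0_iff_AE[OF Linfty_integrable[OF \<beta>(1)] \<beta>(2)] \<beta>(3) integral_nonneg_AE[OF \<beta>(2)] by linarith
    have *: "ereal (t * ?I) \<le> ?L" if "0 \<le> t" "ereal t \<le> weighted_eigenvalue M A g \<beta> k" for t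
    proof -
      obtain C where "AE p in vol. \<bar>\<beta> p\<bar> \<le> C" "\<beta> \<in> borel_measurable vol" by (rule LinftyE[OF \<beta>(1)])
      then have "(\<lambda>p. t * \<beta> p) \<in> Linfty vol" unfolding Linfty_def
        using that(1) by (auto simp: abs_mult intro!: exI[of _ "t * C"] mult_left_mono elim!: eventually_mono)
      then have "ereal (LINT p|vol. t * \<beta> p) \<le> ?L"
        using schroedinger_eigenvalue_scaled_weight[OF \<beta>(1,2) that] by (intro SUP_upper) auto
      then show ?thesis by simp
    qed
    show "weighted_eigenvalue M A g \<beta> k * ereal ?I \<le> ?L"
    proof (cases "weighted_eigenvalue M A g \<beta> k")
      case (real r)
      then show ?thesis using *[of r] weighted_eigenvalue_nonneg[OF \<beta>(2), of k] by simp
    next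
      \<comment> \<open>Every multiple \<open>t * \<beta>\<close> with \<open>t \<ge> 0\<close> is
        then an admissible potential, and these have unbounded integrals because the integral of
        \<open>\<beta>\<close> is positive.\<close>
      case PInf
      have "?L = \<infinity>"
      proof (rule ereal_top)
        fix B :: real
        have "ereal B \<le> ereal (max 0 (B / ?I) * ?I)" using I0 by (simp add: max_def field_simps)
        also have "\<dots> \<le> ?L" by (rule *) (use PInf in auto)
        finally show "ereal B \<le> ?L" .
      qed
      then show ?thesis by simp
    next
      case MInf
      then show ?thesis using weighted_eigenvalue_nonneg[OF \<beta>(2), of k] by simp
    qed
  qed
qed

end

theorem proposition4p1:
  fixes M :: "'a::t2_space set"
    and A :: "('a, 'n::finite) chart set"
    and g :: "('a, 'n) chart \<Rightarrow> real ^ 'n \<Rightarrow> real ^ 'n ^ 'n"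
    and m :: nat
  assumes "closed_riemannian_manifold M A g"
    and "CARD('n) \<ge> 3"
    and "m \<ge> 1"
  defines "\<mu> \<equiv> riemannian_volume M A g"
  shows "(SUP V\<in>{V \<in> Linfty \<mu>. schroedinger_eigenvalue M A g V (m + 1) \<ge> 0}.
            ereal (LINT p|\<mu>. V p)) =
         (SUP \<beta>\<in>{\<beta> \<in> Linfty \<mu>. (AE p in \<mu>. \<beta> p \<ge> 0) \<and> \<not> (AE p in \<mu>. \<beta> p = 0)}.
            weighted_eigenvalue M A g \<beta> m * ereal (LINT p|\<mu>. \<beta> p))"
  unfolding \<mu>_def by (rule closed_riemannian_manifold.sup_potential_eq_sup_weight[OF assms(1)])

end
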